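(* There exists a properly embedded singly periodic minimal surface $\mathcal{M}$ in $\mathbb{R}^3$ with bounded Gaussian curvature such that the quotient of $\mathcal{M}$ by all its periods has genus zero, infinitely many ends and exactly one limit end.
   Context: A limit end of a surface is an end which is a limit point of the (compact, Hausdorff) space of ends. The surface constructed is invariant under a translation (here $(0,0,2)$), i.e. singly periodic, and the quotient is taken by the group generated by all its periods. *)

theory Defs
  imports "HOL-Analysis.Analysis"
begin

type_synonym R3 = "real \<times> real \<times> real"

definition place :: "nat \<Rightarrow> real \<times> real \<Rightarrow> real \<Rightarrow> R3" where
  "place i q h = (case q of (s,t) \<Rightarrow>
     (if i = 0 then (h, s, t) else if i = 1 then (s, h, t) else (s, t, h)))"

definition minimal_chart ::
  "R3 set \<Rightarrow> R3 \<Rightarrow> nat \<Rightarrow> (real \<times> real) set \<Rightarrow> (real \<times> real \<Rightarrow> real) \<Rightarrow>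
   (real \<times> real \<Rightarrow> real) \<Rightarrow> (real \<times> real \<Rightarrow> real) \<Rightarrow> (real \<times> real \<Rightarrow> real) \<Rightarrow>
   (real \<times> real \<Rightarrow> real) \<Rightarrow> (real \<times> real \<Rightarrow> real) \<Rightarrow> bool" where
  "minimal_chart M p i U u ux uy uxx uxy uyy \<longleftrightarrow>
     i < 3 \<and> open U \<and>
     (\<exists>W. open W \<and> p \<in> W \<and> M \<inter> W = (\<lambda>q. place i q (u q)) ` U) \<and>
     (\<forall>q\<in>U. (u has_derivative (\<lambda>(h,k). ux q * h + uy q * k)) (at q)) \<and>
     (\<forall>q\<in>U. (ux has_derivative (\<lambda>(h,k). uxx q * h + uxy q * k)) (at q)) \<and>
     (\<forall>q\<in>U. (uy has_derivative (\<lambda>(h,k). uxy q * h + uyy q * k)) (at q)) \<and>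
     continuous_on U uxx \<and> continuous_on U uxy \<and> continuous_on U uyy \<and>
     (\<forall>q\<in>U. (1 + (uy q)\<^sup>2) * uxx q - 2 * ux q * uy q * uxy q + (1 + (ux q)\<^sup>2) * uyy q = 0)"

definition graph_gauss_curv :: "real \<Rightarrow> real \<Rightarrow> real \<Rightarrow> real \<Rightarrow> real \<Rightarrow> real" where
  "graph_gauss_curv ux uy uxx uxy uyy = (uxx * uyy - uxy\<^sup>2) / (1 + ux\<^sup>2 + uy\<^sup>2)\<^sup>2"

definition properly_embedded_minimal_surface :: "R3 set \<Rightarrow> bool" where
  "properly_embedded_minimal_surface M \<longleftrightarrow> closed M \<and> connected M \<and>
     (\<forall>p\<in>M. \<exists>i U u ux uy uxx uxy uyy. minimal_chart M p i U u ux uy uxx uxy uyy)"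

definition bounded_gauss_curvature :: "R3 set \<Rightarrow> bool" where
  "bounded_gauss_curvature M \<longleftrightarrow> (\<exists>C. \<forall>p\<in>M. \<exists>i U u ux uy uxx uxy uyy.
     minimal_chart M p i U u ux uy uxx uxy uyy \<and>
     (\<forall>q\<in>U. \<bar>graph_gauss_curv (ux q) (uy q) (uxx q) (uxy q) (uyy q)\<bar> \<le> C))"

definition periods :: "R3 set \<Rightarrow> R3 set" where
  "periods M = {v. (\<lambda>x. x + v) ` M = M}"

definition singly_periodic_with :: "R3 set \<Rightarrow> R3 \<Rightarrow> bool" where
  "singly_periodic_with M v \<longleftrightarrow> v \<noteq> 0 \<and> periods M = range (\<lambda>k::int. of_int k *\<^sub>R v)"

text \<open>Concrete model of R^3 / (Z v): the map below is invariant under x \<mapsto> x + v and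
  induces a homeomorphism of R^3/(Z v) onto a closed subset of R^3 \<times> R^2.\<close>
definition quot_map :: "R3 \<Rightarrow> R3 \<Rightarrow> R3 \<times> real \<times> real" where
  "quot_map v x = (let c = (x \<bullet> v) / (v \<bullet> v) in
     (x - c *\<^sub>R v, cos (2 * pi * c), sin (2 * pi * c)))"

definition quotient_surface :: "R3 set \<Rightarrow> R3 \<Rightarrow> (R3 \<times> real \<times> real) set" where
  "quotient_surface M v = quot_map v ` M"

definition genus_zero :: "'a::topological_space set \<Rightarrow> bool" where
  "genus_zero X \<longleftrightarrow> (\<exists>S. openin (top_of_set (sphere (0::R3) 1)) S \<and> X homeomorphic S)"

text \<open>Freudenthal ends of X: coherent choices of a component of X - K with non-compact
  closure in X, for every compact K \<subseteq> X (normalised to {} on other arguments).\<close>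
definition ends_of :: "'a::metric_space set \<Rightarrow> ('a set \<Rightarrow> 'a set) set" where
  "ends_of X = {e.
     (\<forall>K. compact K \<and> K \<subseteq> X \<longrightarrow> e K \<in> components (X - K) \<and> \<not> compact (X \<inter> closure (e K))) \<and>
     (\<forall>K L. compact K \<and> compact L \<and> K \<subseteq> L \<and> L \<subseteq> X \<longrightarrow> e L \<subseteq> e K) \<and>
     (\<forall>K. \<not> (compact K \<and> K \<subseteq> X) \<longrightarrow> e K = {})}"

text \<open>Limit end: a limit point of the end space, whose topology has basic open sets
  {e. e K = C} for compact K \<subseteq> X.\<close>
definition limit_end :: "'a::metric_space set \<Rightarrow> ('a set \<Rightarrow> 'a set) \<Rightarrow> bool" where
  "limit_end X e \<longleftrightarrow> e \<in> ends_of X \<and>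
     (\<forall>K. compact K \<and> K \<subseteq> X \<longrightarrow> (\<exists>e'\<in>ends_of X. e' \<noteq> e \<and> e' K = e K))"

end

theory Submission
  imports Defs "HOL-Complex_Analysis.Complex_Analysis"
begin

text \<open>
The surface is a saddle tower with infinitely many wings, given by explicit Weierstrass data on the plane
punctured at real sites b_i (the numbers $\pm$ pole k). Unit weights w_i define
Phi = Sum w_i / (z - b_i), Psi = Sum cnj w_i / (z - b_i) and chi = Sum e_i / (z - b_i) with signs e_i. If
Phi Psi = chi^2, then (Phi + Psi) / 2, (Phi - Psi) / (2i), i chi are conformal minimal data; the horizontal
coordinates Sum w_i ln |1 - z / b_i| are single valued, and the vertical one has periods in 2 pi Z because
chi has residues 1 and -1. The weights solving Phi Psi = chi^2 are, up to the signs e_i, the values at the sites of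
the Blaschke product g whose zeros are the zeros i (node j) of chi: Phi = chi g and Psi = chi / g.

The poles grow geometrically, with ratios chosen so that w(pole k) = cis (eta k) for a nonnegative and
decreasing sequence eta. This monotonicity gives, for any two points of the closed upper half plane, a
linear functional for which every site contributes to the difference of the horizontal coordinates with the
same sign; hence the horizontal projection is injective on the half plane, and the surface is embedded. The
rapid growth leaves at most one site relevant at each scale, which gives properness and the bound on the
curvature. The quotient is the punctured plane, whose ends are the sites together with their limit at
infinity; there are no other periods because the image in the horizontal plane lies above a wedge that it
nearly touches along two rays.
\<close>

section \<open>Ends of plane domains with discrete punctures\<close>

text \<open>Conjugation fixes the horizontal coordinates and negates the height, which on the open
  upper half plane stays strictly between 0 and pi. A half plane and its reflection therefore never
  collide, and embeddedness reduces to injectivity of the horizontal projection on the closed half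
  plane. The obstacle is that the zeros of \<open>chi\<close> are known only implicitly, whereas
  nonnegativity and monotonicity of \<open>eta\<close> are exact inequalities between series. The
  sequence \<open>rho\<close> is increasing and concave, with second difference -(1/2)^k / 400 at k.
  Its increase makes \<open>eta\<close> nonnegative, its concavity makes \<open>eta\<close>
  decreasing. Every error, in particular the displacement of a zero from the geometric mean of its
  neighbouring poles, must therefore be a small multiple of (1/2)^k; this is the origin of
  \<open>dev\<close> and of most numerical constants. The infinite Blaschke product never appears.
  Factorisations and derivative bounds are proved for the finite products \<open>gapx N\<close>,
  with constants independent of N, and only the sums of simple fractions pass to the limit, by
  dominated convergence.\<close>

definition push_end :: "('a::metric_space \<Rightarrow> 'b::metric_space) \<Rightarrow> ('b \<Rightarrow> 'a) \<Rightarrow> 'b set \<Rightarrow> ('a set \<Rightarrow> 'a set) \<Rightarrow> 'b set \<Rightarrow> 'b set"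
  where "push_end h k Y e L = (if compact L \<and> L \<subseteq> Y then h ` e (k ` L) else {})"

lemma ends_ofD:
  assumes "e \<in> ends_of X" "compact K" "K \<subseteq> X"
  shows "e K \<in> components (X - K)" "\<not> compact (X \<inter> closure (e K))"
  using assms unfolding ends_of_def by auto

lemma ends_of_mono:
  assumes "e \<in> ends_of X" "compact K" "compact L" "K \<subseteq> L" "L \<subseteq> X"
  shows "e L \<subseteq> e K"
  using assms unfolding ends_of_def by auto

lemma ends_of_empty:
  assumes "e \<in> ends_of X" "\<not> (compact K \<and> K \<subseteq> X)"
  shows "e K = {}"
  using assms unfolding ends_of_def by auto

lemma homeomorphism_component_image:
  assumes hom: "homeomorphism X Y h k" and C: "C \<in> components X"
  shows "h ` C \<in> components Y"
proof -
  have C': "C \<noteq> {}" "C \<subseteq> X" "connected C"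
    and mx: "\<And>D. D \<noteq> {} \<Longrightarrow> C \<subseteq> D \<Longrightarrow> D \<subseteq> X \<Longrightarrow> connected D \<Longrightarrow> D = C"
    using iffD1[OF in_components_maximal C] by simp_all
  have hc: "continuous_on X h" and kc: "continuous_on Y k"
    and hY: "h ` X = Y" and kX: "k ` Y = X"
    and kh: "\<And>x. x \<in> X \<Longrightarrow> k (h x) = x" and hk: "\<And>y. y \<in> Y \<Longrightarrow> h (k y) = y"
    using hom by (auto simp: homeomorphism_def)
  have "D = h ` C" if D: "D \<noteq> {}" "h ` C \<subseteq> D" "D \<subseteq> Y" "connected D" for D
  proof -
    have "connected (k ` D)"
      using D kc by (meson connected_continuous_image continuous_on_subset)
    moreover have "C \<subseteq> k ` D"
    proof
      fix x assume "x \<in> C"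
      then have "h x \<in> D" "k (h x) = x" using D C' kh by auto
      then show "x \<in> k ` D" by force
    qed
    moreover have "k ` D \<subseteq> X" using D kX by auto
    ultimately have "k ` D = C" using mx D by auto
    then have "h ` k ` D = h ` C" by simp
    moreover have "h ` k ` D = D"
    proof -
      have "h (k x) = x" if "x \<in> D" for x using that hk D by blast
      then show ?thesis by (simp add: image_image)
    qed
    ultimately show ?thesis by simp
  qed
  moreover have "connected (h ` C)"
    using C' hc by (meson connected_continuous_image continuous_on_subset)
  moreover have "h ` C \<noteq> {}" "h ` C \<subseteq> Y" using C' hY by auto
  ultimately have "h ` C \<noteq> {} \<and> h ` C \<subseteq> Y \<and> connected (h ` C) \<and>
      (\<forall>D. D \<noteq> {} \<and> h ` C \<subseteq> D \<and> D \<subseteq> Y \<and> connected D \<longrightarrow> D = h ` C)" by simp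
  then show ?thesis by (rule iffD2[OF in_components_maximal])
qed

lemma homeomorphism_closure_image:
  fixes X :: "'a::metric_space set" and Y :: "'b::metric_space set"
  assumes hom: "homeomorphism X Y h k" and C: "C \<subseteq> X"
  shows "h ` (X \<inter> closure C) \<subseteq> Y \<inter> closure (h ` C)"
proof
  fix y assume "y \<in> h ` (X \<inter> closure C)"
  then obtain x where x: "x \<in> X" "x \<in> closure C" "y = h x" by auto
  then obtain s where s: "\<And>n. s n \<in> C" "s \<longlonglongrightarrow> x"
    unfolding closure_sequential by auto
  have "continuous_on X h" using hom by (auto simp: homeomorphism_def)
  then have "(\<lambda>n. h (s n)) \<longlonglongrightarrow> h x"
    using s x C continuous_on_tendsto_compose[of X h s x sequentially] by (auto intro: always_eventually)
  then have "h x \<in> closure (h ` C)"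
    unfolding closure_sequential using s by (intro exI[of _ "\<lambda>n. h (s n)"]) auto
  then show "y \<in> Y \<inter> closure (h ` C)" using x hom by (auto simp: homeomorphism_def)
qed

text \<open>The closure in the definition of an end is taken relative to the space, so
  non-compactness is a topological property: the closure images under h and under its inverse give
  the two inclusions that carry a compact closure back to X.\<close>

lemma push_end_in_ends_of:
  assumes hom: "homeomorphism X Y h k" and e: "e \<in> ends_of X"
  shows "push_end h k Y e \<in> ends_of Y"
proof -
  have hc: "continuous_on X h" and kc: "continuous_on Y k"
    and hY: "h ` X = Y" and kX: "k ` Y = X"
    and kh: "\<And>x. x \<in> X \<Longrightarrow> k (h x) = x" and hk: "\<And>y. y \<in> Y \<Longrightarrow> h (k y) = y"
    using hom by (auto simp: homeomorphism_def)
  have kL: "compact (k ` L)" "k ` L \<subseteq> X" if "compact L" "L \<subseteq> Y" for L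
    using that kc kX by (auto intro!: compact_continuous_image elim: continuous_on_subset)
  have comp: "h ` e (k ` L) \<in> components (Y - L) \<and> \<not> compact (Y \<inter> closure (h ` e (k ` L)))"
    if L: "compact L" "L \<subseteq> Y" for L
  proof
    have ek: "e (k ` L) \<in> components (X - k ` L)" "\<not> compact (X \<inter> closure (e (k ` L)))"
      using ends_ofD[OF e kL[OF L]] by auto
    have "h ` (X - k ` L) = Y - L"
    proof
      show "h ` (X - k ` L) \<subseteq> Y - L"
        using hY kh by (force simp: image_iff)
      show "Y - L \<subseteq> h ` (X - k ` L)"
      proof
        fix y assume y: "y \<in> Y - L"
        then have "k y \<in> X - k ` L" using kX hk L by (metis DiffD1 DiffD2 DiffI image_iff subsetD)
        then show "y \<in> h ` (X - k ` L)" using hk y by force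
      qed
    qed
    then have "homeomorphism (X - k ` L) (Y - L) h k"
      using homeomorphism_of_subsets[OF hom] by (metis Diff_subset)
    then show "h ` e (k ` L) \<in> components (Y - L)"
      using homeomorphism_component_image ek by blast
    have sub: "e (k ` L) \<subseteq> X" using ek in_components_subset by fastforce
    show "\<not> compact (Y \<inter> closure (h ` e (k ` L)))"
    proof
      assume c: "compact (Y \<inter> closure (h ` e (k ` L)))"
      have 1: "k ` (Y \<inter> closure (h ` e (k ` L))) \<subseteq> X \<inter> closure (k ` h ` e (k ` L))"
        by (rule homeomorphism_closure_image) (use hom sub hY homeomorphism_sym in blast)+
      have 2: "k ` h ` e (k ` L) = e (k ` L)"
      proof -
        have "k (h x) = x" if "x \<in> e (k ` L)" for x using that kh sub by blast
        then show ?thesis by (simp add: image_image)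
      qed
      have 3: "X \<inter> closure (e (k ` L)) \<subseteq> k ` (Y \<inter> closure (h ` e (k ` L)))"
      proof
        fix x assume x: "x \<in> X \<inter> closure (e (k ` L))"
        then have "h x \<in> Y \<inter> closure (h ` e (k ` L))" using homeomorphism_closure_image[OF hom sub] by blast
        moreover have "k (h x) = x" using kh x by blast
        ultimately show "x \<in> k ` (Y \<inter> closure (h ` e (k ` L)))" by (metis imageI)
      qed
      have "k ` (Y \<inter> closure (h ` e (k ` L))) = X \<inter> closure (e (k ` L))"
        using 1 3 unfolding 2 by (rule subset_antisym)
      moreover have "compact (k ` (Y \<inter> closure (h ` e (k ` L))))"
        using c kc by (auto intro!: compact_continuous_image elim: continuous_on_subset)
      ultimately show False using ek by simp
    qed
  qed
  show ?thesis unfolding ends_of_def mem_Collect_eq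
  proof (intro conjI allI impI)
    fix L assume "compact L \<and> L \<subseteq> Y"
    then show "push_end h k Y e L \<in> components (Y - L)" "\<not> compact (Y \<inter> closure (push_end h k Y e L))"
      using comp by (auto simp: push_end_def)
  next
    fix K L assume a: "compact K \<and> compact L \<and> K \<subseteq> L \<and> L \<subseteq> Y"
    then have "e (k ` L) \<subseteq> e (k ` K)"
      using kL[of L] kL[of K] by (intro ends_of_mono[OF e]) auto
    then show "push_end h k Y e L \<subseteq> push_end h k Y e K" using a by (auto simp: push_end_def)
  qed (auto simp: push_end_def)
qed

lemma push_end_push_end:
  assumes hom: "homeomorphism X Y h k" and e: "e \<in> ends_of X"
  shows "push_end k h X (push_end h k Y e) = e"
proof
  fix K
  have hc: "continuous_on X h" and hY: "h ` X = Y"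
    and kh: "\<And>x. x \<in> X \<Longrightarrow> k (h x) = x"
    using hom by (auto simp: homeomorphism_def)
  show "push_end k h X (push_end h k Y e) K = e K"
  proof (cases "compact K \<and> K \<subseteq> X")
    case True
    then have "compact (h ` K)" "h ` K \<subseteq> Y"
      using hc hY by (auto intro!: compact_continuous_image elim: continuous_on_subset)
    moreover have "k ` h ` K = K"
    proof -
      have "k (h x) = x" if "x \<in> K" for x using that kh True by blast
      then show ?thesis by (simp add: image_image)
    qed
    moreover have "e K \<subseteq> X" using ends_ofD(1)[OF e, of K] True in_components_subset by fastforce
    then have "k (h x) = x" if "x \<in> e K" for x using that kh by blast
    then have "k ` h ` e K = e K" by (simp add: image_image)
    ultimately show ?thesis using True by (simp add: push_end_def)
  qed (use ends_of_empty[OF e] in \<open>auto simp: push_end_def\<close>)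
qed

lemma push_end_limit_end:
  assumes hom: "homeomorphism X Y h k" and e: "limit_end X e"
  shows "limit_end Y (push_end h k Y e)"
proof -
  have eX: "e \<in> ends_of X" using e by (simp add: limit_end_def)
  have "\<exists>e'\<in>ends_of Y. e' \<noteq> push_end h k Y e \<and> e' K = push_end h k Y e K"
    if K: "compact K" "K \<subseteq> Y" for K
  proof -
    have "compact (k ` K)" "k ` K \<subseteq> X"
      using K hom by (auto simp: homeomorphism_def intro!: compact_continuous_image elim: continuous_on_subset)
    then obtain e' where e': "e' \<in> ends_of X" "e' \<noteq> e" "e' (k ` K) = e (k ` K)"
      using e unfolding limit_end_def by blast
    then have "push_end h k Y e' \<noteq> push_end h k Y e"
      using push_end_push_end[OF hom] eX by metis
    moreover have "push_end h k Y e' K = push_end h k Y e K" using e'(3) by (simp add: push_end_def)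
    ultimately show ?thesis using push_end_in_ends_of[OF hom e'(1)] by blast
  qed
  then show ?thesis using push_end_in_ends_of[OF hom eX] by (auto simp: limit_end_def)
qed

text \<open>Lets the ends of the quotient surface be counted in the punctured plane that
  parametrises it.\<close>

lemma homeomorphic_ends:
  assumes "X homeomorphic Y" "infinite (ends_of X)" "\<exists>!e. limit_end X e"
  shows "infinite (ends_of Y)" "\<exists>!e. limit_end Y e"
proof -
  obtain h k where hom: "homeomorphism X Y h k" using assms(1) unfolding homeomorphic_def by blast
  have hom': "homeomorphism Y X k h" using hom homeomorphism_sym by blast
  have "inj_on (push_end h k Y) (ends_of X)"
    using push_end_push_end[OF hom] by (metis inj_onI)
  moreover have "push_end h k Y ` ends_of X \<subseteq> ends_of Y"
    using push_end_in_ends_of[OF hom] by auto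
  ultimately show "infinite (ends_of Y)"
    using assms(2) finite_imageD finite_subset by blast
  obtain e where e: "limit_end X e" and u: "\<And>e'. limit_end X e' \<Longrightarrow> e' = e" using assms(3) by blast
  show "\<exists>!e. limit_end Y e"
  proof (rule ex1I)
    show "limit_end Y (push_end h k Y e)" by (rule push_end_limit_end[OF hom e])
    fix e' assume e': "limit_end Y e'"
    then have "push_end k h X e' = e" using u push_end_limit_end[OF hom'] by blast
    then show "e' = push_end h k Y e"
      using push_end_push_end[OF hom'] e' unfolding limit_end_def by metis
  qed
qed

section \<open>Ends determined by a shrinking sequence of connected sets\<close>

text \<open>For a sequence as in \<open>end_base\<close> exactly one component qualifies; the union
  names it without a choice operator.\<close>

definition seq_end :: "'a::metric_space set \<Rightarrow> (nat \<Rightarrow> 'a set) \<Rightarrow> 'a set \<Rightarrow> 'a set" where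
  "seq_end X N K = (if compact K \<and> K \<subseteq> X then \<Union>{C \<in> components (X - K). \<exists>n. N n \<subseteq> C} else {})"

locale end_base =
  fixes X :: "'a::metric_space set" and N :: "nat \<Rightarrow> 'a set"
  assumes N_connected: "connected (N n)" and N_nonempty: "N n \<noteq> {}" and N_sub: "N n \<subseteq> X"
    and N_dec: "decseq N"
    and N_escape: "compact K \<Longrightarrow> K \<subseteq> X \<Longrightarrow> \<exists>n. N n \<inter> K = {}"
begin

lemma seq_end_eqI:
  assumes K: "compact K" "K \<subseteq> X" and C: "C \<in> components (X - K)" and n: "N n \<subseteq> C"
  shows "seq_end X N K = C"
proof -
  have "D = C" if D: "D \<in> components (X - K)" "N m \<subseteq> D" for D m
  proof -
    have "N (max m n) \<subseteq> D \<inter> C" using D n N_dec unfolding decseq_def by (meson Int_greatest max.cobounded1 max.cobounded2 order_trans)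
    then have "D \<inter> C \<noteq> {}" using N_nonempty by blast
    then show ?thesis using components_nonoverlap[OF D(1) C] by blast
  qed
  then have "{C \<in> components (X - K). \<exists>n. N n \<subseteq> C} = {C}" using C n by blast
  then show ?thesis using K by (simp add: seq_end_def)
qed

lemma seq_end_component:
  assumes K: "compact K" "K \<subseteq> X"
  shows "seq_end X N K \<in> components (X - K)" "\<exists>n. N n \<subseteq> seq_end X N K"
proof -
  obtain n where n: "N n \<inter> K = {}" using N_escape[OF K] by blast
  then have 1: "N n \<subseteq> X - K" using N_sub by blast
  then have "X - K \<noteq> {}" using N_nonempty[of n] by blast
  then obtain C where C: "C \<in> components (X - K)" "N n \<subseteq> C"
    using exists_component_superset[OF 1 _ N_connected] by blast
  then have "seq_end X N K = C" using seq_end_eqI[OF K] by blast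
  then show "seq_end X N K \<in> components (X - K)" "\<exists>n. N n \<subseteq> seq_end X N K" using C by auto
qed

lemma seq_end_in_ends_of: "seq_end X N \<in> ends_of X"
  unfolding ends_of_def mem_Collect_eq
proof (intro conjI allI impI)
  fix K assume K: "compact K \<and> K \<subseteq> X"
  then show "seq_end X N K \<in> components (X - K)" using seq_end_component by blast
  obtain n where n: "N n \<subseteq> seq_end X N K" using K seq_end_component by blast
  show "\<not> compact (X \<inter> closure (seq_end X N K))"
  proof
    assume "compact (X \<inter> closure (seq_end X N K))"
    \<comment> \<open>A compact closure would be a compact subset of X, hence avoided by some
      \<open>N m\<close>; but the sets are nested and eventually lie inside the component.\<close>
    then obtain m where m: "N m \<inter> (X \<inter> closure (seq_end X N K)) = {}" using N_escape by blast
    have "N (max m n) \<subseteq> N m \<inter> N n" using N_dec by (auto simp: decseq_def max_def)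
    then show False using m n N_sub N_nonempty[of "max m n"] closure_subset by blast
  qed
next
  fix K L assume a: "compact K \<and> compact L \<and> K \<subseteq> L \<and> L \<subseteq> X"
  then have K: "compact K" "K \<subseteq> X" and L: "compact L" "L \<subseteq> X" by auto
  obtain n where n: "N n \<subseteq> seq_end X N L" using L seq_end_component by blast
  have cL: "seq_end X N L \<in> components (X - L)" using L seq_end_component by blast
  then have "connected (seq_end X N L)" "seq_end X N L \<subseteq> X - L" "seq_end X N L \<noteq> {}"
    using in_components_connected in_components_subset in_components_nonempty by blast+
  moreover have "X - L \<subseteq> X - K" using a by blast
  ultimately have "seq_end X N L \<subseteq> X - K" "X - K \<noteq> {}" "connected (seq_end X N L)" by auto
  then obtain C where C: "C \<in> components (X - K)" "seq_end X N L \<subseteq> C"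
    using exists_component_superset by metis
  then have "seq_end X N K = C" using seq_end_eqI[OF K] n by blast
  then show "seq_end X N L \<subseteq> seq_end X N K" using C by simp
qed (auto simp: seq_end_def)

end

lemma component_supset:
  assumes "C \<in> components S" "connected N" "N \<subseteq> S" "N \<inter> C \<noteq> {}"
  shows "N \<subseteq> C"
  using components_maximal[OF assms(1,2,3)] assms(4) by blast

section \<open>The plane minus an infinite locally finite set\<close>

locale discrete_punctures =
  fixes P :: "complex set"
  assumes P_infinite: "infinite P" and P_locally_finite: "finite (P \<inter> cball 0 R)"
begin

lemma finite_bounded:
  assumes "bounded S"
  shows "finite (P \<inter> S)"
proof -
  obtain R where "\<forall>x\<in>S. norm x \<le> R" using assms bounded_iff by blast
  then have "S \<subseteq> cball 0 R" by auto
  then have "P \<inter> S \<subseteq> P \<inter> cball 0 R" by blast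
  then show ?thesis using P_locally_finite finite_subset by blast
qed

lemma countable_P: "countable P"
proof -
  have "P = (\<Union>n::nat. P \<inter> cball 0 (real n))"
    by (auto simp: real_arch_simple)
  moreover have "countable (\<Union>n::nat. P \<inter> cball 0 (real n))"
    by (intro countable_UN) (auto intro: countable_finite P_locally_finite)
  ultimately show ?thesis by simp
qed

lemma closed_subset_P:
  assumes "Q \<subseteq> P"
  shows "closed Q"
proof -
  have fin: "finite (Q \<inter> cball 0 R)" for R
    using assms P_locally_finite[of R] finite_subset[of "Q \<inter> cball 0 R" "P \<inter> cball 0 R"] by blast
  have "\<not> x islimpt Q" for x
  proof
    assume "x islimpt Q"
    then have "infinite (Q \<inter> ball x 1)" by (simp add: islimpt_eq_infinite_ball)
    moreover have "Q \<inter> ball x 1 \<subseteq> Q \<inter> cball 0 (cmod x + 1)"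
    proof
      fix a assume a: "a \<in> Q \<inter> ball x 1"
      then have "cmod (a - x) < 1" by (simp add: dist_norm norm_minus_commute)
      then show "a \<in> Q \<inter> cball 0 (cmod x + 1)" using a norm_triangle_ineq2[of a x] by simp
    qed
    ultimately show False using fin finite_subset by blast
  qed
  then show ?thesis by (simp add: closed_limpt)
qed

lemma end_base_puncture:
  assumes p: "p \<in> P"
  obtains r where "r > 0" "end_base (- P) (\<lambda>n. ball p (r / real (Suc n)) - {p})"
proof -
  have "open (- (P - {p}))" "p \<in> - (P - {p})" using closed_subset_P[of "P - {p}"] open_Compl by blast+
  then obtain r where r: "r > 0" "ball p r \<subseteq> - (P - {p})"
    using open_contains_ball_eq by blast
  have le: "r / real (Suc n) \<le> r" "r / real (Suc n) > 0" for n
    using r by (auto simp: divide_le_eq)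
  have "end_base (- P) (\<lambda>n. ball p (r / real (Suc n)) - {p})"
  proof
    fix n
    show "connected (ball p (r / real (Suc n)) - {p})"
      by (intro connected_punctured_ball) auto
    have "p + of_real (t / 2) \<in> ball p t - {p}" if "t > 0" for t
      using that by (auto simp: dist_norm)
    from this[OF le(2)[of n]] show "ball p (r / real (Suc n)) - {p} \<noteq> {}" by blast
    have "ball p (r / real (Suc n)) \<subseteq> ball p r" using le by (intro subset_ball) auto
    then show "ball p (r / real (Suc n)) - {p} \<subseteq> - P" using r by blast
  next
    show "decseq (\<lambda>n. ball p (r / real (Suc n)) - {p})"
      unfolding decseq_def
    proof (intro allI impI Diff_mono subset_ball)
      fix m n :: nat assume "m \<le> n"
      then show "r / real (Suc n) \<le> r / real (Suc m)"
        using r by (intro divide_left_mono) auto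
    qed auto
  next
    fix K :: "complex set" assume K: "compact K" "K \<subseteq> - P"
    then have "open (- K)" "p \<in> - K" using p compact_imp_closed by blast+
    then obtain s where s: "s > 0" "ball p s \<subseteq> - K" using open_contains_ball_eq by blast
    obtain n where "inverse (real (Suc n)) < s / r" using reals_Archimedean[of "s / r"] s r by auto
    then have "r / real (Suc n) < s" using r by (simp add: field_simps)
    then have "ball p (r / real (Suc n)) \<subseteq> ball p s" by (intro subset_ball) auto
    then show "\<exists>n. (ball p (r / real (Suc n)) - {p}) \<inter> K = {}" using s by blast
  qed
  then show ?thesis using that r by blast
qed

text \<open>Removing a countable set from a connected open subset of the plane keeps it connected,
  and the exterior of a disc is uncountable, so it does not become empty either.\<close>

lemma end_base_infinity: "end_base (- P) (\<lambda>n. - cball 0 (real n) - P)"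
proof
  fix n
  show "connected (- cball 0 (real n) - P)"
    using countable_P by (intro connected_open_diff_countable connected_complement_bounded_convex) auto
  have unc: "uncountable (- cball 0 (real n) :: complex set)"
  proof
    assume "countable (- cball 0 (real n) :: complex set)"
    moreover have "open (- cball 0 (real n) :: complex set)" by auto
    moreover have "- cball 0 (real n) \<noteq> ({} :: complex set)"
    proof -
      have "of_real (real n + 1) \<in> - cball (0::complex) (real n)" by (simp add: norm_of_real del: of_real_add)
      then show ?thesis by blast
    qed
    ultimately obtain x e where "e > 0" "ball x e \<subseteq> (- cball 0 (real n) :: complex set)"
      using open_contains_ball by (metis equals0I)
    then show False using uncountable_ball[of e x] \<open>countable (- cball 0 (real n))\<close> countable_subset by blast
  qed
  show "- cball 0 (real n) - P \<noteq> {}"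
  proof
    assume "- cball 0 (real n) - P = {}"
    then have "- cball 0 (real n) \<subseteq> P" by blast
    then show False using unc countable_P countable_subset by blast
  qed
next
  fix K :: "complex set" assume "compact K" "K \<subseteq> - P"
  then obtain B where B: "\<And>x. x \<in> K \<Longrightarrow> norm x \<le> B" using compact_imp_bounded bounded_iff by metis
  obtain n :: nat where "B \<le> real n" using real_arch_simple by blast
  then have "(- cball 0 (real n) - P) \<inter> K = {}" using B by fastforce
  then show "\<exists>n. (- cball 0 (real n) - P) \<inter> K = {}" by blast
qed (auto simp: decseq_def)

text \<open>The radius r isolates p from the other punctures and hence depends on p; the choice
  hides it.\<close>

definition puncture_end :: "complex \<Rightarrow> complex set \<Rightarrow> complex set" where
  "puncture_end p = (SOME e. \<exists>r>0. end_base (- P) (\<lambda>n. ball p (r / real (Suc n)) - {p}) \<and>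
     e = seq_end (- P) (\<lambda>n. ball p (r / real (Suc n)) - {p}))"

definition infinity_end :: "complex set \<Rightarrow> complex set" where
  "infinity_end = seq_end (- P) (\<lambda>n. - cball 0 (real n) - P)"

lemma puncture_end_props:
  assumes p: "p \<in> P"
  obtains r where "r > 0" "end_base (- P) (\<lambda>n. ball p (r / real (Suc n)) - {p})"
    "puncture_end p = seq_end (- P) (\<lambda>n. ball p (r / real (Suc n)) - {p})"
proof -
  have "\<exists>e. \<exists>r>0. end_base (- P) (\<lambda>n. ball p (r / real (Suc n)) - {p}) \<and>
     e = seq_end (- P) (\<lambda>n. ball p (r / real (Suc n)) - {p})"
    using end_base_puncture[OF p] by metis
  from someI_ex[OF this] show ?thesis using that unfolding puncture_end_def by blast
qed

lemma puncture_end_in: "p \<in> P \<Longrightarrow> puncture_end p \<in> ends_of (- P)"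
  using puncture_end_props end_base.seq_end_in_ends_of by metis

lemma infinity_end_in: "infinity_end \<in> ends_of (- P)"
  using end_base.seq_end_in_ends_of[OF end_base_infinity] by (simp add: infinity_end_def)

lemma puncture_end_near:
  assumes p: "p \<in> P" and K: "compact K" "K \<subseteq> - P"
  shows "\<exists>s>0. ball p s - {p} \<subseteq> puncture_end p K"
proof -
  obtain r where r: "r > 0" "end_base (- P) (\<lambda>n. ball p (r / real (Suc n)) - {p})"
    "puncture_end p = seq_end (- P) (\<lambda>n. ball p (r / real (Suc n)) - {p})"
    using puncture_end_props[OF p] by blast
  obtain n where "ball p (r / real (Suc n)) - {p} \<subseteq> puncture_end p K"
    using end_base.seq_end_component(2)[OF r(2) K] r(3) by auto
  then show ?thesis using r(1) by (intro exI[of _ "r / real (Suc n)"]) auto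
qed

lemma infinity_end_near:
  assumes K: "compact K" "K \<subseteq> - P"
  shows "\<exists>n. - cball 0 (real n) - P \<subseteq> infinity_end K"
  using end_base.seq_end_component(2)[OF end_base_infinity K] by (simp add: infinity_end_def)

text \<open>The circle itself serves as the compact set: a connected set that contains points near p
  and avoids the circle cannot leave the disc.\<close>

lemma puncture_end_inside:
  assumes p: "p \<in> P" and d: "d > 0" and K: "sphere p d \<subseteq> - P"
  shows "puncture_end p (sphere p d) \<subseteq> ball p d"
proof
  fix x assume x: "x \<in> puncture_end p (sphere p d)"
  have cK: "compact (sphere p d)" by simp
  have C: "puncture_end p (sphere p d) \<in> components (- P - sphere p d)"
    using ends_ofD(1)[OF puncture_end_in[OF p] cK K] .
  obtain s where s: "s > 0" "ball p s - {p} \<subseteq> puncture_end p (sphere p d)"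
    using puncture_end_near[OF p cK K] by blast
  let ?y = "p + of_real (min s d / 2)"
  have y: "?y \<in> ball p s - {p}" "?y \<in> ball p d"
    using s(1) d by (auto simp: dist_norm min_def)
  show "x \<in> ball p d"
  proof (rule ccontr)
    assume "x \<notin> ball p d"
    moreover have "connected (puncture_end p (sphere p d))" using C in_components_connected by blast
    ultimately have "puncture_end p (sphere p d) \<inter> frontier (ball p d) \<noteq> {}"
      using connected_Int_frontier[of "puncture_end p (sphere p d)" "ball p d"] x y s(2) by blast
    moreover have "frontier (ball p d) = sphere p d" using d by (simp add: frontier_ball)
    moreover have "puncture_end p (sphere p d) \<inter> sphere p d = {}" using C in_components_subset by fastforce
    ultimately show False by simp
  qed
qed

lemma puncture_isolating_radius:
  assumes p: "p \<in> P"
  obtains d where "d > 0" "cball p d \<inter> P = {p}"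
proof -
  have "open (- (P - {p}))" "p \<in> - (P - {p})" using closed_subset_P[of "P - {p}"] open_Compl by blast+
  then obtain d where "d > 0" "cball p d \<subseteq> - (P - {p})" using open_contains_cball_eq by blast
  then have "cball p d \<inter> P = {p}" using p by auto
  then show ?thesis using that \<open>d > 0\<close> by blast
qed

lemma sphere_avoids: "d > 0 \<Longrightarrow> cball p d \<inter> P = {p} \<Longrightarrow> sphere p d \<subseteq> - P"
  by auto (metis IntI dist_self less_irrefl mem_cball order_refl singletonD)

text \<open>A small circle around p is a compact set that tells the ends apart: an end of q agreeing
  with that of p lies inside the circle, which forces q into a disc whose only puncture is
  p.\<close>

lemma inj_puncture_end: "inj_on puncture_end P"
proof (rule inj_onI)
  fix p q assume p: "p \<in> P" and q: "q \<in> P" and eq: "puncture_end p = puncture_end q"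
  obtain d where d: "d > 0" "cball p d \<inter> P = {p}" using puncture_isolating_radius[OF p] by blast
  have K: "compact (sphere p d)" "sphere p d \<subseteq> - P" using sphere_avoids[OF d] by auto
  obtain s where s: "s > 0" "ball q s - {q} \<subseteq> puncture_end q (sphere p d)"
    using puncture_end_near[OF q K] by blast
  have "ball q s - {q} \<subseteq> ball p d" using s puncture_end_inside[OF p d(1) K(2)] eq by auto
  then have "ball q s \<subseteq> cball p d \<union> {q}" by auto
  moreover have "q islimpt ball q s" using s(1) by (simp add: islimpt_ball)
  then have "q \<in> closure (ball q s - {q})"
    by (metis Diff_cancel closure_def islimpt_punctured UnI2 mem_Collect_eq)
  then have "q \<in> cball p d" using \<open>ball q s - {q} \<subseteq> ball p d\<close>
    by (meson ball_subset_cball closed_cball closure_minimal subset_iff order_trans)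
  then have "q \<in> cball p d \<inter> P" using q by simp
  then show "p = q" using d by simp
qed

lemma infinite_ends: "infinite (ends_of (- P))"
proof -
  have "infinite (puncture_end ` P)" using inj_puncture_end P_infinite finite_imageD by blast
  moreover have "puncture_end ` P \<subseteq> ends_of (- P)" using puncture_end_in by auto
  ultimately show ?thesis using finite_subset by blast
qed

text \<open>Every exterior of a disc contains punctures, and the end of such a puncture selects the
  same component as infinity does. It differs from the end at infinity because a circle around the
  puncture confines it.\<close>

lemma limit_end_infinity: "limit_end (- P) infinity_end"
proof -
  have "\<exists>e'\<in>ends_of (- P). e' \<noteq> infinity_end \<and> e' K = infinity_end K"
    if K: "compact K" "K \<subseteq> - P" for K
  proof -
    obtain n where n: "- cball 0 (real n) - P \<subseteq> infinity_end K" using infinity_end_near[OF K] by blast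
    have "\<not> P \<subseteq> cball 0 (real n)" using P_infinite P_locally_finite[of "real n"] by (metis Int_absorb2)
    then obtain p where p: "p \<in> P" "p \<notin> cball 0 (real n)" by blast
    obtain s where s: "s > 0" "ball p s - {p} \<subseteq> puncture_end p K" using puncture_end_near[OF p(1) K] by blast
    obtain d where d: "d > 0" "cball p d \<inter> P = {p}" using puncture_isolating_radius[OF p(1)] by blast
    obtain t where t: "t > 0" "ball p t \<subseteq> - cball 0 (real n)"
    proof -
      have "open (- cball (0::complex) (real n))" "p \<in> - cball 0 (real n)" using p(2) by (auto simp del: mem_cball)
      then show ?thesis using that open_contains_ball_eq by blast
    qed
    let ?m = "min s (min d t)"
    let ?y = "p + of_real (?m / 2)"
    have m: "?m > 0" using s d t by auto
    have y: "dist p ?y = ?m / 2" "?y \<noteq> p" using m by (auto simp: dist_norm)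
    have 1: "?y \<in> ball p s - {p}" "?y \<in> ball p t" "?y \<in> cball p d" using y m by auto
    then have "?y \<notin> P" using d(2) y(2) by blast
    then have "?y \<in> puncture_end p K \<inter> infinity_end K" using 1 s(2) t(2) n by blast
    then have eq: "puncture_end p K = infinity_end K"
      using components_nonoverlap[OF ends_ofD(1)[OF puncture_end_in[OF p(1)] K] ends_ofD(1)[OF infinity_end_in K]]
      by blast
    have K': "compact (sphere p d)" "sphere p d \<subseteq> - P" using sphere_avoids[OF d] by auto
    have "puncture_end p \<noteq> infinity_end"
    proof
      assume e: "puncture_end p = infinity_end"
      obtain k where "- cball 0 (real k) - P \<subseteq> infinity_end (sphere p d)" using infinity_end_near[OF K'] by blast
      then have "- cball 0 (real k) - P \<subseteq> cball p d"
        using puncture_end_inside[OF p(1) d(1) K'(2)] ball_subset_cball[of p d] unfolding e by blast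
      then have sub: "- cball 0 (real k) - P \<subseteq> - cball 0 (real k) \<inter> cball p d" by blast
      obtain j where j: "real j \<ge> real k" "cball p d \<subseteq> cball 0 (real j)"
      proof -
        obtain j :: nat where "real j \<ge> max (real k) (norm p + d)" using real_arch_simple by blast
        moreover then have "cball p d \<subseteq> cball 0 (real j)"
        proof (intro subsetI)
          fix a assume "a \<in> cball p d"
          then have "cmod (a - p) \<le> d" by (simp add: dist_norm norm_minus_commute)
          then show "a \<in> cball 0 (real j)" using norm_triangle_ineq2[of a p] \<open>max (real k) (norm p + d) \<le> real j\<close> by simp
        qed
        ultimately show ?thesis using that by auto
      qed
      have "- cball 0 (real j) - P \<subseteq> - cball 0 (real k) - P" using j by auto
      then have "- cball 0 (real j) - P \<subseteq> cball 0 (real j)" using sub j by blast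
      then have "- cball 0 (real j) - P = {}" by blast
      then show False using end_base.N_nonempty[OF end_base_infinity] by blast
    qed
    then show ?thesis using eq puncture_end_in[OF p(1)] by blast
  qed
  then show ?thesis using infinity_end_in by (auto simp: limit_end_def)
qed

lemma unbounded_end_eq:
  assumes e: "e \<in> ends_of (- P)" and unb: "\<And>K. compact K \<Longrightarrow> K \<subseteq> - P \<Longrightarrow> \<not> bounded (e K)"
  shows "e = infinity_end"
proof
  fix K
  show "e K = infinity_end K"
  proof (cases "compact K \<and> K \<subseteq> - P")
    case True
    then have K: "compact K" "K \<subseteq> - P" by auto
    obtain n where n: "- cball 0 (real n) - P \<subseteq> infinity_end K" using infinity_end_near[OF K] by blast
    have "\<not> e K \<subseteq> cball 0 (real n)" using unb[OF K] bounded_subset by blast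
    moreover have "e K \<subseteq> - P" using ends_ofD(1)[OF e K] in_components_subset by fastforce
    ultimately have "e K \<inter> infinity_end K \<noteq> {}" using n by blast
    then show ?thesis
      using components_nonoverlap[OF ends_ofD(1)[OF e K] ends_ofD(1)[OF infinity_end_in K]] by blast
  next
    case False
    then show ?thesis using ends_of_empty e infinity_end_in by metis
  qed
qed

text \<open>Enlarging the compact set keeps the end inside the ball, where a non-compact relative
  closure is possible only if q is an accumulation point. So both ends contain punctured
  neighbourhoods of q for every compact set, hence choose the same components.\<close>

lemma end_near_puncture_determined:
  assumes e: "e \<in> ends_of (- P)" and e': "e' \<in> ends_of (- P)"
    and K: "compact K" "K \<subseteq> - P" and q: "cball q d \<inter> P = {q}"
    and sub: "e K \<subseteq> ball q d" "e' K \<subseteq> ball q d"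
  shows "e = e'"
proof
  have near: "\<exists>s>0. ball q s - {q} \<subseteq> f L" if f: "f \<in> ends_of (- P)" "f K \<subseteq> ball q d"
    and L: "compact L" "L \<subseteq> - P" for f L
  proof -
    let ?M = "K \<union> L"
    have M: "compact ?M" "?M \<subseteq> - P" using K L by auto
    have c: "f ?M \<in> components (- P - ?M)" and nc: "\<not> compact (- P \<inter> closure (f ?M))"
      using ends_ofD[OF f(1) M] by auto
    have "f ?M \<subseteq> f K" using ends_of_mono[OF f(1) K(1) M(1) _ M(2)] by blast
    then have "f ?M \<subseteq> ball q d" using f(2) by blast
    then have cl: "closure (f ?M) \<subseteq> cball q d" by (meson ball_subset_cball closed_cball closure_minimal order_trans)
    have qcl: "q \<in> closure (f ?M)"
    proof (rule ccontr)
      assume "q \<notin> closure (f ?M)"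
      then have "- P \<inter> closure (f ?M) = closure (f ?M)" using cl q by fastforce
      moreover have "compact (closure (f ?M))"
        using cl by (meson bounded_cball bounded_subset compact_eq_bounded_closed closed_closure)
      ultimately show False using nc by simp
    qed
    have "q \<in> P" using q by blast
    then have "q \<in> - ?M - (P - {q})" using M(2) by blast
    moreover have "open (- ?M - (P - {q}))"
      by (intro open_Diff open_Compl compact_imp_closed[OF M(1)] closed_subset_P) auto
    ultimately have "open (- ?M - (P - {q}))" "q \<in> - ?M - (P - {q})" by auto
    then obtain s where s: "s > 0" "ball q s \<subseteq> - ?M - (P - {q})" using open_contains_ball_eq by blast
    have "f ?M \<inter> ball q s \<noteq> {}" using qcl s(1)
      by (metis centre_in_ball disjoint_iff open_Int_closure_eq_empty open_ball inf_commute)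
    moreover have "q \<notin> f ?M" using c \<open>q \<in> P\<close> in_components_subset by fastforce
    ultimately have "(ball q s - {q}) \<inter> f ?M \<noteq> {}" by blast
    moreover have "connected (ball q s - {q})" by (intro connected_punctured_ball) auto
    moreover have "ball q s - {q} \<subseteq> - P - ?M" using s by blast
    ultimately have "ball q s - {q} \<subseteq> f ?M" using component_supset[OF c] by blast
    moreover have "f ?M \<subseteq> f L" using ends_of_mono[OF f(1) L(1) M(1) _ M(2)] by blast
    ultimately show ?thesis using s(1) by blast
  qed
  fix L
  show "e L = e' L"
  proof (cases "compact L \<and> L \<subseteq> - P")
    case True
    then have L: "compact L" "L \<subseteq> - P" by auto
    obtain s s' where s: "s > 0" "ball q s - {q} \<subseteq> e L" and s': "s' > 0" "ball q s' - {q} \<subseteq> e' L"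
      using near[OF e sub(1) L] near[OF e' sub(2) L] by blast
    let ?y = "q + of_real (min s s' / 2)"
    have "dist q ?y = min s s' / 2" "?y \<noteq> q" using s s' by (auto simp: dist_norm)
    then have "?y \<in> (ball q s - {q}) \<inter> (ball q s' - {q})" using s s' by auto
    then have "e L \<inter> e' L \<noteq> {}" using s s' by blast
    then show ?thesis
      using components_nonoverlap[OF ends_ofD(1)[OF e L] ends_ofD(1)[OF e' L]] by blast
  next
    case False
    then show ?thesis using ends_of_empty e e' by metis
  qed
qed

text \<open>The closure of a bounded \<open>e K\<close> contains finitely many punctures. Adding to
  K everything outside small disjoint discs around them leaves e, by connectedness, in a single
  disc, and there an end is determined by its puncture. So e is isolated in the space of
  ends.\<close>

lemma bounded_end_not_limit:
  assumes e: "e \<in> ends_of (- P)" and K: "compact K" "K \<subseteq> - P" and bd: "bounded (e K)"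
  shows "\<not> limit_end (- P) e"
proof -
  let ?C = "closure (e K)"
  have cC: "compact ?C" using bd by (simp add: compact_closure)
  have "finite (P \<inter> ?C)" using finite_bounded cC compact_imp_bounded by blast
  define Q where "Q = P \<inter> ?C"
  have Q: "finite Q" "Q \<subseteq> P" using \<open>finite (P \<inter> ?C)\<close> Q_def by auto
  have "\<exists>d>0. \<forall>q\<in>Q. cball q d \<inter> P = {q}"
    using Q
  proof (induction Q rule: finite_induct)
    case (insert q Q)
    then obtain d where d: "d > 0" "\<forall>q\<in>Q. cball q d \<inter> P = {q}" by auto
    obtain d' where d': "d' > 0" "cball q d' \<inter> P = {q}" using puncture_isolating_radius insert by blast
    have "cball x (min d d') \<inter> P = {x}" if "x \<in> insert q Q" for x
    proof -
      have "cball x (min d d') \<subseteq> cball x d" "cball x (min d d') \<subseteq> cball x d'" by (auto intro!: subset_cball)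
      moreover have "x \<in> cball x (min d d') \<inter> P" using d d' that insert by auto
      ultimately show ?thesis using that d d' by blast
    qed
    then show ?case using d d' by (intro exI[of _ "min d d'"]) auto
  qed (auto intro: exI[of _ 1])
  then obtain d0 where d0: "d0 > 0" "\<And>q. q \<in> Q \<Longrightarrow> cball q d0 \<inter> P = {q}" by blast
  \<comment> \<open>Two punctures of Q are more than d0 apart, so half the radius makes the discs
    disjoint.\<close>
  define d where "d = d0 / 2"
  have d: "d > 0" "\<And>q. q \<in> Q \<Longrightarrow> cball q d \<inter> P = {q}"
  proof -
    show "d > 0" using d0 by (simp add: d_def)
    fix q assume q: "q \<in> Q"
    have "cball q d \<subseteq> cball q d0" using d0 by (auto simp: d_def)
    moreover have "q \<in> cball q d \<inter> P" using q Q \<open>d > 0\<close> by auto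
    ultimately show "cball q d \<inter> P = {q}" using d0(2)[OF q] by blast
  qed
  have disj: "ball q d \<inter> ball q' d = {}" if "q \<in> Q" "q' \<in> Q" "q \<noteq> q'" for q q'
  proof -
    have "dist q q' > d0"
    proof (rule ccontr)
      assume "\<not> dist q q' > d0"
      then have "q' \<in> cball q d0 \<inter> P" using that Q by auto
      then show False using d0(2)[OF that(1)] that by auto
    qed
    then show ?thesis using d_def by (intro disjoint_ballI) auto
  qed
  define K' where "K' = K \<union> (?C - (\<Union>q\<in>Q. ball q d))"
  have K': "compact K'" "K' \<subseteq> - P"
  proof -
    show "compact K'" unfolding K'_def using K cC by (intro compact_Un compact_diff) auto
    have "x \<notin> P" if "x \<in> ?C - (\<Union>q\<in>Q. ball q d)" for x
      using that d(1) Q_def centre_in_ball by blast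
    then show "K' \<subseteq> - P" using K unfolding K'_def by blast
  qed
  have c: "e K' \<in> components (- P - K')" using ends_ofD(1)[OF e K'] .
  have "e K' \<subseteq> e K" using ends_of_mono[OF e K(1) K'(1) _ K'(2)] K'_def by blast
  then have sub: "e K' \<subseteq> (\<Union>q\<in>Q. ball q d)"
    using c in_components_subset closure_subset unfolding K'_def by fastforce
  obtain x where x: "x \<in> e K'" using c in_components_nonempty by blast
  then obtain q where q: "q \<in> Q" "x \<in> ball q d" using sub by blast
  have "e K' \<subseteq> ball q d"
  proof (rule ccontr)
    assume nsub: "\<not> e K' \<subseteq> ball q d"
    let ?O = "\<Union>q'\<in>Q - {q}. ball q' d"
    have "connected (e K')" using c in_components_connected by blast
    moreover have "open (ball q d)" "open ?O" by auto
    moreover have "e K' \<subseteq> ball q d \<union> ?O" using sub by blast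
    moreover have "ball q d \<inter> ?O \<inter> e K' = {}" using disj q by blast
    moreover have "ball q d \<inter> e K' \<noteq> {}" using x q by blast
    moreover have "?O \<inter> e K' \<noteq> {}" using nsub sub by blast
    ultimately show False using connectedD[of "e K'" "ball q d" ?O] by blast
  qed
  then have "e' = e" if "e' \<in> ends_of (- P)" "e' K' = e K'" for e'
    using end_near_puncture_determined[OF that(1) e K' d(2)[OF q(1)]] that by simp
  then show ?thesis using K' unfolding limit_end_def by blast
qed

lemma unique_limit_end: "\<exists>!e. limit_end (- P) e"
proof (rule ex1I[of "limit_end (- P)", OF limit_end_infinity])
  fix e assume e: "limit_end (- P) e"
  then have e': "e \<in> ends_of (- P)" by (simp add: limit_end_def)
  then show "e = infinity_end"
    using unbounded_end_eq[OF e'] bounded_end_not_limit[OF e'] e by blast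
qed

end

section \<open>Graph charts from Weierstrass data\<close>

text \<open>Cramer's rule in the real basis a, b of the plane; the determinant of two complex
  numbers x, y is \<open>Im (cnj x * y)\<close>. Later the two coefficients are the slopes of the
  surface as a graph.\<close>

lemma real_basis_expansion:
  fixes a b c :: complex
  assumes J: "Im (cnj a * b) \<noteq> 0"
  shows "c = of_real (Im (cnj c * b) / Im (cnj a * b)) * a + of_real (Im (cnj a * c) / Im (cnj a * b)) * b"
proof -
  define j where "j = Im (cnj a * b)"
  define k l where "k = Im (cnj c * b)" and "l = Im (cnj a * c)"
  have "of_real j * c = of_real k * a + of_real l * b"
    unfolding j_def k_def l_def by (simp add: complex_eq_iff algebra_simps)
  moreover have "j \<noteq> 0" using J j_def by simp
  ultimately have "c = of_real (k / j) * a + of_real (l / j) * b" by (simp add: field_simps)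
  then show ?thesis unfolding j_def k_def l_def .
qed

text \<open>Discriminant of the real quadratic form Re (w h^2) in the frame c, d. It is negative
  because a harmonic quadratic form is indefinite.\<close>

lemma quadratic_form_det:
  fixes w c d :: complex
  shows "Re (w * c\<^sup>2) * Re (w * d\<^sup>2) - (Re (w * (c * d)))\<^sup>2 = - (cmod w)\<^sup>2 * (Im (c * cnj d))\<^sup>2"
  unfolding cmod_power2 by (simp add: power2_eq_square algebra_simps)

text \<open>Explicit inverse of the real linear map taking h to (Re (a h), Re (b h)), which is the
  Jacobian of two coordinates of the surface.\<close>

lemma real_solve_Re:
  fixes a b h :: complex
  assumes J: "Im (cnj a * b) \<noteq> 0"
  shows "Re (a * (\<i> * (of_real x * cnj b - of_real y * cnj a) / of_real (Im (cnj a * b)))) = x"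
    and "Re (b * (\<i> * (of_real x * cnj b - of_real y * cnj a) / of_real (Im (cnj a * b)))) = y"
    and "\<i> * (of_real (Re (a * h)) * cnj b - of_real (Re (b * h)) * cnj a) / of_real (Im (cnj a * b)) = h"
proof -
  let ?J = "Im (cnj a * b)"
  have 1: "t * (\<i> * (of_real x * cnj b - of_real y * cnj a) / of_real ?J)
      = (t * (\<i> * (of_real x * cnj b - of_real y * cnj a))) / of_real ?J" for t by simp
  have "Re (a * (\<i> * (of_real x * cnj b - of_real y * cnj a))) = x * ?J"
    by (simp add: algebra_simps)
  then show "Re (a * (\<i> * (of_real x * cnj b - of_real y * cnj a) / of_real ?J)) = x"
    unfolding 1 using J by (simp only: Re_divide_of_real) simp
  have "Re (b * (\<i> * (of_real x * cnj b - of_real y * cnj a))) = y * ?J"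
    by (simp add: algebra_simps)
  then show "Re (b * (\<i> * (of_real x * cnj b - of_real y * cnj a) / of_real ?J)) = y"
    unfolding 1 using J by (simp only: Re_divide_of_real) simp
  define j where "j = ?J"
  have "\<i> * (of_real (Re (a * h)) * cnj b - of_real (Re (b * h)) * cnj a) = h * of_real j"
    unfolding j_def by (simp add: complex_eq_iff algebra_simps)
  then show "\<i> * (of_real (Re (a * h)) * cnj b - of_real (Re (b * h)) * cnj a) / of_real ?J = h"
    using J unfolding j_def[symmetric] by simp
qed

lemma slope_numerator:
  fixes a b c x y v :: complex and p r :: real
  assumes "c = of_real p * a + of_real r * b"
  shows "Im (cnj c * y + cnj v * b) - p * Im (cnj a * y + cnj x * b)
      = Im (cnj (v - of_real p * x - of_real r * y) * b)"
    and "Im (cnj a * v + cnj x * c) - r * Im (cnj a * y + cnj x * b)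
      = Im (cnj a * (v - of_real p * x - of_real r * y))"
  unfolding assms by (simp_all add: algebra_simps)

text \<open>Differentiating c = p a + r b shows that the slopes feel only the residual w, the part
  of c' not matched by p a' + r b'. It is the second fundamental form up to scaling.\<close>

lemma has_derivative_slope:
  fixes a b c :: "complex \<Rightarrow> complex"
  assumes da: "(a has_field_derivative a') (at z)" and db: "(b has_field_derivative b') (at z)"
    and dc: "(c has_field_derivative c') (at z)" and J: "Im (cnj (a z) * b z) \<noteq> 0"
  defines "p \<equiv> \<lambda>z. Im (cnj (c z) * b z) / Im (cnj (a z) * b z)"
    and "r \<equiv> \<lambda>z. Im (cnj (a z) * c z) / Im (cnj (a z) * b z)"
  defines "w \<equiv> c' - of_real (p z) * a' - of_real (r z) * b'"
  shows "(p has_derivative (\<lambda>h. Im (cnj (w * h) * b z) / Im (cnj (a z) * b z))) (at z)"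
    and "(r has_derivative (\<lambda>h. Im (cnj (a z) * (w * h)) / Im (cnj (a z) * b z))) (at z)"
proof -
  let ?J = "Im (cnj (a z) * b z)"
  have a: "(a has_derivative (\<lambda>h. a' * h)) (at z)" and b: "(b has_derivative (\<lambda>h. b' * h)) (at z)"
    and c: "(c has_derivative (\<lambda>h. c' * h)) (at z)"
    using da db dc by (auto simp: has_field_derivative_def)
  have im: "((\<lambda>z. Im (cnj (f z) * g z)) has_derivative (\<lambda>h. Im (cnj (f z) * (g' * h) + cnj (f' * h) * g z))) (at z)"
    if "(f has_derivative (\<lambda>h. f' * h)) (at z)" "(g has_derivative (\<lambda>h. g' * h)) (at z)" for f g :: "complex \<Rightarrow> complex" and f' g'
    by (rule bounded_linear.has_derivative[OF bounded_linear_Im])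
       (intro has_derivative_mult bounded_linear.has_derivative[OF bounded_linear_cnj] that)
  have cancel: "v * t / (t * t) = v / t" if "t \<noteq> 0" for v t :: real using that by simp
  have scale: "x - s * y = v \<Longrightarrow> x * t - s * t * y = v * t" for x y v s t :: real by (auto simp: algebra_simps)
  have exp: "c z = of_real (p z) * a z + of_real (r z) * b z"
    unfolding p_def r_def by (rule real_basis_expansion[OF J])
  have pJ: "p z * ?J = Im (cnj (c z) * b z)" and rJ: "r z * ?J = Im (cnj (a z) * c z)"
    using J by (simp_all add: p_def r_def)
  have dp: "(p has_derivative (\<lambda>h. (Im (cnj (c z) * (b' * h) + cnj (c' * h) * b z) * ?J - Im (cnj (c z) * b z) * Im (cnj (a z) * (b' * h) + cnj (a' * h) * b z)) / (?J * ?J))) (at z)"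
    unfolding p_def by (rule has_derivative_divide'[OF im[OF c b] im[OF a b] J])
  have ep: "(Im (cnj (c z) * (b' * h) + cnj (c' * h) * b z) * ?J - Im (cnj (c z) * b z) * Im (cnj (a z) * (b' * h) + cnj (a' * h) * b z)) / (?J * ?J)
     = Im (cnj (w * h) * b z) / ?J" for h
  proof -
    have "Im (cnj (c z) * (b' * h) + cnj (c' * h) * b z) - p z * Im (cnj (a z) * (b' * h) + cnj (a' * h) * b z)
        = Im (cnj (w * h) * b z)"
      unfolding slope_numerator(1)[OF exp] w_def by (simp only: left_diff_distrib mult.assoc)
    then have "Im (cnj (c z) * (b' * h) + cnj (c' * h) * b z) * ?J - p z * ?J * Im (cnj (a z) * (b' * h) + cnj (a' * h) * b z)
        = Im (cnj (w * h) * b z) * ?J" by (rule scale)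
    then show ?thesis unfolding pJ by (simp only: cancel[OF J])
  qed
  show "(p has_derivative (\<lambda>h. Im (cnj (w * h) * b z) / ?J)) (at z)"
    using dp unfolding ep .
  have dr: "(r has_derivative (\<lambda>h. (Im (cnj (a z) * (c' * h) + cnj (a' * h) * c z) * ?J - Im (cnj (a z) * c z) * Im (cnj (a z) * (b' * h) + cnj (a' * h) * b z)) / (?J * ?J))) (at z)"
    unfolding r_def by (rule has_derivative_divide'[OF im[OF a c] im[OF a b] J])
  have er: "(Im (cnj (a z) * (c' * h) + cnj (a' * h) * c z) * ?J - Im (cnj (a z) * c z) * Im (cnj (a z) * (b' * h) + cnj (a' * h) * b z)) / (?J * ?J)
     = Im (cnj (a z) * (w * h)) / ?J" for h
  proof -
    have "Im (cnj (a z) * (c' * h) + cnj (a' * h) * c z) - r z * Im (cnj (a z) * (b' * h) + cnj (a' * h) * b z)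
        = Im (cnj (a z) * (w * h))"
      unfolding slope_numerator(2)[OF exp] w_def by (simp only: left_diff_distrib mult.assoc)
    then have "Im (cnj (a z) * (c' * h) + cnj (a' * h) * c z) * ?J - r z * ?J * Im (cnj (a z) * (b' * h) + cnj (a' * h) * b z)
        = Im (cnj (a z) * (w * h)) * ?J" by (rule scale)
    then show ?thesis unfolding rJ by (simp only: cancel[OF J])
  qed
  show "(r has_derivative (\<lambda>h. Im (cnj (a z) * (w * h)) / ?J)) (at z)"
    using dr unfolding er .
qed

section \<open>Curvature of a graph in terms of the Weierstrass data\<close>

text \<open>Squared length of the cross product of the real and imaginary parts of the vector (a, b,
  c), that is, of the unnormalised normal.\<close>

definition normal_sq :: "complex \<Rightarrow> complex \<Rightarrow> complex \<Rightarrow> real" where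
  "normal_sq a b c = (Im (cnj b * c))\<^sup>2 + (Im (cnj c * a))\<^sup>2 + (Im (cnj a * b))\<^sup>2"

text \<open>Scalar product of that normal with the derivative of the data: the Hopf differential up
  to normalisation. It vanishes on multiples of (a, b, c), see
  \<open>normal_dot_self\<close>.\<close>

definition normal_dot :: "complex \<Rightarrow> complex \<Rightarrow> complex \<Rightarrow> complex \<Rightarrow> complex \<Rightarrow> complex \<Rightarrow> complex" where
  "normal_dot a b c a' b' c' = of_real (Im (cnj b * c)) * a' + of_real (Im (cnj c * a)) * b' + of_real (Im (cnj a * b)) * c'"

text \<open>The analytic half of \<open>minimal_chart\<close>, separated from the embedding so that
  one graph lemma serves all three choices of the vertical axis.\<close>

definition graph_derivs :: "(real \<times> real) set \<Rightarrow> (real \<times> real \<Rightarrow> real) \<Rightarrow> (real \<times> real \<Rightarrow> real) \<Rightarrow> (real \<times> real \<Rightarrow> real) \<Rightarrow>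
   (real \<times> real \<Rightarrow> real) \<Rightarrow> (real \<times> real \<Rightarrow> real) \<Rightarrow> (real \<times> real \<Rightarrow> real) \<Rightarrow> bool" where
  "graph_derivs U u ux uy uxx uxy uyy \<longleftrightarrow>
     (\<forall>q\<in>U. (u has_derivative (\<lambda>(h,k). ux q * h + uy q * k)) (at q)) \<and>
     (\<forall>q\<in>U. (ux has_derivative (\<lambda>(h,k). uxx q * h + uxy q * k)) (at q)) \<and>
     (\<forall>q\<in>U. (uy has_derivative (\<lambda>(h,k). uxy q * h + uyy q * k)) (at q)) \<and>
     continuous_on U uxx \<and> continuous_on U uxy \<and> continuous_on U uyy \<and>
     (\<forall>q\<in>U. (1 + (uy q)\<^sup>2) * uxx q - 2 * ux q * uy q * uxy q + (1 + (ux q)\<^sup>2) * uyy q = 0)"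

text \<open>In terms of the slopes the normal is J times (-p, -r, 1) and \<open>normal_dot\<close>
  is J w, so both sides reduce to the discriminant of Re (w h^2).\<close>

lemma slope_curvature:
  fixes a b c a' b' c' :: complex
  assumes J: "Im (cnj a * b) \<noteq> 0"
  defines "J \<equiv> Im (cnj a * b)"
  defines "p \<equiv> Im (cnj c * b) / J" and "r \<equiv> Im (cnj a * c) / J"
  defines "w \<equiv> c' - of_real p * a' - of_real r * b'"
  shows "graph_gauss_curv p r (- Re (w * cnj b ^ 2) / J\<^sup>2) (Re (w * (cnj a * cnj b)) / J\<^sup>2) (- Re (w * cnj a ^ 2) / J\<^sup>2)
    = - (cmod (normal_dot a b c a' b' c'))\<^sup>2 / (normal_sq a b c)\<^sup>2"
proof -
  have J0: "J \<noteq> 0" using J J_def by simp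
  have pJ: "p * J = Im (cnj c * b)" and rJ: "r * J = Im (cnj a * c)" using J0 by (simp_all add: p_def r_def)
  have n1: "Im (cnj b * c) = - (p * J)" unfolding pJ by simp
  have n2: "Im (cnj c * a) = - (r * J)" unfolding rJ by simp
  have sq: "normal_sq a b c = J\<^sup>2 * (1 + p\<^sup>2 + r\<^sup>2)"
    unfolding normal_sq_def n1 n2 J_def[symmetric] by (simp add: power2_eq_square algebra_simps)
  have dot: "normal_dot a b c a' b' c' = of_real J * w"
    unfolding normal_dot_def n1 n2 J_def[symmetric] w_def by (simp add: algebra_simps)
  have id: "Re (w * cnj b ^ 2) * Re (w * cnj a ^ 2) - (Re (w * (cnj a * cnj b)))\<^sup>2 = - (cmod w)\<^sup>2 * J\<^sup>2"
  proof -
    have "Im (cnj b * cnj (cnj a)) = - J" by (simp add: J_def)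
    then have "(Im (cnj b * cnj (cnj a)))\<^sup>2 = J\<^sup>2" by (simp only: power2_minus)
    then show ?thesis using quadratic_form_det[of w "cnj b" "cnj a"] by (simp only: mult.commute[of "cnj a"])
  qed
  have sc: "(- x / t) * (- y / t) - (v / t)\<^sup>2 = (x * y - v\<^sup>2) / t\<^sup>2" for x y v t :: real
    by (simp add: power2_eq_square diff_divide_distrib)
  have "(- Re (w * cnj b ^ 2) / J\<^sup>2) * (- Re (w * cnj a ^ 2) / J\<^sup>2) - (Re (w * (cnj a * cnj b)) / J\<^sup>2)\<^sup>2
      = (Re (w * cnj b ^ 2) * Re (w * cnj a ^ 2) - (Re (w * (cnj a * cnj b)))\<^sup>2) / (J\<^sup>2)\<^sup>2"
    by (rule sc)
  also have "\<dots> = - (cmod w)\<^sup>2 / J\<^sup>2"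
    unfolding id using J0 by (simp add: power2_eq_square)
  finally have e: "(- Re (w * cnj b ^ 2) / J\<^sup>2) * (- Re (w * cnj a ^ 2) / J\<^sup>2) - (Re (w * (cnj a * cnj b)) / J\<^sup>2)\<^sup>2
      = - (cmod w)\<^sup>2 / J\<^sup>2" .
  show ?thesis unfolding graph_gauss_curv_def e sq dot norm_mult
  proof -
    have "- x / J\<^sup>2 / t\<^sup>2 = - (J\<^sup>2 * x) / (J\<^sup>2 * t)\<^sup>2" for x t :: real
      using J0 by (simp add: power2_eq_square)
    then show "- (cmod w)\<^sup>2 / J\<^sup>2 / (1 + p\<^sup>2 + r\<^sup>2)\<^sup>2 = - (cmod (complex_of_real J) * cmod w)\<^sup>2 / (J\<^sup>2 * (1 + p\<^sup>2 + r\<^sup>2))\<^sup>2"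
      by (simp add: power_mult_distrib)
  qed
qed

text \<open>The first two coordinates have Jacobian \<open>J\<close>, so the inverse function
  theorem makes them local parameters; the third becomes a function of them, and its derivatives
  follow by the chain rule through the inverse G.\<close>

lemma weierstrass_graph:
  fixes X Y Z :: "complex \<Rightarrow> real" and a b c :: "complex \<Rightarrow> complex"
  assumes D: "open D" "z0 \<in> D"
    and X: "\<And>z. z \<in> D \<Longrightarrow> (X has_derivative (\<lambda>h. Re (a z * h))) (at z)"
    and Y: "\<And>z. z \<in> D \<Longrightarrow> (Y has_derivative (\<lambda>h. Re (b z * h))) (at z)"
    and Z: "\<And>z. z \<in> D \<Longrightarrow> (Z has_derivative (\<lambda>h. Re (c z * h))) (at z)"
    and hol: "a holomorphic_on D" "b holomorphic_on D" "c holomorphic_on D"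
    and conf: "\<And>z. z \<in> D \<Longrightarrow> (a z)\<^sup>2 + (b z)\<^sup>2 + (c z)\<^sup>2 = 0"
    and J0: "Im (cnj (a z0) * b z0) \<noteq> 0"
  obtains N U u ux uy uxx uxy uyy where "open N" "z0 \<in> N" "N \<subseteq> D" "open U"
    "(\<lambda>z. (X z, Y z)) ` N = U" "\<And>z. z \<in> N \<Longrightarrow> u (X z, Y z) = Z z"
    "graph_derivs U u ux uy uxx uxy uyy"
    "\<And>q. q \<in> U \<Longrightarrow> \<exists>z\<in>N. graph_gauss_curv (ux q) (uy q) (uxx q) (uxy q) (uyy q)
        = - (cmod (normal_dot (a z) (b z) (c z) (deriv a z) (deriv b z) (deriv c z)))\<^sup>2 / (normal_sq (a z) (b z) (c z))\<^sup>2"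
proof -
  define J where "J z = Im (cnj (a z) * b z)" for z
  have cont: "continuous_on D a" "continuous_on D b" "continuous_on D c"
    using hol holomorphic_on_imp_continuous_on by auto
  define D' where "D' = D \<inter> J -` (- {0})"
  have "continuous_on D J" unfolding J_def by (intro continuous_intros cont)
  then have D': "open D'" "z0 \<in> D'" "D' \<subseteq> D"
    using D J0 unfolding D'_def by (auto simp: J_def intro!: continuous_open_preimage)
  have J: "J z \<noteq> 0" if "z \<in> D'" for z using that by (auto simp: D'_def)
  \<comment> \<open>The inverse function theorem needs the derivative as a continuous family of
    bounded linear operators; R and I assemble the real pair (Re (a h), Re (b h)) into one
    complex-valued operator.\<close>
  define R where "R = Blinfun (\<lambda>x::complex. complex_of_real (Re x))"
  define I where "I = Blinfun (\<lambda>x::complex. \<i> * complex_of_real (Re x))"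
  have R: "blinfun_apply R x = of_real (Re x)" for x unfolding R_def
    by (subst bounded_linear_Blinfun_apply) (auto intro!: bounded_linear_compose[OF bounded_linear_of_real bounded_linear_Re])
  have I: "blinfun_apply I x = \<i> * of_real (Re x)" for x unfolding I_def
    by (subst bounded_linear_Blinfun_apply)
      (auto intro!: bounded_linear_compose[OF bounded_linear_mult_right bounded_linear_compose[OF bounded_linear_of_real bounded_linear_Re]])
  define f where "f z = Complex (X z) (Y z)" for z
  define f' where "f' z = (R o\<^sub>L blinfun_mult_right (a z)) + (I o\<^sub>L blinfun_mult_right (b z))" for z
  have f'app: "blinfun_apply (f' z) h = Complex (Re (a z * h)) (Re (b z * h))" for z h
    by (simp add: f'_def blinfun.add_left R I complex_eq_iff)
  have df: "(f has_derivative blinfun_apply (f' z)) (at z)" if "z \<in> D'" for z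
  proof -
    have z: "z \<in> D" using that D' by blast
    have "f = (\<lambda>z. of_real (X z) + \<i> * of_real (Y z))" by (auto simp: f_def complex_eq_iff)
    moreover have "((\<lambda>z. of_real (X z) + \<i> * of_real (Y z)) has_derivative (\<lambda>h. of_real (Re (a z * h)) + \<i> * of_real (Re (b z * h)))) (at z)"
      by (intro has_derivative_add has_derivative_mult_right bounded_linear.has_derivative[OF bounded_linear_of_real] X[OF z] Y[OF z])
    moreover have "blinfun_apply (f' z) = (\<lambda>h. of_real (Re (a z * h)) + \<i> * of_real (Re (b z * h)))"
      by (auto simp: f'app complex_eq_iff)
    ultimately show ?thesis by simp
  qed
  have contf': "continuous_on D' f'" unfolding f'_def
    using cont D'(3) by (intro continuous_intros bounded_bilinear.continuous_on[OF bounded_bilinear_blinfun_compose]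
        bounded_linear.continuous_on[OF bounded_linear_blinfun_mult_right]) (auto elim: continuous_on_subset)
  define iv where "iv z w = \<i> * (of_real (Re w) * cnj (b z) - of_real (Im w) * cnj (a z)) / of_real (J z)" for z w
  have ivr: "blinfun_apply (f' z) (iv z w) = w" and ivl: "iv z (blinfun_apply (f' z) h) = h" if "z \<in> D'" for z w h
    using real_solve_Re[of "a z" "b z"] J[OF that] by (auto simp: f'app iv_def J_def complex_eq_iff)
  have bl: "bounded_linear (iv z)" for z unfolding iv_def
    by (intro bounded_linear_divide[THEN bounded_linear_compose] bounded_linear_mult_right[THEN bounded_linear_compose]
        bounded_linear_sub bounded_linear_mult_left[THEN bounded_linear_compose]
        bounded_linear_of_real[THEN bounded_linear_compose] bounded_linear_Re bounded_linear_Im)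
  have inv0: "Blinfun (iv z0) o\<^sub>L f' z0 = id_blinfun"
    by (rule blinfun_eqI) (simp add: bounded_linear_Blinfun_apply[OF bl] ivl[OF D'(2)])
  obtain N V g g' where N: "open N" "N \<subseteq> D'" "z0 \<in> N" and V: "open V" and hom: "homeomorphism N V f g"
    and dg: "\<And>y. y \<in> V \<Longrightarrow> (g has_derivative (g' y)) (at y)"
    and g': "\<And>y. y \<in> V \<Longrightarrow> g' y = inv (blinfun_apply (f' (g y)))"
    and bij: "\<And>y. y \<in> V \<Longrightarrow> bij (blinfun_apply (f' (g y)))"
    using inverse_function_theorem[OF D'(1) df contf' D'(2) inv0] by metis
  have gN: "g y \<in> N" if "y \<in> V" for y using hom that by (auto simp: homeomorphism_def)
  have fg: "f (g y) = y" if "y \<in> V" for y using hom that by (auto simp: homeomorphism_def)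
  have gf: "g (f z) = z" if "z \<in> N" for z using hom that by (auto simp: homeomorphism_def)
  have dg': "(g has_derivative iv (g y)) (at y)" if "y \<in> V" for y
  proof -
    have "g y \<in> D'" using gN[OF that] N by auto
    then have "inv (blinfun_apply (f' (g y))) w = iv (g y) w" for w
      by (intro inv_f_eq ivr) (use bij[OF that] in \<open>auto simp: bij_def\<close>)
    then show ?thesis using dg[OF that] g'[OF that] by (metis ext)
  qed
  define e where "e q = Complex (fst q) (snd q)" for q :: "real \<times> real"
  have e_alt: "e = (\<lambda>q. of_real (fst q) + \<i> * of_real (snd q))" by (auto simp: e_def complex_eq_iff)
  have ble: "bounded_linear e" unfolding e_alt
    by (intro bounded_linear_add bounded_linear_compose[OF bounded_linear_mult_right] bounded_linear_compose[OF bounded_linear_of_real]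
        bounded_linear_fst bounded_linear_snd)
  define U where "U = e -` V"
  have cont_e: "continuous_on S e" for S using ble by (rule linear_continuous_on)
  have U: "open U" unfolding U_def using V continuous_on_open_vimage[of UNIV e] cont_e by auto
  define G where "G q = g (e q)" for q
  have GN: "G q \<in> N" "G q \<in> D'" "G q \<in> D" if "q \<in> U" for q
    using gN that N D' by (auto simp: U_def G_def)
  have dG: "(G has_derivative (\<lambda>(h,k). iv (G q) (Complex h k))) (at q)" if "q \<in> U" for q
  proof -
    have "(e has_derivative e) (at q)" by (rule bounded_linear_imp_has_derivative[OF ble])
    moreover have "(g has_derivative iv (g (e q))) (at (e q))" using dg' that by (simp add: U_def)
    ultimately have "((\<lambda>q. g (e q)) has_derivative (\<lambda>x. iv (g (e q)) (e x))) (at q)"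
      by (rule has_derivative_compose)
    moreover have "(\<lambda>x. iv (g (e q)) (e x)) = (\<lambda>(h,k). iv (G q) (Complex h k))"
      by (auto simp: e_def G_def)
    ultimately show ?thesis unfolding G_def by simp
  qed
  have XYG: "X (G q) = fst q" "Y (G q) = snd q" if "q \<in> U" for q
    using fg[of "e q"] that by (auto simp: U_def G_def f_def e_def)
  have GX: "G (X z, Y z) = z" "(X z, Y z) \<in> U" if "z \<in> N" for z
    using gf[OF that] that hom by (auto simp: G_def f_def e_def U_def homeomorphism_def)
  have img: "(\<lambda>z. (X z, Y z)) ` N = U"
  proof
    show "U \<subseteq> (\<lambda>z. (X z, Y z)) ` N"
    proof
      fix q assume "q \<in> U"
      then have "q = (X (G q), Y (G q))" "G q \<in> N" using XYG GN by auto
      then show "q \<in> (\<lambda>z. (X z, Y z)) ` N" by blast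
    qed
  qed (use GX in auto)
  define p where "p z = Im (cnj (c z) * b z) / J z" for z
  define r where "r z = Im (cnj (a z) * c z) / J z" for z
  define w where "w z = deriv c z - of_real (p z) * deriv a z - of_real (r z) * deriv b z" for z
  define A where "A z = - Re (w z * cnj (b z) ^ 2) / (J z)\<^sup>2" for z
  define B where "B z = Re (w z * (cnj (a z) * cnj (b z))) / (J z)\<^sup>2" for z
  define C where "C z = - Re (w z * cnj (a z) ^ 2) / (J z)\<^sup>2" for z
  have expn: "c z = of_real (p z) * a z + of_real (r z) * b z" if "z \<in> D'" for z
    unfolding p_def r_def J_def by (rule real_basis_expansion) (use J[OF that] in \<open>simp add: J_def\<close>)
  have reiv: "Re (a z * iv z (Complex h k)) = h" "Re (b z * iv z (Complex h k)) = k" if "z \<in> D'" for z h k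
    using ivr[OF that, of "Complex h k"] by (auto simp: f'app)
  have d1: "((\<lambda>q. Z (G q)) has_derivative (\<lambda>(h,k). p (G q) * h + r (G q) * k)) (at q)" if q: "q \<in> U" for q
  proof -
    have "((\<lambda>q. Z (G q)) has_derivative (\<lambda>x. Re (c (G q) * (case x of (h,k) \<Rightarrow> iv (G q) (Complex h k))))) (at q)"
      using has_derivative_compose[OF dG[OF q] Z[OF GN(3)[OF q]]] .
    moreover have "Re (c (G q) * iv (G q) (Complex h k)) = p (G q) * h + r (G q) * k" for h k
    proof -
      let ?v = "iv (G q) (Complex h k)"
      have "c (G q) * ?v = of_real (p (G q)) * (a (G q) * ?v) + of_real (r (G q)) * (b (G q) * ?v)"
        by (subst expn[OF GN(2)[OF q]]) (simp add: algebra_simps)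
      then show ?thesis using reiv[OF GN(2)[OF q], of h k] by simp
    qed
    ultimately show ?thesis by (simp add: case_prod_unfold)
  qed
  have der: "(a has_field_derivative deriv a z) (at z)" "(b has_field_derivative deriv b z) (at z)"
    "(c has_field_derivative deriv c z) (at z)" if "z \<in> D" for z
    using hol D that holomorphic_derivI by blast+
  have slope: "(p has_derivative (\<lambda>h. Im (cnj (w z * h) * b z) / J z)) (at z)"
      "(r has_derivative (\<lambda>h. Im (cnj (a z) * (w z * h)) / J z)) (at z)" if z: "z \<in> D'" for z
  proof -
    have zD: "z \<in> D" and Jz: "Im (cnj (a z) * b z) \<noteq> 0" using z D' J[OF z] by (auto simp: J_def)
    show "(p has_derivative (\<lambda>h. Im (cnj (w z * h) * b z) / J z)) (at z)"
      "(r has_derivative (\<lambda>h. Im (cnj (a z) * (w z * h)) / J z)) (at z)"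
      using has_derivative_slope[OF der[OF zD] Jz] unfolding p_def r_def w_def J_def by auto
  qed
  have lin: "Im (cnj (w z * iv z (Complex h k)) * b z) / J z = A z * h + B z * k"
    "Im (cnj (a z) * (w z * iv z (Complex h k))) / J z = B z * h + C z * k" if z: "z \<in> D'" for z h k
  proof -
    define v where "v = \<i> * (of_real h * cnj (b z) - of_real k * cnj (a z))"
    have iv: "iv z (Complex h k) = v / of_real (J z)" by (simp add: iv_def v_def)
    have "Im (cnj (w z * (v / of_real (J z))) * b z) = Im (cnj (w z * v) * b z) / J z"
      by (simp add: Im_divide_of_real[symmetric])
    moreover have "Im (cnj (w z * v) * b z) = - Re (w z * cnj (b z) ^ 2) * h + Re (w z * (cnj (a z) * cnj (b z))) * k"
      unfolding v_def by (simp add: algebra_simps power2_eq_square)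
    ultimately show "Im (cnj (w z * iv z (Complex h k)) * b z) / J z = A z * h + B z * k"
      unfolding iv A_def B_def by (simp add: power2_eq_square add_divide_distrib)
    have "Im (cnj (a z) * (w z * (v / of_real (J z)))) = Im (cnj (a z) * (w z * v)) / J z"
      by (simp add: Im_divide_of_real[symmetric])
    moreover have "Im (cnj (a z) * (w z * v)) = Re (w z * (cnj (a z) * cnj (b z))) * h + - Re (w z * cnj (a z) ^ 2) * k"
      unfolding v_def by (simp add: algebra_simps power2_eq_square)
    ultimately show "Im (cnj (a z) * (w z * iv z (Complex h k))) / J z = B z * h + C z * k"
      unfolding iv B_def C_def by (simp add: power2_eq_square add_divide_distrib)
  qed
  have d2: "((\<lambda>q. p (G q)) has_derivative (\<lambda>(h,k). A (G q) * h + B (G q) * k)) (at q)" if q: "q \<in> U" for q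
    using has_derivative_compose[OF dG[OF q] slope(1)[OF GN(2)[OF q]]] lin(1)[OF GN(2)[OF q]]
    by (simp add: case_prod_unfold)
  have d3: "((\<lambda>q. r (G q)) has_derivative (\<lambda>(h,k). B (G q) * h + C (G q) * k)) (at q)" if q: "q \<in> U" for q
    using has_derivative_compose[OF dG[OF q] slope(2)[OF GN(2)[OF q]]] lin(2)[OF GN(2)[OF q]]
    by (simp add: case_prod_unfold)
  have cG: "continuous_on U G"
    using dG U by (meson continuous_at_imp_continuous_on has_derivative_continuous)
  have cd: "continuous_on D' a" "continuous_on D' b" "continuous_on D' c" "continuous_on D' J"
     "continuous_on D' (deriv a)" "continuous_on D' (deriv b)" "continuous_on D' (deriv c)"
    using cont \<open>continuous_on D J\<close> D'(3) hol holomorphic_deriv[OF _ D(1)] holomorphic_on_imp_continuous_on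
    by (meson continuous_on_subset)+
  have cw: "continuous_on D' w" "continuous_on D' p" "continuous_on D' r"
    unfolding w_def p_def r_def using J by (auto intro!: continuous_intros cd)
  have cABC: "continuous_on D' A" "continuous_on D' B" "continuous_on D' C"
    unfolding A_def B_def C_def using J by (auto intro!: continuous_intros cd cw)
  have GD: "G ` U \<subseteq> D'" using GN by auto
  have cABCG: "continuous_on U (\<lambda>q. A (G q))" "continuous_on U (\<lambda>q. B (G q))" "continuous_on U (\<lambda>q. C (G q))"
    using cABC cG GD by (auto intro: continuous_on_compose2)
  have re: "Re (complex_of_real s * x) = s * Re x" for s x by simp
  have pde_frac: "s * (- x / t) - 2 * k * l * (y / t) + s' * (- v / t) = - (s * x + 2 * k * l * y + s' * v) / t" for s s' x y v k l t :: real
    by (simp add: add_divide_distrib diff_divide_distrib)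
  \<comment> \<open>Inserting c = p a + r b into the conformality relation gives a quadratic
    relation between a and b with the coefficients of the minimal surface equation. Conjugating it,
    multiplying by w and taking real parts yields that equation.\<close>
  have pde: "(1 + (r z)\<^sup>2) * A z - 2 * p z * r z * B z + (1 + (p z)\<^sup>2) * C z = 0" if z: "z \<in> D'" for z
  proof -
    have "(a z)\<^sup>2 + (b z)\<^sup>2 + (c z)\<^sup>2 = 0" using conf z D' by auto
    then have "of_real (1 + (r z)\<^sup>2) * (b z)\<^sup>2 + of_real (2 * p z * r z) * (a z * b z) + of_real (1 + (p z)\<^sup>2) * (a z)\<^sup>2 = 0"
      unfolding expn[OF z] by (simp add: algebra_simps power2_eq_square)
    then have "cnj (of_real (1 + (r z)\<^sup>2) * (b z)\<^sup>2 + of_real (2 * p z * r z) * (a z * b z) + of_real (1 + (p z)\<^sup>2) * (a z)\<^sup>2) = 0"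
      by simp
    then have "w z * (of_real (1 + (r z)\<^sup>2) * cnj (b z) ^ 2 + of_real (2 * p z * r z) * (cnj (a z) * cnj (b z)) + of_real (1 + (p z)\<^sup>2) * cnj (a z) ^ 2) = 0"
      by simp
    then have "of_real (1 + (r z)\<^sup>2) * (w z * cnj (b z) ^ 2) + of_real (2 * p z * r z) * (w z * (cnj (a z) * cnj (b z)))
        + of_real (1 + (p z)\<^sup>2) * (w z * cnj (a z) ^ 2) = 0"
      by (simp add: algebra_simps)
    then have "Re (of_real (1 + (r z)\<^sup>2) * (w z * cnj (b z) ^ 2) + of_real (2 * p z * r z) * (w z * (cnj (a z) * cnj (b z)))
        + of_real (1 + (p z)\<^sup>2) * (w z * cnj (a z) ^ 2)) = 0" by simp
    then have "(1 + (r z)\<^sup>2) * Re (w z * cnj (b z) ^ 2) + 2 * p z * r z * Re (w z * (cnj (a z) * cnj (b z)))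
        + (1 + (p z)\<^sup>2) * Re (w z * cnj (a z) ^ 2) = 0" unfolding plus_complex.sel re .
    then show ?thesis unfolding A_def B_def C_def pde_frac by simp
  qed
  have gd: "graph_derivs U (\<lambda>q. Z (G q)) (\<lambda>q. p (G q)) (\<lambda>q. r (G q)) (\<lambda>q. A (G q)) (\<lambda>q. B (G q)) (\<lambda>q. C (G q))"
    unfolding graph_derivs_def using d1 d2 d3 cABCG pde GN by auto
  have curv: "\<exists>z\<in>N. graph_gauss_curv (p (G q)) (r (G q)) (A (G q)) (B (G q)) (C (G q))
        = - (cmod (normal_dot (a z) (b z) (c z) (deriv a z) (deriv b z) (deriv c z)))\<^sup>2 / (normal_sq (a z) (b z) (c z))\<^sup>2"
    if q: "q \<in> U" for q
  proof (rule bexI[OF _ GN(1)[OF q]])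
    have Jz: "Im (cnj (a (G q)) * b (G q)) \<noteq> 0" using J[OF GN(2)[OF q]] by (simp add: J_def)
    show "graph_gauss_curv (p (G q)) (r (G q)) (A (G q)) (B (G q)) (C (G q))
        = - (cmod (normal_dot (a (G q)) (b (G q)) (c (G q)) (deriv a (G q)) (deriv b (G q)) (deriv c (G q))))\<^sup>2 / (normal_sq (a (G q)) (b (G q)) (c (G q)))\<^sup>2"
      unfolding A_def B_def C_def w_def p_def r_def J_def by (rule slope_curvature[OF Jz])
  qed
  show ?thesis
    using that[OF N(1,3) _ U img _ gd curv] N D' GX by auto
qed

lemma place_simps [simp]:
  "place 0 (s, t) h = (h, s, t)" "place 1 (s, t) h = (s, h, t)" "place (Suc 0) (s, t) h = (s, h, t)" "place 2 (s, t) h = (s, t, h)"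
  by (simp_all add: place_def)

text \<open>A nonzero normal has a nonzero component, and the corresponding pair of coordinates
  parametrises a graph. The hypothesis \<open>rel_open\<close> supplies what a local computation
  cannot: that no other sheet of M comes near.\<close>

lemma minimal_chart_weierstrass:
  fixes X Y Z :: "complex \<Rightarrow> real" and a b c :: "complex \<Rightarrow> complex"
  assumes D: "open D" "z0 \<in> D"
    and X: "\<And>z. z \<in> D \<Longrightarrow> (X has_derivative (\<lambda>h. Re (a z * h))) (at z)"
    and Y: "\<And>z. z \<in> D \<Longrightarrow> (Y has_derivative (\<lambda>h. Re (b z * h))) (at z)"
    and Z: "\<And>z. z \<in> D \<Longrightarrow> (Z has_derivative (\<lambda>h. Re (c z * h))) (at z)"
    and hol: "a holomorphic_on D" "b holomorphic_on D" "c holomorphic_on D"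
    and conf: "\<And>z. z \<in> D \<Longrightarrow> (a z)\<^sup>2 + (b z)\<^sup>2 + (c z)\<^sup>2 = 0"
    and reg: "normal_sq (a z0) (b z0) (c z0) \<noteq> 0"
    and curv: "\<And>z. z \<in> D \<Longrightarrow> cmod (normal_dot (a z) (b z) (c z) (deriv a z) (deriv b z) (deriv c z)) \<le> B * normal_sq (a z) (b z) (c z)"
    and rel_open: "\<And>N. open N \<Longrightarrow> z0 \<in> N \<Longrightarrow> N \<subseteq> D \<Longrightarrow> \<exists>W. open W \<and> M \<inter> W = (\<lambda>z. (X z, Y z, Z z)) ` N"
  shows "\<exists>i U u ux uy uxx uxy uyy. minimal_chart M (X z0, Y z0, Z z0) i U u ux uy uxx uxy uyy \<and>
     (\<forall>q\<in>U. \<bar>graph_gauss_curv (ux q) (uy q) (uxx q) (uxy q) (uyy q)\<bar> \<le> B\<^sup>2)"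
proof -
  \<comment> \<open>For s = 0 the quotient is 0 by the convention for division.\<close>
  have bound: "\<bar>- (cmod v)\<^sup>2 / s\<^sup>2\<bar> \<le> B\<^sup>2" if "cmod v \<le> B * s" for v and s :: real
  proof (cases "s = 0")
    case False
    have "(cmod v)\<^sup>2 \<le> (B * s)\<^sup>2" using that by (intro power_mono) auto
    then show ?thesis using False by (simp add: power_mult_distrib pos_divide_le_eq)
  qed simp
  have final: ?thesis
    if h: "i < 3" "open N" "z0 \<in> N" "N \<subseteq> D" "open U" "graph_derivs U u ux uy uxx uxy uyy"
      and im: "(\<lambda>z. (X z, Y z, Z z)) ` N = (\<lambda>q. place i q (u q)) ` U"
      and K: "\<And>q. q \<in> U \<Longrightarrow> \<exists>z\<in>N. \<exists>v. graph_gauss_curv (ux q) (uy q) (uxx q) (uxy q) (uyy q) = - (cmod v)\<^sup>2 / (normal_sq (a z) (b z) (c z))\<^sup>2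
         \<and> cmod v = cmod (normal_dot (a z) (b z) (c z) (deriv a z) (deriv b z) (deriv c z))"
    for i N U u ux uy uxx uxy uyy
  proof -
    obtain W where W: "open W" "M \<inter> W = (\<lambda>q. place i q (u q)) ` U" using rel_open[OF h(2-4)] im by metis
    have "(X z0, Y z0, Z z0) \<in> M \<inter> W" using W im h(3) by blast
    then have "minimal_chart M (X z0, Y z0, Z z0) i U u ux uy uxx uxy uyy"
      using h(1,5,6) W unfolding minimal_chart_def graph_derivs_def by blast
    moreover have "\<bar>graph_gauss_curv (ux q) (uy q) (uxx q) (uxy q) (uyy q)\<bar> \<le> B\<^sup>2" if q: "q \<in> U" for q
      using K[OF q] bound curv \<open>N \<subseteq> D\<close> by fastforce
    ultimately show ?thesis by blast
  qed
  \<comment> \<open>Permuting coordinates leaves the normal unchanged up to order and sign, so the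
    curvature bound for (a, b, c) covers all three graphs.\<close>
  have perm: "normal_sq b' c' a' = normal_sq a' b' c'" "normal_sq a' c' b' = normal_sq a' b' c'"
     "normal_dot b' c' a' d e f = normal_dot a' b' c' f d e"
     "normal_dot a' c' b' d f e = - normal_dot a' b' c' d e f" for a' b' c' d e f
    unfolding normal_sq_def normal_dot_def
  proof -
    have m: "Im (cnj x * y) = - Im (cnj y * x)" for x y by simp
    show "(Im (cnj c' * a'))\<^sup>2 + (Im (cnj a' * b'))\<^sup>2 + (Im (cnj b' * c'))\<^sup>2 = (Im (cnj b' * c'))\<^sup>2 + (Im (cnj c' * a'))\<^sup>2 + (Im (cnj a' * b'))\<^sup>2"
      by (simp only: add_ac)
    show "(Im (cnj c' * b'))\<^sup>2 + (Im (cnj b' * a'))\<^sup>2 + (Im (cnj a' * c'))\<^sup>2 = (Im (cnj b' * c'))\<^sup>2 + (Im (cnj c' * a'))\<^sup>2 + (Im (cnj a' * b'))\<^sup>2"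
      unfolding m[of c' b'] m[of b' a'] m[of a' c'] by (simp only: power2_minus add_ac)
    show "of_real (Im (cnj c' * a')) * d + of_real (Im (cnj a' * b')) * e + of_real (Im (cnj b' * c')) * f
       = of_real (Im (cnj b' * c')) * f + of_real (Im (cnj c' * a')) * d + of_real (Im (cnj a' * b')) * e"
      by (simp only: add_ac)
    show "of_real (Im (cnj c' * b')) * d + of_real (Im (cnj b' * a')) * f + of_real (Im (cnj a' * c')) * e
      = - (of_real (Im (cnj b' * c')) * d + of_real (Im (cnj c' * a')) * e + of_real (Im (cnj a' * b')) * f)"
      unfolding m[of c' b'] m[of b' a'] m[of a' c'] by (simp only: of_real_minus mult_minus_left minus_add_distrib add_ac)
  qed
  consider "Im (cnj (a z0) * b z0) \<noteq> 0" | "Im (cnj (b z0) * c z0) \<noteq> 0" | "Im (cnj (a z0) * c z0) \<noteq> 0"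
  proof -
    have "x \<noteq> 0 \<or> y \<noteq> 0 \<or> v \<noteq> 0" if "x\<^sup>2 + (- v)\<^sup>2 + y\<^sup>2 \<noteq> 0" for x y v :: real
      using that by auto
    moreover have "Im (cnj (c z0) * a z0) = - Im (cnj (a z0) * c z0)" by simp
    ultimately have "Im (cnj (b z0) * c z0) \<noteq> 0 \<or> Im (cnj (a z0) * b z0) \<noteq> 0 \<or> Im (cnj (a z0) * c z0) \<noteq> 0"
      using reg unfolding normal_sq_def by metis
    then show ?thesis using that by blast
  qed
  then show ?thesis
  proof cases
    case 1
    obtain N U u ux uy uxx uxy uyy where N: "open N" "z0 \<in> N" "N \<subseteq> D" "open U"
      "(\<lambda>z. (X z, Y z)) ` N = U" "\<And>z. z \<in> N \<Longrightarrow> u (X z, Y z) = Z z"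
      "graph_derivs U u ux uy uxx uxy uyy"
      "\<And>q. q \<in> U \<Longrightarrow> \<exists>z\<in>N. graph_gauss_curv (ux q) (uy q) (uxx q) (uxy q) (uyy q)
        = - (cmod (normal_dot (a z) (b z) (c z) (deriv a z) (deriv b z) (deriv c z)))\<^sup>2 / (normal_sq (a z) (b z) (c z))\<^sup>2"
      by (rule weierstrass_graph[OF D X Y Z hol conf 1]; (assumption | (rule that; assumption)))
    show ?thesis
    proof (rule final[OF _ N(1-4) N(7)])
      show "(\<lambda>z. (X z, Y z, Z z)) ` N = (\<lambda>q. place 2 q (u q)) ` U"
        unfolding N(5)[symmetric] image_image using N(6) by (intro image_cong) auto
      fix q assume "q \<in> U"
      from N(8)[OF this] show "\<exists>z\<in>N. \<exists>v. graph_gauss_curv (ux q) (uy q) (uxx q) (uxy q) (uyy q) = - (cmod v)\<^sup>2 / (normal_sq (a z) (b z) (c z))\<^sup>2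
         \<and> cmod v = cmod (normal_dot (a z) (b z) (c z) (deriv a z) (deriv b z) (deriv c z))"
        by blast
    qed simp
  next
    case 2
    have conf': "(b z)\<^sup>2 + (c z)\<^sup>2 + (a z)\<^sup>2 = 0" if "z \<in> D" for z using conf[OF that] by (simp only: add_ac)
    obtain N U u ux uy uxx uxy uyy where N: "open N" "z0 \<in> N" "N \<subseteq> D" "open U"
      "(\<lambda>z. (Y z, Z z)) ` N = U" "\<And>z. z \<in> N \<Longrightarrow> u (Y z, Z z) = X z"
      "graph_derivs U u ux uy uxx uxy uyy"
      "\<And>q. q \<in> U \<Longrightarrow> \<exists>z\<in>N. graph_gauss_curv (ux q) (uy q) (uxx q) (uxy q) (uyy q)
        = - (cmod (normal_dot (b z) (c z) (a z) (deriv b z) (deriv c z) (deriv a z)))\<^sup>2 / (normal_sq (b z) (c z) (a z))\<^sup>2"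
      by (rule weierstrass_graph[OF D Y Z X hol(2,3,1) conf' 2]; (assumption | (rule that; assumption)))
    show ?thesis
    proof (rule final[OF _ N(1-4) N(7)])
      show "(\<lambda>z. (X z, Y z, Z z)) ` N = (\<lambda>q. place 0 q (u q)) ` U"
        unfolding N(5)[symmetric] image_image using N(6) by (intro image_cong) auto
      fix q assume "q \<in> U"
      from N(8)[OF this] obtain z where z: "z \<in> N" "graph_gauss_curv (ux q) (uy q) (uxx q) (uxy q) (uyy q)
        = - (cmod (normal_dot (b z) (c z) (a z) (deriv b z) (deriv c z) (deriv a z)))\<^sup>2 / (normal_sq (b z) (c z) (a z))\<^sup>2" by blast
      show "\<exists>z\<in>N. \<exists>v. graph_gauss_curv (ux q) (uy q) (uxx q) (uxy q) (uyy q) = - (cmod v)\<^sup>2 / (normal_sq (a z) (b z) (c z))\<^sup>2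
         \<and> cmod v = cmod (normal_dot (a z) (b z) (c z) (deriv a z) (deriv b z) (deriv c z))"
        using z(2) unfolding perm(1)[of "b z" "c z" "a z"] perm(3)[of "b z" "c z" "a z"] by (intro bexI[OF _ z(1)] exI conjI) (assumption, rule refl)
    qed simp
  next
    case 3
    have conf': "(a z)\<^sup>2 + (c z)\<^sup>2 + (b z)\<^sup>2 = 0" if "z \<in> D" for z using conf[OF that] by (simp only: add_ac)
    obtain N U u ux uy uxx uxy uyy where N: "open N" "z0 \<in> N" "N \<subseteq> D" "open U"
      "(\<lambda>z. (X z, Z z)) ` N = U" "\<And>z. z \<in> N \<Longrightarrow> u (X z, Z z) = Y z"
      "graph_derivs U u ux uy uxx uxy uyy"
      "\<And>q. q \<in> U \<Longrightarrow> \<exists>z\<in>N. graph_gauss_curv (ux q) (uy q) (uxx q) (uxy q) (uyy q)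
        = - (cmod (normal_dot (a z) (c z) (b z) (deriv a z) (deriv c z) (deriv b z)))\<^sup>2 / (normal_sq (a z) (c z) (b z))\<^sup>2"
      by (rule weierstrass_graph[OF D X Z Y hol(1,3,2) conf' 3]; (assumption | (rule that; assumption)))
    show ?thesis
    proof (rule final[OF _ N(1-4) N(7)])
      show "(\<lambda>z. (X z, Y z, Z z)) ` N = (\<lambda>q. place 1 q (u q)) ` U"
        unfolding N(5)[symmetric] image_image using N(6) by (intro image_cong) auto
      fix q assume "q \<in> U"
      from N(8)[OF this] obtain z where z: "z \<in> N" "graph_gauss_curv (ux q) (uy q) (uxx q) (uxy q) (uyy q)
        = - (cmod (normal_dot (a z) (c z) (b z) (deriv a z) (deriv c z) (deriv b z)))\<^sup>2 / (normal_sq (a z) (c z) (b z))\<^sup>2" by blast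
      show "\<exists>z\<in>N. \<exists>v. graph_gauss_curv (ux q) (uy q) (uxx q) (uxy q) (uyy q) = - (cmod v)\<^sup>2 / (normal_sq (a z) (b z) (c z))\<^sup>2
         \<and> cmod v = cmod (normal_dot (a z) (b z) (c z) (deriv a z) (deriv b z) (deriv c z))"
        using z(2) unfolding perm(2)[of "a z" "c z" "b z"] perm(4)[of "a z" "c z" "b z"] norm_minus_cancel by (intro bexI[OF _ z(1)] exI conjI) (assumption, rule refl)
    qed simp
  qed
qed

section \<open>Poles and nodes\<close>

text \<open>The slow increase of the ratios rho k is what makes the sequence eta below decreasing.\<close>

definition rho :: "nat \<Rightarrow> real" where "rho k = (2 - (1/2) ^ k) / 200"

text \<open>Since \<open>rho k\<close> is the square root of the ratio of consecutive poles,
  \<open>pole k / rho k\<close> is their geometric mean, near which the zero \<open>node k\<close>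
  will lie.\<close>

primrec pole :: "nat \<Rightarrow> real" where
  "pole 0 = 1"
| "pole (Suc k) = pole k / (rho k)\<^sup>2"

lemma rho_bounds: "1 / 200 \<le> rho k" "rho k < 1 / 100" "0 < rho k"
proof -
  have "0 < (1/2::real) ^ k" "(1/2::real) ^ k \<le> 1" by (auto simp: power_le_one)
  then show "1 / 200 \<le> rho k" "rho k < 1 / 100" "0 < rho k" by (auto simp: rho_def)
qed

lemma rho_sq_less: "(rho k)\<^sup>2 < 1 / 10000"
proof -
  have "(rho k)\<^sup>2 < (1/100)\<^sup>2" using rho_bounds[of k] by (intro power_strict_mono) auto
  then show ?thesis by (simp add: power2_eq_square)
qed

declare pole.simps(2) [simp del]

lemma rho_mono: "j \<le> k \<Longrightarrow> rho j \<le> rho k"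
  unfolding rho_def by (simp add: divide_le_cancel power_decreasing)

lemma pole_pos: "pole k > 0"
  by (induction k) (auto simp: pole.simps(2) rho_bounds(3) less_imp_neq[symmetric])

lemma pole_ratio: "pole k = (rho k)\<^sup>2 * pole (Suc k)"
  using rho_bounds(3)[of k] by (simp add: pole.simps(2))

lemma pole_Suc_ge: "10000 * pole k \<le> pole (Suc k)"
proof -
  have "pole k = (rho k)\<^sup>2 * pole (Suc k)" by (rule pole_ratio)
  also have "\<dots> \<le> 1 / 10000 * pole (Suc k)"
    using rho_sq_less[of k] pole_pos[of "Suc k"] by (intro mult_right_mono) auto
  finally show ?thesis by simp
qed

lemma pole_add_ge: "10000 ^ i * pole k \<le> pole (k + i)"
proof (induction i)
  case (Suc i)
  have "10000 ^ Suc i * pole k = 10000 * (10000 ^ i * pole k)" by simp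
  also have "\<dots> \<le> 10000 * pole (k + i)" using Suc by simp
  also have "\<dots> \<le> pole (k + Suc i)" using pole_Suc_ge[of "k + i"] by simp
  finally show ?case .
qed simp

lemma pole_strict_mono: "strict_mono pole"
  unfolding strict_mono_Suc_iff using pole_Suc_ge pole_pos by (smt (verit))

lemma pole_mono: "j \<le> k \<Longrightarrow> pole j \<le> pole k"
  using pole_strict_mono by (simp add: strict_mono_less_eq)

lemma pole_ge_power: "10000 ^ k \<le> pole k"
  using pole_add_ge[of k 0] by simp

lemma pole_ge_1: "1 \<le> pole k"
  using pole_mono[of 0 k] by simp

lemma pole_quotient_le: "pole k / pole (k + i) \<le> (1/10000) ^ i"
  using pole_add_ge[of i k] pole_pos[of "k + i"] by (simp add: power_divide field_simps)

lemma summable_inverse_pole: "summable (\<lambda>k. 1 / pole k)"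
proof (rule summable_comparison_test')
  show "summable (\<lambda>k. (1/10000::real) ^ k)" by (simp add: summable_geometric)
  show "norm (1 / pole n) \<le> (1/10000) ^ n" if "n \<ge> 0" for n
    using pole_quotient_le[of 0 n] pole_pos[of n] by simp
qed

section \<open>Location of the zeros of \<open>chi\<close> on the imaginary axis\<close>

definition alt :: "real \<Rightarrow> real" where
  "alt t = (\<Sum>k. (-1) ^ k * (pole k / (t + (pole k)\<^sup>2)))"

lemma alt_term_bound:
  assumes "t \<ge> 0"
  shows "norm ((-1) ^ k * (pole k / (t + (pole k)\<^sup>2))) \<le> 1 / pole k"
proof -
  have "pole k / (t + (pole k)\<^sup>2) \<le> pole k / (pole k)\<^sup>2"
    using assms pole_pos[of k] by (intro divide_left_mono) (auto intro!: mult_pos_pos add_nonneg_pos)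
  also have "\<dots> = 1 / pole k" by (simp add: power2_eq_square)
  finally have "pole k / (t + (pole k)\<^sup>2) \<le> 1 / pole k" .
  moreover have "0 \<le> pole k / (t + (pole k)\<^sup>2)" using assms pole_pos[of k] by simp
  ultimately show ?thesis
    by (simp only: real_norm_def abs_mult power_abs abs_minus_cancel abs_one power_one mult_1 abs_of_nonneg)
qed

lemma summable_alt: "t \<ge> 0 \<Longrightarrow> summable (\<lambda>k. (-1) ^ k * (pole k / (t + (pole k)\<^sup>2)))"
  using alt_term_bound by (intro summable_comparison_test'[OF summable_inverse_pole]) auto

lemma continuous_alt: "continuous_on {0..} alt"
proof -
  have "uniform_limit {0..} (\<lambda>n t. \<Sum>k<n. (-1) ^ k * (pole k / (t + (pole k)\<^sup>2))) (\<lambda>t. \<Sum>k. (-1) ^ k * (pole k / (t + (pole k)\<^sup>2))) sequentially"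
  proof (rule Weierstrass_m_test[OF _ summable_inverse_pole])
    fix n :: nat and t :: real assume "t \<in> {0..}"
    then show "norm ((-1) ^ n * (pole n / (t + (pole n)\<^sup>2))) \<le> 1 / pole n" by (intro alt_term_bound) simp
  qed
  then have "uniform_limit {0..} (\<lambda>n t. \<Sum>k<n. (-1) ^ k * (pole k / (t + (pole k)\<^sup>2))) alt sequentially"
    unfolding alt_def[abs_def] .
  moreover have "t + (pole k)\<^sup>2 \<noteq> 0" if "t \<ge> 0" for t k using that pole_pos[of k] by (smt (verit) zero_less_power)
  ultimately show ?thesis
    by (intro uniform_limit_theorem[where F = sequentially]) (auto intro!: always_eventually continuous_intros)
qed

text \<open>Reflecting the index at \<^term>\<open>j\<close> pairs the terms of \<^const>\<open>alt\<close>, and a pair almost cancels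
  for t near the product of the two neighbouring poles.\<close>

definition lo_quot :: "nat \<Rightarrow> nat \<Rightarrow> real" where
  "lo_quot j i = (if i \<le> j then pole (j - i) / pole j else 0)"

definition hi_quot :: "nat \<Rightarrow> nat \<Rightarrow> real" where
  "hi_quot j i = pole (Suc j) / pole (Suc j + i)"

lemma lo_quot_bounds: "0 \<le> lo_quot j i" "lo_quot j i \<le> (1/10000) ^ i"
  using pole_quotient_le[of "j - i" i] pole_pos[of j] pole_pos[of "j - i"] by (auto simp: lo_quot_def)

lemma hi_quot_bounds: "0 \<le> hi_quot j i" "hi_quot j i \<le> (1/10000) ^ i"
  using pole_quotient_le[of "Suc j" i] pole_pos[of "Suc j"] pole_pos[of "Suc j + i"] unfolding hi_quot_def by auto

lemma rho_sq_diff: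
  assumes "m \<le> n"
  shows "\<bar>(rho m)\<^sup>2 - (rho n)\<^sup>2\<bar> \<le> (1/10000) * (1/2) ^ m"
proof -
  have x: "0 < (1/2::real) ^ n" "(1/2::real) ^ n \<le> (1/2) ^ m" using assms by (auto intro: power_decreasing)
  have "(rho n)\<^sup>2 - (rho m)\<^sup>2 = (rho n - rho m) * (rho n + rho m)" by (simp add: power2_eq_square algebra_simps)
  moreover have "0 \<le> rho n - rho m" using rho_mono[OF assms] by simp
  moreover have "rho n - rho m \<le> (1/2) ^ m / 200" using x(1) by (simp add: rho_def diff_divide_distrib[symmetric])
  moreover have "0 \<le> rho n + rho m" "rho n + rho m \<le> 2 / 100"
    using rho_bounds[of n] rho_bounds[of m] by auto
  ultimately have "0 \<le> (rho n)\<^sup>2 - (rho m)\<^sup>2" "(rho n)\<^sup>2 - (rho m)\<^sup>2 \<le> (1/2) ^ m / 200 * (2 / 100)"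
    by (simp, simp only: mult_mono zero_le_power zero_le_divide_1_iff zero_le_numeral divide_nonneg_nonneg)
  then show ?thesis by simp
qed

text \<open>One step multiplies the two quotients by the squares of rho at indices m = j - i - 1 and
  j + 1 + i, which differ by at most a multiple of (1/2)^m. Relative to (1/2)^j this costs a factor
  2^(i + 1), and summing these losses gives 2^i - 1.\<close>

lemma quot_diff_aux:
  assumes "i \<le> j"
  shows "\<bar>lo_quot j i - hi_quot j i\<bar> \<le> 2 * (2 ^ i - 1) * (1/10000) ^ i * (1/2) ^ j"
  using assms
proof (induction i)
  case 0
  then show ?case using pole_pos[of j] pole_pos[of "Suc j"] by (simp add: lo_quot_def hi_quot_def)
next
  case (Suc i)
  define m where "m = j - Suc i"
  have m: "j - i = Suc m" "j = m + Suc i" using Suc.prems by (auto simp: m_def)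
  have x: "lo_quot j (Suc i) = lo_quot j i * (rho m)\<^sup>2"
    using Suc.prems m pole_ratio[of m] by (simp add: lo_quot_def m_def[symmetric])
  have y: "hi_quot j (Suc i) = hi_quot j i * (rho (Suc j + i))\<^sup>2"
    using rho_bounds(3)[of "Suc j + i"] by (simp add: hi_quot_def pole.simps(2)[of "Suc (j + i)"])
  let ?n = "Suc j + i"
  have "lo_quot j (Suc i) - hi_quot j (Suc i)
      = lo_quot j i * ((rho m)\<^sup>2 - (rho ?n)\<^sup>2) + (rho ?n)\<^sup>2 * (lo_quot j i - hi_quot j i)"
    unfolding x y by (simp add: algebra_simps)
  then have "\<bar>lo_quot j (Suc i) - hi_quot j (Suc i)\<bar>
      \<le> lo_quot j i * \<bar>(rho m)\<^sup>2 - (rho ?n)\<^sup>2\<bar> + (rho ?n)\<^sup>2 * \<bar>lo_quot j i - hi_quot j i\<bar>"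
    using lo_quot_bounds(1)[of j i] by (metis abs_mult abs_of_nonneg abs_triangle_ineq zero_le_power2)
  also have "\<dots> \<le> (1/10000) ^ i * ((1/10000) * (1/2) ^ m) + 1/10000 * (2 * (2 ^ i - 1) * (1/10000) ^ i * (1/2) ^ j)"
    using rho_sq_diff[of m ?n] rho_sq_less[of ?n] lo_quot_bounds[of j i] Suc m
    by (intro add_mono mult_mono) auto
  also have "(1/2::real) ^ m = 2 * 2 ^ i * (1/2) ^ j" unfolding m(2) by (simp add: power_add power_divide)
  also have "(1/10000) ^ i * ((1/10000) * (2 * 2 ^ i * (1/2) ^ j)) + 1/10000 * (2 * (2 ^ i - 1) * (1/10000) ^ i * (1/2) ^ j)
     = 2 * (2 ^ Suc i - 1) * (1/10000::real) ^ Suc i * (1/2) ^ j" by (simp add: algebra_simps)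
  finally show ?case .
qed

lemma quot_diff: "\<bar>lo_quot j i - hi_quot j i\<bar> \<le> 2 * (2/10000) ^ i * (1/2) ^ j"
proof (cases "i \<le> j")
  case True
  have "2 * (2 ^ i - 1) * (1/10000) ^ i * (1/2) ^ j \<le> 2 * 2 ^ i * (1/10000::real) ^ i * (1/2) ^ j"
    by (intro mult_right_mono) auto
  also have "2 * 2 ^ i * (1/10000) ^ i = 2 * (2/10000::real) ^ i"
    by (simp only: mult.assoc power_mult_distrib[symmetric]) simp
  finally show ?thesis using quot_diff_aux[OF True] by linarith
next
  \<comment> \<open>Below index 0 there is no pole to pair with, but then i > j and the geometric
    decay of the remaining quotient already contains a factor (1/2)^j.\<close>
  case False
  have "\<bar>lo_quot j i - hi_quot j i\<bar> = hi_quot j i" using False hi_quot_bounds[of j i] by (simp add: lo_quot_def)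
  also have "\<dots> \<le> (1/10000) ^ i" by (rule hi_quot_bounds)
  also have "\<dots> = (2/10000) ^ i * (1/2) ^ i" by (simp add: power_mult_distrib[symmetric])
  also have "\<dots> \<le> (2/10000) ^ i * (1/2) ^ j" using False by (intro mult_left_mono power_decreasing) auto
  also have "\<dots> \<le> 2 * (2/10000) ^ i * (1/2) ^ j" by simp
  finally show ?thesis .
qed

text \<open>E is t divided by the product of the two neighbouring poles. The indices j - i and j + 1
  + i have opposite parity, hence the difference; the factor \<open>pole (Suc j)\<close> of
  \<open>alt_pair_sums\<close> has been absorbed.\<close>

definition alt_pair :: "nat \<Rightarrow> real \<Rightarrow> nat \<Rightarrow> real" where
  "alt_pair j E i = lo_quot j i / (E + (rho j)\<^sup>2 * (lo_quot j i)\<^sup>2) - hi_quot j i / (1 + (rho j)\<^sup>2 * E * (hi_quot j i)\<^sup>2)"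

lemma alt_pair_sums:
  assumes E: "E > 0"
  shows "(\<lambda>i. (-1) ^ i * alt_pair j E i) sums ((-1) ^ j * pole (Suc j) * alt (pole j * pole (Suc j) * E))"
proof -
  let ?t = "pole j * pole (Suc j) * E"
  let ?q = "(rho j)\<^sup>2"
  define g where "g k = pole k / (?t + (pole k)\<^sup>2)" for k
  have pos: "pole k > 0" for k by (rule pole_pos)
  have q: "?q > 0" "pole j = ?q * pole (Suc j)" using rho_bounds(3)[of j] pole_ratio[of j] by auto
  have t: "?t > 0" using E pos by simp
  have lo: "pole (Suc j) * g (j - i) = lo_quot j i / (E + ?q * (lo_quot j i)\<^sup>2)" if "i \<le> j" for i
  proof -
    define x where "x = lo_quot j i"
    have "pole (j - i) = x * pole j" using that pos[of j] by (simp add: x_def lo_quot_def)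
    then have "pole (j - i) = x * (?q * pole (Suc j))" using q by simp
    then have "pole (Suc j) * g (j - i) = pole (Suc j) * (x * (?q * pole (Suc j))) / (?q * pole (Suc j) * pole (Suc j) * E + (x * (?q * pole (Suc j)))\<^sup>2)"
      unfolding g_def using q(2) by (simp)
    also have "\<dots> = (?q * pole (Suc j) * pole (Suc j)) * x / ((?q * pole (Suc j) * pole (Suc j)) * (E + ?q * x\<^sup>2))"
      by (simp add: power2_eq_square algebra_simps)
    also have "\<dots> = x / (E + ?q * x\<^sup>2)"
    proof -
      have "?q * pole (Suc j) * pole (Suc j) \<noteq> 0" using q(1) pos[of "Suc j"] by (simp)
      then show ?thesis by (rule mult_divide_mult_cancel_left)
    qed
    finally show ?thesis by (simp add: x_def)
  qed
  have hi: "pole (Suc j) * g (Suc j + i) = hi_quot j i / (1 + ?q * E * (hi_quot j i)\<^sup>2)" for i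
  proof -
    define b where "b = pole (Suc j + i)"
    define c where "c = pole (Suc j)"
    have bc: "b > 0" "c > 0" using pos by (auto simp: b_def c_def)
    have "c * (b / (?q * c * c * E + b\<^sup>2)) = (c / b) / (1 + ?q * E * (c / b)\<^sup>2)"
    proof -
      have "1 + ?q * E * (c / b)\<^sup>2 = (?q * c * c * E + b\<^sup>2) / b\<^sup>2" using bc by (simp add: power2_eq_square field_simps)
      then show ?thesis using bc by (simp add: power2_eq_square)
    qed
    then show ?thesis unfolding g_def hi_quot_def b_def[symmetric] c_def[symmetric] q(2)[unfolded c_def[symmetric]] .
  qed
  have summ: "summable (\<lambda>k. (-1) ^ k * g k)" unfolding g_def using summable_alt[of ?t] t by simp
  have "(\<lambda>i. (-1) ^ (i + Suc j) * g (i + Suc j)) sums (alt ?t - (\<Sum>k<Suc j. (-1) ^ k * g k))"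
    using summable_sums[OF summ] unfolding alt_def g_def[symmetric] by (rule sums_split_initial_segment)
  then have H0: "(\<lambda>i. (-1) ^ Suc j * pole (Suc j) * ((-1) ^ (i + Suc j) * g (i + Suc j))) sums ((-1) ^ Suc j * pole (Suc j) * (alt ?t - (\<Sum>k<Suc j. (-1) ^ k * g k)))"
    by (rule sums_mult)
  have sq1: "(-1::real) ^ n * (-1) ^ n = 1" for n by (simp add: power_add[symmetric] mult_2[symmetric])
  have H1: "(-1) ^ Suc j * pole (Suc j) * ((-1) ^ (i + Suc j) * g (i + Suc j)) = (-1) ^ i * (pole (Suc j) * g (Suc j + i))" for i
  proof -
    have "(-1) ^ Suc j * pole (Suc j) * ((-1) ^ (i + Suc j) * g (i + Suc j)) = ((-1) ^ Suc j * (-1) ^ Suc j) * ((-1) ^ i * (pole (Suc j) * g (Suc j + i)))"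
      by (simp only: power_add add.commute mult_ac)
    then show ?thesis unfolding sq1 by simp
  qed
  have H: "(\<lambda>i. (-1) ^ i * (pole (Suc j) * g (Suc j + i))) sums ((-1) ^ Suc j * pole (Suc j) * (alt ?t - (\<Sum>k<Suc j. (-1) ^ k * g k)))"
    using H0 unfolding H1 .
  \<comment> \<open>The quotients vanish beyond j, so the finitely many lower terms may be treated
    as a series.\<close>
  have L: "(\<lambda>i. (-1) ^ i * (lo_quot j i / (E + ?q * (lo_quot j i)\<^sup>2))) sums (\<Sum>i\<in>{..j}. (-1) ^ i * (lo_quot j i / (E + ?q * (lo_quot j i)\<^sup>2)))"
    by (rule sums_finite) (auto simp: lo_quot_def)
  have "(\<Sum>i\<in>{..j}. (-1) ^ i * (lo_quot j i / (E + ?q * (lo_quot j i)\<^sup>2))) = (\<Sum>i\<in>{..j}. (-1) ^ i * (pole (Suc j) * g (j - i)))"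
    by (intro sum.cong refl) (simp only: lo atMost_iff)
  also have "\<dots> = (\<Sum>k\<in>{..j}. (-1) ^ (j - k) * (pole (Suc j) * g k))"
    by (rule sum.reindex_bij_witness[of _ "\<lambda>k. j - k" "\<lambda>k. j - k"]) auto
  also have "\<dots> = (\<Sum>k\<in>{..j}. (-1) ^ j * pole (Suc j) * ((-1) ^ k * g k))"
  proof (intro sum.cong refl)
    fix k assume "k \<in> {..j}"
    then have "(-1::real) ^ j = (-1) ^ (j - k) * (-1) ^ k" by (simp add: power_add[symmetric])
    then have "(-1) ^ j * pole (Suc j) * ((-1) ^ k * g k) = ((-1) ^ k * (-1) ^ k) * ((-1) ^ (j - k) * (pole (Suc j) * g k))"
      by (simp only: mult_ac)
    then show "(-1) ^ (j - k) * (pole (Suc j) * g k) = (-1) ^ j * pole (Suc j) * ((-1) ^ k * g k)" unfolding sq1 by (simp only: mult_1)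
  qed
  also have "\<dots> = (-1) ^ j * pole (Suc j) * (\<Sum>k<Suc j. (-1) ^ k * g k)"
    by (simp only: sum_distrib_left lessThan_Suc_atMost)
  finally have S: "(\<Sum>i\<in>{..j}. (-1) ^ i * (lo_quot j i / (E + ?q * (lo_quot j i)\<^sup>2))) = (-1) ^ j * pole (Suc j) * (\<Sum>k<Suc j. (-1) ^ k * g k)" .
  have "(\<lambda>i. (-1) ^ i * (lo_quot j i / (E + ?q * (lo_quot j i)\<^sup>2)) - (-1) ^ i * (pole (Suc j) * g (Suc j + i))) sums
     ((-1) ^ j * pole (Suc j) * (\<Sum>k<Suc j. (-1) ^ k * g k) - (-1) ^ Suc j * pole (Suc j) * (alt ?t - (\<Sum>k<Suc j. (-1) ^ k * g k)))"
    using sums_diff[OF L[unfolded S] H] .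
  moreover have "(-1) ^ i * (lo_quot j i / (E + ?q * (lo_quot j i)\<^sup>2)) - (-1) ^ i * (pole (Suc j) * g (Suc j + i)) = (-1) ^ i * alt_pair j E i" for i
    unfolding hi alt_pair_def by (simp only: right_diff_distrib)
  moreover have "(-1) ^ j * pole (Suc j) * s - (-1) ^ Suc j * pole (Suc j) * (v - s) = (-1) ^ j * pole (Suc j) * v" for s v
    by (simp add: algebra_simps)
  ultimately show ?thesis by (simp only:)
qed

text \<open>At E = 1 both quotients are values of x / (1 + q x^2), which does not increase distances
  where q x y is at most 1. Moving E away from 1 changes them by at most 2 d x and 2 d y.\<close>

lemma quot_perturb:
  fixes x y q E d :: real
  assumes x: "0 \<le> x" and y: "0 \<le> y" "y \<le> 1" and q: "0 \<le> q" "q \<le> 1"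
    and xy: "q * x * y \<le> 1" and E: "\<bar>E - 1\<bar> \<le> d" "d \<le> 1/2"
  shows "\<bar>x / (E + q * x\<^sup>2) - y / (1 + q * E * y\<^sup>2)\<bar> \<le> \<bar>x - y\<bar> + 2 * d * (x + y)"
proof -
  have E2: "1/2 \<le> E" using E by linarith
  have qx: "0 \<le> q * x\<^sup>2" "0 \<le> q * y\<^sup>2" using q by auto
  have 1: "\<bar>x / (E + q * x\<^sup>2) - x / (1 + q * x\<^sup>2)\<bar> \<le> 2 * d * x"
  proof -
    have "x / (E + q * x\<^sup>2) - x / (1 + q * x\<^sup>2) = x * (1 - E) / ((E + q * x\<^sup>2) * (1 + q * x\<^sup>2))"
      using E2 qx by (simp add: divide_simps add_nonneg_eq_0_iff) (simp add: algebra_simps)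
    moreover have "1/2 * 1 \<le> (E + q * x\<^sup>2) * (1 + q * x\<^sup>2)" using E2 qx by (intro mult_mono) auto
    then have "\<bar>x * (1 - E) / ((E + q * x\<^sup>2) * (1 + q * x\<^sup>2))\<bar> \<le> \<bar>x * (1 - E)\<bar> / (1/2)"
      unfolding abs_divide by (intro divide_left_mono) auto
    moreover have "\<bar>x * (1 - E)\<bar> \<le> x * d" using x E unfolding abs_mult by (intro mult_mono) auto
    ultimately have "\<bar>x / (E + q * x\<^sup>2) - x / (1 + q * x\<^sup>2)\<bar> \<le> \<bar>x * (1 - E)\<bar> / (1/2)" by (simp only:)
    also have "\<dots> = 2 * \<bar>x * (1 - E)\<bar>" by simp
    also have "\<dots> \<le> 2 * (x * d)" using \<open>\<bar>x * (1 - E)\<bar> \<le> x * d\<close> by linarith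
    finally show ?thesis by (simp add: mult_ac)
  qed
  have 2: "\<bar>y / (1 + q * y\<^sup>2) - y / (1 + q * E * y\<^sup>2)\<bar> \<le> 2 * d * y"
  proof -
    have pos: "1 + q * y\<^sup>2 \<ge> 1" "1 + q * E * y\<^sup>2 \<ge> 1" using q E2 by auto
    have "y / (1 + q * y\<^sup>2) - y / (1 + q * E * y\<^sup>2) = y * (q * y\<^sup>2 * (E - 1)) / ((1 + q * y\<^sup>2) * (1 + q * E * y\<^sup>2))"
      using pos by (simp add: divide_simps) (simp add: algebra_simps)
    moreover have "1 * 1 \<le> (1 + q * y\<^sup>2) * (1 + q * E * y\<^sup>2)" using pos by (intro mult_mono) auto
    then have "\<bar>y * (q * y\<^sup>2 * (E - 1)) / ((1 + q * y\<^sup>2) * (1 + q * E * y\<^sup>2))\<bar> \<le> \<bar>y * (q * y\<^sup>2 * (E - 1))\<bar> / 1"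
      unfolding abs_divide by (intro divide_left_mono) auto
    moreover have "\<bar>y * (q * y\<^sup>2 * (E - 1))\<bar> \<le> y * (1 * d)"
    proof -
      have "y\<^sup>2 \<le> 1" using y by (simp add: power_le_one)
      then have "q * y\<^sup>2 \<le> 1 * 1" using q by (intro mult_mono) auto
      then have "q * y\<^sup>2 * \<bar>E - 1\<bar> \<le> 1 * d" using E qx by (intro mult_mono) auto
      moreover have "\<bar>y * (q * y\<^sup>2 * (E - 1))\<bar> = y * (q * y\<^sup>2 * \<bar>E - 1\<bar>)"
        using y q by (simp add: abs_mult)
      ultimately show ?thesis using y by (simp add: mult_left_mono)
    qed
    ultimately have "\<bar>y / (1 + q * y\<^sup>2) - y / (1 + q * E * y\<^sup>2)\<bar> \<le> y * (1 * d)" by simp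
    also have "y * (1 * d) \<le> 2 * d * y" using y E by (simp add: mult_left_mono)
    finally show ?thesis .
  qed
  have 3: "\<bar>x / (1 + q * x\<^sup>2) - y / (1 + q * y\<^sup>2)\<bar> \<le> \<bar>x - y\<bar>"
  proof -
    have pos: "1 + q * x\<^sup>2 \<ge> 1" "1 + q * y\<^sup>2 \<ge> 1" using qx by auto
    have "x / (1 + q * x\<^sup>2) - y / (1 + q * y\<^sup>2) = (x - y) * (1 - q * x * y) / ((1 + q * x\<^sup>2) * (1 + q * y\<^sup>2))"
      using pos by (simp add: divide_simps) (simp add: algebra_simps power2_eq_square)
    moreover have "1 * 1 \<le> (1 + q * x\<^sup>2) * (1 + q * y\<^sup>2)" using pos by (intro mult_mono) auto
    then have "\<bar>(x - y) * (1 - q * x * y) / ((1 + q * x\<^sup>2) * (1 + q * y\<^sup>2))\<bar> \<le> \<bar>(x - y) * (1 - q * x * y)\<bar> / 1"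
      unfolding abs_divide by (intro divide_left_mono) auto
    moreover have "\<bar>(x - y) * (1 - q * x * y)\<bar> \<le> \<bar>x - y\<bar> * 1"
    proof -
      have "0 \<le> q * x * y" using q x y by simp
      then show ?thesis using xy unfolding abs_mult by (intro mult_left_mono) auto
    qed
    ultimately show ?thesis by simp
  qed
  have "2 * d * (x + y) = 2 * d * x + 2 * d * y" by (rule distrib_left)
  then show ?thesis using 1 2 3 by linarith
qed

text \<open>Large enough to beat the tail of the paired series in \<open>alt_sign\<close>, at most
  6.2/10000 times (1/2)^j, and small enough to leave the concavity of \<open>rho\<close> visible in
  \<open>eta_main_step\<close>.\<close>

definition dev :: "nat \<Rightarrow> real" where "dev j = 8 / 10000 * (1/2) ^ j"

lemma dev_bounds: "0 < dev j" "dev j \<le> 8 / 10000"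
  by (auto simp: dev_def power_le_one)

lemma alt_pair_bound:
  assumes "\<bar>E - 1\<bar> \<le> dev j"
  shows "\<bar>alt_pair j E i\<bar> \<le> 3 * (2/10000) ^ i * (1/2) ^ j"
proof -
  have le1: "(1/10000::real) ^ i \<le> 1" by (simp add: power_le_one)
  have q: "0 \<le> (rho j)\<^sup>2" "(rho j)\<^sup>2 \<le> 1" using rho_sq_less[of j] by auto
  have "lo_quot j i * hi_quot j i \<le> 1 * 1" using lo_quot_bounds[of j i] hi_quot_bounds[of j i] le1 by (intro mult_mono) auto
  then have "(rho j)\<^sup>2 * (lo_quot j i * hi_quot j i) \<le> 1 * 1"
    using q lo_quot_bounds[of j i] hi_quot_bounds[of j i] by (intro mult_mono) auto
  then have "\<bar>alt_pair j E i\<bar> \<le> \<bar>lo_quot j i - hi_quot j i\<bar> + 2 * dev j * (lo_quot j i + hi_quot j i)"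
    unfolding alt_pair_def using lo_quot_bounds[of j i] hi_quot_bounds[of j i] le1 q assms dev_bounds[of j]
    by (intro quot_perturb) (auto simp: mult.assoc)
  also have "\<dots> \<le> 2 * (2/10000) ^ i * (1/2) ^ j + 2 * dev j * ((1/10000) ^ i + (1/10000) ^ i)"
    using quot_diff[of j i] lo_quot_bounds[of j i] hi_quot_bounds[of j i] dev_bounds[of j]
    by (intro add_mono mult_left_mono) auto
  also have "2 * dev j * ((1/10000) ^ i + (1/10000) ^ i) = (32/10000 * (1/10000) ^ i) * (1/2) ^ j" by (simp add: dev_def)
  also have "(32/10000 * (1/10000::real) ^ i) * (1/2) ^ j \<le> (2/10000) ^ i * (1/2) ^ j"
  proof (rule mult_right_mono)
    have "(32/10000 * (1/10000::real) ^ i) \<le> 1 * (1/10000) ^ i" by (intro mult_right_mono) auto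
    also have "\<dots> \<le> (2/10000) ^ i" by (simp add: power_mono)
    finally show "32/10000 * (1/10000::real) ^ i \<le> (2/10000) ^ i" .
  qed simp
  finally show ?thesis by (simp add: algebra_simps)
qed

lemma alt_pair_0:
  assumes E: "\<bar>E - 1\<bar> \<le> dev j"
  shows "alt_pair j E 0 = (1 - (rho j)\<^sup>2) * (1 - E) / ((E + (rho j)\<^sup>2) * (1 + (rho j)\<^sup>2 * E))"
proof -
  have "E > 0" "(rho j)\<^sup>2 > 0" using E dev_bounds[of j] rho_bounds(3)[of j] by auto
  then have pos: "E + (rho j)\<^sup>2 > 0" "1 + (rho j)\<^sup>2 * E > 0" by (auto intro: add_pos_pos)
  have "alt_pair j E 0 = 1 / (E + (rho j)\<^sup>2) - 1 / (1 + (rho j)\<^sup>2 * E)"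
    using pole_pos[of j] pole_pos[of "Suc j"] by (simp add: alt_pair_def lo_quot_def hi_quot_def)
  also have "\<dots> = (1 - (rho j)\<^sup>2) * (1 - E) / ((E + (rho j)\<^sup>2) * (1 + (rho j)\<^sup>2 * E))"
    using pos by (simp add: diff_frac_eq) (simp add: algebra_simps)
  finally show ?thesis .
qed

text \<open>The pair i = 0 has the sign of 1 - E and modulus at least 0.99 \<open>dev j\<close>,
  while all other pairs together contribute at most 0.775 \<open>dev j\<close>.\<close>

lemma alt_sign:
  assumes E: "\<bar>E - 1\<bar> = dev j"
  shows "(1 - E) * ((-1) ^ j * alt (pole j * pole (Suc j) * E)) > 0"
proof -
  let ?A = "(-1) ^ j * pole (Suc j) * alt (pole j * pole (Suc j) * E)"
  have E0: "\<bar>E - 1\<bar> \<le> dev j" using E by simp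
  have Epos: "E > 0" "E \<le> 1 + 8/10000" using E dev_bounds[of j] by auto
  have S: "(\<lambda>i. (-1) ^ i * alt_pair j E i) sums ?A" by (rule alt_pair_sums[OF Epos(1)])
  have "(\<lambda>i. (-1) ^ (i + 1) * alt_pair j E (i + 1)) sums (?A - (\<Sum>i<1. (-1) ^ i * alt_pair j E i))"
    by (rule sums_split_initial_segment[OF S])
  then have T: "(\<lambda>i. (-1) ^ (i + 1) * alt_pair j E (i + 1)) sums (?A - alt_pair j E 0)" by simp
  have geo: "(\<lambda>i. 3 * (2/10000) ^ (i + 1) * (1/2::real) ^ j) sums (3 * (2/10000) * (1 / (1 - 2/10000)) * (1/2) ^ j)"
  proof -
    have "(\<lambda>i. (2/10000::real) ^ i) sums (1 / (1 - 2/10000))" by (rule geometric_sums) simp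
    from sums_mult[OF this, of "3 * (2/10000) * (1/2) ^ j"] show ?thesis by (simp add: mult_ac)
  qed
  have "norm (?A - alt_pair j E 0) \<le> 3 * (2/10000) * (1 / (1 - 2/10000)) * (1/2) ^ j"
  proof -
    have b: "norm ((-1) ^ (i + 1) * alt_pair j E (i + 1)) \<le> 3 * (2/10000) ^ (i + 1) * (1/2) ^ j" for i
      using alt_pair_bound[OF E0, of "i + 1"] by (simp add: abs_mult)
    have "norm (\<Sum>i. (-1) ^ (i + 1) * alt_pair j E (i + 1)) \<le> (\<Sum>i. 3 * (2/10000) ^ (i + 1) * (1/2) ^ j)"
      by (rule summable_norm_comparison_test[THEN summable_norm[THEN order_trans]] suminf_le norm_suminf_le)
         (use b sums_summable[OF geo] in auto)
    then show ?thesis using sums_unique[OF T] sums_unique[OF geo] by simp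
  qed
  also have "\<dots> \<le> 62/100000 * (1/2) ^ j" by simp
  finally have rest: "\<bar>?A - alt_pair j E 0\<bar> \<le> 62/100000 * (1/2) ^ j" by simp
  define c where "c = (1 - (rho j)\<^sup>2) / ((E + (rho j)\<^sup>2) * (1 + (rho j)\<^sup>2 * E))"
  have q: "(rho j)\<^sup>2 > 0" "(rho j)\<^sup>2 < 1/10000" using rho_bounds(3)[of j] rho_sq_less by auto
  have c: "c \<ge> 99/100"
  proof -
    have pos: "0 < E + (rho j)\<^sup>2" "0 < 1 + (rho j)\<^sup>2 * E" using Epos q by (auto intro: add_pos_pos)
    have "(rho j)\<^sup>2 * E \<le> 1/10000 * 2" using q Epos by (intro mult_mono) auto
    then have "(E + (rho j)\<^sup>2) * (1 + (rho j)\<^sup>2 * E) \<le> (1 + 9/10000) * (1 + 2/10000)"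
      using pos q Epos by (intro mult_mono) auto
    then have "99/100 * ((E + (rho j)\<^sup>2) * (1 + (rho j)\<^sup>2 * E)) \<le> 1 - (rho j)\<^sup>2" using q by simp
    then show ?thesis unfolding c_def using pos by (subst pos_le_divide_eq) auto
  qed
  have A0: "alt_pair j E 0 = c * (1 - E)" using alt_pair_0[OF E0] by (simp add: c_def)
  have "(1 - E) * alt_pair j E 0 = c * (dev j)\<^sup>2" unfolding A0 E[symmetric] by (simp add: power2_eq_square abs_if algebra_simps)
  also have "\<dots> \<ge> 99/100 * (dev j)\<^sup>2" using c by (intro mult_right_mono) auto
  finally have main: "(1 - E) * alt_pair j E 0 \<ge> 99/100 * (dev j)\<^sup>2" .
  have "\<bar>(1 - E) * (?A - alt_pair j E 0)\<bar> \<le> dev j * (62/100000 * (1/2) ^ j)"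
    unfolding abs_mult using rest E dev_bounds[of j] by (intro mult_mono) (auto simp: abs_minus_commute)
  also have "\<dots> = 775/1000 * (dev j)\<^sup>2" by (simp add: dev_def power2_eq_square)
  finally have "\<bar>(1 - E) * (?A - alt_pair j E 0)\<bar> \<le> 775/1000 * (dev j)\<^sup>2" .
  moreover have "(1 - E) * ?A = (1 - E) * alt_pair j E 0 + (1 - E) * (?A - alt_pair j E 0)" by (simp add: algebra_simps)
  ultimately have "(1 - E) * ?A \<ge> 99/100 * (dev j)\<^sup>2 - 775/1000 * (dev j)\<^sup>2"
    using main by linarith
  moreover have "(dev j)\<^sup>2 > 0" using dev_bounds[of j] by simp
  ultimately have "(1 - E) * ?A > 0" by linarith
  also have "(1 - E) * ?A = pole (Suc j) * ((1 - E) * ((-1) ^ j * alt (pole j * pole (Suc j) * E)))"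
    by (simp only: mult_ac)
  finally have "pole (Suc j) * ((1 - E) * ((-1) ^ j * alt (pole j * pole (Suc j) * E))) > 0" .
  then show ?thesis using pole_pos[of "Suc j"] zero_less_mult_pos by blast
qed

text \<open>Opposite signs at E = 1 - \<open>dev j\<close> and E = 1 + \<open>dev j\<close> give a
  root by the intermediate value theorem; the square root only moves it closer to 1.\<close>

lemma alt_root_exists: "\<exists>t>0. alt (t\<^sup>2) = 0 \<and> \<bar>t * rho j / pole j - 1\<bar> \<le> dev j"
proof -
  let ?s = "pole j * pole (Suc j)"
  define f where "f E = (-1) ^ j * alt (?s * E)" for E
  have s: "?s > 0" using pole_pos by simp
  have d: "0 < dev j" "dev j \<le> 8/10000" by (rule dev_bounds)+
  have "continuous_on {1 - dev j..1 + dev j} f"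
    unfolding f_def
  proof (rule continuous_on_mult[OF continuous_on_const continuous_on_compose2[OF continuous_alt]])
    show "continuous_on {1 - dev j..1 + dev j} (\<lambda>E. ?s * E)" by (intro continuous_intros)
    show "(\<lambda>E. ?s * E) ` {1 - dev j..1 + dev j} \<subseteq> {0..}"
    proof clarsimp
      fix E assume "1 - dev j \<le> E"
      then have "0 \<le> E" using d by simp
      then show "0 \<le> pole j * pole (Suc j) * E" using s by simp
    qed
  qed
  moreover have "f (1 - dev j) > 0" using alt_sign[of "1 - dev j" j] d by (simp add: f_def zero_less_mult_iff)
  moreover have "f (1 + dev j) < 0"
    using alt_sign[of "1 + dev j" j] d by (simp add: f_def mult_less_0_iff zero_less_mult_iff)
  ultimately obtain E where E: "1 - dev j \<le> E" "E \<le> 1 + dev j" "f E = 0"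
    using IVT2'[of f "1 + dev j" 0 "1 - dev j"] d by auto
  have Epos: "E > 0" using E d by auto
  define t where "t = sqrt (?s * E)"
  have "t > 0" using s Epos by (simp add: t_def)
  moreover have "t\<^sup>2 = ?s * E" using s Epos by (simp add: t_def)
  then have "alt (t\<^sup>2) = 0" using E by (simp add: f_def)
  moreover have "t * rho j / pole j = sqrt E"
  proof -
    have "(t * rho j / pole j)\<^sup>2 = ?s * E * (rho j)\<^sup>2 / (pole j)\<^sup>2"
      using \<open>t\<^sup>2 = ?s * E\<close> by (simp add: power_mult_distrib power_divide)
    also have "\<dots> = E" using rho_bounds(3)[of j] pole_pos[of j] by (simp add: power2_eq_square pole.simps(2))
    finally show ?thesis using \<open>t > 0\<close> rho_bounds(3)[of j] pole_pos[of j]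
      by (metis divide_nonneg_pos less_imp_le mult_nonneg_nonneg real_sqrt_unique)
  qed
  moreover have "\<bar>sqrt E - 1\<bar> \<le> \<bar>E - 1\<bar>"
  proof -
    have "E - 1 = (sqrt E - 1) * (sqrt E + 1)" using Epos by (simp add: algebra_simps)
    then have "\<bar>E - 1\<bar> = \<bar>sqrt E - 1\<bar> * (sqrt E + 1)" using Epos by (simp add: abs_mult)
    moreover have "\<bar>sqrt E - 1\<bar> * 1 \<le> \<bar>sqrt E - 1\<bar> * (sqrt E + 1)" using Epos by (intro mult_left_mono) auto
    ultimately show ?thesis by simp
  qed
  ultimately show ?thesis using E by (intro exI[of _ t]) auto
qed

text \<open>Up to the factor -2, alt (t^2) is the value of chi at i t, so i node j is a zero of chi.\<close>

definition node :: "nat \<Rightarrow> real" where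
  "node j = (SOME t. t > 0 \<and> alt (t\<^sup>2) = 0 \<and> \<bar>t * rho j / pole j - 1\<bar> \<le> dev j)"

text \<open>Ratio of \<open>node j\<close> to the geometric mean of its two neighbouring
  poles.\<close>

definition corr :: "nat \<Rightarrow> real" where "corr j = node j * rho j / pole j"

lemma node_props: "node j > 0" "alt ((node j)\<^sup>2) = 0" "\<bar>corr j - 1\<bar> \<le> dev j"
  using someI_ex[OF alt_root_exists[of j]] unfolding node_def[symmetric] corr_def by auto

lemma node_eq: "node j = pole j * corr j / rho j"
  using rho_bounds(3)[of j] pole_pos[of j] by (simp add: corr_def)

lemma corr_dev: "1 - 8 / 10000 * (1/2) ^ j \<le> corr j" "corr j \<le> 1 + 8 / 10000 * (1/2) ^ j"
  using node_props(3)[of j] unfolding dev_def abs_le_iff by linarith+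

lemma corr_bounds: "999/1000 \<le> corr j" "corr j \<le> 1001/1000"
  using node_props(3)[of j] dev_bounds[of j] by auto

lemma node_ratio: "node j / node (Suc j) = rho j * rho (Suc j) * (corr j / corr (Suc j))"
  unfolding node_eq pole.simps(2)
  using rho_bounds(3)[of j] rho_bounds(3)[of "Suc j"] pole_pos[of j] corr_bounds[of "Suc j"]
  by (simp add: field_simps power2_eq_square)

lemma corr_ratio: "\<bar>corr j / corr (Suc j) - 1\<bar> \<le> 24/10000 * (1/2) ^ j"
proof -
  have "dev (Suc j) = dev j / 2" by (simp add: dev_def)
  then have "\<bar>corr j - corr (Suc j)\<bar> \<le> 3 / 2 * dev j" using node_props(3)[of j] node_props(3)[of "Suc j"] by linarith
  moreover have "corr j / corr (Suc j) - 1 = (corr j - corr (Suc j)) / corr (Suc j)"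
    using corr_bounds[of "Suc j"] by (simp add: field_simps)
  moreover have "\<bar>(corr j - corr (Suc j)) / corr (Suc j)\<bar> \<le> (3 / 2 * dev j) / (999/1000)"
    unfolding abs_divide using corr_bounds[of "Suc j"] \<open>\<bar>corr j - corr (Suc j)\<bar> \<le> 3 / 2 * dev j\<close> dev_bounds[of j] by (intro frac_le) auto
  moreover have "(3 / 2 * dev j) / (999/1000) \<le> 24/10000 * (1/2) ^ j" by (simp add: dev_def)
  ultimately show ?thesis by linarith
qed

lemma corr_ratio_bounds:
  "1 - 24/10000 * (1/2) ^ j \<le> corr j / corr (Suc j)" "corr j / corr (Suc j) \<le> 1 + 24/10000 * (1/2) ^ j"
  using corr_ratio[of j] unfolding abs_le_iff by linarith+

lemma node_bounds: "99 * pole j \<le> node j" "node j \<le> 11/1000 * pole (Suc j)" "node j \<le> 202 * pole j"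
proof -
  have r: "rho j > 0" "rho j < 1/100" "rho j \<ge> 1/200" by (rule rho_bounds)+
  have p: "pole j > 0" by (rule pole_pos)
  have c: "999/1000 \<le> corr j" "corr j \<le> 1001/1000" by (rule corr_bounds)+
  have "99 * pole j * rho j \<le> 99 * pole j * (1/100)" using p r by (intro mult_left_mono) auto
  also have "\<dots> \<le> pole j * corr j" using p c by simp
  finally show "99 * pole j \<le> node j" unfolding node_eq using r by (simp add: le_divide_eq)
  have "node j = rho j * corr j * pole (Suc j)" unfolding node_eq using r pole_ratio[of j] by (simp add: field_simps power2_eq_square)
  moreover have "rho j * corr j \<le> 1/100 * (1001/1000)" using r c by (intro mult_mono) auto
  then have "rho j * corr j * pole (Suc j) \<le> 11/1000 * pole (Suc j)" using pole_pos[of "Suc j"] by (intro mult_right_mono) auto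
  ultimately show "node j \<le> 11/1000 * pole (Suc j)" by simp
  have "pole j * corr j \<le> pole j * (1001/1000)" using p c by (intro mult_left_mono) auto
  also have "\<dots> \<le> pole j * (202 * rho j)" using p r by (intro mult_left_mono) auto
  finally show "node j \<le> 202 * pole j" unfolding node_eq using r by (simp add: divide_le_eq mult_ac)
qed

lemma node_Suc_ge: "2 * node j \<le> node (Suc j)"
  using node_bounds(2)[of j] node_bounds(1)[of "Suc j"] pole_pos[of "Suc j"] by linarith

lemma node_strict_mono: "strict_mono node"
  unfolding strict_mono_Suc_iff using node_Suc_ge node_props(1) by (smt (verit))

section \<open>Arguments of the Blaschke product at the poles\<close>

text \<open>The factor with zero i t has argument 2 arctan (x / t) at the real point x. Here
  \<open>up\<close> lists these quotients for the nodes above \<open>pole k\<close>, and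
  \<open>dn\<close> the inverse quotients for the nodes below; all of them are small.\<close>

definition up :: "nat \<Rightarrow> nat \<Rightarrow> real" where "up k i = pole k / node (k + i)"
definition dn :: "nat \<Rightarrow> nat \<Rightarrow> real" where "dn k j = node j / pole k"

lemma up_pos: "0 < up k i" and dn_pos: "0 < dn k j"
  using pole_pos node_props(1) by (auto simp: up_def dn_def)

lemma up_bound: "up k i \<le> 11/1000 * (1/10000) ^ i"
proof -
  have "up k i \<le> pole k / (99 * pole (k + i))" unfolding up_def
    using node_bounds(1)[of "k + i"] pole_pos[of "k + i"] pole_pos[of k] node_props(1)[of "k + i"] by (intro divide_left_mono mult_pos_pos) auto
  also have "\<dots> = pole k / pole (k + i) / 99" by simp
  also have "\<dots> \<le> (1/10000) ^ i / 99" using pole_quotient_le[of k i] by (intro divide_right_mono) auto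
  also have "\<dots> \<le> 11/1000 * (1/10000) ^ i" by simp
  finally show ?thesis .
qed

lemma arctan_nonneg_le: "0 \<le> x \<Longrightarrow> 0 \<le> arctan x \<and> arctan x \<le> x"
  using arctan_le_self[of x] by simp

lemma summable_up: "summable (\<lambda>i. arctan (up k i))"
proof (rule summable_comparison_test')
  show "summable (\<lambda>i. 11/1000 * (1/10000::real) ^ i)" by (intro summable_mult summable_geometric) simp
  show "norm (arctan (up k i)) \<le> 11/1000 * (1/10000) ^ i" if "i \<ge> 0" for i
    using up_bound[of k i] up_pos[of k i] arctan_nonneg_le[of "up k i"] by simp
qed

text \<open>The Blaschke product with zeros i node j has argument eta k + k pi at pole k; the factors with j < k
  are rewritten by arctan x = pi / 2 - arctan (1 / x).\<close>

definition eta :: "nat \<Rightarrow> real" where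
  "eta k = 2 * ((\<Sum>i. arctan (up k i)) - (\<Sum>j<k. arctan (dn k j)))"

lemma up_suminf_bounds: "0 < (\<Sum>i. arctan (up 0 i))" "(\<Sum>i. arctan (up 0 i)) \<le> 12/1000"
proof -
  show "0 < (\<Sum>i. arctan (up 0 i))" by (intro suminf_pos summable_up) (simp add: up_pos)
  have geo: "(\<lambda>i. 11/1000 * (1/10000::real) ^ i) sums (11/1000 * (1 / (1 - 1/10000)))"
    by (intro sums_mult geometric_sums) simp
  have "(\<Sum>i. arctan (up 0 i)) \<le> (\<Sum>i. 11/1000 * (1/10000::real) ^ i)"
    by (intro suminf_le summable_up sums_summable[OF geo] order_trans[OF _ up_bound]) (use arctan_nonneg_le up_pos less_imp_le in blast)
  then show "(\<Sum>i. arctan (up 0 i)) \<le> 12/1000" using sums_unique[OF geo] by simp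
qed

lemma eta_0: "0 < eta 0" "eta 0 \<le> 3/100"
  using up_suminf_bounds by (auto simp: eta_def)

text \<open>Concavity of arctan on the nonnegative half line.\<close>

lemma arctan_tangent:
  assumes "0 \<le> x" "0 \<le> m"
  shows "arctan x \<le> arctan m + (x - m) / (1 + m\<^sup>2)"
proof (cases x m rule: linorder_cases)
  case less
  obtain c where c: "x < c" "c < m" "arctan m - arctan x = (m - x) * (1 / (1 + c\<^sup>2))"
    using MVT2[OF less, of arctan "\<lambda>t. 1 / (1 + t\<^sup>2)"] DERIV_arctan by (auto simp: inverse_eq_divide)
  have "c\<^sup>2 \<le> m\<^sup>2" using c assms by (intro power_mono) auto
  moreover have "1 + c\<^sup>2 > 0" by (simp add: add_pos_nonneg)
  ultimately have "1 / (1 + m\<^sup>2) \<le> 1 / (1 + c\<^sup>2)" by (intro frac_le) auto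
  then have "(m - x) * (1 / (1 + m\<^sup>2)) \<le> arctan m - arctan x" unfolding c(3) using less by (intro mult_left_mono) auto
  then show ?thesis by (simp add: diff_divide_distrib)
next
  case greater
  obtain c where c: "m < c" "c < x" "arctan x - arctan m = (x - m) * (1 / (1 + c\<^sup>2))"
    using MVT2[OF greater, of arctan "\<lambda>t. 1 / (1 + t\<^sup>2)"] DERIV_arctan by (auto simp: inverse_eq_divide)
  have "m\<^sup>2 \<le> c\<^sup>2" using c assms by (intro power_mono) auto
  moreover have "1 + m\<^sup>2 > 0" by (simp add: add_pos_nonneg)
  ultimately have "1 / (1 + c\<^sup>2) \<le> 1 / (1 + m\<^sup>2)" by (intro frac_le) auto
  then have "(x - m) * (1 / (1 + c\<^sup>2)) \<le> (x - m) * (1 / (1 + m\<^sup>2))" using greater by (intro mult_left_mono) auto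
  then show ?thesis using c by (simp add: diff_divide_distrib)
qed simp

text \<open>By the addition formula only the sum of the two arguments matters, their product being
  fixed, and the sum is smallest when they are equal. Thus the error \<open>corr k\<close>, which
  enters \<open>up k 0\<close> and \<open>dn (Suc k) k\<close> inversely, can only help.\<close>

lemma arctan_balanced:
  assumes "0 < p" "p \<le> 1/2" "1/2 < e" "e < 2"
  shows "2 * arctan p \<le> arctan (p / e) + arctan (p * e)"
proof -
  have le: "p / e < 1" "p * e < 1" "0 < p / e" "0 < p * e"
  proof -
    show "p / e < 1" using assms by (simp add: divide_less_eq)
    have "p * e < 1/2 * 2" using assms by (intro mult_le_less_imp_less) auto
    then show "p * e < 1" by simp
  qed (use assms in auto)
  have "p * p \<le> 1/2 * (1/2)" using assms by (intro mult_mono) auto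
  then have pp: "p * p < 1" by simp
  have "arctan (p / e) + arctan (p * e) = arctan ((p / e + p * e) / (1 - p / e * (p * e)))"
    using le by (intro arctan_add) auto
  moreover have "2 * arctan p = arctan ((p + p) / (1 - p * p))"
    using arctan_add[of p p] assms by simp
  moreover have "p / e * (p * e) = p * p" using assms by simp
  moreover have "p + p \<le> p / e + p * e"
  proof -
    have "0 \<le> p * (e - 1)\<^sup>2 / e" using assms by simp
    also have "\<dots> = p / e + p * e - (p + p)" using assms by (simp add: field_simps power2_eq_square)
    finally show ?thesis by simp
  qed
  ultimately show ?thesis using pp by (simp add: divide_right_mono arctan_le_iff)
qed

lemma up_dn_eq:
  "up k 0 = rho k / corr k" "dn (Suc k) k = rho k * corr k"
  using rho_bounds(3)[of k] pole_pos[of k] corr_bounds[of k]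
  by (auto simp: up_def dn_def node_eq pole.simps(2) field_simps power2_eq_square)

text \<open>Up to the errors in the nodes this compares rho (k + 1) + rho (k - 1) with 2 rho k. The
  second difference supplies 25/10000 times (1/2)^k, the nodes cost less than 1/10000, and the
  derivative of arctan loses a bounded factor. The value 0 of Q at k = 0 agrees with extending the
  formula of \<open>rho\<close> to index -1.\<close>

lemma eta_main_step:
  defines "Q \<equiv> \<lambda>k. case k of 0 \<Rightarrow> 0 | Suc m \<Rightarrow> dn (Suc m) m"
  shows "arctan (up (Suc k) 0) + arctan (Q k) + 2/1000 * (1/2) ^ k \<le> arctan (up k 0) + arctan (dn (Suc k) k)"
proof -
  define x where "x = (1/2::real) ^ k"
  have x: "0 < x" "x \<le> 1" by (auto simp: x_def power_le_one)
  have r: "rho k > 0" "rho k < 1/100" "rho k = (2 - x) / 200" using rho_bounds[of k] by (auto simp: rho_def x_def)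
  have main: "2 * arctan (rho k) \<le> arctan (up k 0) + arctan (dn (Suc k) k)"
    unfolding up_dn_eq using r corr_bounds[of k] by (intro arctan_balanced) auto
  have up1: "0 \<le> up (Suc k) 0" "up (Suc k) 0 \<le> (2 - x / 2) / 200 + 1/100000 * x"
  proof -
    show "0 \<le> up (Suc k) 0" using up_pos less_imp_le by blast
    have c: "corr (Suc k) \<ge> 1 - 4/10000 * x" using corr_dev(1)[of "Suc k"] by (simp add: x_def)
    have "0 \<le> x * (1 - x)" using x by simp
    then have xx: "x * x \<le> x" by (simp add: algebra_simps)
    have "rho (Suc k) = (2 - x / 2) / 200" by (simp add: rho_def x_def)
    moreover have "(2 - x / 2) / 200 \<le> ((2 - x / 2) / 200 + 1/100000 * x) * (1 - 4/10000 * x)"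
    proof -
      define L where "L = (2 - x / 2) / 200"
      have "4/10000 * L \<le> 4/1000000" using x by (simp add: L_def)
      then have "0 \<le> x * (1/100000 - 4/10000 * L - 4/1000000000 * x)" using x by (intro mult_nonneg_nonneg) auto
      also have "\<dots> = (L + 1/100000 * x) * (1 - 4/10000 * x) - L" by (simp add: algebra_simps)
      finally show ?thesis unfolding L_def by simp
    qed
    moreover have "\<dots> \<le> ((2 - x / 2) / 200 + 1/100000 * x) * corr (Suc k)"
      using c x by (intro mult_left_mono) auto
    ultimately have "rho (Suc k) \<le> ((2 - x / 2) / 200 + 1/100000 * x) * corr (Suc k)" by linarith
    then show "up (Suc k) 0 \<le> (2 - x / 2) / 200 + 1/100000 * x"
      unfolding up_dn_eq using corr_bounds[of "Suc k"] by (simp add: divide_le_eq)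
  qed
  have Q: "0 \<le> Q k" "Q k \<le> (2 - 2 * x) / 200 + 2/100000 * x"
  proof -
    show "0 \<le> Q k" using dn_pos less_imp_le unfolding Q_def by (auto split: nat.split)
    show "Q k \<le> (2 - 2 * x) / 200 + 2/100000 * x"
    proof (cases k)
      case 0
      then show ?thesis using x_def by (simp add: Q_def)
    next
      case (Suc m)
      have xm: "(1/2::real) ^ m = 2 * x" by (simp add: x_def Suc)
      have "corr m \<le> 1 + 16/10000 * x" using corr_dev(2)[of m] by (simp add: xm)
      moreover have "rho m = (2 - 2 * x) / 200" by (simp add: rho_def xm)
      ultimately have "rho m * corr m \<le> (2 - 2 * x) / 200 * (1 + 16/10000 * x)"
        using rho_bounds(3)[of m] corr_bounds[of m] by (intro mult_mono) auto
      also have "\<dots> \<le> (2 - 2 * x) / 200 + 2/100000 * x"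
      proof -
        have "(2 - 2 * x) / 200 + 2/100000 * x - (2 - 2 * x) / 200 * (1 + 16/10000 * x) = 4/1000000 * x + 16/1000000 * (x * x)"
          by (simp add: field_simps)
        moreover have "0 \<le> x * x" by simp
        ultimately show ?thesis using x by linarith
      qed
      finally show ?thesis by (simp add: Q_def Suc up_dn_eq)
    qed
  qed
  have t1: "arctan (up (Suc k) 0) \<le> arctan (rho k) + (up (Suc k) 0 - rho k) / (1 + (rho k)\<^sup>2)"
    using up1 r by (intro arctan_tangent) auto
  have t2: "arctan (Q k) \<le> arctan (rho k) + (Q k - rho k) / (1 + (rho k)\<^sup>2)"
    using Q r by (intro arctan_tangent) auto
  have "(up (Suc k) 0 - rho k) / (1 + (rho k)\<^sup>2) + (Q k - rho k) / (1 + (rho k)\<^sup>2)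
      = (up (Suc k) 0 + Q k - 2 * rho k) / (1 + (rho k)\<^sup>2)"
    by (simp add: add_divide_distrib diff_divide_distrib)
  also have "\<dots> \<le> (- 24/10000 * x) / (1 + (rho k)\<^sup>2)"
    using up1(2) Q(2) r(3) x by (intro divide_right_mono) (auto simp: field_simps)
  also have "\<dots> \<le> - 2/1000 * x"
  proof -
    have "1 + (rho k)\<^sup>2 \<le> 12/10" using rho_sq_less[of k] by simp
    then have "2/1000 * x * (1 + (rho k)\<^sup>2) \<le> 2/1000 * x * (12/10)" using x by (intro mult_left_mono) auto
    then have "2/1000 * x \<le> 24/10000 * x / (1 + (rho k)\<^sup>2)"
      by (subst pos_le_divide_eq) (auto simp: add_pos_nonneg)
    then show ?thesis by simp
  qed
  finally have t3: "(up (Suc k) 0 - rho k) / (1 + (rho k)\<^sup>2) + (Q k - rho k) / (1 + (rho k)\<^sup>2) \<le> - 2/1000 * x" .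
  show ?thesis using t1 t2 t3 main unfolding x_def[symmetric] by linarith
qed

text \<open>Apart from \<open>corr\<close> the ratio is a product of two later values of
  \<open>rho\<close>, each below 1/100, over the square of \<open>rho k\<close>, which equals 1/100
  times 1 - (1/2)^(k + 1).\<close>

lemma up_Suc_ratio: "up (Suc k) i \<le> (1 + 4 * (1/2) ^ k) * up k i"
proof -
  define x where "x = (1/2::real) ^ k"
  have x: "0 < x" "x \<le> 1" by (auto simp: x_def power_le_one)
  let ?j = "k + i"
  have rk: "rho k = (2 - x) / 200" by (simp add: rho_def x_def)
  have rkpos: "rho k > 0" by (rule rho_bounds)
  have eq: "up (Suc k) i = up k i * (rho ?j * rho (Suc ?j) * (corr ?j / corr (Suc ?j)) / (rho k)\<^sup>2)"
  proof -
    have "up (Suc k) i = up k i * (node ?j / node (Suc ?j)) / (rho k)\<^sup>2"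
      using node_props(1)[of ?j] node_props(1)[of "Suc ?j"] by (simp add: up_def pole.simps(2))
    then show ?thesis unfolding node_ratio by (simp only: times_divide_eq_right)
  qed
  have cr: "corr ?j / corr (Suc ?j) \<le> 1 + 24/10000 * x"
  proof -
    have "(1/2::real) ^ ?j \<le> x" unfolding x_def by (intro power_decreasing) auto
    then show ?thesis using corr_ratio[of ?j] by linarith
  qed
  have cpos: "0 \<le> corr ?j / corr (Suc ?j)" using corr_bounds[of ?j] corr_bounds[of "Suc ?j"] by simp
  have "rho ?j * rho (Suc ?j) * (corr ?j / corr (Suc ?j)) \<le> 1/100 * (1/100) * (1 + 24/10000 * x)"
    using rho_bounds[of ?j] rho_bounds[of "Suc ?j"] cr cpos less_imp_le by (intro mult_mono) auto
  also have "\<dots> \<le> (1 + 4 * x) * (rho k)\<^sup>2"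
  proof -
    have "0 \<le> x * (1 - x)" "0 \<le> x * x * x" using x by auto
    then have "0 \<le> (1 + 4 * x) * (2 - x) * (2 - x) - 4 * (1 + 24/10000 * x)"
    proof -
      have "(1 + 4 * x) * (2 - x) * (2 - x) - 4 * (1 + 24/10000 * x) = 12 * x - 15 * (x * x) + 4 * (x * x * x) - 96/10000 * x"
        by (simp add: algebra_simps)
      also have "\<dots> = x * (12 - 15 * x + 4 * (x * x) - 96/10000)" by (simp add: algebra_simps)
      also have "\<dots> \<ge> 0"
      proof (intro mult_nonneg_nonneg)
        have "0 \<le> (1 - x) * (1 - x)" by simp
        then have "2 * x \<le> 1 + x * x" by (simp add: algebra_simps)
        then show "0 \<le> 12 - 15 * x + 4 * (x * x) - 96/10000" using x by linarith
      qed (use x in simp)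
      finally show ?thesis .
    qed
    then show ?thesis unfolding rk by (simp add: power2_eq_square field_simps)
  qed
  finally have "rho ?j * rho (Suc ?j) * (corr ?j / corr (Suc ?j)) / (rho k)\<^sup>2 \<le> 1 + 4 * x"
    by (subst pos_divide_le_eq) (use rkpos in auto)
  from mult_left_mono[OF this, of "up k i"] show ?thesis
    unfolding eq x_def[symmetric] using up_pos[of k i] by (simp only: mult.commute[of "up k i"] less_imp_le)
qed

text \<open>The relative growth is of order (1/2)^k, and the terms beyond the first are smaller by a
  factor 10000, so the loss stays below half of the gain in \<open>eta_main_step\<close>.\<close>

lemma up_tail_step: "(\<Sum>i. arctan (up (Suc k) (Suc i))) \<le> (\<Sum>i. arctan (up k (Suc i))) + 1/1000 * (1/2) ^ k"
proof -
  have geo: "(\<lambda>i. 44/1000 * (1/10000) * (1/2) ^ k * (1/10000::real) ^ i) sums (44/1000 * (1/10000) * (1/2) ^ k * (1 / (1 - 1/10000)))"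
    by (intro sums_mult geometric_sums) simp
  have s: "summable (\<lambda>i. arctan (up l (Suc i)))" for l
    using summable_up[of l] by (subst summable_Suc_iff)
  have "arctan (up (Suc k) (Suc i)) \<le> arctan (up k (Suc i)) + 44/1000 * (1/10000) * (1/2) ^ k * (1/10000) ^ i" for i
  proof -
    have b: "4 * (1/2) ^ k * up k (Suc i) \<le> 4 * (1/2) ^ k * (11/1000 * (1/10000) ^ Suc i)"
      by (intro mult_left_mono up_bound) auto
    have "arctan (up (Suc k) (Suc i)) \<le> arctan ((1 + 4 * (1/2) ^ k) * up k (Suc i))"
      using up_Suc_ratio by (simp add: arctan_le_iff)
    also have "\<dots> \<le> arctan (up k (Suc i)) + ((1 + 4 * (1/2) ^ k) * up k (Suc i) - up k (Suc i)) / (1 + (up k (Suc i))\<^sup>2)"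
      using up_pos[of k "Suc i"] by (intro arctan_tangent) auto
    also have "(1 + 4 * (1/2) ^ k) * up k (Suc i) - up k (Suc i) = 4 * (1/2) ^ k * up k (Suc i)" by (simp add: algebra_simps)
    also have "4 * (1/2) ^ k * up k (Suc i) / (1 + (up k (Suc i))\<^sup>2) \<le> 4 * (1/2) ^ k * up k (Suc i) / 1"
      using up_pos[of k "Suc i"] by (intro divide_left_mono) (auto simp: add_pos_nonneg)
    finally have "arctan (up (Suc k) (Suc i)) \<le> arctan (up k (Suc i)) + 4 * (1/2) ^ k * up k (Suc i)" by (simp only: div_by_1)
    also have "\<dots> \<le> arctan (up k (Suc i)) + 4 * (1/2) ^ k * (11/1000 * (1/10000) ^ Suc i)" using b by linarith
    finally show ?thesis by (simp add: algebra_simps)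
  qed
  then have "(\<Sum>i. arctan (up (Suc k) (Suc i))) \<le> (\<Sum>i. arctan (up k (Suc i)) + 44/1000 * (1/10000) * (1/2) ^ k * (1/10000) ^ i)"
    by (intro suminf_le s summable_add sums_summable[OF geo])
  also have "\<dots> = (\<Sum>i. arctan (up k (Suc i))) + 44/1000 * (1/10000) * (1/2) ^ k * (1 / (1 - 1/10000))"
    using suminf_add[OF s sums_summable[OF geo], of k] sums_unique[OF geo] by simp
  also have "\<dots> \<le> (\<Sum>i. arctan (up k (Suc i))) + 1/1000 * (1/2) ^ k" by simp
  finally show ?thesis .
qed

text \<open>Shifting both indices replaces ratios by later, larger ones; the increase of
  \<open>rho\<close> over two steps outweighs the error in the quotient of the
  \<open>corr\<close>.\<close>

lemma dn_shift: "dn (Suc m) l \<le> dn (Suc (Suc m)) (Suc l)" if "l < m"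
proof -
  define x where "x = (1/2::real) ^ l"
  have x: "0 < x" "x \<le> 1" by (auto simp: x_def power_le_one)
  have c: "corr l / corr (Suc l) \<le> 1 + 24/10000 * x" "0 \<le> corr l / corr (Suc l)"
    using corr_ratio_bounds[of l] corr_bounds[of l] corr_bounds[of "Suc l"] by (auto simp: x_def)
  have "rho l * rho (Suc l) * (corr l / corr (Suc l)) \<le> rho (Suc (Suc l)) * rho (Suc m)"
  proof -
    have "rho l * (corr l / corr (Suc l)) \<le> rho l * (1 + 24/10000 * x)" using c rho_bounds(3)[of l] by (intro mult_left_mono) auto
    also have "\<dots> \<le> rho (Suc (Suc l))"
    proof -
      have r: "rho l = (2 - x) / 200" "rho (Suc (Suc l)) = (2 - x / 4) / 200" by (simp_all add: rho_def x_def)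
      have "0 \<le> x * x" by simp
      then have "(2 - x) * (1 + 24/10000 * x) \<le> 2 - x / 4" using x by (simp add: algebra_simps)
      then show ?thesis unfolding r by simp
    qed
    finally have "rho l * (corr l / corr (Suc l)) * rho (Suc l) \<le> rho (Suc (Suc l)) * rho (Suc m)"
      using rho_mono[of "Suc l" "Suc m"] that rho_bounds(3) less_imp_le by (intro mult_mono) auto
    then show ?thesis by (simp add: mult_ac)
  qed
  also have "\<dots> \<le> rho (Suc m) * rho (Suc m)"
    using rho_mono[of "Suc (Suc l)" "Suc m"] that rho_bounds(3)[of "Suc m"] by (intro mult_right_mono) auto
  finally have "node l / node (Suc l) \<le> (rho (Suc m))\<^sup>2" unfolding node_ratio by (simp add: power2_eq_square)
  then have "node l \<le> (rho (Suc m))\<^sup>2 * node (Suc l)" using node_props(1)[of "Suc l"] by (simp add: divide_le_eq)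
  then have "node l / pole (Suc m) \<le> (rho (Suc m))\<^sup>2 * node (Suc l) / pole (Suc m)"
    using pole_pos[of "Suc m"] by (intro divide_right_mono) auto
  also have "\<dots> = dn (Suc (Suc m)) (Suc l)" using rho_bounds(3)[of "Suc m"] by (simp add: dn_def pole.simps(2)[of "Suc m"])
  finally show ?thesis by (simp add: dn_def)
qed

text \<open>The two nodes next to the poles gain 2/1000 times (1/2)^k, the distant nodes above lose
  at most 1/1000 of it, and those below are compared by the index shift, which leaves one extra
  nonnegative term.\<close>

lemma eta_antimono_Suc: "eta (Suc k) \<le> eta k"
proof -
  define Q where "Q k = (case k of 0 \<Rightarrow> 0 | Suc m \<Rightarrow> dn (Suc m) m)" for k
  have split: "(\<Sum>i. arctan (up k i)) = (\<Sum>i. arctan (up k (Suc i))) + arctan (up k 0)" for k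
    using suminf_split_head[OF summable_up[of k]] by simp
  have dnsum: "(\<Sum>j<k. arctan (dn k j)) \<le> (\<Sum>j<Suc k. arctan (dn (Suc k) j)) - arctan (dn (Suc k) k) + arctan (Q k)"
  proof (cases k)
    case 0
    then show ?thesis by (simp add: Q_def)
  next
    case (Suc m)
    have "(\<Sum>j<k. arctan (dn k j)) = (\<Sum>l<m. arctan (dn (Suc m) l)) + arctan (Q k)" by (simp add: Suc Q_def)
    moreover have "(\<Sum>l<m. arctan (dn (Suc m) l)) \<le> (\<Sum>l<m. arctan (dn (Suc (Suc m)) (Suc l)))"
      using dn_shift by (intro sum_mono) (auto simp: arctan_le_iff)
    moreover have "(\<Sum>j<Suc k. arctan (dn (Suc k) j)) = arctan (dn (Suc k) 0) + (\<Sum>l<m. arctan (dn (Suc (Suc m)) (Suc l))) + arctan (dn (Suc k) k)"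
      unfolding Suc by (subst sum.lessThan_Suc, subst sum.lessThan_Suc_shift) simp
    moreover have "0 \<le> arctan (dn (Suc k) 0)" using dn_pos[of "Suc k" 0] by simp
    ultimately show ?thesis by linarith
  qed
  have "(1/2::real) ^ k > 0" by simp
  then have "(1/1000::real) * (1/2) ^ k \<le> 2/1000 * (1/2) ^ k" by simp
  then show ?thesis
    unfolding eta_def split[of k] split[of "Suc k"]
    using dnsum eta_main_step[of k, folded Q_def] up_tail_step[of k] by argo
qed

lemma eta_antimono: "j \<le> k \<Longrightarrow> eta k \<le> eta j"
  using lift_Suc_antimono_le[of eta] eta_antimono_Suc by blast

text \<open>The two nodes are mirror images in the ordering around \<open>pole (Suc k)\<close>.
  Because \<open>rho\<close> increases, consecutive gaps shrink upwards on the logarithmic scale, so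
  the lower node is further from the pole than the upper one; the margin absorbs
  \<open>corr\<close>.\<close>

lemma node_product_le: "node (Suc k + i) * node (k - i) \<le> (pole (Suc k))\<^sup>2" if "i \<le> k"
  using that
proof (induction i)
  case 0
  define x where "x = (1/2::real) ^ k"
  have x: "0 < x" "x \<le> 1" by (auto simp: x_def power_le_one)
  have "node (Suc k) * node k = (pole (Suc k))\<^sup>2 * (rho k * corr k * corr (Suc k) / rho (Suc k))"
    unfolding node_eq using pole_ratio[of k] rho_bounds(3)[of k] rho_bounds(3)[of "Suc k"]
    by (simp add: power2_eq_square field_simps)
  also have "\<dots> \<le> (pole (Suc k))\<^sup>2 * 1"
  proof (intro mult_left_mono)
    have "corr k \<le> 1 + 8/10000 * x" "corr (Suc k) \<le> 1 + 4/10000 * x"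
      using corr_dev(2)[of k] corr_dev(2)[of "Suc k"] by (auto simp: x_def)
    then have "rho k * corr k * corr (Suc k) \<le> rho k * (1 + 8/10000 * x) * (1 + 4/10000 * x)"
      using rho_bounds(3)[of k] corr_bounds[of k] corr_bounds[of "Suc k"] x by (intro mult_mono) auto
    also have "\<dots> \<le> rho k * (1 + 16/10000 * x)"
    proof -
      have "0 \<le> x * x" "x * x \<le> x * 1" using x by (simp, intro mult_left_mono) auto
      moreover have "(1 + 8/10000 * x) * (1 + 4/10000 * x) = 1 + 12/10000 * x + 32/100000000 * (x * x)"
        by (simp add: algebra_simps)
      ultimately have "(1 + 8/10000 * x) * (1 + 4/10000 * x) \<le> 1 + 16/10000 * x" using x by linarith
      then show ?thesis using rho_bounds(3)[of k] by (simp only: mult.assoc) (simp add: mult_left_mono)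
    qed
    also have "\<dots> \<le> rho (Suc k)"
    proof -
      have r: "rho k = (2 - x) / 200" "rho (Suc k) = (2 - x / 2) / 200" by (simp_all add: rho_def x_def)
      have "0 \<le> x * x" by simp
      then have "(2 - x) * (1 + 16/10000 * x) \<le> 2 - x / 2" using x by (simp add: algebra_simps)
      then show ?thesis unfolding r by simp
    qed
    finally show "rho k * corr k * corr (Suc k) / rho (Suc k) \<le> 1" using rho_bounds(3)[of "Suc k"] by (simp add: divide_le_eq)
  qed simp
  finally show ?case by simp
next
  case (Suc i)
  define l where "l = k - Suc i"
  have l: "k - i = Suc l" "k = l + Suc i" using Suc.prems by (auto simp: l_def)
  let ?j = "Suc k + i"
  define x where "x = (1/2::real) ^ l"
  have x: "0 < x" "x \<le> 1" by (auto simp: x_def power_le_one)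
  have cl: "corr l / corr (Suc l) \<le> 1 + 24/10000 * x" "0 \<le> corr l / corr (Suc l)"
    using corr_ratio_bounds[of l] corr_bounds[of l] corr_bounds[of "Suc l"] by (auto simp: x_def)
  have cj: "1 - 24/10000 * x \<le> corr ?j / corr (Suc ?j)"
  proof -
    have "(1/2::real) ^ ?j \<le> x" unfolding x_def using l by (intro power_decreasing) auto
    then show ?thesis using corr_ratio[of ?j] by linarith
  qed
  have "node l / node (Suc l) \<le> node ?j / node (Suc ?j)"
  proof -
    have "rho l * rho (Suc l) * (corr l / corr (Suc l)) \<le> rho l * rho (Suc l) * (1 + 24/10000 * x)"
      using cl rho_bounds(3)[of l] rho_bounds(3)[of "Suc l"] by (intro mult_left_mono) auto
    also have "\<dots> \<le> rho (Suc (Suc l)) * (1 - 24/10000 * x) * rho (Suc l)"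
    proof -
      have "rho l * (1 + 24/10000 * x) \<le> rho (Suc (Suc l)) * (1 - 24/10000 * x)"
      proof -
        have r: "rho l = (2 - x) / 200" "rho (Suc (Suc l)) = (2 - x / 4) / 200" by (simp_all add: rho_def x_def)
        have "0 \<le> x * (3/4 - 96/10000) + 30/10000 * (x * x)" using x by (intro add_nonneg_nonneg) auto
        also have "\<dots> = (2 - x / 4) * (1 - 24/10000 * x) - (2 - x) * (1 + 24/10000 * x)"
          by (simp add: field_simps)
        finally have "(2 - x) * (1 + 24/10000 * x) \<le> (2 - x / 4) * (1 - 24/10000 * x)" by (simp only: diff_ge_0_iff_ge)
        then show ?thesis unfolding r by simp
      qed
      then show ?thesis using rho_bounds(3)[of "Suc l"] by (simp add: mult_ac mult_left_mono)
    qed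
    also have "\<dots> \<le> rho ?j * (corr ?j / corr (Suc ?j)) * rho (Suc ?j)"
    proof -
      have "0 \<le> 1 - 24/10000 * x" using x by simp
      moreover have "rho (Suc (Suc l)) \<le> rho ?j" "rho (Suc l) \<le> rho (Suc ?j)" using l by (auto intro!: rho_mono)
      ultimately show ?thesis using cj rho_bounds(3) less_imp_le
        by (intro mult_mono mult_nonneg_nonneg) (auto intro: order_trans)
    qed
    finally show ?thesis unfolding node_ratio by (simp add: mult_ac)
  qed
  then have "node l * node (Suc ?j) \<le> node ?j * node (Suc l)"
    using node_props(1)[of "Suc l"] node_props(1)[of "Suc ?j"] by (simp add: divide_simps mult_ac)
  then have "node (Suc ?j) * node l \<le> node (Suc k + i) * node (k - i)" by (simp add: l mult.commute)
  also have "\<dots> \<le> (pole (Suc k))\<^sup>2" using Suc by simp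
  finally show ?case by (simp add: l_def)
qed

text \<open>Pair each node below the pole with its mirror image above: by
  \<open>node_product_le\<close> the upper one contributes at least as much.\<close>

lemma eta_nonneg: "0 \<le> eta k"
proof (cases k)
  case 0
  then show ?thesis using eta_0 by simp
next
  case (Suc m)
  have "(\<Sum>j<k. arctan (dn k j)) = (\<Sum>i<k. arctan (dn k (m - i)))"
    by (rule sum.reindex_bij_witness[of _ "\<lambda>i. m - i" "\<lambda>i. m - i"]) (auto simp: Suc)
  also have "\<dots> \<le> (\<Sum>i<k. arctan (up k i))"
  proof (intro sum_mono)
    fix i assume "i \<in> {..<k}"
    then have "i \<le> m" by (simp add: Suc)
    from node_product_le[OF this] have "node (m - i) * node (k + i) \<le> pole k * pole k"
      by (simp add: Suc power2_eq_square mult.commute)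
    then show "arctan (dn k (m - i)) \<le> arctan (up k i)"
      unfolding arctan_le_iff dn_def up_def using pole_pos[of k] node_props(1)[of "k + i"] by (simp add: divide_simps)
  qed
  also have "\<dots> \<le> (\<Sum>i. arctan (up k i))"
    by (intro sum_le_suminf summable_up) (use up_pos less_imp_le in auto)
  finally show ?thesis by (simp add: eta_def)
qed

lemma eta_le: "eta k \<le> 3/100"
  using eta_antimono[of 0 k] eta_0 by simp

lemma arctan_pole_node_sums: "(\<lambda>j. arctan (pole k / node j)) sums (eta k / 2 + k * (pi / 2))"
proof -
  have 1: "(\<lambda>i. arctan (pole k / node (i + k))) sums (\<Sum>i. arctan (up k i))"
    using summable_sums[OF summable_up[of k]] by (simp add: up_def add.commute)
  have 2: "(\<Sum>j<k. arctan (pole k / node j)) = k * (pi / 2) - (\<Sum>j<k. arctan (dn k j))"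
  proof -
    have "arctan (pole k / node j) = pi / 2 - arctan (dn k j)" for j
      using arctan_inverse[of "dn k j"] dn_pos[of k j] by (simp add: dn_def)
    then show ?thesis by (simp add: sum_subtractf)
  qed
  have "(\<lambda>j. arctan (pole k / node j)) sums ((\<Sum>i. arctan (up k i)) + (\<Sum>j<k. arctan (pole k / node j)))"
    using 1 by (subst (asm) sums_iff_shift) (simp add: add.commute)
  moreover have "(\<Sum>i. arctan (up k i)) + (k * (pi / 2) - (\<Sum>j<k. arctan (dn k j))) = eta k / 2 + k * (pi / 2)"
    by (simp add: eta_def)
  ultimately show ?thesis unfolding 2 by (simp only:)
qed

text \<open>The terms at least double with the index while y j stays below x and at least halve
  afterwards.\<close>

lemma doubling_sum_bound:
  fixes y :: "nat \<Rightarrow> real"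
  assumes y: "\<And>n. 0 < y n" "\<And>n. 2 * y n \<le> y (Suc n)" and x: "0 < x"
  shows "(\<Sum>j<n. min (y j / x) (x / y j)) \<le> 4"
proof -
  \<comment> \<open>The strengthened bounds let the induction close: below x the last term controls
    the geometric sum, and above x the amount x / y n is kept in reserve for the later
    terms.\<close>
  have "(\<Sum>j<Suc n. min (y j / x) (x / y j)) \<le> (if y n \<le> x then 2 * y n / x else 4 - x / y n)" for n
  proof (induction n)
    case 0
    show ?case
    proof (cases "y 0 \<le> x")
      case True
      have "min (y 0 / x) (x / y 0) \<le> y 0 / x" by simp
      also have "\<dots> \<le> 2 * y 0 / x" using y(1)[of 0] x by (intro divide_right_mono) auto
      finally show ?thesis using True by simp
    next
      case False
      then have "x / y 0 \<le> 1" using y(1)[of 0] by simp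
      then show ?thesis using False by (simp add: min_def)
    qed
  next
    case (Suc n)
    have pos: "0 < y n" "0 < y (Suc n)" "2 * y n \<le> y (Suc n)" using y by auto
    show ?case
    proof (cases "y (Suc n) \<le> x")
      case True
      then have yn: "y n \<le> x" using pos by linarith
      have "2 * y n / x \<le> y (Suc n) / x" using pos x by (intro divide_right_mono) auto
      then show ?thesis using Suc yn True by (simp add: min_def)
    next
      case False
      then have s1: "x / y (Suc n) \<le> 1" using pos by simp
      show ?thesis
      proof (cases "y n \<le> x")
        case True
        then have "2 * y n / x \<le> 2" using x by (simp add: divide_le_eq)
        then show ?thesis using Suc True False s1 by (simp add: min_def)
      next
        case yn: False
        have "x / y (Suc n) \<le> x / (2 * y n)" using pos x by (intro divide_left_mono mult_pos_pos) auto
        then have "2 * (x / y (Suc n)) \<le> x / y n" by simp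
        then show ?thesis using Suc yn False by (simp add: min_def split: if_splits)
      qed
    qed
  qed
  moreover have "(if y m \<le> x then 2 * y m / x else 4 - x / y m) \<le> 4" for m
    using y(1)[of m] x by (auto simp: divide_le_eq)
  ultimately show ?thesis by (cases n) (auto intro: order_trans simp del: sum.lessThan_Suc)
qed

section \<open>Weierstrass data\<close>

text \<open>The poles k and -k sit at indices 2k and 2k + 1, so that \<open>sums_pairs\<close>
  groups symmetric sites.\<close>

definition site :: "nat \<Rightarrow> real" where
  "site i = (if even i then pole (i div 2) else - pole (i div 2))"

definition psign :: "nat \<Rightarrow> real" where
  "psign i = (if even i then (-1) ^ (i div 2) else - ((-1) ^ (i div 2)))"

definition sites :: "complex set" where "sites = range (\<lambda>i. of_real (site i))"

text \<open>At a site the singular term is 0 by the convention for division, so the series converges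
  for every z without exception.\<close>

definition csum :: "(nat \<Rightarrow> complex) \<Rightarrow> complex \<Rightarrow> complex" where
  "csum w z = (\<Sum>i. w i / (z - of_real (site i)))"

lemma abs_site: "\<bar>site i\<bar> = pole (i div 2)"
  using pole_pos[of "i div 2"] by (simp add: site_def)

lemma norm_psign: "\<bar>psign i\<bar> = 1"
  by (simp add: psign_def power_abs)

text \<open>Two sites share each modulus, so the growth per index is the square root of 10000; the
  extra factor 100 pays for odd indices.\<close>

lemma abs_site_ge: "(100::real) ^ i \<le> 100 * \<bar>site i\<bar>"
proof -
  have "i \<le> 2 * (i div 2) + 1" by simp
  then have "(100::real) ^ i \<le> 100 ^ (2 * (i div 2) + 1)" by (intro power_increasing) auto
  also have "\<dots> = 100 * 10000 ^ (i div 2)" by (simp add: power_mult)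
  also have "\<dots> \<le> 100 * \<bar>site i\<bar>" using pole_ge_power[of "i div 2"] by (simp add: abs_site)
  finally show ?thesis .
qed

lemma abs_site_ge_1: "1 \<le> \<bar>site i\<bar>"
  using pole_ge_1 by (simp add: abs_site)

lemma inverse_site_le: "1 / \<bar>site i\<bar> \<le> 100 * (1/100) ^ i"
  using abs_site_ge[of i] abs_site_ge_1[of i] by (simp add: power_divide divide_simps mult.commute)

lemma summable_inverse_site: "summable (\<lambda>i. 1 / \<bar>site i\<bar>)"
proof (rule summable_comparison_test')
  show "summable (\<lambda>i. 100 * (1/100::real) ^ i)" by (intro summable_mult summable_geometric) simp
  show "norm (1 / \<bar>site i\<bar>) \<le> 100 * (1/100) ^ i" if "i \<ge> 0" for i
    using inverse_site_le[of i] by simp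
qed

lemma eventually_site_ge: "eventually (\<lambda>i. R \<le> \<bar>site i\<bar>) sequentially"
proof -
  have "eventually (\<lambda>i. 1 / \<bar>site i\<bar> < 1 / (\<bar>R\<bar> + 1)) sequentially"
    using summable_LIMSEQ_zero[OF summable_inverse_site] by (rule order_tendstoD) simp
  then show ?thesis
  proof eventually_elim
    case (elim i)
    then have "\<bar>R\<bar> + 1 < \<bar>site i\<bar>" using abs_site_ge_1[of i] by (simp add: divide_simps split: if_splits)
    then show ?case by simp
  qed
qed

lemma inj_site: "inj site"
proof (rule injI)
  fix i j assume eq: "site i = site j"
  then have "pole (i div 2) = pole (j div 2)" using abs_site by metis
  then have d: "i div 2 = j div 2" using pole_strict_mono by (simp add: strict_mono_eq)
  moreover have "even i = even j" using eq d pole_pos[of "j div 2"] by (auto simp: site_def split: if_splits)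
  ultimately have "i mod 2 = j mod 2" by (simp add: mod2_eq_if)
  then show "i = j" using d by (metis div_mult_mod_eq)
qed

lemma infinite_sites: "infinite sites"
proof -
  have "inj (\<lambda>i. complex_of_real (site i))" using inj_site by (auto simp: inj_def)
  then show ?thesis unfolding sites_def using range_inj_infinite by blast
qed

lemma sites_locally_finite: "finite (sites \<inter> cball 0 R)"
proof -
  obtain n where n: "\<And>i. i \<ge> n \<Longrightarrow> R + 1 \<le> \<bar>site i\<bar>"
    using eventually_site_ge[of "R + 1"] unfolding eventually_sequentially by blast
  have "sites \<inter> cball 0 R \<subseteq> (\<lambda>i. of_real (site i)) ` {..<n}"
  proof
    fix z assume "z \<in> sites \<inter> cball 0 R"
    then obtain i where i: "z = of_real (site i)" "\<bar>site i\<bar> \<le> R" by (auto simp: sites_def)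
    then have "i < n" using n[of i] by (cases "i < n") auto
    then show "z \<in> (\<lambda>i. of_real (site i)) ` {..<n}" using i by blast
  qed
  then show ?thesis using finite_subset by blast
qed

interpretation sites: discrete_punctures sites
  by unfold_locales (rule infinite_sites sites_locally_finite)+

lemma closed_sites: "closed sites"
  by (rule sites.closed_subset_P) simp

lemma site_in_sites: "of_real (site i) \<in> sites"
  by (auto simp: sites_def)

lemma notin_sites: "z \<notin> sites \<Longrightarrow> z - of_real (site i) \<noteq> 0"
  using site_in_sites by (metis eq_iff_diff_eq_0)

lemma notin_sites_Im: "Im z \<noteq> 0 \<Longrightarrow> z \<notin> sites"
  by (auto simp: sites_def)

lemma sites_dist:
  assumes "z \<notin> sites"
  obtains d where "d > 0" "\<And>i. d \<le> cmod (z - of_real (site i))"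
proof -
  obtain d where d: "d > 0" "ball z d \<subseteq> - sites"
    using closed_sites assms open_contains_ball_eq[OF open_Compl[OF closed_sites]] by blast
  have "d \<le> cmod (z - of_real (site i))" for i
  proof (rule ccontr)
    assume "\<not> d \<le> cmod (z - of_real (site i))"
    then have "of_real (site i) \<in> ball z d" by (simp add: dist_norm)
    then show False using d site_in_sites by blast
  qed
  then show ?thesis using that d by blast
qed

lemma summable_inverse_dist: "summable (\<lambda>i. 1 / cmod (z - of_real (site i)))"
proof (rule summable_comparison_test_ev)
  show "summable (\<lambda>i. 2 * (1 / \<bar>site i\<bar>))" by (intro summable_mult summable_inverse_site)
  show "eventually (\<lambda>i. norm (1 / cmod (z - of_real (site i))) \<le> 2 * (1 / \<bar>site i\<bar>)) sequentially"
    using eventually_site_ge[of "2 * cmod z + 1"]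
  proof eventually_elim
    case (elim i)
    have "\<bar>site i\<bar> - cmod z \<le> cmod (z - of_real (site i))"
      using norm_triangle_ineq2[of "of_real (site i)" z] by (simp add: norm_minus_commute)
    then have "\<bar>site i\<bar> / 2 \<le> cmod (z - of_real (site i))" using elim by linarith
    then have "1 / cmod (z - of_real (site i)) \<le> 1 / (\<bar>site i\<bar> / 2)"
      using abs_site_ge_1[of i] by (intro divide_left_mono mult_pos_pos) auto
    then show ?case by simp
  qed
qed

lemma norm_div_sq: "cmod (- w / x\<^sup>2) = cmod w / (cmod x * cmod x)"
  by (simp add: norm_divide power2_eq_square norm_mult)

section \<open>Sums of simple fractions with bounded weights\<close>

locale weights =
  fixes w :: "nat \<Rightarrow> complex"
  assumes w_le: "cmod (w i) \<le> 1"
begin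

lemma summable_norm_csum: "summable (\<lambda>i. cmod (w i / (z - of_real (site i))))"
proof (rule summable_comparison_test'[OF summable_inverse_dist])
  show "norm (cmod (w i / (z - of_real (site i)))) \<le> 1 / cmod (z - of_real (site i))" if "i \<ge> 0" for i
    using w_le[of i] by (simp add: norm_divide divide_right_mono)
qed

lemma csum_sums: "(\<lambda>i. w i / (z - of_real (site i))) sums csum w z"
  unfolding csum_def by (rule summable_sums[OF summable_norm_cancel[OF summable_norm_csum]])

lemma half_dist:
  assumes d: "\<And>i. d \<le> cmod (z0 - of_real (site i))" and z: "z \<in> ball z0 (d / 2)"
  shows "cmod (z0 - of_real (site i)) / 2 \<le> cmod (z - of_real (site i))"
    and "z - of_real (site i) \<noteq> 0" and "cmod ((z - z0) / (z0 - of_real (site i))) < 1"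
proof -
  let ?r = "cmod (z0 - of_real (site i))"
  have zz: "cmod (z - z0) < d / 2" using z by (simp add: dist_norm norm_minus_commute)
  then have "0 < d" using norm_ge_zero[of "z - z0"] by linarith
  then have r: "?r > 0" "d \<le> ?r" using d[of i] by linarith+
  have "z0 - of_real (site i) = (z - of_real (site i)) - (z - z0)" by simp
  then have "?r \<le> cmod (z - of_real (site i)) + cmod (z - z0)" by (metis norm_triangle_ineq4)
  then show 1: "?r / 2 \<le> cmod (z - of_real (site i))" using zz r by linarith
  then show "z - of_real (site i) \<noteq> 0" using r by auto
  have "cmod (z - z0) < ?r" using zz r \<open>0 < d\<close> by linarith
  then show "cmod ((z - z0) / (z0 - of_real (site i))) < 1" using r by (simp add: norm_divide divide_less_eq)
qed

lemma uniform_csum: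
  assumes d: "0 < d" "\<And>i. d \<le> cmod (z0 - of_real (site i))"
  shows "uniform_limit (ball z0 (d / 2)) (\<lambda>n z. \<Sum>i<n. w i / (z - of_real (site i))) (csum w) sequentially"
  unfolding csum_def[abs_def]
proof (rule Weierstrass_m_test)
  show "summable (\<lambda>i. 2 * (1 / cmod (z0 - of_real (site i))))" by (intro summable_mult summable_inverse_dist)
  fix i z assume z: "z \<in> ball z0 (d / 2)"
  have r: "cmod (z0 - of_real (site i)) > 0" using d(1) d(2)[of i] by linarith
  have "cmod (w i / (z - of_real (site i))) \<le> 1 / (cmod (z0 - of_real (site i)) / 2)"
    unfolding norm_divide using w_le[of i] half_dist(1)[OF d(2) z, of i] r by (intro frac_le) auto
  then show "norm (w i / (z - of_real (site i))) \<le> 2 * (1 / cmod (z0 - of_real (site i)))" by simp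
qed

lemma uniform_csum_deriv:
  assumes d: "0 < d" "\<And>i. d \<le> cmod (z0 - of_real (site i))"
  shows "uniform_limit (ball z0 (d / 2)) (\<lambda>n z. \<Sum>i<n. - w i / (z - of_real (site i))\<^sup>2)
     (\<lambda>z. \<Sum>i. - w i / (z - of_real (site i))\<^sup>2) sequentially"
proof (rule Weierstrass_m_test)
  show "summable (\<lambda>i. 4 / d * (1 / cmod (z0 - of_real (site i))))" by (intro summable_mult summable_inverse_dist)
  fix i z assume z: "z \<in> ball z0 (d / 2)"
  let ?r = "cmod (z0 - of_real (site i))"
  have r: "?r > 0" using d(1) d(2)[of i] by linarith
  have "(d / 2) * (?r / 2) \<le> cmod (z - of_real (site i)) * cmod (z - of_real (site i))"
    using half_dist(1)[OF d(2) z, of i] d(1) d(2)[of i] r by (intro mult_mono) auto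
  then have "cmod (- w i / (z - of_real (site i))\<^sup>2) \<le> 1 / ((d / 2) * (?r / 2))"
    unfolding norm_div_sq using w_le[of i] r d(1) by (intro frac_le) auto
  then show "norm (- w i / (z - of_real (site i))\<^sup>2) \<le> 4 / d * (1 / ?r)" by (simp add: mult.commute)
qed

text \<open>A primitive of \<open>csum w\<close> near z0 that vanishes at z0. Writing (z - b) / (z0
  - b) as 1 plus a number of modulus below 1 keeps every logarithm in its principal branch.\<close>

definition logsum :: "complex \<Rightarrow> complex \<Rightarrow> complex" where
  "logsum z0 z = (\<Sum>i. w i * Ln (1 + (z - z0) / (z0 - of_real (site i))))"

lemma logsum_props:
  assumes d: "0 < d" "\<And>i. d \<le> cmod (z0 - of_real (site i))" and z: "z \<in> ball z0 (d / 2)"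
  shows "(\<lambda>i. w i * Ln (1 + (z - z0) / (z0 - of_real (site i)))) sums logsum z0 z"
    and "(logsum z0 has_field_derivative csum w z) (at z)"
proof -
  let ?f = "\<lambda>i z. w i * Ln (1 + (z - z0) / (z0 - of_real (site i)))"
  have df: "(?f i has_field_derivative w i / (z - of_real (site i))) (at z within ball z0 (d / 2))"
    if z: "z \<in> ball z0 (d / 2)" for i z
  proof -
    have r: "z0 - of_real (site i) \<noteq> 0" using d(1) d(2)[of i] by auto
    have "1 + (z - z0) / (z0 - of_real (site i)) \<notin> \<real>\<^sub>\<le>\<^sub>0"
    proof
      assume "1 + (z - z0) / (z0 - of_real (site i)) \<in> \<real>\<^sub>\<le>\<^sub>0"
      then have "Re ((z - z0) / (z0 - of_real (site i))) \<le> - 1" by (simp add: complex_nonpos_Reals_iff)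
      then have "1 \<le> cmod ((z - z0) / (z0 - of_real (site i)))" using abs_Re_le_cmod[of "(z - z0) / (z0 - of_real (site i))"] by linarith
      then show False using half_dist(3)[OF d(2) z, of i] by simp
    qed
    moreover have dg: "((\<lambda>z. 1 + (z - z0) / (z0 - of_real (site i))) has_field_derivative 1 / (z0 - of_real (site i))) (at z within ball z0 (d / 2))"
      using r by (auto intro!: derivative_eq_intros)
    ultimately have A: "(?f i has_field_derivative w i * (inverse (1 + (z - z0) / (z0 - of_real (site i))) * (1 / (z0 - of_real (site i))))) (at z within ball z0 (d / 2))"
      by (intro DERIV_cmult DERIV_chain2[OF has_field_derivative_Ln dg])
    have B: "1 + (z - z0) / (z0 - of_real (site i)) = (z - of_real (site i)) / (z0 - of_real (site i))"
      using r by (simp add: field_simps)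
    have C: "w i * (inverse ((z - of_real (site i)) / (z0 - of_real (site i))) * (1 / (z0 - of_real (site i)))) = w i / (z - of_real (site i))"
      using r by simp
    show ?thesis using A unfolding B C .
  qed
  have z0: "z0 \<in> ball z0 (d / 2)" using d by simp
  obtain g where g: "\<And>z. z \<in> ball z0 (d / 2) \<Longrightarrow> (\<lambda>i. ?f i z) sums g z \<and> (g has_field_derivative csum w z) (at z within ball z0 (d / 2))"
  proof -
    have "summable (\<lambda>i. ?f i z0)" by simp
    then show ?thesis using that has_field_derivative_series[OF convex_ball df uniform_csum[OF d] z0] by blast
  qed
  have eq: "g z = logsum z0 z" if "z \<in> ball z0 (d / 2)" for z using g[OF that] by (simp add: logsum_def sums_iff)
  then show "(\<lambda>i. ?f i z) sums logsum z0 z" using g[OF z] z by simp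
  have "(g has_field_derivative csum w z) (at z)" using g[OF z] at_within_open[OF z open_ball] by simp
  then show "(logsum z0 has_field_derivative csum w z) (at z)"
    using eq z by (subst DERIV_cong_ev[OF refl _ refl]) (auto intro!: eventually_mono[OF eventually_nhds_in_open[OF open_ball z]])
qed

lemma csum_deriv:
  assumes "z0 \<notin> sites"
  shows "(\<lambda>i. - w i / (z0 - of_real (site i))\<^sup>2) sums deriv (csum w) z0"
    and "csum w field_differentiable at z0"
proof -
  obtain d where d: "d > 0" "\<And>i. d \<le> cmod (z0 - of_real (site i))" using sites_dist[OF assms] by blast
  have z0: "z0 \<in> ball z0 (d / 2)" using d by simp
  have df: "((\<lambda>z. w i / (z - of_real (site i))) has_field_derivative - w i / (z - of_real (site i))\<^sup>2) (at z within ball z0 (d / 2))"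
    if z: "z \<in> ball z0 (d / 2)" for i z
    using half_dist(2)[OF d(2) z, of i] by (auto intro!: derivative_eq_intros simp: power2_eq_square)
  obtain g where g: "\<And>z. z \<in> ball z0 (d / 2) \<Longrightarrow> (\<lambda>i. w i / (z - of_real (site i))) sums g z \<and>
      (g has_field_derivative (\<Sum>i. - w i / (z - of_real (site i))\<^sup>2)) (at z within ball z0 (d / 2))"
    using has_field_derivative_series[OF convex_ball df uniform_csum_deriv[OF d] z0 sums_summable[OF csum_sums]] by blast
  have eq: "g z = csum w z" if "z \<in> ball z0 (d / 2)" for z using g[OF that] csum_sums[of z] sums_unique2 by blast
  have "(g has_field_derivative (\<Sum>i. - w i / (z0 - of_real (site i))\<^sup>2)) (at z0)"
    using g[OF z0] at_within_open[OF z0 open_ball] by simp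
  then have der: "(csum w has_field_derivative (\<Sum>i. - w i / (z0 - of_real (site i))\<^sup>2)) (at z0)"
    using eq z0 by (subst DERIV_cong_ev[OF refl _ refl, of _ g]) (auto intro!: eventually_mono[OF eventually_nhds_in_open[OF open_ball z0]])
  then show "csum w field_differentiable at z0" by (auto simp: field_differentiable_def)
  have "summable (\<lambda>i. - w i / (z0 - of_real (site i))\<^sup>2)"
  proof (rule summable_comparison_test')
    show "summable (\<lambda>i. 1 / d * (1 / cmod (z0 - of_real (site i))))" by (intro summable_mult summable_inverse_dist)
    fix i :: nat
    let ?r = "cmod (z0 - of_real (site i))"
    have r: "?r > 0" using d(1) d(2)[of i] by linarith
    have "d * ?r \<le> ?r * ?r" using d(2)[of i] r by (intro mult_right_mono) auto
    then have "cmod (- w i / (z0 - of_real (site i))\<^sup>2) \<le> 1 / (d * ?r)"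
      unfolding norm_div_sq using w_le[of i] r d(1) by (intro frac_le) auto
    then show "norm (- w i / (z0 - of_real (site i))\<^sup>2) \<le> 1 / d * (1 / ?r)" by simp
  qed
  then show "(\<lambda>i. - w i / (z0 - of_real (site i))\<^sup>2) sums deriv (csum w) z0"
    using der by (simp add: DERIV_imp_deriv summable_sums)
qed

end

lemma weights_cnj: "weights w \<Longrightarrow> weights (\<lambda>i. cnj (w i))"
  by (simp add: weights_def)

lemma csum_cnj:
  assumes "weights w"
  shows "csum (\<lambda>i. cnj (w i)) (cnj z) = cnj (csum w z)"
proof -
  have "(\<lambda>i. cnj (w i / (z - of_real (site i)))) sums cnj (csum w z)"
    using weights.csum_sums[OF assms] by (simp only: sums_cnj)
  then have "(\<lambda>i. cnj (w i) / (cnj z - of_real (site i))) sums cnj (csum w z)" by simp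
  then show ?thesis using weights.csum_sums[OF weights_cnj[OF assms], of "cnj z"] sums_unique2 by blast
qed

lemma tannery:
  fixes f :: "nat \<Rightarrow> nat \<Rightarrow> complex"
  assumes lim: "\<And>i. (\<lambda>N. f N i) \<longlonglongrightarrow> l i" and bd: "\<And>N i. cmod (f N i) \<le> M i" and M: "summable M"
  shows "(\<lambda>N. \<Sum>i. f N i) \<longlonglongrightarrow> (\<Sum>i. l i)"
proof (rule swap_uniform_limit'[where F = sequentially and S = UNIV])
  show "uniform_limit UNIV (\<lambda>n N. \<Sum>i<n. f N i) (\<lambda>N. \<Sum>i. f N i) sequentially"
    by (rule Weierstrass_m_test[OF _ M]) (use bd in auto)
  show "\<forall>\<^sub>F n in sequentially. (\<lambda>N. \<Sum>i<n. f N i) \<longlonglongrightarrow> (\<Sum>i<n. l i)"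
    by (intro always_eventually allI tendsto_sum lim)
  have "cmod (l i) \<le> M i" for i using lim bd by (intro Lim_norm_ubound[OF _ lim]) auto
  then have "summable l" using M by (intro summable_comparison_test'[OF M]) auto
  then show "(\<lambda>n. \<Sum>i<n. l i) \<longlonglongrightarrow> (\<Sum>i. l i)" by (rule summable_LIMSEQ)
qed auto

lemma csum_tendsto:
  assumes "\<And>N. weights (w N)" "\<And>i. (\<lambda>N. w N i) \<longlonglongrightarrow> l i"
  shows "(\<lambda>N. csum (w N) z) \<longlonglongrightarrow> csum l z"
  unfolding csum_def
proof (rule tannery[OF _ _ summable_inverse_dist])
  show "(\<lambda>N. w N i / (z - of_real (site i))) \<longlonglongrightarrow> l i / (z - of_real (site i))" for i
  proof (cases "z - of_real (site i) = 0")
    case False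
    then show ?thesis by (intro tendsto_divide assms tendsto_const)
  qed simp
  show "cmod (w N i / (z - of_real (site i))) \<le> 1 / cmod (z - of_real (site i))" for N i
    using weights.w_le[OF assms(1)] by (simp add: norm_divide divide_right_mono)
qed

lemma csum_deriv_tendsto:
  assumes w: "\<And>N. weights (w N)" "weights l" "\<And>i. (\<lambda>N. w N i) \<longlonglongrightarrow> l i" and z: "z \<notin> sites"
  shows "(\<lambda>N. deriv (csum (w N)) z) \<longlonglongrightarrow> deriv (csum l) z"
proof -
  obtain d where d: "d > 0" "\<And>i. d \<le> cmod (z - of_real (site i))" using sites_dist[OF z] by blast
  have "(\<lambda>N. \<Sum>i. - w N i / (z - of_real (site i))\<^sup>2) \<longlonglongrightarrow> (\<Sum>i. - l i / (z - of_real (site i))\<^sup>2)"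
  proof (rule tannery)
    show "(\<lambda>N. - w N i / (z - of_real (site i))\<^sup>2) \<longlonglongrightarrow> - l i / (z - of_real (site i))\<^sup>2" for i
      using notin_sites[OF z, of i] by (intro tendsto_divide tendsto_minus assms tendsto_const) auto
    show "summable (\<lambda>i. 1 / d * (1 / cmod (z - of_real (site i))))" by (intro summable_mult summable_inverse_dist)
    fix N i
    let ?r = "cmod (z - of_real (site i))"
    have r: "?r > 0" using d(1) d(2)[of i] by linarith
    have "d * ?r \<le> ?r * ?r" using d(2)[of i] r by (intro mult_right_mono) auto
    then have "cmod (- w N i / (z - of_real (site i))\<^sup>2) \<le> 1 / (d * ?r)"
      unfolding norm_div_sq using weights.w_le[OF w(1)] r d(1) by (intro frac_le) auto
    then show "cmod (- w N i / (z - of_real (site i))\<^sup>2) \<le> 1 / d * (1 / ?r)" by simp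
  qed
  then show ?thesis
    using weights.csum_deriv(1)[OF w(1) z, THEN sums_unique] weights.csum_deriv(1)[OF w(2) z, THEN sums_unique] by simp
qed

section \<open>The function \<open>chi\<close> and multiplication by Blaschke factors\<close>

definition chi :: "complex \<Rightarrow> complex" where "chi = csum (\<lambda>i. of_real (psign i))"

lemma weights_psign: "weights (\<lambda>i. of_real (psign i))"
  by (simp add: weights_def norm_psign)

lemma chi_cnj: "chi (cnj z) = cnj (chi z)"
  using csum_cnj[OF weights_psign, of z] by (simp add: chi_def)

lemma sums_pairs:
  fixes f :: "nat \<Rightarrow> 'a::real_normed_vector"
  assumes "f sums s"
  shows "(\<lambda>k. f (2 * k) + f (2 * k + 1)) sums s"
proof -
  have "(\<lambda>k. sum f {k * 2..<k * 2 + 2}) sums s" using sums_group[OF assms, of 2] by simp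
  moreover have "sum f {k * 2..<k * 2 + 2} = f (2 * k) + f (2 * k + 1)" for k
  proof -
    have "{k * 2..<k * 2 + 2} = {2 * k, 2 * k + 1}" by auto
    then show ?thesis by simp
  qed
  ultimately show ?thesis by simp
qed

lemma site_even [simp]: "site (2 * k) = pole k" and site_odd [simp]: "site (2 * k + 1) = - pole k" "site (Suc (2 * k)) = - pole k"
  by (auto simp: site_def)

lemma psign_even [simp]: "psign (2 * k) = (-1) ^ k" and psign_odd [simp]: "psign (2 * k + 1) = - ((-1) ^ k)" "psign (Suc (2 * k)) = - ((-1) ^ k)"
  by (auto simp: psign_def)

lemma pole_in_sites: "of_real (pole k) \<in> sites" "- of_real (pole k) \<in> sites"
  using site_in_sites[of "2 * k"] site_in_sites[of "2 * k + 1"] by auto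

lemma chi_pairs:
  assumes "z \<notin> sites"
  shows "(\<lambda>k. (-1) ^ k * (2 * of_real (pole k) / (z\<^sup>2 - (of_real (pole k))\<^sup>2))) sums chi z"
proof -
  have nz: "z - of_real (pole k) \<noteq> 0" "z + of_real (pole k) \<noteq> 0" for k
    using assms pole_in_sites[of k] by (auto simp: add_eq_0_iff)
  have "(\<lambda>k. (-1) ^ k / (z - of_real (pole k)) + - ((-1) ^ k) / (z + of_real (pole k))) sums chi z"
    using sums_pairs[OF weights.csum_sums[OF weights_psign, of z]] by (simp add: chi_def)
  moreover have "(-1) ^ k / (z - of_real (pole k)) + - ((-1) ^ k) / (z + of_real (pole k)) = (-1) ^ k * (2 * of_real (pole k) / (z\<^sup>2 - (of_real (pole k))\<^sup>2))" for k
  proof -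
    have "(1::complex) / (z - of_real (pole k)) - 1 / (z + of_real (pole k)) = 2 * of_real (pole k) / ((z - of_real (pole k)) * (z + of_real (pole k)))"
      using nz[of k] by (subst diff_frac_eq) (auto simp: algebra_simps)
    moreover have "(z - of_real (pole k)) * (z + of_real (pole k)) = z\<^sup>2 - (of_real (pole k))\<^sup>2"
      by (simp add: power2_eq_square algebra_simps)
    moreover have "(-1) ^ k / (z - of_real (pole k)) + - ((-1) ^ k) / (z + of_real (pole k))
       = (-1) ^ k * (1 / (z - of_real (pole k)) - 1 / (z + of_real (pole k)))" by (simp add: right_diff_distrib)
    ultimately show ?thesis by simp
  qed
  ultimately show ?thesis by simp
qed

lemma chi_node: "chi (\<i> * of_real (node j)) = 0" "chi (- \<i> * of_real (node j)) = 0"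
proof -
  have nz: "z \<notin> sites" if "z = \<i> * of_real (node j) \<or> z = - \<i> * of_real (node j)" for z
    using that node_props(1)[of j] by (intro notin_sites_Im) auto
  have "chi z = 0" if z: "z = \<i> * of_real (node j) \<or> z = - \<i> * of_real (node j)" for z
  proof -
    have z2: "z\<^sup>2 = of_real (- ((node j)\<^sup>2))" using z by (auto simp: power_mult_distrib)
    have "(\<lambda>k. complex_of_real ((-1) ^ k * (pole k / ((node j)\<^sup>2 + (pole k)\<^sup>2)))) sums of_real (alt ((node j)\<^sup>2))"
      unfolding alt_def by (intro sums_of_real summable_sums summable_alt) simp
    then have A: "(\<lambda>k. - 2 * complex_of_real ((-1) ^ k * (pole k / ((node j)\<^sup>2 + (pole k)\<^sup>2)))) sums (- 2 * of_real (alt ((node j)\<^sup>2)))"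
      by (rule sums_mult)
    have B: "- 2 * complex_of_real ((-1) ^ k * (pole k / ((node j)\<^sup>2 + (pole k)\<^sup>2))) = (-1) ^ k * (2 * of_real (pole k) / (z\<^sup>2 - (of_real (pole k))\<^sup>2))" for k
    proof -
      have "z\<^sup>2 - (of_real (pole k))\<^sup>2 = - complex_of_real ((node j)\<^sup>2 + (pole k)\<^sup>2)" unfolding z2 by simp
      then show ?thesis by (simp only: divide_minus_right) simp
    qed
    have "(\<lambda>k. (-1) ^ k * (2 * of_real (pole k) / (z\<^sup>2 - (of_real (pole k))\<^sup>2))) sums (- 2 * of_real (alt ((node j)\<^sup>2)))"
      using A unfolding B .
    then have "chi z = - 2 * of_real (alt ((node j)\<^sup>2))" using chi_pairs[OF nz[OF z]] sums_unique2 by blast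
    then show ?thesis using node_props(2)[of j] by simp
  qed
  then show "chi (\<i> * of_real (node j)) = 0" "chi (- \<i> * of_real (node j)) = 0" by auto
qed

text \<open>Multiplying a sum of simple fractions by a Blaschke factor whose pole is a zero of the sum
  again gives a sum of simple fractions; the partial fraction expansion of the product needs no estimates.\<close>

definition beta :: "real \<Rightarrow> complex \<Rightarrow> complex" where
  "beta t z = (of_real t + \<i> * z) / (of_real t - \<i> * z)"

lemma csum_blaschke:
  assumes w: "weights w" and w': "weights (\<lambda>i. w i * beta t (of_real (site i)))" and t: "t > 0"
    and zero: "csum w (- \<i> * of_real t) = 0" and z: "z \<notin> sites"
  shows "csum (\<lambda>i. w i * beta t (of_real (site i))) z * (of_real t - \<i> * z) = csum w z * (of_real t + \<i> * z)"
proof -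
  let ?b = "\<lambda>i. complex_of_real (site i)"
  have nz: "of_real t - \<i> * ?b i \<noteq> 0" for i using t by (auto simp: complex_eq_iff)
  have "(\<lambda>i. (w i * beta t (?b i)) / (z - ?b i) * (of_real t - \<i> * z)) sums (csum (\<lambda>i. w i * beta t (?b i)) z * (of_real t - \<i> * z))"
    by (intro sums_mult2 weights.csum_sums w')
  moreover have "(\<lambda>i. w i / (z - ?b i) * (of_real t + \<i> * z)) sums (csum w z * (of_real t + \<i> * z))"
    by (intro sums_mult2 weights.csum_sums w)
  \<comment> \<open>This series has sum 0 because -i t is a zero of \<open>csum w\<close>.
    Subtracting it makes the difference of the two sides vanish term by term, so no residue argument
    is necessary.\<close>
  moreover have "(\<lambda>i. - 2 * of_real t * (w i / (- \<i> * of_real t - ?b i))) sums (- 2 * of_real t * 0)"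
    using sums_mult[OF weights.csum_sums[OF w, of "- \<i> * of_real t"], of "- 2 * of_real t"] unfolding zero .
  ultimately have S: "(\<lambda>i. w i * beta t (?b i) / (z - ?b i) * (of_real t - \<i> * z) - w i / (z - ?b i) * (of_real t + \<i> * z)
        - - 2 * of_real t * (w i / (- \<i> * of_real t - ?b i)))
     sums (csum (\<lambda>i. w i * beta t (?b i)) z * (of_real t - \<i> * z) - csum w z * (of_real t + \<i> * z) - (- 2 * of_real t * 0))"
    by (intro sums_diff)
  have frac: "v * (a / c) / x * y - v / x * t = v / x * ((a * y - t * c) / c)" if "c \<noteq> 0" "x \<noteq> 0" for v a c x y t :: complex
    using that by (simp add: field_simps)
  have "w i * beta t (?b i) / (z - ?b i) * (of_real t - \<i> * z) - w i / (z - ?b i) * (of_real t + \<i> * z)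
        - - 2 * of_real t * (w i / (- \<i> * of_real t - ?b i)) = 0" for i
  proof -
    let ?c = "of_real t - \<i> * ?b i"
    have zb: "z - ?b i \<noteq> 0" using notin_sites[OF z] .
    have c: "- \<i> * of_real t - ?b i = - \<i> * ?c" by (simp add: algebra_simps)
    have num: "(of_real t + \<i> * ?b i) * (of_real t - \<i> * z) - (of_real t + \<i> * z) * ?c = - 2 * \<i> * of_real t * (z - ?b i)"
      by (simp add: algebra_simps)
    have "w i * beta t (?b i) / (z - ?b i) * (of_real t - \<i> * z) - w i / (z - ?b i) * (of_real t + \<i> * z)
       = w i / (z - ?b i) * (((of_real t + \<i> * ?b i) * (of_real t - \<i> * z) - (of_real t + \<i> * z) * ?c) / ?c)"
      unfolding beta_def by (rule frac[OF nz[of i] zb])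
    also have "\<dots> = - 2 * \<i> * of_real t * w i / ?c" unfolding num using zb by simp
    also have "\<dots> = - 2 * of_real t * (w i / (- \<i> * of_real t - ?b i))"
    proof -
      have "v / (- \<i> * c) = \<i> * (v / c)" if "c \<noteq> 0" for v c :: complex using that by (simp add: field_simps)
      from this[OF nz[of i]] show ?thesis unfolding c by (simp only: mult_ac times_divide_eq_right)
    qed
    finally show ?thesis by simp
  qed
  note Z = this
  have "csum (\<lambda>i. w i * beta t (?b i)) z * (of_real t - \<i> * z) - csum w z * (of_real t + \<i> * z) - (- 2 * of_real t * 0) = 0"
    using S unfolding Z by (rule sums_unique2[OF _ sums_zero])
  then show ?thesis by simp
qed

lemma norm_beta_real [simp]: "t > 0 \<Longrightarrow> cmod (beta t (of_real x)) = 1"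
proof -
  assume "t > 0"
  have e: "of_real t - \<i> * complex_of_real x = cnj (of_real t + \<i> * of_real x)" by simp
  have "of_real t + \<i> * complex_of_real x \<noteq> 0" using \<open>t > 0\<close> by (auto simp: complex_eq_iff)
  then show ?thesis unfolding beta_def e norm_divide by (simp only: complex_mod_cnj) simp
qed

lemma beta_real_cis: "t > 0 \<Longrightarrow> beta t (of_real x) = cis (2 * arctan (x / t))"
proof -
  assume t: "t > 0"
  define y where "y = x / t"
  have pos: "1 + y\<^sup>2 > 0" by (simp add: add_pos_nonneg)
  have "beta t (of_real x) = (1 + \<i> * of_real y) / (1 - \<i> * of_real y)"
    using t by (simp add: beta_def y_def field_simps)
  also have "\<dots> = (1 + \<i> * of_real y)\<^sup>2 / of_real (1 + y\<^sup>2)"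
  proof -
    have "1 - \<i> * of_real y \<noteq> 0" "1 + \<i> * of_real y \<noteq> 0" by (auto simp: complex_eq_iff)
    moreover have "complex_of_real (1 + y\<^sup>2) = (1 + \<i> * of_real y) * (1 - \<i> * of_real y)"
      by (simp add: algebra_simps power2_eq_square)
    ultimately show ?thesis by (simp add: power2_eq_square)
  qed
  also have "\<dots> = (cis (arctan y))\<^sup>2"
  proof -
    have "cis (arctan y) = (1 + \<i> * of_real y) / of_real (sqrt (1 + y\<^sup>2))"
      by (simp add: complex_eq_iff cos_arctan sin_arctan)
    moreover have "(complex_of_real (sqrt (1 + y\<^sup>2)))\<^sup>2 = of_real (1 + y\<^sup>2)"
      using pos by (simp only: of_real_power[symmetric] real_sqrt_pow2 less_imp_le)
    ultimately show ?thesis by (simp add: power_divide)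
  qed
  also have "\<dots> = cis (2 * arctan y)" by (simp add: power2_eq_square cis_mult)
  finally show ?thesis by (simp add: y_def)
qed

section \<open>The weights as limits of Blaschke values\<close>

definition wapx :: "nat \<Rightarrow> nat \<Rightarrow> complex" where
  "wapx N i = of_real (psign i) * (\<Prod>j<N. beta (node j) (of_real (site i)))"

text \<open>The sign (-1)^k of \<open>psign\<close> cancels the k half turns of the Blaschke
  argument. What remains points nearly along the positive axis at the positive poles and along the
  negative axis at the negative ones, with nonnegative imaginary part throughout.\<close>

definition wlim :: "nat \<Rightarrow> complex" where
  "wlim i = (if even i then cis (eta (i div 2)) else - cis (- eta (i div 2)))"

lemma norm_wapx: "cmod (wapx N i) = 1"
  by (simp add: wapx_def norm_mult norm_psign prod_norm[symmetric] node_props)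

lemma weights_wapx: "weights (wapx N)" and weights_wlim: "weights wlim"
  by (auto simp: weights_def norm_wapx wlim_def)

lemma wapx_tendsto: "(\<lambda>N. wapx N i) \<longlonglongrightarrow> wlim i"
proof -
  define k where "k = i div 2"
  define s :: real where "s = (if even i then 1 else - 1)"
  have site: "site i = s * pole k" by (simp add: site_def s_def k_def)
  have psign: "psign i = s * (-1) ^ k" by (simp add: psign_def s_def k_def)
  have w: "wapx N i = of_real (psign i) * cis (2 * s * (\<Sum>j<N. arctan (pole k / node j)))" for N
  proof -
    have "(\<Prod>j<N. beta (node j) (of_real (site i))) = (\<Prod>j<N. cis (2 * s * arctan (pole k / node j)))"
      using node_props(1) by (intro prod.cong refl) (simp only: beta_real_cis, simp add: site s_def arctan_minus)
    also have "\<dots> = cis (\<Sum>j<N. 2 * s * arctan (pole k / node j))" by (induction N) (auto simp: cis_mult add.commute)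
    finally show ?thesis by (simp add: wapx_def sum_distrib_left)
  qed
  have "(\<lambda>N. of_real (psign i) * cis (2 * s * (\<Sum>j<N. arctan (pole k / node j)))) \<longlonglongrightarrow> of_real (psign i) * cis (2 * s * (eta k / 2 + k * (pi / 2)))"
    using arctan_pole_node_sums[of k] unfolding sums_def
    by (intro tendsto_mult tendsto_const continuous_on_tendsto_compose[OF continuous_on_cis[OF continuous_on_id, of UNIV]]) auto
  moreover have "of_real (psign i) * cis (2 * s * (eta k / 2 + k * (pi / 2))) = wlim i"
  proof -
    have "cis (2 * s * (eta k / 2 + k * (pi / 2))) = cis (s * eta k) * cis (real k * (s * pi))"
      by (simp add: cis_mult algebra_simps)
    also have "cis (real k * (s * pi)) = (cis (s * pi)) ^ k" by (simp only: Complex.DeMoivre)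
    also have "cis (s * pi) = - 1" by (simp add: s_def complex_eq_iff)
    finally have "of_real (psign i) * cis (2 * s * (eta k / 2 + k * (pi / 2))) = of_real s * ((-1) ^ k * (-1) ^ k) * cis (s * eta k)"
      by (simp add: psign)
    also have "(-1) ^ k * (-1) ^ k = (1::complex)" by (simp add: power_add[symmetric] mult_2[symmetric])
    finally show ?thesis by (simp add: wlim_def s_def k_def)
  qed
  ultimately show ?thesis unfolding w by simp
qed

definition numer :: "nat \<Rightarrow> complex \<Rightarrow> complex" where "numer N z = (\<Prod>j<N. of_real (node j) + \<i> * z)"
definition denom :: "nat \<Rightarrow> complex \<Rightarrow> complex" where "denom N z = (\<Prod>j<N. of_real (node j) - \<i> * z)"

text \<open>Kept in multiplied form, the identity can be evaluated at -i \<open>node N\<close>: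
  there \<open>chi\<close> vanishes and the earlier denominators do not, since the nodes are
  distinct. This yields the zero that the next Blaschke factor requires.\<close>

lemma csum_wapx: "z \<notin> sites \<Longrightarrow> csum (wapx N) z * denom N z = chi z * numer N z"
proof (induction N arbitrary: z)
  case 0
  have "wapx 0 = (\<lambda>i. of_real (psign i))" by (auto simp: wapx_def)
  then show ?case by (simp add: chi_def numer_def denom_def)
next
  case (Suc N)
  let ?t = "node N"
  have w: "wapx (Suc N) = (\<lambda>i. wapx N i * beta ?t (of_real (site i)))" by (auto simp: wapx_def)
  have "- \<i> * of_real ?t \<notin> sites" using node_props(1)[of N] by (intro notin_sites_Im) simp
  then have "csum (wapx N) (- \<i> * of_real ?t) * denom N (- \<i> * of_real ?t) = 0"
    using Suc.IH chi_node by simp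
  moreover have "denom N (- \<i> * of_real ?t) \<noteq> 0"
  proof -
    have "of_real (node j) - \<i> * (- \<i> * of_real ?t) = complex_of_real (node j - ?t)" for j by simp
    moreover have "node j \<noteq> ?t" if "j < N" for j using node_strict_mono that by (metis less_irrefl strict_mono_eq)
    ultimately show ?thesis unfolding denom_def by (auto simp del: of_real_diff)
  qed
  ultimately have "csum (wapx N) (- \<i> * of_real ?t) = 0" by simp
  then have "csum (wapx (Suc N)) z * (of_real ?t - \<i> * z) = csum (wapx N) z * (of_real ?t + \<i> * z)"
    unfolding w using csum_blaschke[OF weights_wapx[of N] _ node_props(1)[of N] _ Suc.prems] weights_wapx[of "Suc N"] unfolding w by blast
  moreover have "denom (Suc N) z = denom N z * (of_real ?t - \<i> * z)" "numer (Suc N) z = numer N z * (of_real ?t + \<i> * z)"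
    by (simp_all add: denom_def numer_def)
  ultimately have "csum (wapx (Suc N)) z * denom (Suc N) z = (csum (wapx N) z * denom N z) * (of_real ?t + \<i> * z)"
    by (simp add: mult_ac)
  also have "\<dots> = chi z * numer (Suc N) z" using Suc.IH[OF Suc.prems] by (simp add: numer_def mult_ac)
  finally show ?case .
qed

definition Phi :: "complex \<Rightarrow> complex" where "Phi = csum wlim"
definition Psi :: "complex \<Rightarrow> complex" where "Psi = csum (\<lambda>i. cnj (wlim i))"
definition Phia :: "nat \<Rightarrow> complex \<Rightarrow> complex" where "Phia N = csum (wapx N)"
definition Psia :: "nat \<Rightarrow> complex \<Rightarrow> complex" where "Psia N = csum (\<lambda>i. cnj (wapx N i))"

lemma Psi_cnj: "Psi (cnj z) = cnj (Phi z)" "Phi (cnj z) = cnj (Psi z)"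
proof -
  show 1: "Psi (cnj z) = cnj (Phi z)" for z using csum_cnj[OF weights_wlim, of z] by (simp add: Psi_def Phi_def)
  show "Phi (cnj z) = cnj (Psi z)" using 1[of "cnj z"] by simp
qed

lemma sites_cnj: "cnj z \<in> sites \<longleftrightarrow> z \<in> sites"
  by (auto simp: sites_def complex_eq_iff)

text \<open>Conjugation exchanges the zeros and the poles of the Blaschke product, so this is the
  conjugate of \<open>csum_wapx\<close>.\<close>

lemma Psia_numer: "z \<notin> sites \<Longrightarrow> Psia N z * numer N z = chi z * denom N z"
proof -
  assume "z \<notin> sites"
  then have "csum (wapx N) (cnj z) * denom N (cnj z) = chi (cnj z) * numer N (cnj z)"
    by (intro csum_wapx) (simp add: sites_cnj)
  moreover have "denom N (cnj z) = cnj (numer N z)" "numer N (cnj z) = cnj (denom N z)"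
    by (simp_all add: numer_def denom_def)
  moreover have "csum (wapx N) (cnj z) = cnj (Psia N z)"
    using csum_cnj[OF weights_wapx[of N], of "cnj z"] by (simp add: Psia_def)
  ultimately have "cnj (Psia N z * numer N z) = cnj (chi z * denom N z)" by (simp add: chi_cnj)
  then show ?thesis by (simp only: complex_cnj_cancel_iff)
qed

definition gapx :: "nat \<Rightarrow> complex \<Rightarrow> complex" where "gapx N z = (\<Prod>j<N. beta (node j) z)"

lemma denom_nonzero: "0 \<le> Im z \<Longrightarrow> t > 0 \<Longrightarrow> of_real t - \<i> * z \<noteq> 0"
  by (auto simp: complex_eq_iff)

lemma gapx_eq: "gapx N z = numer N z / denom N z"
  by (simp add: gapx_def beta_def numer_def denom_def prod_dividef)

lemma denom_neq_0: "(\<And>j. j < N \<Longrightarrow> z \<noteq> - \<i> * of_real (node j)) \<Longrightarrow> denom N z \<noteq> 0"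
proof -
  assume z: "\<And>j. j < N \<Longrightarrow> z \<noteq> - \<i> * of_real (node j)"
  have "of_real (node j) - \<i> * z \<noteq> 0" if "j < N" for j
  proof
    assume "of_real (node j) - \<i> * z = 0"
    then have "of_real (node j) = \<i> * z" by simp
    then have "- \<i> * of_real (node j) = z" by simp
    then show False using z[OF that] by simp
  qed
  then show ?thesis unfolding denom_def by simp
qed

text \<open>Factoring out \<open>Psia N\<close> rather than dividing by \<open>gapx N\<close> keeps
  the formulas valid at the zeros of \<open>gapx N\<close>, which lie in the upper half
  plane.\<close>

lemma apx_factor:
  assumes z: "z \<notin> sites" "\<And>j. j < N \<Longrightarrow> z \<noteq> - \<i> * of_real (node j)"
  shows "chi z = Psia N z * gapx N z" "Phia N z = Psia N z * (gapx N z)\<^sup>2"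
proof -
  have d: "denom N z \<noteq> 0" using denom_neq_0 z(2) by blast
  show 1: "chi z = Psia N z * gapx N z" using Psia_numer[OF z(1), of N] d by (simp add: gapx_eq field_simps)
  have "Phia N z = chi z * gapx N z" using csum_wapx[OF z(1), of N] d by (simp add: gapx_eq Phia_def field_simps)
  then show "Phia N z = Psia N z * (gapx N z)\<^sup>2" using 1 by (simp add: power2_eq_square)
qed

lemma not_node_upper: "0 \<le> Im z \<Longrightarrow> z \<noteq> - \<i> * of_real (node j)"
  using node_props(1)[of j] by auto

lemma Phia_tendsto: "(\<lambda>N. Phia N z) \<longlonglongrightarrow> Phi z" and Psia_tendsto: "(\<lambda>N. Psia N z) \<longlonglongrightarrow> Psi z"
  unfolding Phia_def Phi_def Psia_def Psi_def
  by (intro csum_tendsto weights_wapx weights_cnj wapx_tendsto tendsto_cnj)+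

text \<open>Exact for every finite product, hence for the limit; the lower half plane follows by
  conjugation, which exchanges Phi and Psi.\<close>

lemma Phi_Psi: "z \<notin> sites \<Longrightarrow> Phi z * Psi z = (chi z)\<^sup>2"
proof -
  have *: "Phi z * Psi z = (chi z)\<^sup>2" if z: "z \<notin> sites" "0 \<le> Im z" for z
  proof -
    have "Phia N z * Psia N z = (chi z)\<^sup>2" for N
      using apx_factor[OF z(1) not_node_upper[OF z(2)], of N] by (simp add: power2_eq_square)
    moreover have "(\<lambda>N. Phia N z * Psia N z) \<longlonglongrightarrow> Phi z * Psi z" by (intro tendsto_mult Phia_tendsto Psia_tendsto)
    ultimately show ?thesis by (simp add: LIMSEQ_const_iff)
  qed
  assume z: "z \<notin> sites"
  show ?thesis
  proof (cases "0 \<le> Im z")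
    case False
    then have "Phi (cnj z) * Psi (cnj z) = (chi (cnj z))\<^sup>2" using z by (intro *) (auto simp: sites_cnj)
    then have "cnj (Phi z * Psi z) = cnj ((chi z)\<^sup>2)" by (simp add: Psi_cnj chi_cnj mult.commute)
    then show ?thesis by (simp only: complex_cnj_cancel_iff)
  qed (use * z in auto)
qed

lemma norm_beta_le:
  assumes "t > 0" "0 \<le> Im z"
  shows "cmod (beta t z) \<le> 1"
proof -
  have "(cmod (of_real t + \<i> * z))\<^sup>2 \<le> (cmod (of_real t - \<i> * z))\<^sup>2"
    unfolding cmod_power2 using assms by (simp add: power2_eq_square algebra_simps)
  then have "cmod (of_real t + \<i> * z) \<le> cmod (of_real t - \<i> * z)" by (rule power2_le_imp_le) simp
  moreover have "cmod (of_real t - \<i> * z) > 0" using denom_nonzero assms by simp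
  ultimately show ?thesis by (simp add: beta_def norm_divide)
qed

lemma denom_norm_ge:
  assumes "t > 0" "0 \<le> Im z"
  shows "(cmod z)\<^sup>2 + t\<^sup>2 \<le> (cmod (of_real t - \<i> * z))\<^sup>2"
proof -
  have "(cmod (of_real t - \<i> * z))\<^sup>2 = (cmod z)\<^sup>2 + t\<^sup>2 + 2 * (t * Im z)"
    unfolding cmod_power2 by (simp add: power2_eq_square algebra_simps)
  then show ?thesis using assms by simp
qed

lemma norm_gapx_le: "0 \<le> Im z \<Longrightarrow> cmod (gapx N z) \<le> 1"
  unfolding gapx_def prod_norm[symmetric] using norm_beta_le node_props(1) by (intro prod_le_1) auto

lemma norm_gapx_le_beta:
  assumes "0 \<le> Im z" "m < N"
  shows "cmod (gapx N z) \<le> cmod (beta (node m) z)"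
proof -
  have "gapx N z = beta (node m) z * (\<Prod>j\<in>{..<N} - {m}. beta (node j) z)"
    unfolding gapx_def using assms by (subst prod.remove[of _ m]) auto
  moreover have "cmod (\<Prod>j\<in>{..<N} - {m}. beta (node j) z) \<le> 1"
    unfolding prod_norm[symmetric] using norm_beta_le node_props(1) assms by (intro prod_le_1) auto
  ultimately show ?thesis by (simp add: norm_mult mult_left_le)
qed

text \<open>Majorant, on the half circle of radius r in the closed upper half plane, for the
  derivatives of all finite Blaschke products: the factor with zero i t contributes 2 t / |t - i
  z|^2, and the other factors have modulus at most 1.\<close>

definition hsum :: "real \<Rightarrow> real" where "hsum r = (\<Sum>j. 2 * node j / (r\<^sup>2 + (node j)\<^sup>2))"

lemma hsum_term_le: "2 * node j / (r\<^sup>2 + (node j)\<^sup>2) \<le> 1 / pole j" "0 \<le> 2 * node j / (r\<^sup>2 + (node j)\<^sup>2)"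
proof -
  have n: "node j > 0" "99 * pole j \<le> node j" "pole j > 0" using node_props(1) node_bounds(1) pole_pos by auto
  show "0 \<le> 2 * node j / (r\<^sup>2 + (node j)\<^sup>2)" using n by simp
  have "2 * node j / (r\<^sup>2 + (node j)\<^sup>2) \<le> 2 * node j / (node j)\<^sup>2" using n by (intro divide_left_mono mult_pos_pos add_nonneg_pos) auto
  also have "\<dots> = 2 / node j" by (simp add: power2_eq_square)
  also have "\<dots> \<le> 2 / (2 * pole j)" using n by (intro divide_left_mono mult_pos_pos) auto
  finally show "2 * node j / (r\<^sup>2 + (node j)\<^sup>2) \<le> 1 / pole j" by simp
qed

lemma summable_hsum: "summable (\<lambda>j. 2 * node j / (r\<^sup>2 + (node j)\<^sup>2))"
  by (rule summable_comparison_test'[OF summable_inverse_pole])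
    (simp only: real_norm_def abs_of_nonneg[OF hsum_term_le(2)] hsum_term_le(1))

lemma hsum_nonneg: "0 \<le> hsum r"
  unfolding hsum_def by (intro suminf_nonneg summable_hsum hsum_term_le)

lemma hsum_le:
  assumes "r > 0"
  shows "hsum r \<le> 8 / r"
  unfolding hsum_def
proof (rule suminf_le_const[OF summable_hsum])
  fix n
  have "2 * node j / (r\<^sup>2 + (node j)\<^sup>2) \<le> 2 / r * min (node j / r) (r / node j)" for j
  proof -
    have n: "node j > 0" by (rule node_props)
    have "2 * node j / (r\<^sup>2 + (node j)\<^sup>2) \<le> 2 * node j / r\<^sup>2" "2 * node j / (r\<^sup>2 + (node j)\<^sup>2) \<le> 2 * node j / (node j)\<^sup>2"
      using n assms by (auto intro!: divide_left_mono mult_pos_pos add_pos_nonneg add_nonneg_pos)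
    then show ?thesis using n assms by (auto simp: min_def power2_eq_square)
  qed
  then have "(\<Sum>j<n. 2 * node j / (r\<^sup>2 + (node j)\<^sup>2)) \<le> (\<Sum>j<n. 2 / r * min (node j / r) (r / node j))"
    by (intro sum_mono)
  also have "\<dots> = 2 / r * (\<Sum>j<n. min (node j / r) (r / node j))" by (simp add: sum_distrib_left)
  also have "\<dots> \<le> 2 / r * 4"
    using doubling_sum_bound[of node r n] node_props(1) node_Suc_ge assms by (intro mult_left_mono) auto
  finally show "(\<Sum>j<n. 2 * node j / (r\<^sup>2 + (node j)\<^sup>2)) \<le> 8 / r" by simp
qed

lemma gapx_deriv:
  assumes z: "0 \<le> Im z"
  shows "gapx N field_differentiable at z" "cmod (deriv (gapx N) z) \<le> hsum (cmod z)"
proof -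
  have db: "(beta t has_field_derivative 2 * \<i> * of_real t / (of_real t - \<i> * z)\<^sup>2) (at z)" if t: "t > 0" for t
    unfolding beta_def[abs_def] using denom_nonzero[OF z t]
    by (auto intro!: derivative_eq_intros simp: power2_eq_square algebra_simps)
  have "\<exists>D. (gapx N has_field_derivative D) (at z) \<and> cmod D \<le> (\<Sum>j<N. 2 * node j / ((cmod z)\<^sup>2 + (node j)\<^sup>2))"
  proof (induction N)
    case 0
    have "gapx 0 = (\<lambda>_. 1)" by (auto simp: gapx_def)
    then show ?case by (intro exI[of _ 0]) auto
  next
    case (Suc N)
    then obtain D where D: "(gapx N has_field_derivative D) (at z)" "cmod D \<le> (\<Sum>j<N. 2 * node j / ((cmod z)\<^sup>2 + (node j)\<^sup>2))" by blast
    let ?t = "node N"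
    let ?D = "2 * \<i> * of_real ?t / (of_real ?t - \<i> * z)\<^sup>2"
    have t: "?t > 0" by (rule node_props)
    have e: "gapx (Suc N) = (\<lambda>z. gapx N z * beta ?t z)" by (auto simp: gapx_def)
    have "(gapx (Suc N) has_field_derivative D * beta ?t z + ?D * gapx N z) (at z)"
      unfolding e by (intro DERIV_mult D db t)
    moreover have "cmod (D * beta ?t z + ?D * gapx N z) \<le> cmod D * 1 + cmod ?D * 1"
      using norm_beta_le[OF t z] norm_gapx_le[OF z, of N]
      by (intro order_trans[OF norm_triangle_ineq] add_mono) (simp_all only: norm_mult mult_left_mono norm_ge_zero)
    moreover have "cmod ?D \<le> 2 * ?t / ((cmod z)\<^sup>2 + ?t\<^sup>2)"
      using denom_norm_ge[OF t z] t by (simp add: norm_divide norm_mult norm_power) (intro frac_le, auto simp: add_nonneg_pos)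
    ultimately show ?case using D(2) by (intro exI[of _ "D * beta ?t z + ?D * gapx N z"]) auto
  qed
  then obtain D where D: "(gapx N has_field_derivative D) (at z)" "cmod D \<le> (\<Sum>j<N. 2 * node j / ((cmod z)\<^sup>2 + (node j)\<^sup>2))" by blast
  then show "gapx N field_differentiable at z" by (auto simp: field_differentiable_def)
  have "(\<Sum>j<N. 2 * node j / ((cmod z)\<^sup>2 + (node j)\<^sup>2)) \<le> hsum (cmod z)"
    unfolding hsum_def by (intro sum_le_suminf summable_hsum hsum_term_le) auto
  then show "cmod (deriv (gapx N) z) \<le> hsum (cmod z)" using D by (simp add: DERIV_imp_deriv)
qed

section \<open>The curvature estimate\<close>

lemma sum_pole_le: "(\<Sum>k<m. pole k) \<le> 1/5000 * pole m"
proof (induction m)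
  case (Suc m)
  have "(\<Sum>k<Suc m. pole k) \<le> 2 * pole m" using Suc pole_pos[of m] by simp
  then show ?case using pole_Suc_ge[of m] by simp
qed simp

text \<open>Subtracting the vanishing value at i \<open>node m\<close> term by term pulls the factor
  z^2 + \<open>node m\<close>^2 out of the series, so that the remaining sum can be bounded below
  even near that zero.\<close>

lemma chi_divided_difference:
  assumes z: "z \<notin> sites"
  shows "(\<lambda>k. (-1) ^ k * (2 * of_real (pole k) / ((z\<^sup>2 - (of_real (pole k))\<^sup>2) * of_real ((node m)\<^sup>2 + (pole k)\<^sup>2)))
     * (z\<^sup>2 + of_real ((node m)\<^sup>2))) sums chi z"
proof -
  let ?p = "\<lambda>k. complex_of_real (pole k)"
  let ?n = "\<i> * complex_of_real (node m)"
  have n: "?n \<notin> sites" using node_props(1)[of m] by (intro notin_sites_Im) simp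
  have "(\<lambda>k. (-1) ^ k * (2 * ?p k / (z\<^sup>2 - (?p k)\<^sup>2)) - (-1) ^ k * (2 * ?p k / (?n\<^sup>2 - (?p k)\<^sup>2))) sums (chi z - chi ?n)"
    by (intro sums_diff chi_pairs z n)
  moreover have "(-1) ^ k * (2 * ?p k / (z\<^sup>2 - (?p k)\<^sup>2)) - (-1) ^ k * (2 * ?p k / (?n\<^sup>2 - (?p k)\<^sup>2))
     = (-1) ^ k * (2 * ?p k / ((z\<^sup>2 - (?p k)\<^sup>2) * of_real ((node m)\<^sup>2 + (pole k)\<^sup>2))) * (z\<^sup>2 + of_real ((node m)\<^sup>2))" for k
  proof -
    define A where "A = z\<^sup>2 - (?p k)\<^sup>2"
    define B where "B = complex_of_real ((node m)\<^sup>2 + (pole k)\<^sup>2)"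
    have "z - ?p k \<noteq> 0" "z + ?p k \<noteq> 0" using z pole_in_sites[of k] by (auto simp: add_eq_0_iff)
    then have "(z - ?p k) * (z + ?p k) \<noteq> 0" by simp
    then have A: "A \<noteq> 0" unfolding A_def by (simp add: power2_eq_square algebra_simps)
    have "(node m)\<^sup>2 + (pole k)\<^sup>2 \<noteq> 0" using pole_pos[of k] by (metis add_nonneg_pos less_irrefl zero_le_power2 zero_less_power)
    then have B: "B \<noteq> 0" unfolding B_def by (simp only: of_real_eq_0_iff) simp
    have nB: "?n\<^sup>2 - (?p k)\<^sup>2 = - B" unfolding B_def by (simp add: power_mult_distrib)
    have AB: "A + B = z\<^sup>2 + of_real ((node m)\<^sup>2)" by (simp add: A_def B_def)
    have "2 * ?p k / A - 2 * ?p k / (- B) = 2 * ?p k / (A * B) * (A + B)" using A B by (simp add: field_simps)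
    then show ?thesis unfolding nB A_def[symmetric] B_def[symmetric] AB[symmetric]
      by (simp only: right_diff_distrib[symmetric] mult.assoc)
  qed
  ultimately show ?thesis using chi_node(1)[of m] by simp
qed

text \<open>The term of index m outweighs all others: those before it are proportional to the poles,
  whose sum is at most \<open>pole m\<close> / 5000, and those after it decay geometrically.\<close>

lemma dominated_alternating:
  fixes x :: "nat \<Rightarrow> complex"
  assumes s: "x sums S" and lo: "\<And>k. k < m \<Longrightarrow> cmod (x k) \<le> a * pole k / pole m * cmod (x m)"
    and hi: "\<And>i. cmod (x (Suc m + i)) \<le> c * (1/10000) ^ i * cmod (x m)"
    and a: "0 \<le> a" and c: "0 \<le> c" and tot: "a / 5000 + 101/100 * c \<le> b"
  shows "(1 - b) * cmod (x m) \<le> cmod S"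
proof -
  have geo: "(\<lambda>i. c * (1/10000) ^ i * cmod (x m)) sums (c * (1 / (1 - 1/10000)) * cmod (x m))"
    by (intro sums_mult2 sums_mult geometric_sums) simp
  have "(\<lambda>i. x (i + Suc m)) sums (S - (\<Sum>k<Suc m. x k))" by (rule sums_split_initial_segment[OF s])
  then have t: "(\<lambda>i. x (Suc m + i)) sums (S - (\<Sum>k<Suc m. x k))" by (simp add: add.commute)
  then have "cmod (S - (\<Sum>k<Suc m. x k)) \<le> c * (1 / (1 - 1/10000)) * cmod (x m)"
    using norm_suminf_le[OF hi sums_summable[OF geo]] sums_unique[OF t] sums_unique[OF geo] by simp
  also have "\<dots> \<le> 101/100 * c * cmod (x m)" using c by (intro mult_right_mono) auto
  finally have 1: "cmod (S - (\<Sum>k<Suc m. x k)) \<le> 101/100 * c * cmod (x m)" .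
  have "cmod (\<Sum>k<m. x k) \<le> (\<Sum>k<m. a * pole k / pole m * cmod (x m))" by (rule sum_norm_le) (use lo in auto)
  also have "\<dots> = a / pole m * cmod (x m) * (\<Sum>k<m. pole k)" by (simp add: sum_distrib_left sum_divide_distrib mult_ac)
  also have "\<dots> \<le> a / pole m * cmod (x m) * (1/5000 * pole m)"
    using a pole_pos[of m] by (intro mult_left_mono sum_pole_le) auto
  also have "\<dots> = a / 5000 * cmod (x m)" using pole_pos[of m] by simp
  finally have 2: "cmod (\<Sum>k<m. x k) \<le> a / 5000 * cmod (x m)" .
  have "x m = S - (S - (\<Sum>k<Suc m. x k)) - (\<Sum>k<m. x k)" by simp
  then have "cmod (x m) \<le> cmod (S - (S - (\<Sum>k<Suc m. x k))) + cmod (\<Sum>k<m. x k)"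
    using norm_triangle_ineq4[of "S - (S - (\<Sum>k<Suc m. x k))" "\<Sum>k<m. x k"] by simp
  moreover have "cmod (S - (S - (\<Sum>k<Suc m. x k))) \<le> cmod S + cmod (S - (\<Sum>k<Suc m. x k))"
    by (rule norm_triangle_ineq4)
  moreover have "(a / 5000 + 101/100 * c) * cmod (x m) \<le> b * cmod (x m)" using tot by (intro mult_right_mono) auto
  ultimately show ?thesis using 1 2 by (simp add: algebra_simps)
qed

lemma node_sq_le: "(node m)\<^sup>2 + (pole m)\<^sup>2 \<le> 101/100 * (pole m * pole (Suc m))"
proof -
  have "node m = pole m * corr m / rho m" by (rule node_eq)
  then have "(node m)\<^sup>2 = (corr m)\<^sup>2 * (pole m * pole (Suc m))"
    using rho_bounds(3)[of m] by (simp add: pole.simps(2) power2_eq_square)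
  also have "\<dots> \<le> (1001/1000)\<^sup>2 * (pole m * pole (Suc m))"
    using corr_bounds[of m] pole_pos[of m] pole_pos[of "Suc m"] by (intro mult_right_mono power_mono) auto
  finally have "(node m)\<^sup>2 \<le> (1001/1000)\<^sup>2 * (pole m * pole (Suc m))" .
  moreover have "(pole m)\<^sup>2 \<le> 1/10000 * (pole m * pole (Suc m))"
    using pole_Suc_ge[of m] pole_pos[of m] by (simp add: power2_eq_square)
  moreover have "0 \<le> pole m * pole (Suc m)" using pole_pos[of m] pole_pos[of "Suc m"] by simp
  ultimately show ?thesis by (simp add: power2_eq_square)
qed

text \<open>In this annulus only \<open>pole m\<close> is near, and after the zero at i
  \<open>node m\<close> has been divided out the term of index m dominates. Half of that term is the
  stated bound.\<close>

lemma chi_lower_annulus: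
  assumes z: "z \<notin> sites" and r: "pole m / 2 \<le> cmod z" "cmod z \<le> pole (Suc m) / 2"
  shows "pole m * cmod (z\<^sup>2 + of_real ((node m)\<^sup>2)) / (cmod (z\<^sup>2 - (of_real (pole m))\<^sup>2) * ((node m)\<^sup>2 + (pole m)\<^sup>2)) \<le> cmod (chi z)"
proof -
  define R where "R = (cmod z)\<^sup>2"
  have Rp: "0 \<le> R" by (simp add: R_def)
  define q where "q k = cmod (z\<^sup>2 - (of_real (pole k))\<^sup>2)" for k
  define n where "n k = (node m)\<^sup>2 + (pole k)\<^sup>2" for k
  let ?x = "\<lambda>k. (-1) ^ k * (2 * of_real (pole k) / ((z\<^sup>2 - (of_real (pole k))\<^sup>2) * of_real ((node m)\<^sup>2 + (pole k)\<^sup>2)))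
     * (z\<^sup>2 + of_real ((node m)\<^sup>2))"
  let ?F = "cmod (z\<^sup>2 + of_real ((node m)\<^sup>2))"
  have p: "pole k > 0" for k by (rule pole_pos)
  have npos: "n k > 0" for k using p[of k] by (simp add: n_def add_nonneg_pos)
  have qpos: "q k > 0" for k
  proof -
    have "z - of_real (pole k) \<noteq> 0" "z + of_real (pole k) \<noteq> 0" using z pole_in_sites[of k] by (auto simp: add_eq_0_iff)
    then have "(z - of_real (pole k)) * (z + of_real (pole k)) \<noteq> 0" by simp
    then show ?thesis unfolding q_def by (simp add: power2_eq_square algebra_simps)
  qed
  have xn: "cmod (?x k) = 2 * pole k / (q k * n k) * ?F" for k
    using p[of k] npos[of k] unfolding norm_mult norm_divide norm_of_real q_def n_def by (simp add: norm_power)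
  have qle: "q k \<le> R + (pole k)\<^sup>2" "R - (pole k)\<^sup>2 \<le> q k" "(pole k)\<^sup>2 - R \<le> q k" for k
  proof -
    have e: "cmod ((of_real (pole k))\<^sup>2) = (pole k)\<^sup>2" "cmod (z\<^sup>2) = R" by (simp_all add: norm_power R_def)
    show "q k \<le> R + (pole k)\<^sup>2" unfolding q_def e[symmetric] by (rule norm_triangle_ineq4)
    show "R - (pole k)\<^sup>2 \<le> q k" unfolding q_def e[symmetric] by (rule norm_triangle_ineq2)
    show "(pole k)\<^sup>2 - R \<le> q k" unfolding q_def e[symmetric] by (subst norm_minus_commute) (rule norm_triangle_ineq2)
  qed
  have Rm: "(pole m)\<^sup>2 / 4 \<le> R"
  proof -
    have "(pole m / 2)\<^sup>2 \<le> R" unfolding R_def using r p[of m] by (intro power_mono) auto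
    then show ?thesis by (simp add: power_divide)
  qed
  have RM: "R \<le> (pole (Suc m))\<^sup>2 / 4"
  proof -
    have "R \<le> (pole (Suc m) / 2)\<^sup>2" unfolding R_def using r by (intro power_mono) auto
    then show ?thesis by (simp add: power_divide)
  qed
  have nm: "n m \<le> 2 * (node m)\<^sup>2"
  proof -
    have "(pole m)\<^sup>2 \<le> (node m)\<^sup>2" using node_bounds(1)[of m] p[of m] by (intro power_mono) auto
    then show ?thesis by (simp add: n_def)
  qed
  have xeq: "cmod (?x k) = (pole k * q m * n m / (pole m * q k * n k)) * cmod (?x m)" for k
    unfolding xn using p[of k] p[of m] qpos[of k] qpos[of m] npos[of k] npos[of m] by (simp add: field_simps)
  have lo: "cmod (?x k) \<le> 12 * pole k / pole m * cmod (?x m)" if k: "k < m" for k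
  proof -
    have pk: "10000 * pole k \<le> pole m"
      using pole_Suc_ge[of k] pole_mono[of "Suc k" m] k by simp
    have "(pole k)\<^sup>2 \<le> R / 10"
    proof -
      have "(10000 * pole k)\<^sup>2 \<le> (pole m)\<^sup>2" using pk p[of k] by (intro power_mono) auto
      then have "100000000 * (pole k)\<^sup>2 \<le> (pole m)\<^sup>2" by (simp add: power_mult_distrib)
      then show ?thesis using Rm zero_le_power2[of "pole k"] by linarith
    qed
    then have "q m \<le> 6 * q k" using qle(1)[of m] qle(2)[of k] Rm Rp by linarith
    moreover have "n m \<le> 2 * n k"
    proof -
      have "N + P \<le> 2 * N \<Longrightarrow> 0 \<le> K \<Longrightarrow> N + P \<le> 2 * (N + K)" for N P K :: real by simp
      then show ?thesis using nm unfolding n_def by (simp only: zero_le_power2)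
    qed
    ultimately have "q m * n m \<le> (6 * q k) * (2 * n k)"
      using qpos[of m] npos[of m] qpos[of k] npos[of k] by (intro mult_mono) auto
    then have "q m * n m / (q k * n k) \<le> 12" using qpos[of k] npos[of k] by (simp add: divide_le_eq)
    then have "pole k / pole m * (q m * n m / (q k * n k)) \<le> pole k / pole m * 12" using p[of k] p[of m] by (intro mult_left_mono) auto
    then have "pole k * q m * n m / (pole m * q k * n k) \<le> 12 * pole k / pole m" by (simp add: mult_ac)
    then show ?thesis unfolding xeq[of k] by (rule mult_right_mono) simp
  qed
  have hi: "cmod (?x (Suc m + i)) \<le> 36/100 * (1/10000) ^ i * cmod (?x m)" for i
  proof -
    let ?k = "Suc m + i"
    define P where "P = pole (Suc m)"
    define Q where "Q = pole ?k"
    have PQ: "0 < P" "P \<le> Q" "0 < Q" unfolding P_def Q_def using p pole_mono by auto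
    have sq: "P\<^sup>2 \<le> Q\<^sup>2" using PQ by (intro power_mono) auto
    have "(10000 * pole m)\<^sup>2 \<le> P\<^sup>2" unfolding P_def using pole_Suc_ge[of m] p[of m] by (intro power_mono) auto
    then have "100000000 * (pole m)\<^sup>2 \<le> P\<^sup>2" by (simp add: power_mult_distrib)
    moreover have "100000000 * A \<le> B \<Longrightarrow> 0 \<le> A \<Longrightarrow> A \<le> B / 100" for A B :: real by simp
    ultimately have pm: "(pole m)\<^sup>2 \<le> P\<^sup>2 / 100" using zero_le_power2 by blast
    have 1: "q m \<le> 26/100 * P\<^sup>2" using qle(1)[of m] RM pm by (simp add: P_def)
    have 2: "3/4 * Q\<^sup>2 \<le> q ?k" using qle(3)[of ?k] RM sq unfolding P_def Q_def by linarith
    have 3: "n m \<le> 101/100 * (pole m * P)" using node_sq_le[of m] by (simp add: n_def P_def)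
    have 4: "Q\<^sup>2 \<le> n ?k" by (simp add: n_def Q_def)
    have "q m * n m \<le> (26/100 * P\<^sup>2) * (101/100 * (pole m * P))"
      using 1 3 qpos[of m] npos[of m] PQ p[of m] by (intro mult_mono) auto
    moreover have "(3/4 * Q\<^sup>2) * Q\<^sup>2 \<le> q ?k * n ?k" using 2 4 qpos[of ?k] by (intro mult_mono) auto
    ultimately have "q m * n m / (q ?k * n ?k) \<le> (26/100 * P\<^sup>2) * (101/100 * (pole m * P)) / ((3/4 * Q\<^sup>2) * Q\<^sup>2)"
      using PQ qpos[of m] npos[of m] p[of m] by (intro frac_le) auto
    then have "Q / pole m * (q m * n m / (q ?k * n ?k)) \<le> Q / pole m * ((26/100 * P\<^sup>2) * (101/100 * (pole m * P)) / ((3/4 * Q\<^sup>2) * Q\<^sup>2))"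
      using PQ p[of m] by (intro mult_left_mono) auto
    also have "\<dots> = (26/100 * (101/100) / (3/4)) * (P / Q) ^ 3"
      using PQ p[of m] by (simp add: field_simps power2_eq_square power3_eq_cube)
    also have "\<dots> \<le> 36/100 * (P / Q)"
    proof -
      have PQ1: "P / Q \<le> 1" "0 \<le> P / Q" using PQ by auto
      have le: "26/100 * (101/100) / (3/4) * Y \<le> 36/100 * X" if "Y \<le> X" "0 \<le> X" for X Y :: real using that by simp
      have "(P / Q) ^ 3 \<le> P / Q" using power_decreasing[of 1 3 "P / Q"] PQ1 by simp
      then show ?thesis by (rule le[OF _ PQ1(2)])
    qed
    also have "\<dots> \<le> 36/100 * (1/10000) ^ i"
      using pole_quotient_le[of "Suc m" i] unfolding P_def Q_def by (intro mult_left_mono) auto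
    finally have "Q / pole m * (q m * n m / (q ?k * n ?k)) \<le> 36/100 * (1/10000) ^ i" .
    then have "pole ?k * q m * n m / (pole m * q ?k * n ?k) \<le> 36/100 * (1/10000) ^ i"
      unfolding Q_def by (simp add: mult_ac)
    then show ?thesis unfolding xeq[of ?k] by (rule mult_right_mono) simp
  qed
  have "(1 - 1/2) * cmod (?x m) \<le> cmod (chi z)"
    \<comment> \<open>The constants fit because 12/5000 + 101/100 * 36/100 is below 1/2.\<close>
    by (rule dominated_alternating[OF chi_divided_difference[OF z] lo hi]) auto
  then show ?thesis unfolding xn by (simp add: q_def n_def)
qed

lemma norm_sq_sum_split: "cmod (z\<^sup>2 + of_real (t\<^sup>2)) = cmod (of_real t + \<i> * z) * cmod (of_real t - \<i> * z)"
  unfolding norm_mult[symmetric] by (simp add: power2_eq_square algebra_simps)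

text \<open>\<open>chi\<close> is small near i \<open>node m\<close>, but \<open>Psia N\<close> is
  \<open>chi\<close> divided by \<open>gapx N\<close>, and a single Blaschke factor, that of
  \<open>node m\<close>, removes the small numerator; the others only help, being at most 1 in
  modulus.\<close>

lemma Psi_lower_annulus:
  assumes z: "z \<notin> sites" "0 \<le> Im z" and r: "pole m / 2 \<le> cmod z" "cmod z \<le> pole (Suc m) / 2"
  shows "pole m * ((cmod z)\<^sup>2 + (node m)\<^sup>2) \<le> 10 * (cmod z)\<^sup>2 * (node m)\<^sup>2 * cmod (Psi z)"
proof -
  let ?t = "node m"
  have t: "?t > 0" by (rule node_props)
  have generic: "pole m * ((cmod z)\<^sup>2 + ?t\<^sup>2) \<le> 10 * (cmod z)\<^sup>2 * ?t\<^sup>2 * cmod (Psi z)"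
    if z: "z \<notin> sites" "0 \<le> Im z" and r: "pole m / 2 \<le> cmod z" "cmod z \<le> pole (Suc m) / 2"
      and nz: "z \<noteq> \<i> * of_real ?t" for z
  proof -
    define q where "q = cmod (z\<^sup>2 - (of_real (pole m))\<^sup>2)"
    define n where "n = ?t\<^sup>2 + (pole m)\<^sup>2"
    define u where "u = cmod (of_real ?t + \<i> * z)"
    define v where "v = cmod (of_real ?t - \<i> * z)"
    have p: "pole m > 0" by (rule pole_pos)
    have u: "u > 0"
    proof -
      have "of_real ?t + \<i> * z \<noteq> 0"
      proof
        assume "of_real ?t + \<i> * z = 0"
        then have "of_real ?t = - (\<i> * z)" by (simp add: eq_neg_iff_add_eq_0)
        then have "\<i> * of_real ?t = z" by simp
        then show False using nz by simp
      qed
      then show ?thesis by (simp add: u_def)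
    qed
    have v: "v > 0" unfolding v_def using denom_nonzero[OF z(2) t] by simp
    have q: "q > 0"
    proof -
      have "z - of_real (pole m) \<noteq> 0" "z + of_real (pole m) \<noteq> 0" using z pole_in_sites[of m] by (auto simp: add_eq_0_iff)
      then have "(z - of_real (pole m)) * (z + of_real (pole m)) \<noteq> 0" by simp
      then show ?thesis unfolding q_def by (simp add: power2_eq_square algebra_simps)
    qed
    have n: "n > 0" using t by (simp add: n_def add_pos_nonneg)
    have chi: "pole m * (u * v) / (q * n) \<le> cmod (chi z)"
      using chi_lower_annulus[OF z(1) r] unfolding norm_sq_sum_split u_def v_def q_def n_def .
    have "pole m * v\<^sup>2 / (q * n) \<le> cmod (Psia N z)" if N: "m < N" for N
    proof -
      have "cmod (chi z) = cmod (Psia N z) * cmod (gapx N z)"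
        using apx_factor(1)[OF z(1) not_node_upper[OF z(2)], of N] by (simp add: norm_mult)
      also have "\<dots> \<le> cmod (Psia N z) * (u / v)"
        using norm_gapx_le_beta[OF z(2) N] unfolding beta_def norm_divide u_def v_def by (intro mult_left_mono) auto
      finally have "pole m * (u * v) / (q * n) \<le> cmod (Psia N z) * (u / v)" using chi by linarith
      then have "pole m * (u * v) / (q * n) * (v / u) \<le> cmod (Psia N z) * (u / v) * (v / u)"
        using u v by (intro mult_right_mono) auto
      then show ?thesis using u v by (simp add: power2_eq_square)
    qed
    then have "pole m * v\<^sup>2 / (q * n) \<le> cmod (Psi z)"
      by (intro tendsto_lowerbound[OF tendsto_norm[OF Psia_tendsto]] eventually_mono[OF eventually_gt_at_top[of m]]) auto
    moreover have "(cmod z)\<^sup>2 + ?t\<^sup>2 \<le> v\<^sup>2" unfolding v_def by (rule denom_norm_ge[OF t z(2)])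
    then have "pole m * ((cmod z)\<^sup>2 + ?t\<^sup>2) / (q * n) \<le> pole m * v\<^sup>2 / (q * n)"
      using p q n by (intro divide_right_mono mult_left_mono) auto
    ultimately have "pole m * ((cmod z)\<^sup>2 + ?t\<^sup>2) / (q * n) \<le> cmod (Psi z)" by linarith
    then have 1: "pole m * ((cmod z)\<^sup>2 + ?t\<^sup>2) \<le> cmod (Psi z) * (q * n)" using q n by (simp add: pos_divide_le_eq)
    have "q \<le> (cmod z)\<^sup>2 + (pole m)\<^sup>2"
      unfolding q_def using norm_triangle_ineq4[of "z\<^sup>2" "(of_real (pole m))\<^sup>2"] by (simp add: norm_power)
    moreover have "(pole m / 2)\<^sup>2 \<le> (cmod z)\<^sup>2" using r p by (intro power_mono) auto
    ultimately have 2: "q \<le> 5 * (cmod z)\<^sup>2" by (simp add: power_divide)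
    have "(pole m)\<^sup>2 \<le> ?t\<^sup>2" using node_bounds(1)[of m] p by (intro power_mono) auto
    then have 3: "n \<le> 2 * ?t\<^sup>2" by (simp add: n_def)
    have "q * n \<le> (5 * (cmod z)\<^sup>2) * (2 * ?t\<^sup>2)" using 2 3 q n by (intro mult_mono) auto
    then have "cmod (Psi z) * (q * n) \<le> cmod (Psi z) * ((5 * (cmod z)\<^sup>2) * (2 * ?t\<^sup>2))" by (intro mult_left_mono) auto
    then show ?thesis using 1 by (simp add: mult_ac)
  qed
  show ?thesis
  proof (cases "z = \<i> * of_real ?t")
    case True
    \<comment> \<open>At the zero itself both sides of the division vanish; the inequality is closed
      and holds at all nearby points.\<close>
    define f where "f z = 10 * (cmod z)\<^sup>2 * ?t\<^sup>2 * cmod (Psi z) - pole m * ((cmod z)\<^sup>2 + ?t\<^sup>2)" for z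
    have "isCont Psi z" unfolding Psi_def
      using weights.csum_deriv(2)[OF weights_cnj[OF weights_wlim] z(1)] by (rule field_differentiable_imp_continuous_at)
    then have "isCont f z" unfolding f_def by (intro continuous_intros)
    then have lim: "(f \<longlongrightarrow> f z) (at z)" by (simp add: isCont_def)
    define D where "D = {z. 0 < Im z} \<inter> (ball 0 (pole (Suc m) / 2) - cball 0 (pole m / 2))"
    have "open D" unfolding D_def by (intro open_Int open_Diff open_halfspace_Im_gt open_ball closed_cball)
    moreover have "z \<in> D"
      using True t node_bounds(1,2)[of m] pole_pos[of m] pole_pos[of "Suc m"] by (auto simp: D_def norm_mult)
    ultimately have ev: "eventually (\<lambda>x. x \<in> D - {z}) (at z)"
      using eventually_at_in_open[of D z] by simp
    have "eventually (\<lambda>x. 0 \<le> f x) (at z)"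
      using ev
    proof eventually_elim
      case (elim x)
      then have "0 < Im x" "pole m / 2 \<le> cmod x" "cmod x \<le> pole (Suc m) / 2" "x \<noteq> \<i> * of_real ?t"
        using True by (auto simp: D_def)
      then show ?case unfolding f_def using generic[of x] notin_sites_Im[of x] by simp
    qed
    then have "0 \<le> f z" by (rule tendsto_lowerbound[OF lim]) simp
    then show ?thesis by (simp add: f_def)
  qed (use generic[OF z r] in blast)
qed

lemma norm_chi_le_Psi:
  assumes z: "z \<notin> sites" "0 \<le> Im z"
  shows "cmod (chi z) \<le> cmod (Psi z)"
proof (rule tendsto_lowerbound[OF tendsto_norm[OF Psia_tendsto]])
  show "\<forall>\<^sub>F N in sequentially. cmod (chi z) \<le> cmod (Psia N z)"
  proof (intro always_eventually allI)
    fix N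
    have "cmod (chi z) = cmod (Psia N z) * cmod (gapx N z)"
      using apx_factor(1)[OF z(1) not_node_upper[OF z(2)], of N] by (simp add: norm_mult)
    then show "cmod (chi z) \<le> cmod (Psia N z)" using norm_gapx_le[OF z(2), of N] by (simp add: mult_left_le)
  qed
qed simp

lemma chi_lower_disc:
  assumes z: "z \<notin> sites" and r: "cmod z \<le> 1/2"
  shows "1 \<le> cmod (chi z)"
proof -
  let ?x = "\<lambda>k. (-1) ^ k * (2 * complex_of_real (pole k) / (z\<^sup>2 - (of_real (pole k))\<^sup>2))"
  have p: "pole k > 0" "1 \<le> pole k" for k by (rule pole_pos pole_ge_1)+
  have xn: "cmod (?x k) = 2 * pole k / cmod (z\<^sup>2 - (of_real (pole k))\<^sup>2)" for k
    using p[of k] by (simp add: norm_mult norm_divide norm_power)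
  have R: "(cmod z)\<^sup>2 \<le> 1/4" using power_mono[OF r, of 2] by (simp add: power2_eq_square)
  have z1: "z\<^sup>2 - 1 \<noteq> 0"
  proof
    assume "z\<^sup>2 - 1 = 0"
    then have "cmod (z\<^sup>2) = 1" by simp
    then show False using R by (simp add: norm_power)
  qed
  have "cmod (z\<^sup>2 - 1) \<le> 5/4" using norm_triangle_ineq4[of "z\<^sup>2" 1] R by (simp add: norm_power)
  then have "2 / (5/4) \<le> 2 / cmod (z\<^sup>2 - 1)" using z1 by (intro divide_left_mono mult_pos_pos) auto
  then have x0: "8/5 \<le> cmod (?x 0)" unfolding xn by simp
  have hi: "cmod (?x (Suc 0 + i)) \<le> 4/10000 * (1/10000) ^ i * cmod (?x 0)" for i
  proof -
    let ?p = "pole (Suc 0 + i)"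
    have "cmod ((of_real ?p)\<^sup>2) - cmod (z\<^sup>2) \<le> cmod (z\<^sup>2 - (of_real ?p)\<^sup>2)" by (subst norm_minus_commute) (rule norm_triangle_ineq2)
    moreover have "1 \<le> ?p\<^sup>2" using p(2)[of "Suc 0 + i"] by simp
    ultimately have "?p\<^sup>2 / 2 \<le> cmod (z\<^sup>2 - (of_real ?p)\<^sup>2)" using R by (simp add: norm_power)
    then have "cmod (?x (Suc 0 + i)) \<le> 2 * ?p / (?p\<^sup>2 / 2)"
      unfolding xn using p[of "Suc 0 + i"] by (intro divide_left_mono mult_pos_pos) (auto intro: less_le_trans[of _ "?p\<^sup>2 / 2"])
    also have "\<dots> = 4 * (1 / ?p)" using p(1)[of "Suc 0 + i"] by (simp add: power2_eq_square)
    also have "\<dots> \<le> 4 * (1/10000) ^ (Suc 0 + i)" using pole_quotient_le[of 0 "Suc 0 + i"] by simp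
    also have "\<dots> = 4/10000 * (1/10000) ^ i * 1" by simp
    also have "\<dots> \<le> 4/10000 * (1/10000) ^ i * cmod (?x 0)" using x0 by (intro mult_left_mono) auto
    finally show ?thesis .
  qed
  have "(1 - 1/100) * cmod (?x 0) \<le> cmod (chi z)"
    by (rule dominated_alternating[OF chi_pairs[OF z], where a = 0 and c = "4/10000"]) (use hi in auto)
  moreover have "1 \<le> c" if "(1 - 1/100) * X \<le> c" "8/5 \<le> X" for c X :: real using that by simp
  ultimately show ?thesis using x0 by blast
qed

lemma annulus_exists:
  assumes "1/2 < r"
  obtains m where "pole m / 2 \<le> r" "r \<le> pole (Suc m) / 2"
proof -
  obtain n where "2 * r < 10000 ^ n" using real_arch_pow[of 10000 "2 * r"] by auto
  then have ex: "r \<le> pole n / 2" using pole_ge_power[of n] by linarith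
  define n0 where "n0 = (LEAST n. r \<le> pole n / 2)"
  have n0: "r \<le> pole n0 / 2" unfolding n0_def using ex by (rule LeastI)
  have "n0 \<noteq> 0" using n0 assms by (cases n0) auto
  then obtain m where m: "n0 = Suc m" by (cases n0) auto
  have "\<not> r \<le> pole m / 2" using not_less_Least[of m "\<lambda>n. r \<le> pole n / 2"] m n0_def by simp
  then show ?thesis using that[of m] n0 m by simp
qed

text \<open>The heart of the curvature bound: the Gauss map varies no faster than \<open>Psi\<close>
  is large. In an annulus the factor 8080 = 8 * 202 * 5 comes from \<open>hsum_le\<close>,
  \<open>node_bounds\<close> and \<open>Psi_lower_annulus\<close>; in the inner disc
  \<open>chi\<close> alone suffices.\<close>

lemma hsum_le_Psi:
  assumes z: "z \<notin> sites" "0 \<le> Im z"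
  shows "hsum (cmod z) \<le> 10000 * cmod (Psi z)"
proof (cases "cmod z \<le> 1/2")
  case True
  have "hsum (cmod z) \<le> (\<Sum>j. (1/10000) ^ j)"
    unfolding hsum_def
  proof (rule suminf_le[OF _ summable_hsum])
    show "2 * node j / ((cmod z)\<^sup>2 + (node j)\<^sup>2) \<le> (1/10000) ^ j" for j
      using hsum_term_le(1)[of j "cmod z"] pole_quotient_le[of 0 j] by simp
  qed (simp add: summable_geometric)
  also have "\<dots> \<le> 2" by (subst suminf_geometric) auto
  finally show ?thesis using chi_lower_disc[OF z(1) True] norm_chi_le_Psi[OF z] by linarith
next
  case False
  then obtain m where m: "pole m / 2 \<le> cmod z" "cmod z \<le> pole (Suc m) / 2" using annulus_exists[of "cmod z"] by auto
  let ?r = "cmod z" and ?t = "node m"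
  have r: "?r > 0" using False by linarith
  have t: "?t > 0" by (rule node_props)
  have "0 \<le> (?r - ?t)\<^sup>2" by simp
  then have "2 * ?r * ?t \<le> ?r\<^sup>2 + ?t\<^sup>2" by (simp add: power2_eq_square algebra_simps)
  then have "pole m * (2 * ?r * ?t) \<le> pole m * (?r\<^sup>2 + ?t\<^sup>2)" using pole_pos[of m] by (intro mult_left_mono) auto
  also have "\<dots> \<le> 10 * ?r\<^sup>2 * ?t\<^sup>2 * cmod (Psi z)" by (rule Psi_lower_annulus[OF z m])
  finally have "(2 * ?r * ?t) * pole m \<le> (2 * ?r * ?t) * (5 * ?r * ?t * cmod (Psi z))"
    by (simp add: power2_eq_square mult_ac)
  then have P: "pole m \<le> 5 * ?r * ?t * cmod (Psi z)"
    by (rule mult_left_le_imp_le) (use r t in simp)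
  have "8 * ?t \<le> 8 * (202 * pole m)" using node_bounds(3)[of m] by simp
  also have "\<dots> \<le> 8 * (202 * (5 * ?r * ?t * cmod (Psi z)))" using P by simp
  finally have "?t * 8 \<le> ?t * (8080 * ?r * cmod (Psi z))" by (simp add: mult_ac)
  then have "8 \<le> 8080 * ?r * cmod (Psi z)" by (rule mult_left_le_imp_le) (use t in simp)
  then have "8 / ?r \<le> 8080 * cmod (Psi z)" using r by (simp add: divide_le_eq mult_ac)
  then show ?thesis using hsum_le[OF r] norm_ge_zero[of "Psi z"] by linarith
qed

lemma Psi_nonzero: "z \<notin> sites \<Longrightarrow> 0 \<le> Im z \<Longrightarrow> Psi z \<noteq> 0"
proof -
  assume z: "z \<notin> sites" "0 \<le> Im z"
  have "0 < hsum (cmod z)" unfolding hsum_def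
    by (intro suminf_pos summable_hsum divide_pos_pos mult_pos_pos add_nonneg_pos zero_le_power2 zero_less_power node_props(1)) simp
  then show "Psi z \<noteq> 0" using hsum_le_Psi[OF z] by auto
qed

section \<open>Regularity and curvature of the conformal data\<close>

lemma normal_dot_self: "normal_dot a b c a b c = 0"
  by (simp add: normal_dot_def complex_eq_iff algebra_simps)

text \<open>Lagrange's identity U V - W^2 for the real and imaginary parts of (a, b, c), which
  conformality makes orthogonal and of equal length.\<close>

lemma normal_sq_conformal:
  assumes "a\<^sup>2 + b\<^sup>2 + c\<^sup>2 = 0"
  shows "normal_sq a b c = (((cmod a)\<^sup>2 + (cmod b)\<^sup>2 + (cmod c)\<^sup>2) / 2)\<^sup>2"
proof -
  define U where "U = (Re a)\<^sup>2 + (Re b)\<^sup>2 + (Re c)\<^sup>2"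
  define V where "V = (Im a)\<^sup>2 + (Im b)\<^sup>2 + (Im c)\<^sup>2"
  define W where "W = Re a * Im a + Re b * Im b + Re c * Im c"
  have "Re (a\<^sup>2 + b\<^sup>2 + c\<^sup>2) = 0" "Im (a\<^sup>2 + b\<^sup>2 + c\<^sup>2) = 0" using assms by simp_all
  moreover have "U - V = Re (a\<^sup>2 + b\<^sup>2 + c\<^sup>2)" "2 * W = Im (a\<^sup>2 + b\<^sup>2 + c\<^sup>2)"
    unfolding U_def V_def W_def by (simp_all add: power2_eq_square algebra_simps)
  ultimately have UV: "U = V" and W: "W = 0" by linarith+
  have "normal_sq a b c = U * V - W\<^sup>2"
    unfolding normal_sq_def U_def V_def W_def by (simp add: power2_eq_square algebra_simps)
  moreover have "(cmod a)\<^sup>2 + (cmod b)\<^sup>2 + (cmod c)\<^sup>2 = U + V" unfolding U_def V_def cmod_power2 by simp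
  ultimately show ?thesis using UV W by (simp add: power2_eq_square)
qed

lemma norm_normal_dot: "cmod (normal_dot a b c d e f) \<le> sqrt (normal_sq a b c) * (cmod d + cmod e + cmod f)"
proof -
  have le: "\<bar>Im (cnj b * c)\<bar> \<le> sqrt (normal_sq a b c)" "\<bar>Im (cnj c * a)\<bar> \<le> sqrt (normal_sq a b c)" "\<bar>Im (cnj a * b)\<bar> \<le> sqrt (normal_sq a b c)"
    unfolding normal_sq_def by (rule real_le_rsqrt; simp del: times_complex.sel)+
  have "cmod (normal_dot a b c d e f) \<le> \<bar>Im (cnj b * c)\<bar> * cmod d + \<bar>Im (cnj c * a)\<bar> * cmod e + \<bar>Im (cnj a * b)\<bar> * cmod f"
    unfolding normal_dot_def by (rule order_trans[OF norm_triangle_ineq]) (auto simp: norm_mult intro!: add_mono order_trans[OF norm_triangle_ineq] simp del: times_complex.sel)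
  also have "\<dots> \<le> sqrt (normal_sq a b c) * cmod d + sqrt (normal_sq a b c) * cmod e + sqrt (normal_sq a b c) * cmod f"
    using le by (intro add_mono mult_right_mono) auto
  finally show ?thesis by (simp add: algebra_simps)
qed

lemma normal_dot_linear:
  "normal_dot a b c (s * d + t * d') (s * e + t * e') (s * f + t * f') = s * normal_dot a b c d e f + t * normal_dot a b c d' e' f'"
  by (simp add: normal_dot_def algebra_simps del: times_complex.sel)

definition fx :: "complex \<Rightarrow> complex" where "fx z = (Phi z + Psi z) / 2"
definition fy :: "complex \<Rightarrow> complex" where "fy z = (Phi z - Psi z) / (2 * \<i>)"
definition fz :: "complex \<Rightarrow> complex" where "fz z = \<i> * chi z"

lemma conformal: "z \<notin> sites \<Longrightarrow> (fx z)\<^sup>2 + (fy z)\<^sup>2 + (fz z)\<^sup>2 = 0"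
proof -
  assume "z \<notin> sites"
  have "(fx z)\<^sup>2 + (fy z)\<^sup>2 = Phi z * Psi z"
    by (simp add: fx_def fy_def power_divide power_mult_distrib power2_eq_square field_simps)
  then show ?thesis using Phi_Psi[OF \<open>z \<notin> sites\<close>] by (simp add: fz_def power_mult_distrib)
qed

lemma differentiable_data:
  assumes "z \<notin> sites"
  shows "(Phi has_field_derivative deriv Phi z) (at z)" "(Psi has_field_derivative deriv Psi z) (at z)"
    "(chi has_field_derivative deriv chi z) (at z)"
    "(Phia N has_field_derivative deriv (Phia N) z) (at z)" "(Psia N has_field_derivative deriv (Psia N) z) (at z)"
  unfolding Phi_def Psi_def chi_def Phia_def Psia_def DERIV_deriv_iff_field_differentiable
  by (intro weights.csum_deriv(2) weights_wlim weights_cnj weights_wapx weights_psign assms)+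

text \<open>The part of the derivative proportional to (a, b, c), which carries p', is orthogonal to
  the normal. Only the derivative of the Gauss map g survives.\<close>

lemma normal_dot_factor:
  fixes p p' g g' :: complex
  defines "a \<equiv> p * (g\<^sup>2 + 1) / 2" and "b \<equiv> p * (g\<^sup>2 - 1) / (2 * \<i>)" and "c \<equiv> \<i> * (p * g)"
  shows "cmod (normal_dot a b c ((p' * g\<^sup>2 + 2 * p * g * g' + p') / 2) ((p' * g\<^sup>2 + 2 * p * g * g' - p') / (2 * \<i>)) (\<i> * (p' * g + p * g')))
    \<le> sqrt (normal_sq a b c) * (cmod p * cmod g' * (2 * cmod g + 1))"
proof (cases "p = 0")
  case True
  then show ?thesis by (simp add: a_def b_def c_def normal_dot_def)
next
  case False
  define s where "s = p' / p"
  have p': "p' = s * p" using False by (simp add: s_def)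
  have eq: "(p' * g\<^sup>2 + 2 * p * g * g' + p') / 2 = s * a + (p * g') * g"
    "(p' * g\<^sup>2 + 2 * p * g * g' - p') / (2 * \<i>) = s * b + (p * g') * (g / \<i>)"
    "\<i> * (p' * g + p * g') = s * c + (p * g') * \<i>"
    by (simp_all add: p' a_def b_def c_def field_simps)
  have "cmod (normal_dot a b c g (g / \<i>) \<i>) \<le> sqrt (normal_sq a b c) * (2 * cmod g + 1)"
    using norm_normal_dot[of a b c g "g / \<i>" \<i>] by (simp add: norm_divide norm_mult)
  then have "cmod (p * g') * cmod (normal_dot a b c g (g / \<i>) \<i>) \<le> cmod (p * g') * (sqrt (normal_sq a b c) * (2 * cmod g + 1))"
    by (intro mult_left_mono) auto
  then show ?thesis unfolding eq normal_dot_linear normal_dot_self by (simp add: norm_mult mult_ac)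
qed

text \<open>Proved for each N, where the data factor through \<open>gapx N\<close>, with a bound in
  which N enters only through convergent quantities; hence stable in the limit.\<close>

lemma curvature_upper:
  assumes z: "z \<notin> sites" "0 \<le> Im z"
  shows "cmod (normal_dot (fx z) (fy z) (fz z) ((deriv Phi z + deriv Psi z) / 2) ((deriv Phi z - deriv Psi z) / (2 * \<i>)) (\<i> * deriv chi z))
    \<le> sqrt (normal_sq (fx z) (fy z) (fz z)) * (3 * cmod (Psi z) * hsum (cmod z))"
proof (rule LIMSEQ_le)
  have lim: "(\<lambda>N. deriv (Phia N) z) \<longlonglongrightarrow> deriv Phi z" "(\<lambda>N. deriv (Psia N) z) \<longlonglongrightarrow> deriv Psi z"
    unfolding Phia_def Phi_def Psia_def Psi_def
    by (intro csum_deriv_tendsto weights_wapx weights_wlim weights_cnj wapx_tendsto tendsto_cnj z)+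
  define a where "a N = (Phia N z + Psia N z) / 2" for N
  define b where "b N = (Phia N z - Psia N z) / (2 * \<i>)" for N
  have al: "a \<longlonglongrightarrow> fx z" "b \<longlonglongrightarrow> fy z" unfolding a_def b_def fx_def fy_def
    by (intro tendsto_intros Phia_tendsto Psia_tendsto; simp)+
  show "(\<lambda>N. cmod (normal_dot (a N) (b N) (fz z) ((deriv (Phia N) z + deriv (Psia N) z) / 2) ((deriv (Phia N) z - deriv (Psia N) z) / (2 * \<i>)) (\<i> * deriv chi z)))
     \<longlonglongrightarrow> cmod (normal_dot (fx z) (fy z) (fz z) ((deriv Phi z + deriv Psi z) / 2) ((deriv Phi z - deriv Psi z) / (2 * \<i>)) (\<i> * deriv chi z))"
    unfolding normal_dot_def by (intro tendsto_intros al lim) auto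
  show "(\<lambda>N. sqrt (normal_sq (a N) (b N) (fz z)) * (3 * cmod (Psia N z) * hsum (cmod z)))
     \<longlonglongrightarrow> sqrt (normal_sq (fx z) (fy z) (fz z)) * (3 * cmod (Psi z) * hsum (cmod z))"
    unfolding normal_sq_def by (intro tendsto_intros al Psia_tendsto)
  have "cmod (normal_dot (a N) (b N) (fz z) ((deriv (Phia N) z + deriv (Psia N) z) / 2) ((deriv (Phia N) z - deriv (Psia N) z) / (2 * \<i>)) (\<i> * deriv chi z))
      \<le> sqrt (normal_sq (a N) (b N) (fz z)) * (3 * cmod (Psia N z) * hsum (cmod z))" for N
  proof -
    define g where "g = gapx N z"
    define p where "p = Psia N z"
    define g' where "g' = deriv (gapx N) z"
    define p' where "p' = deriv (Psia N) z"
    have dg: "(gapx N has_field_derivative g') (at z)"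
      unfolding g'_def DERIV_deriv_iff_field_differentiable by (rule gapx_deriv(1)[OF z(2)])
    have dp: "(Psia N has_field_derivative p') (at z)" unfolding p'_def by (rule differentiable_data(5)[OF z(1)])
    \<comment> \<open>Differentiating the factorisation requires it on a full neighbourhood, and for
      real z this dips into the lower half plane; the finitely many poles of \<open>gapx N\<close>
      there are removed.\<close>
    define S where "S = - sites - (\<lambda>j. - \<i> * of_real (node j)) ` {..<N}"
    have S: "open S" "z \<in> S" unfolding S_def using z closed_sites not_node_upper[OF z(2)]
      by (auto intro!: open_Diff finite_imp_closed)
    have nS: "x \<notin> sites" "\<And>j. j < N \<Longrightarrow> x \<noteq> - \<i> * of_real (node j)" if "x \<in> S" for x using that unfolding S_def by blast+
    have "((\<lambda>z. Psia N z * gapx N z) has_field_derivative p' * g + g' * p) (at z)"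
      unfolding g_def p_def by (rule DERIV_mult[OF dp dg])
    then have "(chi has_field_derivative p' * g + g' * p) (at z)"
      by (rule has_field_derivative_transform_within_open[OF _ S]) (metis apx_factor(1) nS)
    then have dc: "deriv chi z = p' * g + p * g'" by (simp add: DERIV_imp_deriv mult.commute)
    have "((\<lambda>z. Psia N z * (gapx N z)\<^sup>2) has_field_derivative p' * g\<^sup>2 + (2 * (g * g')) * p) (at z)"
      unfolding g_def p_def using DERIV_mult[OF dp DERIV_power[OF dg, of 2]] by (simp add: mult_ac)
    then have "(Phia N has_field_derivative p' * g\<^sup>2 + (2 * (g * g')) * p) (at z)"
      by (rule has_field_derivative_transform_within_open[OF _ S]) (metis apx_factor(2) nS)
    then have dP: "deriv (Phia N) z = p' * g\<^sup>2 + 2 * p * g * g'" by (simp add: DERIV_imp_deriv mult_ac)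
    have P: "Phia N z = p * g\<^sup>2" "chi z = p * g"
      using apx_factor[OF z(1) not_node_upper[OF z(2)], of N] by (simp_all add: g_def p_def)
    have e: "a N = p * (g\<^sup>2 + 1) / 2" "b N = p * (g\<^sup>2 - 1) / (2 * \<i>)" "fz z = \<i> * (p * g)"
      by (simp_all add: a_def b_def fz_def P p_def[symmetric] algebra_simps)
    have "cmod (normal_dot (a N) (b N) (fz z) ((deriv (Phia N) z + p') / 2) ((deriv (Phia N) z - p') / (2 * \<i>)) (\<i> * deriv chi z))
      \<le> sqrt (normal_sq (a N) (b N) (fz z)) * (cmod p * cmod g' * (2 * cmod g + 1))"
      unfolding e dc dP by (rule normal_dot_factor)
    also have "\<dots> \<le> sqrt (normal_sq (a N) (b N) (fz z)) * (cmod p * hsum (cmod z) * 3)"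
      using norm_gapx_le[OF z(2), of N] gapx_deriv(2)[OF z(2), of N]
      by (intro mult_left_mono mult_mono) (auto simp: g_def g'_def normal_sq_def hsum_nonneg)
    finally show ?thesis by (simp add: p_def p'_def mult_ac)
  qed
  then show "\<exists>M. \<forall>N\<ge>M. cmod (normal_dot (a N) (b N) (fz z) ((deriv (Phia N) z + deriv (Psia N) z) / 2) ((deriv (Phia N) z - deriv (Psia N) z) / (2 * \<i>)) (\<i> * deriv chi z))
      \<le> sqrt (normal_sq (a N) (b N) (fz z)) * (3 * cmod (Psia N z) * hsum (cmod z))" by blast
qed

lemma data_deriv:
  assumes "z \<notin> sites"
  shows "(fx has_field_derivative (deriv Phi z + deriv Psi z) / 2) (at z)"
    "(fy has_field_derivative (deriv Phi z - deriv Psi z) / (2 * \<i>)) (at z)"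
    "(fz has_field_derivative \<i> * deriv chi z) (at z)"
  unfolding fx_def[abs_def] fy_def[abs_def] fz_def[abs_def]
  by (intro DERIV_cdivide DERIV_add DERIV_diff DERIV_cmult differentiable_data assms)+

lemma data_cnj: "fx (cnj z) = cnj (fx z)" "fy (cnj z) = cnj (fy z)" "fz (cnj z) = - cnj (fz z)"
  by (simp_all add: fx_def fy_def fz_def Psi_cnj chi_cnj add.commute complex_eq_iff diff_divide_distrib)

lemma normal_sq_bound:
  assumes z: "z \<notin> sites" "0 \<le> Im z"
  shows "(cmod (Psi z))\<^sup>2 / 4 \<le> sqrt (normal_sq (fx z) (fy z) (fz z))" "0 < normal_sq (fx z) (fy z) (fz z)"
proof -
  have "Psi z = fx z - \<i> * fy z" by (simp add: fx_def fy_def field_simps)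
  then have "cmod (Psi z) \<le> cmod (fx z) + cmod (fy z)" using norm_triangle_ineq4[of "fx z" "\<i> * fy z"] by (simp add: norm_mult)
  then have "(cmod (Psi z))\<^sup>2 \<le> (cmod (fx z) + cmod (fy z))\<^sup>2" by (intro power_mono) auto
  moreover have "0 \<le> (cmod (fx z) - cmod (fy z))\<^sup>2" by simp
  ultimately have 1: "(cmod (Psi z))\<^sup>2 \<le> 2 * ((cmod (fx z))\<^sup>2 + (cmod (fy z))\<^sup>2)"
    by (simp add: power2_eq_square algebra_simps)
  have e: "normal_sq (fx z) (fy z) (fz z) = (((cmod (fx z))\<^sup>2 + (cmod (fy z))\<^sup>2 + (cmod (fz z))\<^sup>2) / 2)\<^sup>2"
    by (rule normal_sq_conformal[OF conformal[OF z(1)]])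
  then show 2: "(cmod (Psi z))\<^sup>2 / 4 \<le> sqrt (normal_sq (fx z) (fy z) (fz z))" 
  proof -
    have "P \<le> 2 * (X + Y) \<Longrightarrow> 0 \<le> Z \<Longrightarrow> P / 4 \<le> (X + Y + Z) / 2" for P X Y Z :: real by simp
    moreover have "sqrt (normal_sq (fx z) (fy z) (fz z)) = ((cmod (fx z))\<^sup>2 + (cmod (fy z))\<^sup>2 + (cmod (fz z))\<^sup>2) / 2"
      unfolding e by (intro real_sqrt_unique) auto
    ultimately show ?thesis using 1 by (simp only: zero_le_power2)
  qed
  have "0 < (cmod (Psi z))\<^sup>2 / 4" using Psi_nonzero[OF z] by simp
  then show "0 < normal_sq (fx z) (fy z) (fz z)" using 2 by (metis less_le_trans real_sqrt_gt_0_iff)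
qed

text \<open>The constant is 3 * 10000 * 4, from \<open>curvature_upper\<close>,
  \<open>hsum_le_Psi\<close> and the lower bound |Psi|^2 / 4 for the length of the normal. The lower
  half plane is its mirror image.\<close>

lemma curvature_bound:
  assumes z: "z \<notin> sites"
  shows "normal_sq (fx z) (fy z) (fz z) > 0"
    "cmod (normal_dot (fx z) (fy z) (fz z) (deriv fx z) (deriv fy z) (deriv fz z)) \<le> 120000 * normal_sq (fx z) (fy z) (fz z)"
proof -
  have up: "cmod (normal_dot (fx z) (fy z) (fz z) (deriv fx z) (deriv fy z) (deriv fz z)) \<le> 120000 * normal_sq (fx z) (fy z) (fz z)"
    if z: "z \<notin> sites" "0 \<le> Im z" for z
  proof -
    let ?n = "sqrt (normal_sq (fx z) (fy z) (fz z))"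
    have "3 * cmod (Psi z) * hsum (cmod z) \<le> 3 * cmod (Psi z) * (10000 * cmod (Psi z))"
      by (intro mult_left_mono hsum_le_Psi z) auto
    also have "\<dots> = 120000 * ((cmod (Psi z))\<^sup>2 / 4)" by (simp add: power2_eq_square)
    also have "\<dots> \<le> 120000 * ?n" using normal_sq_bound(1)[OF z] by simp
    finally have "?n * (3 * cmod (Psi z) * hsum (cmod z)) \<le> ?n * (120000 * ?n)"
      using normal_sq_bound(2)[OF z] by (intro mult_left_mono) auto
    also have "\<dots> = 120000 * normal_sq (fx z) (fy z) (fz z)" using normal_sq_bound(2)[OF z] by simp
    finally show ?thesis using curvature_upper[OF z] unfolding data_deriv[OF z(1), THEN DERIV_imp_deriv] by linarith
  qed
  have "normal_sq (fx z) (fy z) (fz z) > 0 \<and>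
    cmod (normal_dot (fx z) (fy z) (fz z) (deriv fx z) (deriv fy z) (deriv fz z)) \<le> 120000 * normal_sq (fx z) (fy z) (fz z)"
  proof (cases "0 \<le> Im z")
    case False
    let ?y = "cnj z"
    have y: "?y \<notin> sites" "0 \<le> Im ?y" using False z by (auto simp: sites_cnj)
    have dc: "deriv f z = c * cnj (deriv f ?y)" if e: "\<And>z. f (cnj z) = c * cnj (f z)" and d: "(f has_field_derivative D) (at ?y)" for f c D
    proof -
      have "(cnj \<circ> f \<circ> cnj has_field_derivative cnj D) (at z)" using has_field_derivative_cnj_cnj[OF d] by simp
      then have "((\<lambda>z. c * (cnj \<circ> f \<circ> cnj) z) has_field_derivative c * cnj D) (at z)" by (rule DERIV_cmult)
      moreover have "(\<lambda>z. c * (cnj \<circ> f \<circ> cnj) z) = f"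
      proof
        fix x
        show "c * (cnj \<circ> f \<circ> cnj) x = f x" using e[of "cnj x"] by simp
      qed
      ultimately show ?thesis using d by (simp add: DERIV_imp_deriv)
    qed
    have d: "deriv fx z = cnj (deriv fx ?y)" "deriv fy z = cnj (deriv fy ?y)" "deriv fz z = - cnj (deriv fz ?y)"
      using dc[of fx 1, OF _ data_deriv(1)[OF y(1)]] dc[of fy 1, OF _ data_deriv(2)[OF y(1)]] dc[of fz "- 1", OF _ data_deriv(3)[OF y(1)]]
      by (simp_all add: data_cnj)
    have f: "fx z = cnj (fx ?y)" "fy z = cnj (fy ?y)" "fz z = - cnj (fz ?y)" by (simp_all add: data_cnj)
    have nd: "normal_dot (cnj a) (cnj b) (- cnj c) (cnj a') (cnj b') (- cnj c') = cnj (normal_dot a b c a' b' c')" for a b c a' b' c'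
      by (simp add: normal_dot_def complex_eq_iff algebra_simps)
    have "normal_sq (fx z) (fy z) (fz z) = normal_sq (fx ?y) (fy ?y) (fz ?y)"
      unfolding data_cnj normal_sq_def by (simp add: algebra_simps power2_eq_square)
    moreover have "cmod (normal_dot (fx z) (fy z) (fz z) (deriv fx z) (deriv fy z) (deriv fz z))
      = cmod (normal_dot (fx ?y) (fy ?y) (fz ?y) (deriv fx ?y) (deriv fy ?y) (deriv fz ?y))"
      unfolding d f nd by (rule complex_mod_cnj)
    ultimately show ?thesis using up[OF y] normal_sq_bound(2)[OF y] by simp
  qed (use up z normal_sq_bound in auto)
  then show "normal_sq (fx z) (fy z) (fz z) > 0"
    "cmod (normal_dot (fx z) (fy z) (fz z) (deriv fx z) (deriv fy z) (deriv fz z)) \<le> 120000 * normal_sq (fx z) (fy z) (fz z)" by auto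
qed

section \<open>The horizontal coordinates\<close>

text \<open>Dividing by the site in each logarithm makes the series converge and normalises the
  potential to 0 at the origin.\<close>

definition pot :: "(nat \<Rightarrow> real) \<Rightarrow> complex \<Rightarrow> real" where
  "pot w z = (\<Sum>i. w i * ln (cmod (1 - z / of_real (site i))))"

lemma abs_ln_norm_le:
  fixes v :: complex
  assumes "cmod v \<le> 1/2"
  shows "\<bar>ln (cmod (1 + v))\<bar> \<le> 2 * cmod v"
proof -
  have le: "1 - cmod v \<le> cmod (1 + v)" "cmod (1 + v) \<le> 1 + cmod v"
    using norm_triangle_ineq2[of 1 "- v"] norm_triangle_ineq[of 1 v] by simp_all
  have pos: "0 < cmod (1 + v)" using le assms by linarith
  have "ln (cmod (1 + v)) \<le> ln (1 + cmod v)" using le pos by simp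
  also have "\<dots> \<le> cmod v" by (rule ln_add_one_self_le_self) simp
  finally have 1: "ln (cmod (1 + v)) \<le> cmod v" .
  have "- cmod v - 2 * (cmod v)\<^sup>2 \<le> ln (1 - cmod v)" using assms by (intro ln_one_minus_pos_lower_bound) auto
  also have "\<dots> \<le> ln (cmod (1 + v))" using le assms pos by (subst ln_le_cancel_iff) linarith+
  finally have "- cmod v - 2 * (cmod v)\<^sup>2 \<le> ln (cmod (1 + v))" .
  moreover have "cmod v * cmod v \<le> (1/2) * cmod v" using assms by (intro mult_right_mono) auto
  ultimately show ?thesis using 1 norm_ge_zero[of v] unfolding power2_eq_square by linarith
qed

lemma cmod_site_quotient: "cmod (1 - z / of_real (site i)) = cmod (z - of_real (site i)) / \<bar>site i\<bar>"
proof -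
  have "site i \<noteq> 0" using abs_site_ge_1[of i] by auto
  then have "1 - z / of_real (site i) = - (z - of_real (site i)) / of_real (site i)" by (simp add: field_simps)
  then show ?thesis by (simp add: norm_divide norm_minus_commute)
qed

lemma pot_sums:
  assumes w: "\<And>i. \<bar>w i\<bar> \<le> 1"
  shows "(\<lambda>i. w i * ln (cmod (1 - z / of_real (site i)))) sums pot w z"
  unfolding pot_def
proof (rule summable_sums, rule summable_comparison_test_ev)
  show "summable (\<lambda>i. 2 * cmod z * (1 / \<bar>site i\<bar>))" by (intro summable_mult summable_inverse_site)
  show "\<forall>\<^sub>F i in sequentially. norm (w i * ln (cmod (1 - z / of_real (site i)))) \<le> 2 * cmod z * (1 / \<bar>site i\<bar>)"
    using eventually_site_ge[of "2 * cmod z"]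
  proof eventually_elim
    case (elim i)
    have "cmod (- z / of_real (site i)) \<le> 1/2" using elim abs_site_ge_1[of i] by (simp add: norm_divide divide_le_eq)
    then have "\<bar>ln (cmod (1 + - z / of_real (site i)))\<bar> \<le> 2 * cmod (- z / of_real (site i))" by (rule abs_ln_norm_le)
    then have "\<bar>ln (cmod (1 - z / of_real (site i)))\<bar> \<le> 2 * cmod z * (1 / \<bar>site i\<bar>)" by (simp add: norm_divide)
    moreover have "\<bar>w i\<bar> * \<bar>ln (cmod (1 - z / of_real (site i)))\<bar> \<le> 1 * \<bar>ln (cmod (1 - z / of_real (site i)))\<bar>"
      by (intro mult_right_mono w) simp
    ultimately show ?case by (simp add: abs_mult)
  qed
qed

lemma pot_diff:
  assumes w: "\<And>i. \<bar>w i\<bar> \<le> 1" and z: "z1 \<notin> sites" "z2 \<notin> sites"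
  shows "(\<lambda>i. w i * ln (cmod (z2 - of_real (site i)) / cmod (z1 - of_real (site i)))) sums (pot w z2 - pot w z1)"
proof -
  have "(\<lambda>i. w i * ln (cmod (1 - z2 / of_real (site i))) - w i * ln (cmod (1 - z1 / of_real (site i)))) sums (pot w z2 - pot w z1)"
    by (intro sums_diff pot_sums w)
  moreover have "w i * ln (cmod (1 - z2 / of_real (site i))) - w i * ln (cmod (1 - z1 / of_real (site i)))
     = w i * ln (cmod (z2 - of_real (site i)) / cmod (z1 - of_real (site i)))" for i
  proof -
    have "cmod (z1 - of_real (site i)) > 0" "cmod (z2 - of_real (site i)) > 0" using notin_sites[OF z(1)] notin_sites[OF z(2)] by simp_all
    moreover have "\<bar>site i\<bar> > 0" using abs_site_ge_1[of i] by linarith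
    ultimately show ?thesis unfolding cmod_site_quotient by (simp add: ln_div right_diff_distrib)
  qed
  ultimately show ?thesis by simp
qed

lemma pot_expand:
  assumes w: "\<And>i. \<bar>w i\<bar> \<le> 1" and d: "0 < d" "\<And>i. d \<le> cmod (z0 - of_real (site i))" and z: "z \<in> ball z0 (d / 2)"
  shows "pot w z = pot w z0 + Re (weights.logsum (\<lambda>i. of_real (w i)) z0 z)"
proof -
  have W: "weights (\<lambda>i. of_real (w i))" using w by (simp add: weights_def)
  have nz: "z - of_real (site i) \<noteq> 0" "z0 - of_real (site i) \<noteq> 0" for i
    using weights.half_dist(2)[OF W d(2) z, of i] d(1) d(2)[of i] by auto
  then have ns: "z \<notin> sites" "z0 \<notin> sites" by (auto simp: sites_def)
  have A: "(\<lambda>i. Re (of_real (w i) * Ln (1 + (z - z0) / (z0 - of_real (site i))))) sums Re (weights.logsum (\<lambda>i. of_real (w i)) z0 z)"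
    by (rule sums_Re[OF weights.logsum_props(1)[OF W d z]])
  have B: "Re (of_real (w i) * Ln (1 + (z - z0) / (z0 - of_real (site i)))) = w i * ln (cmod (z - of_real (site i)) / cmod (z0 - of_real (site i)))" for i
  proof -
    have e: "1 + (z - z0) / (z0 - of_real (site i)) = (z - of_real (site i)) / (z0 - of_real (site i))" using nz[of i] by (simp add: field_simps)
    show ?thesis unfolding e using nz[of i] by (simp add: norm_divide)
  qed
  show ?thesis using sums_unique2[OF A[unfolded B] pot_diff[OF w ns(2,1)]] by simp
qed

lemma has_derivative_Re_field:
  assumes "(f has_field_derivative D) (at z)"
  shows "((\<lambda>z. Re (f z)) has_derivative (\<lambda>h. Re (D * h))) (at z)"
  using bounded_linear.has_derivative[OF bounded_linear_Re assms[unfolded has_field_derivative_def]] by simp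

lemma pot_deriv:
  assumes w: "\<And>i. \<bar>w i\<bar> \<le> 1" and z: "z0 \<notin> sites"
  shows "(pot w has_derivative (\<lambda>h. Re (csum (\<lambda>i. of_real (w i)) z0 * h))) (at z0)"
proof -
  have W: "weights (\<lambda>i. of_real (w i))" using w by (simp add: weights_def)
  obtain d where d: "d > 0" "\<And>i. d \<le> cmod (z0 - of_real (site i))" using sites_dist[OF z] by blast
  have z0: "z0 \<in> ball z0 (d / 2)" using d by simp
  have "((\<lambda>z. pot w z0 + Re (weights.logsum (\<lambda>i. of_real (w i)) z0 z)) has_derivative (\<lambda>h. 0 + Re (csum (\<lambda>i. of_real (w i)) z0 * h))) (at z0)"
    by (intro has_derivative_add has_derivative_const has_derivative_Re_field weights.logsum_props(2)[OF W d z0])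
  then have "(pot w has_derivative (\<lambda>h. 0 + Re (csum (\<lambda>i. of_real (w i)) z0 * h))) (at z0)"
    by (rule has_derivative_transform_within_open[OF _ open_ball z0 pot_expand[OF w d, symmetric]])
  then show ?thesis by simp
qed

lemma pot_cnj: "pot w (cnj z) = pot w z"
proof -
  have "cmod (1 - cnj z / of_real (site i)) = cmod (1 - z / of_real (site i))" for i
  proof -
    have "1 - cnj z / of_real (site i) = cnj (1 - z / of_real (site i))" by simp
    then show ?thesis by (metis complex_mod_cnj)
  qed
  then show ?thesis by (simp add: pot_def)
qed

lemma ln_ratio_bound:
  fixes b z1 z2 :: complex
  assumes "z1 \<noteq> b" "z2 \<noteq> b"
  shows "\<bar>ln (cmod (z2 - b) / cmod (z1 - b))\<bar> \<le> cmod (z2 - z1) * (1 / cmod (z1 - b) + 1 / cmod (z2 - b))"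
proof -
  define r1 r2 where "r1 = cmod (z1 - b)" and "r2 = cmod (z2 - b)"
  have r: "r1 > 0" "r2 > 0" using assms by (simp_all add: r1_def r2_def)
  have t: "r2 - r1 \<le> cmod (z2 - z1)" "r1 - r2 \<le> cmod (z2 - z1)"
    using norm_triangle_ineq2[of "z2 - b" "z1 - b"] norm_triangle_ineq2[of "z1 - b" "z2 - b"] norm_minus_commute[of z1 z2]
    by (simp_all add: r1_def r2_def)
  have "ln (r2 / r1) \<le> r2 / r1 - 1" using r by (intro ln_le_minus_one) auto
  also have "\<dots> = (r2 - r1) / r1" using r by (simp add: field_simps)
  also have "\<dots> \<le> cmod (z2 - z1) / r1" using t r by (intro divide_right_mono) auto
  finally have 1: "ln (r2 / r1) \<le> cmod (z2 - z1) / r1" .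
  have "ln (r1 / r2) \<le> r1 / r2 - 1" using r by (intro ln_le_minus_one) auto
  also have "\<dots> = (r1 - r2) / r2" using r by (simp add: field_simps)
  also have "\<dots> \<le> cmod (z2 - z1) / r2" using t r by (intro divide_right_mono) auto
  finally have 2: "- ln (r2 / r1) \<le> cmod (z2 - z1) / r2" using r by (simp add: ln_div)
  have "0 \<le> cmod (z2 - z1) / r1" "0 \<le> cmod (z2 - z1) / r2" using r by auto
  then have "\<bar>ln (r2 / r1)\<bar> \<le> cmod (z2 - z1) / r1 + cmod (z2 - z1) / r2" using 1 2 by linarith
  then show ?thesis by (simp add: r1_def r2_def algebra_simps)
qed

lemma sites_separated:
  assumes "i \<noteq> j"
  shows "1 \<le> \<bar>site i - site j\<bar>"
proof -
  have p: "1 \<le> pole k" for k by (rule pole_ge_1)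
  have gap: "pole k + 1 \<le> pole l" if "k < l" for k l
    using pole_Suc_ge[of k] pole_mono[of "Suc k" l] p[of k] that by simp
  show ?thesis
  proof (cases "even i = even j")
    case True
    then have "i div 2 \<noteq> j div 2" using assms
    proof -
      have "i mod 2 = j mod 2" using True by (simp add: mod2_eq_if)
      then show ?thesis using assms by (metis div_mult_mod_eq)
    qed
    then show ?thesis using True gap[of "i div 2" "j div 2"] gap[of "j div 2" "i div 2"] by (auto simp: site_def neq_iff)
  next
    case False
    then show ?thesis using p[of "i div 2"] p[of "j div 2"] by (auto simp: site_def)
  qed
qed

lemma pot_near_site:
  assumes w: "\<And>i. \<bar>w i\<bar> \<le> 1"
  obtains C where "\<And>z. z \<notin> sites \<Longrightarrow> cmod (z - of_real (site i)) \<le> 1/2 \<Longrightarrow> \<bar>pot w z - w i * ln (cmod (z - of_real (site i)))\<bar> \<le> C"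
proof -
  let ?b = "\<lambda>j. complex_of_real (site j)"
  \<comment> \<open>A reference point at distance exactly 1 from the site, so that its own logarithm
    there is 0.\<close>
  define z0 where "z0 = ?b i + \<i>"
  \<comment> \<open>Within 1/2 of the site one has |z - z0| <= 2 and the distances to every other
    site are comparable up to a factor 4, hence 10 = 2 * (1 + 4).\<close>
  define M where "M j = 10 * (1 / cmod (z0 - ?b j))" for j
  have z0: "z0 \<notin> sites" unfolding z0_def by (intro notin_sites_Im) simp
  have M: "summable M" unfolding M_def by (intro summable_mult summable_inverse_dist)
  have "\<bar>pot w z - w i * ln (cmod (z - ?b i))\<bar> \<le> suminf M + \<bar>pot w z0\<bar>"
    if z: "z \<notin> sites" and zi: "cmod (z - ?b i) \<le> 1/2" for z
  proof -
    let ?t = "\<lambda>j. w j * ln (cmod (z - ?b j) / cmod (z0 - ?b j))"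
    have "(\<lambda>j. ?t j - (if j = i then ?t j else 0)) sums (pot w z - pot w z0 - ?t i)"
      by (intro sums_diff pot_diff w z z0 sums_single)
    then have s: "(\<lambda>j. if j = i then 0 else ?t j) sums (pot w z - pot w z0 - ?t i)"
      by (rule sums_cong[THEN iffD1, rotated]) simp
    have "\<bar>if j = i then 0 else ?t j\<bar> \<le> M j" for j
    proof (cases "j = i")
      case False
      define r where "r = \<bar>site i - site j\<bar>"
      have r: "1 \<le> r" unfolding r_def using sites_separated[of i j] False by simp
      have rb: "cmod (?b i - ?b j) = r" by (simp only: r_def of_real_diff[symmetric] norm_of_real)
      have "r \<le> cmod (z - ?b j) + cmod (z - ?b i)"
        using norm_triangle_ineq4[of "z - ?b j" "z - ?b i"] rb by simp
      then have a: "r / 2 \<le> cmod (z - ?b j)" using zi r by linarith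
      have "cmod (z0 - ?b j) \<le> r + 1"
        using norm_triangle_ineq[of "?b i - ?b j" \<i>] rb by (simp add: z0_def add_diff_eq add.commute diff_add_eq)
      then have b: "cmod (z0 - ?b j) \<le> 4 * cmod (z - ?b j)" using a r by linarith
      have pos: "0 < cmod (z0 - ?b j)" "0 < cmod (z - ?b j)" using notin_sites[OF z0, of j] notin_sites[OF z, of j] by auto
      have c: "1 / cmod (z - ?b j) \<le> 4 * (1 / cmod (z0 - ?b j))" using b pos by (simp add: field_simps)
      have "cmod (z - z0) \<le> 2" using norm_triangle_ineq4[of "z - ?b i" \<i>] zi by (simp add: z0_def diff_diff_eq)
      then have "cmod (z - z0) * (1 / cmod (z0 - ?b j) + 1 / cmod (z - ?b j)) \<le> 2 * (1 / cmod (z0 - ?b j) + 4 * (1 / cmod (z0 - ?b j)))"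
        using c by (intro mult_mono) auto
      then have "\<bar>ln (cmod (z - ?b j) / cmod (z0 - ?b j))\<bar> \<le> M j"
        using ln_ratio_bound[of z0 "?b j" z] pos by (simp add: M_def)
      moreover have "\<bar>w j\<bar> * \<bar>ln (cmod (z - ?b j) / cmod (z0 - ?b j))\<bar> \<le> 1 * \<bar>ln (cmod (z - ?b j) / cmod (z0 - ?b j))\<bar>"
        by (intro mult_right_mono w) simp
      ultimately show ?thesis using False by (simp add: abs_mult)
    qed (simp add: M_def)
    then have "norm (\<Sum>j. if j = i then 0 else ?t j) \<le> suminf M" by (intro norm_suminf_le M) (simp only: real_norm_def)
    then have "\<bar>pot w z - pot w z0 - ?t i\<bar> \<le> suminf M" using sums_unique[OF s] by simp
    moreover have "?t i = w i * ln (cmod (z - ?b i))" by (simp add: z0_def)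
    ultimately show ?thesis by linarith
  qed
  then show ?thesis using that by blast
qed

text \<open>The logarithm of a quotient of distances has the sign of the difference of the squared
  distances, so all terms of the difference series have one sign. The squares are used because their
  difference is affine in the site.\<close>

lemma pot_injective:
  assumes w: "\<And>i. \<bar>w i\<bar> \<le> 1" and z: "z1 \<notin> sites" "z2 \<notin> sites"
    and sign: "\<And>i. 0 \<le> \<kappa> * (w i * ((cmod (z2 - of_real (site i)))\<^sup>2 - (cmod (z1 - of_real (site i)))\<^sup>2))"
    and strict: "0 < \<kappa> * (w j * ((cmod (z2 - of_real (site j)))\<^sup>2 - (cmod (z1 - of_real (site j)))\<^sup>2))"
  shows "pot w z1 \<noteq> pot w z2"
proof
  assume eq: "pot w z1 = pot w z2"
  let ?r1 = "\<lambda>i. cmod (z1 - of_real (site i))" and ?r2 = "\<lambda>i. cmod (z2 - of_real (site i))"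
  have r: "?r1 i > 0" "?r2 i > 0" for i using notin_sites[OF z(1), of i] notin_sites[OF z(2), of i] by auto
  have s: "(\<lambda>i. \<kappa> * (w i * ln (?r2 i / ?r1 i))) sums 0"
    using sums_mult[OF pot_diff[where w = w, OF w z], of \<kappa>] eq by simp
  have ln2: "ln (?r2 i / ?r1 i) = ((?r2 i)\<^sup>2 - (?r1 i)\<^sup>2) * c i" "0 < c i"
    if "c i = (if ?r2 i = ?r1 i then 1 else ln (?r2 i / ?r1 i) / ((?r2 i)\<^sup>2 - (?r1 i)\<^sup>2))" for i c
  proof -
    have sq: "(?r2 i)\<^sup>2 - (?r1 i)\<^sup>2 = (?r2 i - ?r1 i) * (?r2 i + ?r1 i)" by (simp add: power2_eq_square algebra_simps)
    have nz: "(?r2 i)\<^sup>2 - (?r1 i)\<^sup>2 \<noteq> 0" if "?r2 i \<noteq> ?r1 i"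
    proof -
      have "?r2 i + ?r1 i > 0" by (rule add_pos_pos[OF r(2) r(1)])
      then show ?thesis unfolding sq using that by simp
    qed
    show "ln (?r2 i / ?r1 i) = ((?r2 i)\<^sup>2 - (?r1 i)\<^sup>2) * c i" unfolding that using r[of i] nz by auto
    consider "?r2 i = ?r1 i" | "?r2 i < ?r1 i" | "?r1 i < ?r2 i" by linarith
    then show "0 < c i"
    proof cases
      case 2
      then have "ln (?r2 i / ?r1 i) < 0" using r[of i] by simp
      moreover have "(?r2 i)\<^sup>2 - (?r1 i)\<^sup>2 < 0" unfolding sq using 2 by (intro mult_neg_pos add_pos_pos r) auto
      ultimately show ?thesis unfolding that using 2 by (simp add: divide_neg_neg)
    next
      case 3
      then have "ln (?r2 i / ?r1 i) > 0" using r[of i] by simp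
      moreover have "(?r2 i)\<^sup>2 - (?r1 i)\<^sup>2 > 0" unfolding sq using 3 by (intro mult_pos_pos add_pos_pos r) auto
      ultimately show ?thesis unfolding that using 3 by simp
    qed (simp add: that)
  qed
  define c where "c i = (if ?r2 i = ?r1 i then 1 else ln (?r2 i / ?r1 i) / ((?r2 i)\<^sup>2 - (?r1 i)\<^sup>2))" for i
  have trm: "\<kappa> * (w i * ln (?r2 i / ?r1 i)) = \<kappa> * (w i * ((?r2 i)\<^sup>2 - (?r1 i)\<^sup>2)) * c i" and c: "0 < c i" for i
    using ln2[of c i] by (simp_all add: c_def)
  have nn: "0 \<le> \<kappa> * (w i * ln (?r2 i / ?r1 i))" for i unfolding trm using sign[of i] c[of i] by simp
  have "0 < \<kappa> * (w j * ln (?r2 j / ?r1 j))" unfolding trm using strict c[of j] by simp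
  then have "0 < (\<Sum>i. \<kappa> * (w i * ln (?r2 i / ?r1 i)))" using suminf_pos2[OF sums_summable[OF s] nn] by blast
  then show False using sums_unique[OF s] by simp
qed

section \<open>Injectivity of the horizontal projection\<close>

definition surfx :: "complex \<Rightarrow> real" where "surfx = pot (\<lambda>i. Re (wlim i))"
definition surfy :: "complex \<Rightarrow> real" where "surfy = pot (\<lambda>i. Im (wlim i))"

lemma norm_wlim: "cmod (wlim i) = 1"
  by (simp add: wlim_def)

lemma wlim_parts_le: "\<bar>Re (wlim i)\<bar> \<le> 1" "\<bar>Im (wlim i)\<bar> \<le> 1"
  using abs_Re_le_cmod[of "wlim i"] abs_Im_le_cmod[of "wlim i"] by (simp_all add: norm_wlim)

lemma pot_linear:
  assumes v: "\<And>i. \<bar>v i\<bar> \<le> 1" and w: "\<And>i. \<bar>w i\<bar> \<le> 1"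
  shows "pot (\<lambda>i. s * v i + t * w i) z = s * pot v z + t * pot w z"
proof -
  have "(\<lambda>i. s * (v i * ln (cmod (1 - z / of_real (site i)))) + t * (w i * ln (cmod (1 - z / of_real (site i))))) sums (s * pot v z + t * pot w z)"
    by (intro sums_add sums_mult pot_sums v w)
  then show ?thesis unfolding pot_def[of "\<lambda>i. s * v i + t * w i"] by (simp add: sums_iff algebra_simps)
qed

lemma wlim_even [simp]: "wlim (2 * k) = cis (eta k)" and wlim_odd [simp]: "wlim (Suc (2 * k)) = - cis (- eta k)" "wlim (2 * k + 1) = - cis (- eta k)"
  by (auto simp: wlim_def)

lemma even_odd_cases:
  obtains k where "i = 2 * k" | k where "i = Suc (2 * k)"
  by (metis evenE oddE Suc_eq_plus1)

lemma sin_eta_nonneg: "0 \<le> sin (eta k)" and cos_eta_pos: "0 < cos (eta k)" and sin_eta_0: "0 < sin (eta 0)"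
proof -
  have e: "0 \<le> eta k" "eta k \<le> 3/100" for k using eta_nonneg eta_le by auto
  have p: "3/100 < pi / 2" using pi_gt3 by simp
  show "0 \<le> sin (eta k)" using e[of k] p by (intro sin_ge_zero) auto
  show "0 < cos (eta k)" using e[of k] p by (intro cos_gt_zero_pi) auto
  show "0 < sin (eta 0)" using eta_0 p by (intro sin_gt_zero) auto
qed

text \<open>Rotated by a right angle minus b = \<open>eta n\<close>, with n the first index whose
  pole reaches |x0|, the weights on the side of x0 become sin (b - eta k) up to sign. Since
  \<open>eta\<close> decreases they change sign exactly where the poles pass |x0|; on the other side
  they are sin (b + eta k) and never change sign.\<close>

lemma direction_exists:
  obtains \<alpha> where "\<And>i. \<bar>cos \<alpha> * Re (wlim i) + sin \<alpha> * Im (wlim i)\<bar> \<le> 1"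
    "\<And>i. 0 \<le> (cos \<alpha> * Re (wlim i) + sin \<alpha> * Im (wlim i)) * (site i - x0)"
    "\<exists>j. 0 < (cos \<alpha> * Re (wlim j) + sin \<alpha> * Im (wlim j)) * (site j - x0)"
proof -
  have le: "\<bar>cos \<alpha> * Re (wlim i) + sin \<alpha> * Im (wlim i)\<bar> \<le> 1" for \<alpha> i
  proof -
    have "Re (cis (- \<alpha>) * wlim i) = cos \<alpha> * Re (wlim i) + sin \<alpha> * Im (wlim i)" by simp
    then show ?thesis using abs_Re_le_cmod[of "cis (- \<alpha>) * wlim i"] by (simp add: norm_mult norm_wlim del: times_complex.sel)
  qed
  have ex: "\<exists>n. \<bar>x0\<bar> \<le> pole n"
  proof -
    obtain n where "\<bar>x0\<bar> < 10000 ^ n" using real_arch_pow[of 10000 "\<bar>x0\<bar>"] by auto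
    then show ?thesis using pole_ge_power[of n] by (intro exI[of _ n]) linarith
  qed
  \<comment> \<open>The rotation angle b is read off at the first pole beyond |x0|.\<close>
  define n where "n = (LEAST n. \<bar>x0\<bar> \<le> pole n)"
  define b where "b = eta n"
  have ge: "\<bar>x0\<bar> \<le> pole k \<and> eta k \<le> b" if "n \<le> k" for k
    using LeastI_ex[OF ex] pole_mono[OF that] eta_antimono[OF that] unfolding n_def b_def by auto
  have lt: "pole k < \<bar>x0\<bar> \<and> b \<le> eta k" if "k < n" for k
    using not_less_Least[of k "\<lambda>n. \<bar>x0\<bar> \<le> pole n"] that eta_antimono[of k n] unfolding n_def b_def by auto
  have e: "0 \<le> eta k" "eta k \<le> 3/100" for k using eta_nonneg eta_le by auto
  have b: "0 \<le> b" "b \<le> 3/100" using e by (auto simp: b_def)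
  have p: "3 < pi" by (rule pi_gt3)
  have diff: "0 \<le> sin (b - eta k) * (pole k - \<bar>x0\<bar>)" for k
  proof (cases "n \<le> k")
    case True
    then have "0 \<le> sin (b - eta k)" using ge e[of k] b p by (intro sin_ge_zero) auto
    then show ?thesis using ge[OF True] by simp
  next
    case False
    then have "0 \<le> sin (eta k - b)" using lt[of k] e[of k] b p by (intro sin_ge_zero) auto
    then have "sin (b - eta k) \<le> 0" using sin_minus[of "eta k - b"] by simp
    then show ?thesis using lt[of k] False by (intro mult_nonpos_nonpos) auto
  qed
  have plus: "0 \<le> sin (b + eta k)" for k using e[of k] b p by (intro sin_ge_zero) auto
  have plus0: "0 < sin (b + eta 0)" using b eta_0 p by (intro sin_gt_zero) auto
  have pp: "0 < pole k" for k by (rule pole_pos)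
  show ?thesis
  proof (cases "0 \<le> x0")
    case True
    define \<alpha> where "\<alpha> = b - pi / 2"
    have a: "cos \<alpha> = sin b" "sin \<alpha> = - cos b" by (simp_all add: \<alpha>_def cos_diff sin_diff)
    have ev: "cos \<alpha> * Re (wlim (2 * k)) + sin \<alpha> * Im (wlim (2 * k)) = sin (b - eta k)" for k
      by (simp add: a sin_diff)
    have od: "cos \<alpha> * Re (wlim (Suc (2 * k))) + sin \<alpha> * Im (wlim (Suc (2 * k))) = - sin (b + eta k)" for k
      by (simp add: a sin_add)
    have nn: "0 \<le> (cos \<alpha> * Re (wlim i) + sin \<alpha> * Im (wlim i)) * (site i - x0)" for i
    proof (cases i rule: even_odd_cases)
      case (1 k)
      then show ?thesis using diff[of k] True unfolding 1 ev by simp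
    next
      case (2 k)
      have "- sin (b + eta k) * (- pole k - x0) = sin (b + eta k) * (pole k + x0)" by (simp add: algebra_simps)
      then show ?thesis using plus[of k] pp[of k] True unfolding 2 od by simp
    qed
    have "- sin (b + eta 0) * (- pole 0 - x0) = sin (b + eta 0) * (pole 0 + x0)" by (simp add: algebra_simps)
    then have "0 < (cos \<alpha> * Re (wlim (Suc (2 * 0))) + sin \<alpha> * Im (wlim (Suc (2 * 0)))) * (site (Suc (2 * 0)) - x0)"
      unfolding od using plus0 pp[of 0] True by (simp only: site_odd) simp
    then show ?thesis using that[OF le nn] by blast
  next
    case False
    define \<alpha> where "\<alpha> = pi / 2 - b"
    have a: "cos \<alpha> = sin b" "sin \<alpha> = cos b" by (simp_all add: \<alpha>_def cos_diff sin_diff)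
    have ev: "cos \<alpha> * Re (wlim (2 * k)) + sin \<alpha> * Im (wlim (2 * k)) = sin (b + eta k)" for k
      by (simp add: a sin_add)
    have od: "cos \<alpha> * Re (wlim (Suc (2 * k))) + sin \<alpha> * Im (wlim (Suc (2 * k))) = - sin (b - eta k)" for k
      by (simp add: a sin_diff)
    have nn: "0 \<le> (cos \<alpha> * Re (wlim i) + sin \<alpha> * Im (wlim i)) * (site i - x0)" for i
    proof (cases i rule: even_odd_cases)
      case (1 k)
      then show ?thesis using plus[of k] pp[of k] False unfolding 1 ev by simp
    next
      case (2 k)
      have "- sin (b - eta k) * (- pole k - x0) = sin (b - eta k) * (pole k - \<bar>x0\<bar>)" using False by (simp add: algebra_simps)
      then show ?thesis using diff[of k] unfolding 2 od by simp
    qed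
    have "0 < (cos \<alpha> * Re (wlim (2 * 0)) + sin \<alpha> * Im (wlim (2 * 0))) * (site (2 * 0) - x0)"
      unfolding ev using plus0 pp[of 0] False by (simp only: site_even) simp
    then show ?thesis using that[OF le nn] by blast
  qed
qed

lemma surf_injective:
  assumes z: "z1 \<notin> sites" "z2 \<notin> sites" "0 \<le> Im z1" "0 \<le> Im z2"
    and eq: "surfx z1 = surfx z2" "surfy z1 = surfy z2"
  shows "z1 = z2"
proof (rule ccontr)
  assume ne: "z1 \<noteq> z2"
  have sq: "(cmod (z2 - of_real b))\<^sup>2 - (cmod (z1 - of_real b))\<^sup>2
     = (cmod z2)\<^sup>2 - (cmod z1)\<^sup>2 - 2 * b * (Re z2 - Re z1)" for b
    unfolding cmod_power2 by (simp add: power2_eq_square algebra_simps)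
  show False
  proof (cases "Re z1 = Re z2")
    case True
    \<comment> \<open>The perpendicular bisector of the two points is parallel to the real axis, so
      one of them is nearer to every site; the second coordinate decides because its weights are
      nonnegative and one of them is positive.\<close>
    define \<kappa> where "\<kappa> = (Im z2)\<^sup>2 - (Im z1)\<^sup>2"
    have k: "(cmod (z2 - of_real b))\<^sup>2 - (cmod (z1 - of_real b))\<^sup>2 = \<kappa>" for b
      unfolding sq unfolding cmod_power2 \<kappa>_def by (simp add: True)
    have "Im z1 \<noteq> Im z2" using True ne by (simp add: complex_eq_iff)
    then have "\<kappa> \<noteq> 0" unfolding \<kappa>_def using z by (simp add: power2_eq_iff_nonneg)
    then have k2: "0 < \<kappa> * \<kappa>" by (simp add: zero_less_mult_iff) linarith
    have "0 \<le> Im (wlim i)" for i by (cases i rule: even_odd_cases) (auto simp: sin_eta_nonneg)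
    moreover have "0 < Im (wlim (2 * 0))" unfolding wlim_even by (simp add: sin_eta_0)
    ultimately have "pot (\<lambda>i. Im (wlim i)) z1 \<noteq> pot (\<lambda>i. Im (wlim i)) z2"
      using k2 by (intro pot_injective[where w = "\<lambda>i. Im (wlim i)" and j = "2 * 0" and \<kappa> = \<kappa>, OF wlim_parts_le(2) z(1,2)]) (auto simp: k mult.left_commute[of \<kappa>])
    then show False using eq by (simp add: surfy_def)
  next
    case False
    define \<kappa> where "\<kappa> = Re z1 - Re z2"
    \<comment> \<open>The perpendicular bisector meets the real axis at x0: sites on one side of x0
      are nearer to z1, those on the other side nearer to z2.\<close>
    define x0 where "x0 = ((cmod z2)\<^sup>2 - (cmod z1)\<^sup>2) / (- 2 * \<kappa>)"
    have k0: "\<kappa> \<noteq> 0" using False by (simp add: \<kappa>_def)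
    have x0: "(cmod z2)\<^sup>2 - (cmod z1)\<^sup>2 = - 2 * \<kappa> * x0" using k0 by (simp add: x0_def)
    have k: "(cmod (z2 - of_real b))\<^sup>2 - (cmod (z1 - of_real b))\<^sup>2 = 2 * \<kappa> * (b - x0)" for b
      unfolding sq x0 by (simp add: \<kappa>_def algebra_simps)
    obtain \<alpha> where a: "\<And>i. \<bar>cos \<alpha> * Re (wlim i) + sin \<alpha> * Im (wlim i)\<bar> \<le> 1"
      "\<And>i. 0 \<le> (cos \<alpha> * Re (wlim i) + sin \<alpha> * Im (wlim i)) * (site i - x0)"
      "\<exists>j. 0 < (cos \<alpha> * Re (wlim j) + sin \<alpha> * Im (wlim j)) * (site j - x0)"
      using direction_exists[of x0] by blast
    then obtain j where j: "0 < (cos \<alpha> * Re (wlim j) + sin \<alpha> * Im (wlim j)) * (site j - x0)" by blast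
    have k2: "0 < 2 * (\<kappa> * \<kappa>)" using k0 by (simp add: zero_less_mult_iff) linarith
    have e: "\<kappa> * (x * (2 * \<kappa> * y)) = (2 * (\<kappa> * \<kappa>)) * (x * y)" for x y by (simp add: algebra_simps)
    have "pot (\<lambda>i. cos \<alpha> * Re (wlim i) + sin \<alpha> * Im (wlim i)) z1 \<noteq> pot (\<lambda>i. cos \<alpha> * Re (wlim i) + sin \<alpha> * Im (wlim i)) z2"
    proof (rule pot_injective[where w = "\<lambda>i. cos \<alpha> * Re (wlim i) + sin \<alpha> * Im (wlim i)" and j = j and \<kappa> = \<kappa>, OF a(1) z(1,2)])
      fix i
      show "0 \<le> \<kappa> * ((cos \<alpha> * Re (wlim i) + sin \<alpha> * Im (wlim i)) * ((cmod (z2 - of_real (site i)))\<^sup>2 - (cmod (z1 - of_real (site i)))\<^sup>2))"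
        unfolding k e by (rule mult_nonneg_nonneg[OF less_imp_le[OF k2] a(2)])
      show "0 < \<kappa> * ((cos \<alpha> * Re (wlim j) + sin \<alpha> * Im (wlim j)) * ((cmod (z2 - of_real (site j)))\<^sup>2 - (cmod (z1 - of_real (site j)))\<^sup>2))"
        unfolding k e by (rule mult_pos_pos[OF k2 j])
    qed
    then show False using eq 
      unfolding pot_linear[where v = "\<lambda>i. Re (wlim i)" and w = "\<lambda>i. Im (wlim i)", OF wlim_parts_le] by (simp add: surfx_def surfy_def)
  qed
qed

section \<open>Growth of the horizontal coordinates\<close>

lemma surf_pairs:
  "(\<lambda>k. cos (eta k) * (ln (cmod (1 - z / of_real (pole k))) - ln (cmod (1 + z / of_real (pole k))))) sums surfx z"
  "(\<lambda>k. sin (eta k) * (ln (cmod (1 - z / of_real (pole k))) + ln (cmod (1 + z / of_real (pole k))))) sums surfy z"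
  using sums_pairs[OF pot_sums[where w = "\<lambda>i. Re (wlim i)" and z = z, OF wlim_parts_le(1)]]
    sums_pairs[OF pot_sums[where w = "\<lambda>i. Im (wlim i)" and z = z, OF wlim_parts_le(2)]]
  by (simp_all add: surfx_def surfy_def right_diff_distrib distrib_left)

lemma sums_split_bound:
  fixes f :: "nat \<Rightarrow> real"
  assumes s: "f sums S" and t: "\<And>i. \<bar>f (Suc m + i)\<bar> \<le> 2 * (1/10000) ^ i"
  shows "\<bar>S - (\<Sum>k<m. f k) - f m\<bar> \<le> 3"
proof -
  have geo: "(\<lambda>i. 2 * (1/10000::real) ^ i) sums (2 * (1 / (1 - 1/10000)))" by (intro sums_mult geometric_sums) simp
  have "(\<lambda>i. f (i + Suc m)) sums (S - (\<Sum>k<Suc m. f k))" by (rule sums_split_initial_segment[OF s])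
  then have u: "(\<lambda>i. f (Suc m + i)) sums (S - (\<Sum>k<Suc m. f k))" by (simp add: add.commute)
  have "norm (\<Sum>i. f (Suc m + i)) \<le> (\<Sum>i. 2 * (1/10000) ^ i)"
    using t by (intro norm_suminf_le sums_summable[OF geo]) (simp only: real_norm_def)
  then have "\<bar>S - (\<Sum>k<Suc m. f k)\<bar> \<le> 2 * (1 / (1 - 1/10000))" using sums_unique[OF u] sums_unique[OF geo] by simp
  also have "\<dots> \<le> 3" by simp
  finally show ?thesis by (simp add: diff_diff_eq)
qed

text \<open>If $|z|$ lies between consecutive poles, the terms of lower index contribute the logarithmic growth to
  the second coordinate, those of higher index are negligible, and the term of the nearby pole enters both
  coordinates with comparable size.\<close>

lemma growth:
  obtains C where "\<And>z. z \<notin> sites \<Longrightarrow> 1/2 < cmod z \<Longrightarrow>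
    2 * sin (eta 0) * ln (cmod z) - tan (eta 0) * \<bar>surfx z\<bar> - C \<le> surfy z"
proof -
  define \<sigma> where "\<sigma> = tan (eta 0)"
  define s0 where "s0 = sin (eta 0)"
  have s0: "0 < s0" "s0 \<le> 1" using sin_eta_0 by (simp_all add: s0_def)
  have \<sigma>: "0 < \<sigma>" using sin_eta_0 cos_eta_pos[of 0] by (simp add: \<sigma>_def tan_def)
  \<comment> \<open>All angles \<open>eta k\<close> are at most \<open>eta 0\<close>, so no wing is
    steeper than the outermost ones.\<close>
  have sc: "sin (eta k) \<le> \<sigma> * cos (eta k)" for k
  proof -
    have "0 \<le> sin (eta 0 - eta k)"
      using eta_antimono[of 0 k] eta_nonneg[of k] eta_le[of 0] pi_gt3 by (intro sin_ge_zero) auto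
    then have "sin (eta k) * cos (eta 0) \<le> sin (eta 0) * cos (eta k)" by (simp add: sin_diff mult.commute)
    then show ?thesis using cos_eta_pos[of 0] by (simp add: \<sigma>_def tan_def field_simps)
  qed
  have main: "2 * s0 * ln (cmod z) - \<sigma> * \<bar>surfx z\<bar> - (2 * s0 * ln 2 + 2 * s0 * ln (pole 1) + 4 * \<sigma> + 3) \<le> surfy z"
    if z: "z \<notin> sites" and zr: "1/2 < cmod z" for z
  proof -
    let ?r = "cmod z"
    obtain m where m: "pole m / 2 \<le> ?r" "?r \<le> pole (Suc m) / 2" using annulus_exists[OF zr] by blast
    define P where "P k = ln (cmod (1 - z / of_real (pole k)))" for k
    define Q where "Q k = ln (cmod (1 + z / of_real (pole k)))" for k
    have p: "pole k > 0" for k by (rule pole_pos)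
    have X: "(\<lambda>k. cos (eta k) * (P k - Q k)) sums surfx z" and Y: "(\<lambda>k. sin (eta k) * (P k + Q k)) sums surfy z"
      using surf_pairs[of z] by (simp_all only: P_def Q_def)
    have c1: "\<bar>cos (eta k) * x\<bar> \<le> \<bar>x\<bar>" "\<bar>sin (eta k) * x\<bar> \<le> \<bar>x\<bar>" for k x
      using mult_right_mono[OF abs_cos_le_one[of "eta k"], of "\<bar>x\<bar>"] mult_right_mono[OF abs_sin_le_one[of "eta k"], of "\<bar>x\<bar>"]
      by (simp_all add: abs_mult)
    have hi: "\<bar>P (Suc m + i)\<bar> \<le> (1/10000) ^ i" "\<bar>Q (Suc m + i)\<bar> \<le> (1/10000) ^ i" for i
    proof -
      let ?v = "z / complex_of_real (pole (Suc m + i))"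
      have "cmod ?v = ?r / pole (Suc m + i)" using p[of "Suc m + i"] by (simp add: norm_divide)
      also have "\<dots> \<le> pole (Suc m) / 2 / pole (Suc m + i)" using m(2) p[of "Suc m + i"] by (intro divide_right_mono) auto
      also have "\<dots> = (1/2) * (pole (Suc m) / pole (Suc m + i))" by simp
      also have "\<dots> \<le> (1/2) * (1/10000) ^ i" using pole_quotient_le[of "Suc m" i] by simp
      finally have v: "cmod ?v \<le> (1/2) * (1/10000) ^ i" .
      have "(1/10000::real) ^ i \<le> 1" by (simp add: power_le_one)
      then have v2: "cmod ?v \<le> 1/2" using v by simp
      show "\<bar>P (Suc m + i)\<bar> \<le> (1/10000) ^ i" using abs_ln_norm_le[of "- ?v"] v v2 by (simp add: P_def)
      show "\<bar>Q (Suc m + i)\<bar> \<le> (1/10000) ^ i" using abs_ln_norm_le[of ?v] v v2 by (simp add: Q_def)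
    qed
    have tX: "\<bar>surfx z - (\<Sum>k<m. cos (eta k) * (P k - Q k)) - cos (eta m) * (P m - Q m)\<bar> \<le> 3"
    proof (rule sums_split_bound[OF X])
      fix i
      show "\<bar>cos (eta (Suc m + i)) * (P (Suc m + i) - Q (Suc m + i))\<bar> \<le> 2 * (1/10000) ^ i"
        using c1(1)[of "Suc m + i" "P (Suc m + i) - Q (Suc m + i)"] hi[of i] by linarith
    qed
    have tY: "\<bar>surfy z - (\<Sum>k<m. sin (eta k) * (P k + Q k)) - sin (eta m) * (P m + Q m)\<bar> \<le> 3"
    proof (rule sums_split_bound[OF Y])
      fix i
      show "\<bar>sin (eta (Suc m + i)) * (P (Suc m + i) + Q (Suc m + i))\<bar> \<le> 2 * (1/10000) ^ i"
        using c1(2)[of "Suc m + i" "P (Suc m + i) + Q (Suc m + i)"] hi[of i] by linarith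
    qed
    have rp: "?r > 0" and z0: "z \<noteq> 0" using zr by auto
    have far: "10000 * pole k \<le> 2 * ?r" if "k < m" for k
      using pole_Suc_ge[of k] pole_mono[of "Suc k" m] that m(1) by simp
    have lowX: "\<bar>P k - Q k\<bar> \<le> 8 / pole m * pole k" if k: "k < m" for k
    proof -
      define v where "v = complex_of_real (pole k) / z"
      have vn: "cmod v \<le> 2 / pole m * pole k" using m(1) p[of k] p[of m] rp by (simp add: v_def norm_divide field_simps)
      have v2: "cmod v \<le> 1/2" using far[OF k] p[of k] rp by (simp add: v_def norm_divide field_simps)
      \<comment> \<open>Far outside a pole both logarithms share the large part ln |z / pole k|; it
        cancels in the first coordinate and leaves a remainder proportional to the pole.\<close>
      have e: "1 - z / of_real (pole k) = - (z / of_real (pole k)) * (1 - v)" "1 + z / of_real (pole k) = (z / of_real (pole k)) * (1 + v)"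
        using p[of k] z0 by (simp_all add: v_def field_simps)
      have nz: "cmod (1 - v) > 0" "cmod (1 + v) > 0"
        using norm_triangle_ineq2[of 1 v] norm_triangle_ineq2[of 1 "- v"] v2 unfolding norm_one norm_minus_cancel diff_minus_eq_add by linarith+
      have q: "cmod (z / of_real (pole k)) > 0" using z0 p[of k] by simp
      have "P k = ln (cmod (z / of_real (pole k))) + ln (cmod (1 - v))"
        unfolding P_def e(1) norm_mult norm_minus_cancel by (rule ln_mult_pos[OF q nz(1)])
      moreover have "Q k = ln (cmod (z / of_real (pole k))) + ln (cmod (1 + v))"
        unfolding Q_def e(2) norm_mult by (rule ln_mult_pos[OF q nz(2)])
      ultimately have "\<bar>P k - Q k\<bar> \<le> \<bar>ln (cmod (1 - v))\<bar> + \<bar>ln (cmod (1 + v))\<bar>" by linarith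
      also have "\<dots> \<le> 4 * cmod v" using abs_ln_norm_le[of v] abs_ln_norm_le[of "- v"] v2 by simp
      also have "\<dots> \<le> 8 / pole m * pole k" using vn by simp
      finally show ?thesis .
    qed
    have sX: "\<bar>\<Sum>k<m. cos (eta k) * (P k - Q k)\<bar> \<le> 1"
    proof -
      have "\<bar>\<Sum>k<m. cos (eta k) * (P k - Q k)\<bar> \<le> (\<Sum>k<m. 8 / pole m * pole k)"
        using lowX c1(1) by (intro order_trans[OF sum_abs] sum_mono) (meson lessThan_iff order_trans)
      also have "\<dots> = 8 / pole m * (\<Sum>k<m. pole k)" by (simp add: sum_distrib_left)
      also have "\<dots> \<le> 8 / pole m * (1/5000 * pole m)" using p[of m] by (intro mult_left_mono sum_pole_le) auto
      also have "\<dots> \<le> 1" using p[of m] by simp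
      finally show ?thesis .
    qed
    have big: "?r / pole k - 1 \<le> cmod (1 - z / of_real (pole k))" "?r / pole k - 1 \<le> cmod (1 + z / of_real (pole k))" for k
      using norm_triangle_ineq2[of "z / of_real (pole k)" 1] norm_triangle_ineq2[of "z / of_real (pole k)" "- 1"] p[of k]
      by (simp_all add: norm_divide norm_minus_commute add.commute)
    have lowY: "0 \<le> P k \<and> 0 \<le> Q k" if k: "k < m" for k
    proof -
      have "5000 \<le> ?r / pole k" using far[OF k] p[of k] by (simp add: field_simps)
      then show ?thesis using big[of k] by (simp add: P_def Q_def)
    qed
    have sY: "s0 * (P 0 + Q 0) \<le> (\<Sum>k<m. sin (eta k) * (P k + Q k))" if "0 < m"
    proof -
      have "(\<Sum>k\<in>{0}. sin (eta k) * (P k + Q k)) \<le> (\<Sum>k<m. sin (eta k) * (P k + Q k))"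
        using lowY sin_eta_nonneg that by (intro sum_mono2) auto
      then show ?thesis by (simp add: s0_def)
    qed
    have logs: "2 * s0 * ln ?r - (2 * s0 * ln 2 + 2 * s0 * ln (pole 1)) \<le> (\<Sum>k<m. sin (eta k) * (P k + Q k))"
    proof (cases "m = 0")
      case True
      have "?r \<le> pole 1" using True m(2) p[of 1] by simp
      then have "ln ?r \<le> ln (pole 1)" using rp by (intro ln_mono) auto
      then have "2 * s0 * ln ?r \<le> 2 * s0 * ln (pole 1)" using s0 by simp
      moreover have "0 \<le> s0 * ln 2" using s0 by simp
      ultimately show ?thesis using True by simp
    next
      case False
      have p0: "pole 0 = 1" by simp
      have r2: "?r / 2 \<le> ?r / pole 0 - 1" using far[of 0] False unfolding p0 by simp
      have "ln (?r / 2) \<le> P 0" "ln (?r / 2) \<le> Q 0"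
        unfolding P_def Q_def using r2 big[of 0] rp by (intro ln_mono; linarith)+
      then have "s0 * (2 * ln ?r - 2 * ln 2) \<le> s0 * (P 0 + Q 0)" using s0 rp by (simp add: ln_div)
      moreover have "0 \<le> s0 * ln (pole 1)" using s0 pole_ge_1[of 1] by simp
      ultimately show ?thesis using sY False by (simp add: algebra_simps)
    qed
    \<comment> \<open>The moduli |1 - v| and |1 + v| add up to at least 2, so one of the two
      logarithms is nonnegative. A very negative sum then forces an equally large difference, which
      the first coordinate sees.\<close>
    have nearY: "- \<bar>P m - Q m\<bar> \<le> P m + Q m"
    proof -
      have "2 \<le> cmod (1 - z / of_real (pole m)) + cmod (1 + z / of_real (pole m))"
        using norm_triangle_ineq[of "1 - z / of_real (pole m)" "1 + z / of_real (pole m)"] by simp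
      then have "1 \<le> cmod (1 - z / of_real (pole m)) \<or> 1 \<le> cmod (1 + z / of_real (pole m))" by linarith
      then have "0 \<le> P m \<or> 0 \<le> Q m" unfolding P_def Q_def by auto
      then show ?thesis by linarith
    qed
    have "sin (eta m) * (- \<bar>P m - Q m\<bar>) \<le> sin (eta m) * (P m + Q m)"
      by (rule mult_left_mono[OF nearY sin_eta_nonneg])
    moreover have "sin (eta m) * \<bar>P m - Q m\<bar> \<le> (\<sigma> * cos (eta m)) * \<bar>P m - Q m\<bar>" by (intro mult_right_mono sc) simp
    moreover have "cos (eta m) * \<bar>P m - Q m\<bar> \<le> \<bar>surfx z\<bar> + 4"
    proof -
      have "cos (eta m) * \<bar>P m - Q m\<bar> = \<bar>cos (eta m) * (P m - Q m)\<bar>" using cos_eta_pos[of m] by (simp add: abs_mult)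
      then show ?thesis using tX sX by linarith
    qed
    then have "\<sigma> * (cos (eta m) * \<bar>P m - Q m\<bar>) \<le> \<sigma> * (\<bar>surfx z\<bar> + 4)" using \<sigma> by (intro mult_left_mono) auto
    then have "(\<sigma> * cos (eta m)) * \<bar>P m - Q m\<bar> \<le> \<sigma> * \<bar>surfx z\<bar> + 4 * \<sigma>" by (simp add: algebra_simps)
    ultimately have "- (\<sigma> * \<bar>surfx z\<bar>) - 4 * \<sigma> \<le> sin (eta m) * (P m + Q m)" by simp
    then show ?thesis using tY logs by linarith
  qed
  show ?thesis by (rule that[of "2 * s0 * ln 2 + 2 * s0 * ln (pole 1) + 4 * \<sigma> + 3"]) (use main in \<open>simp add: s0_def \<sigma>_def\<close>)
qed

lemma pot_bounded_disc:
  assumes w: "\<And>i. \<bar>w i\<bar> \<le> 1"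
  obtains C where "\<And>z. cmod z \<le> 1/2 \<Longrightarrow> \<bar>pot w z\<bar> \<le> C"
proof -
  have ns: "z \<notin> sites" if "z \<in> cball 0 (1/2)" for z
  proof
    assume "z \<in> sites"
    then obtain i where "z = of_real (site i)" by (auto simp: sites_def)
    then show False using that abs_site_ge_1[of i] by simp
  qed
  have "continuous_on (cball 0 (1/2)) (pot w)"
    by (intro continuous_at_imp_continuous_on ballI has_derivative_continuous[OF pot_deriv[where w = w, OF w ns]])
  then have "bounded (pot w ` cball 0 (1/2))" by (intro compact_imp_bounded compact_continuous_image compact_cball)
  then obtain C where C: "\<And>x. x \<in> pot w ` cball 0 (1/2) \<Longrightarrow> norm x \<le> C" unfolding bounded_iff by blast
  show ?thesis by (rule that[of C]) (use C in auto)
qed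

text \<open>The wedge above which the horizontal image lies: the growth estimate with its logarithm
  discarded, and boundedness in the inner disc.\<close>

lemma surfy_lower:
  obtains C where "\<And>z. z \<notin> sites \<Longrightarrow> - tan (eta 0) * \<bar>surfx z\<bar> - C \<le> surfy z"
proof -
  obtain C1 where C1: "\<And>z. z \<notin> sites \<Longrightarrow> 1/2 < cmod z \<Longrightarrow>
    2 * sin (eta 0) * ln (cmod z) - tan (eta 0) * \<bar>surfx z\<bar> - C1 \<le> surfy z" using growth by blast
  obtain C2 where C2: "\<And>z. cmod z \<le> 1/2 \<Longrightarrow> \<bar>surfy z\<bar> \<le> C2"
    using pot_bounded_disc[where w = "\<lambda>i. Im (wlim i)", OF wlim_parts_le(2)] unfolding surfy_def by blast
  have t: "0 < tan (eta 0)" using sin_eta_0 cos_eta_pos[of 0] by (simp add: tan_def)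
  have "- tan (eta 0) * \<bar>surfx z\<bar> - (\<bar>C1\<bar> + \<bar>C2\<bar> + 2 * sin (eta 0) * ln 2) \<le> surfy z" if z: "z \<notin> sites" for z
  proof (cases "cmod z \<le> 1/2")
    case True
    have "0 \<le> tan (eta 0) * \<bar>surfx z\<bar>" "0 \<le> 2 * sin (eta 0) * ln 2" using t sin_eta_0 by simp_all
    then show ?thesis using C2[OF True] by linarith
  next
    case False
    then have "ln (1/2) \<le> ln (cmod z)" by (intro ln_mono) auto
    then have "2 * sin (eta 0) * - ln 2 \<le> 2 * sin (eta 0) * ln (cmod z)" using sin_eta_0 by (intro mult_left_mono) (auto simp: ln_div)
    then show ?thesis using C1[OF z] False by linarith
  qed
  then show ?thesis using that by blast
qed

text \<open>Every wing escapes in the first coordinate, since cos (eta k) is positive; this is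
  properness at the sites.\<close>

lemma surfx_near_site:
  obtains d where "0 < d" "\<And>z. z \<notin> sites \<Longrightarrow> cmod (z - of_real (site i)) < d \<Longrightarrow> K < \<bar>surfx z\<bar>"
proof -
  obtain C where C: "\<And>z. z \<notin> sites \<Longrightarrow> cmod (z - of_real (site i)) \<le> 1/2 \<Longrightarrow>
      \<bar>surfx z - Re (wlim i) * ln (cmod (z - of_real (site i)))\<bar> \<le> C"
    using pot_near_site[where w = "\<lambda>i. Re (wlim i)", OF wlim_parts_le(1)] unfolding surfx_def by blast
  define c where "c = \<bar>Re (wlim i)\<bar>"
  have c: "0 < c" unfolding c_def by (cases i rule: even_odd_cases) (use cos_eta_pos in \<open>auto simp: less_imp_neq[symmetric]\<close>)
  define L where "L = (\<bar>K\<bar> + \<bar>C\<bar> + 1) / c"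
  have L: "0 < L" "c * L = \<bar>K\<bar> + \<bar>C\<bar> + 1" using c by (auto simp: L_def)
  have "K < \<bar>surfx z\<bar>" if z: "z \<notin> sites" "cmod (z - of_real (site i)) < min (1/2) (exp (- L))" for z
  proof -
    let ?r = "cmod (z - of_real (site i))"
    have r: "?r > 0" using notin_sites[OF z(1), of i] by simp
    have "?r \<le> exp (- L)" using z(2) by simp
    then have "ln ?r \<le> ln (exp (- L))" using r by (intro ln_mono) auto
    then have "ln ?r \<le> - L" by simp
    then have "L \<le> \<bar>ln ?r\<bar>" by linarith
    then have "c * L \<le> c * \<bar>ln ?r\<bar>" using c by simp
    also have "\<dots> = \<bar>Re (wlim i) * ln ?r\<bar>" by (simp add: c_def abs_mult)
    finally show ?thesis using C[OF z(1)] z(2) L by linarith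
  qed
  then show ?thesis using that[of "min (1/2) (exp (- L))"] by simp
qed

text \<open>Near the sites $\pm 1$ the image is asymptotic to rays of slope $\pm$ tan (eta 0), which excludes horizontal periods.\<close>

lemma surf_wings:
  obtains C where
    "\<And>X. \<exists>z. z \<notin> sites \<and> surfx z \<le> - X \<and> surfy z \<le> tan (eta 0) * surfx z + C"
    "\<And>X. \<exists>z. z \<notin> sites \<and> X \<le> surfx z \<and> surfy z \<le> - tan (eta 0) * surfx z + C"
proof -
  have wing: "\<exists>C. \<forall>X. \<exists>z. z \<notin> sites \<and> X \<le> s * surfx z \<and> surfy z \<le> - tan (eta 0) * (s * surfx z) + C"
    if i: "Im (wlim i) = sin (eta 0)" "Re (wlim i) = - s * cos (eta 0)" and s: "s = 1 \<or> s = - 1" for i s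
  proof -
    obtain C1 where C1: "\<And>z. z \<notin> sites \<Longrightarrow> cmod (z - of_real (site i)) \<le> 1/2 \<Longrightarrow>
        \<bar>surfx z - Re (wlim i) * ln (cmod (z - of_real (site i)))\<bar> \<le> C1"
      using pot_near_site[where w = "\<lambda>i. Re (wlim i)", OF wlim_parts_le(1)] unfolding surfx_def by blast
    obtain C2 where C2: "\<And>z. z \<notin> sites \<Longrightarrow> cmod (z - of_real (site i)) \<le> 1/2 \<Longrightarrow>
        \<bar>surfy z - Im (wlim i) * ln (cmod (z - of_real (site i)))\<bar> \<le> C2"
      using pot_near_site[where w = "\<lambda>i. Im (wlim i)", OF wlim_parts_le(2)] unfolding surfy_def by blast
    have c0: "0 < cos (eta 0)" by (rule cos_eta_pos)
    have t: "0 < tan (eta 0)" "sin (eta 0) = tan (eta 0) * cos (eta 0)" using sin_eta_0 c0 by (simp_all add: tan_def)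
    have "\<exists>z. z \<notin> sites \<and> X \<le> s * surfx z \<and> surfy z \<le> - tan (eta 0) * (s * surfx z) + (tan (eta 0) * \<bar>C1\<bar> + C2)" for X
    proof -
      define L where "L = (\<bar>X\<bar> + \<bar>C1\<bar>) / cos (eta 0) + 1"
      have L: "1 \<le> L" using c0 by (simp add: L_def)
      have cL: "cos (eta 0) * L = \<bar>X\<bar> + \<bar>C1\<bar> + cos (eta 0)" using c0 by (simp add: L_def field_simps)
      \<comment> \<open>Approaching the site vertically avoids all sites and makes its logarithm
        exactly -L.\<close>
      define z where "z = of_real (site i) + \<i> * of_real (exp (- L))"
      have z: "z \<notin> sites" unfolding z_def by (intro notin_sites_Im) simp
      have r: "cmod (z - of_real (site i)) = exp (- L)" by (simp add: z_def norm_mult)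
      have "exp (- L) \<le> exp (- 1)" using L by simp
      also have "exp (- 1) \<le> (1/2::real)"
      proof -
        have "2 \<le> exp (1::real)" using exp_ge_add_one_self[of 1] by simp
        then show ?thesis by (simp add: exp_minus field_simps)
      qed
      finally have r2: "cmod (z - of_real (site i)) \<le> 1/2" using r by simp
      have "\<bar>surfx z - s * (cos (eta 0) * L)\<bar> \<le> C1" using C1[OF z r2] unfolding r i by simp
      then have x: "\<bar>s * surfx z - cos (eta 0) * L\<bar> \<le> C1" using s by auto
      have y: "\<bar>surfy z + sin (eta 0) * L\<bar> \<le> C2" using C2[OF z r2] unfolding r i by simp
      have "X \<le> s * surfx z" using x cL c0 by linarith
      moreover have "tan (eta 0) * (s * surfx z) \<le> tan (eta 0) * (cos (eta 0) * L + \<bar>C1\<bar>)" using x t by (intro mult_left_mono) auto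
      then have "tan (eta 0) * (s * surfx z) \<le> sin (eta 0) * L + tan (eta 0) * \<bar>C1\<bar>" unfolding t(2) by (simp add: algebra_simps)
      then have "surfy z \<le> - tan (eta 0) * (s * surfx z) + (tan (eta 0) * \<bar>C1\<bar> + C2)" using y by linarith
      ultimately show ?thesis using z by blast
    qed
    then show ?thesis by blast
  qed
  obtain C1 where C1: "\<And>X. \<exists>z. z \<notin> sites \<and> X \<le> - 1 * surfx z \<and> surfy z \<le> - tan (eta 0) * (- 1 * surfx z) + C1"
    using wing[of "2 * 0" "- 1"] unfolding wlim_even by auto
  obtain C2 where C2: "\<And>X. \<exists>z. z \<notin> sites \<and> X \<le> 1 * surfx z \<and> surfy z \<le> - tan (eta 0) * (1 * surfx z) + C2"
    using wing[of "Suc (2 * 0)" 1] unfolding wlim_odd by auto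
  show ?thesis
  proof (rule that[of "max C1 C2"])
    fix X
    obtain z where "z \<notin> sites" "X \<le> - 1 * surfx z" "surfy z \<le> - tan (eta 0) * (- 1 * surfx z) + C1" using C1[of X] by blast
    then show "\<exists>z. z \<notin> sites \<and> surfx z \<le> - X \<and> surfy z \<le> tan (eta 0) * surfx z + max C1 C2"
      by (intro exI[of _ z]) auto
    obtain z where "z \<notin> sites" "X \<le> 1 * surfx z" "surfy z \<le> - tan (eta 0) * (1 * surfx z) + C2" using C2[of X] by blast
    then show "\<exists>z. z \<notin> sites \<and> X \<le> surfx z \<and> surfy z \<le> - tan (eta 0) * surfx z + max C1 C2"
      by (intro exI[of _ z]) auto
  qed
qed

section \<open>The vertical coordinate\<close>

text \<open>Up to multiples of 2 pi, ang a z is the argument of (a + z) / (a - z); this form takes on the real axis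
  the limit from the upper half plane.\<close>

definition ang :: "real \<Rightarrow> complex \<Rightarrow> real" where
  "ang a z = Arg (of_real a + z) + Arg (of_real a - cnj z)"

definition height :: "complex \<Rightarrow> real" where
  "height z = (\<Sum>k. (-1) ^ k * ang (pole k) z)"

lemma abs_Arg_le:
  assumes "a > 0" "2 * cmod v < a"
  shows "\<bar>Arg (of_real a + v)\<bar> \<le> 2 * cmod v / a"
proof -
  let ?w = "v / of_real a"
  have w: "cmod ?w < 1/2" using assms by (simp add: norm_divide field_simps)
  have nz: "1 + ?w \<noteq> 0"
  proof
    assume "1 + ?w = 0"
    then have "?w = - 1" by (metis add.inverse_inverse add_eq_0_iff)
    then have "cmod ?w = 1" by simp
    then show False using w by simp
  qed
  have "of_real a + v = of_real a * (1 + ?w)" using assms by (simp add: field_simps)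
  then have "Arg (of_real a + v) = Arg (1 + ?w)" using Arg_times_of_real[OF assms(1), of "1 + ?w"] by simp
  also have "\<dots> = Im (Ln (1 + ?w))" by (rule Arg_eq_Im_Ln[OF nz])
  finally show ?thesis using norm_Ln_le[OF w] abs_Im_le_cmod[of "Ln (1 + ?w)"] assms by (simp add: norm_divide)
qed

lemma abs_ang_le:
  assumes "a > 0" "2 * cmod z < a"
  shows "\<bar>ang a z\<bar> \<le> 4 * cmod z * (1 / a)"
  using abs_Arg_le[of a z] abs_Arg_le[of a "- cnj z"] assms by (simp add: ang_def)

lemma eventually_pole_gt: "eventually (\<lambda>k. R < pole k) sequentially"
proof -
  have "eventually (\<lambda>k. 1 / pole k < 1 / (\<bar>R\<bar> + 1)) sequentially"
    using summable_LIMSEQ_zero[OF summable_inverse_pole] by (rule order_tendstoD) simp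
  then show ?thesis
  proof eventually_elim
    case (elim k)
    then have "\<bar>R\<bar> + 1 < pole k" using pole_pos[of k] by (simp add: field_simps)
    then show ?case by simp
  qed
qed

lemma height_sums: "(\<lambda>k. (-1) ^ k * ang (pole k) z) sums height z"
proof -
  have "summable (\<lambda>k. (-1) ^ k * ang (pole k) z)"
  proof (rule summable_comparison_test_ev)
    show "summable (\<lambda>k. 4 * cmod z * (1 / pole k))" by (intro summable_mult summable_inverse_pole)
    show "\<forall>\<^sub>F k in sequentially. norm ((-1) ^ k * ang (pole k) z) \<le> 4 * cmod z * (1 / pole k)"
      using eventually_pole_gt[of "2 * cmod z"]
    proof eventually_elim
      case (elim k)
      show ?case using abs_ang_le[OF pole_pos elim] by (simp add: abs_mult power_abs)
    qed
  qed
  then show ?thesis unfolding height_def by (rule summable_sums)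
qed

lemma Arg_upper:
  assumes "0 < Im w"
  shows "Arg w = pi / 2 - arctan (Re w / Im w)"
proof (rule cis_Arg_unique)
  define t where "t = Re w / Im w"
  have sq: "0 < sqrt (1 + t\<^sup>2)" by (simp add: add_pos_nonneg)
  have w: "w = of_real (Im w) * Complex t 1" using assms by (simp add: t_def complex_eq_iff)
  have "sgn w = sgn (Complex t 1)" using assms by (subst w) (simp add: sgn_mult sgn_of_real del: of_real_mult)
  also have "cmod (Complex t 1) = sqrt (1 + t\<^sup>2)" by (simp add: cmod_def add.commute)
  then have "sgn (Complex t 1) = cis (pi / 2 - arctan t)"
    using sq by (simp add: sgn_eq complex_eq_iff cos_diff sin_diff cos_arctan sin_arctan)
  finally show "sgn w = cis (pi / 2 - arctan (Re w / Im w))" by (simp add: t_def)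
  show "- pi < pi / 2 - arctan (Re w / Im w)" "pi / 2 - arctan (Re w / Im w) \<le> pi"
    using arctan_bounded[of "Re w / Im w"] by linarith+
qed

lemma ang_upper:
  assumes "0 < Im z"
  shows "ang a z = pi - arctan ((a + Re z) / Im z) - arctan ((a - Re z) / Im z)"
  using Arg_upper[of "of_real a + z"] Arg_upper[of "of_real a - cnj z"] assms by (simp add: ang_def)

text \<open>For z in the upper half plane, pi minus \<open>ang a z\<close> is the angle under which
  z sees the segment from -a to a, and that angle grows with the segment.\<close>

lemma ang_decreasing:
  assumes "0 < Im z" "a < b"
  shows "ang b z < ang a z"
proof -
  have "arctan ((a + Re z) / Im z) < arctan ((b + Re z) / Im z)" "arctan ((a - Re z) / Im z) < arctan ((b - Re z) / Im z)"
    unfolding arctan_less_iff using assms by (intro divide_strict_right_mono; simp)+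
  then show ?thesis unfolding ang_upper[OF assms(1)] by linarith
qed

lemma ang_less_pi:
  assumes "0 < Im z" "0 < a"
  shows "ang a z < pi"
proof -
  have "- ((a + Re z) / Im z) = (- a - Re z) / Im z" by (simp add: minus_divide_left)
  also have "\<dots> < (a - Re z) / Im z" using assms by (intro divide_strict_right_mono) auto
  finally have "arctan (- ((a + Re z) / Im z)) < arctan ((a - Re z) / Im z)" by (simp only: arctan_less_iff)
  then show ?thesis unfolding ang_upper[OF assms(1)] arctan_minus by linarith
qed

text \<open>An alternating series with strictly decreasing terms: pairing from the first term gives
  positivity, pairing from the second bounds the sum by the first term, which is below pi.\<close>

lemma height_upper:
  assumes "0 < Im z"
  shows "0 < height z" "height z < pi"
proof -
  have dec: "ang (pole (Suc k)) z < ang (pole k) z" for k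
    using ang_decreasing[OF assms] strict_monoD[OF pole_strict_mono, of k "Suc k"] by simp
  have s: "(\<lambda>k. (-1) ^ (2 * k) * ang (pole (2 * k)) z + (-1) ^ (2 * k + 1) * ang (pole (2 * k + 1)) z) sums height z"
    by (rule sums_pairs[OF height_sums])
  have pos: "0 < (-1) ^ (2 * k) * ang (pole (2 * k)) z + (-1) ^ (2 * k + 1) * ang (pole (2 * k + 1)) z" for k
    using dec[of "2 * k"] by simp
  show "0 < height z" using suminf_pos[OF sums_summable[OF s] pos] sums_unique[OF s] by simp
  have "(\<lambda>k. (-1) ^ (k + 1) * ang (pole (k + 1)) z) sums (height z - (\<Sum>k<1. (-1) ^ k * ang (pole k) z))"
    by (rule sums_split_initial_segment[OF height_sums])
  then have "(\<lambda>k. - ((-1) ^ (k + 1) * ang (pole (k + 1)) z)) sums (ang (pole 0) z - height z)"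
    using sums_minus by fastforce
  then have t: "(\<lambda>k. - ((-1) ^ (2 * k + 1) * ang (pole (2 * k + 1)) z) + - ((-1) ^ (2 * k + 1 + 1) * ang (pole (2 * k + 1 + 1)) z)) sums (ang (pole 0) z - height z)"
    by (rule sums_pairs)
  have pos: "0 < - ((-1) ^ (2 * k + 1) * ang (pole (2 * k + 1)) z) + - ((-1) ^ (2 * k + 1 + 1) * ang (pole (2 * k + 1 + 1)) z)" for k
    using dec[of "2 * k + 1"] by simp
  have "0 < ang (pole 0) z - height z" using suminf_pos[OF sums_summable[OF t] pos] sums_unique[OF t] by simp
  then show "height z < pi" using ang_less_pi[OF assms pole_pos[of 0]] by linarith
qed

lemma height_cnj:
  assumes "Im z \<noteq> 0"
  shows "height (cnj z) = - height z"
proof -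
  have "ang a (cnj z) = - ang a z" for a
  proof -
    have "of_real a + cnj z = cnj (of_real a + z)" "of_real a - z = cnj (of_real a - cnj z)" by simp_all
    moreover have "of_real a + z \<notin> \<real>" "of_real a - cnj z \<notin> \<real>" using assms by (simp_all add: complex_is_Real_iff)
    ultimately have "Arg (of_real a + cnj z) = - Arg (of_real a + z)" "Arg (of_real a - z) = - Arg (of_real a - cnj z)"
      by (simp_all only: Arg_cnj if_False)
    then show ?thesis by (simp add: ang_def)
  qed
  then have "(\<lambda>k. - ((-1) ^ k * ang (pole k) z)) sums height (cnj z)" using height_sums[of "cnj z"] by simp
  then show ?thesis using sums_minus[OF height_sums[of z]] sums_unique2 by blast
qed

lemma height_0: "height 0 = 0"
proof -
  have "ang (pole k) 0 = 0" for k using pole_pos[of k] by (simp add: ang_def)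
  then show ?thesis by (simp add: height_def)
qed

text \<open>The point 2 lies between the first two positive poles, so exactly one argument is a half
  turn. It is where consecutive copies of the fundamental piece meet.\<close>

lemma height_2: "height 2 = pi"
proof -
  have "(-1) ^ k * ang (pole k) 2 = (if k = 0 then pi else 0)" for k
  proof (cases k)
    case 0
    have "Arg (1 + 2) = 0" "Arg (1 - 2) = pi"
      using Arg_of_real[of 3] Arg_of_real[of "- 1"] by simp_all
    then show ?thesis using 0 by (simp add: ang_def)
  next
    case (Suc j)
    have "10000 \<le> pole k" using pole_Suc_ge[of j] pole_ge_1[of j] Suc by simp
    then have "Arg (of_real (pole k + 2)) = 0" "Arg (of_real (pole k - 2)) = 0" unfolding Arg_of_real by simp_all
    then show ?thesis using Suc by (simp add: ang_def)
  qed
  then have "(\<lambda>k. (-1) ^ k * ang (pole k) 2) sums pi" using sums_single[of 0 "\<lambda>_. pi"] by simp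
  then show ?thesis using height_sums sums_unique2 by blast
qed

text \<open>Rotating by -i moves the closed upper half plane to the right half plane, away from the
  cut of the principal branch, at the cost of a constant pi / 2.\<close>

lemma continuous_Arg_upper: "continuous_on ({w. 0 \<le> Im w} - {0}) Arg"
proof -
  have eq: "Arg (- \<i> * w) + pi / 2 = Arg w" if w: "w \<in> {w. 0 \<le> Im w} - {0}" for w
  proof (rule cis_Arg_unique[symmetric])
    have nz: "- \<i> * w \<noteq> 0" using w by simp
    have "cis (Arg (- \<i> * w) + pi / 2) = sgn (- \<i> * w) * \<i>"
      by (simp only: cis_mult[symmetric] cis_Arg[OF nz] cis_pi_half)
    also have "\<dots> = sgn w"
    proof -
      have i: "sgn (- \<i>) = - \<i>" by (simp add: sgn_eq)
      have "- \<i> * x * \<i> = x" for x by (simp add: complex_eq_iff)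
      then show ?thesis by (simp only: sgn_mult i)
    qed
    finally show "sgn w = cis (Arg (- \<i> * w) + pi / 2)" ..
    have "\<bar>Im (Ln (- \<i> * w))\<bar> \<le> pi / 2" using Re_Ln_pos_le[OF nz] w by simp
    then have "\<bar>Arg (- \<i> * w)\<bar> \<le> pi / 2" using Arg_eq_Im_Ln[OF nz] by simp
    then show "- pi < Arg (- \<i> * w) + pi / 2" "Arg (- \<i> * w) + pi / 2 \<le> pi" using pi_gt_zero by linarith+
  qed
  have "continuous_on ({w. 0 \<le> Im w} - {0}) (\<lambda>w. Arg (- \<i> * w) + pi / 2)"
  proof (intro continuous_on_add continuous_on_const continuous_at_imp_continuous_on ballI)
    fix w assume w: "w \<in> {w. 0 \<le> Im w} - {0::complex}"
    have "- \<i> * w \<notin> \<real>\<^sub>\<le>\<^sub>0" using w by (auto simp: complex_nonpos_Reals_iff complex_eq_iff)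
    then show "isCont (\<lambda>w. Arg (- \<i> * w)) w"
      by (intro continuous_within_compose2[where g = Arg and s = UNIV and f = "\<lambda>w. - \<i> * w"] continuous_intros continuous_at_imp_continuous_at_within[OF continuous_at_Arg])
  qed
  then show ?thesis using eq by (subst (asm) continuous_on_cong[OF refl, of _ _ Arg]) auto
qed

lemma continuous_height_upper: "continuous_on ({z. 0 \<le> Im z} - sites) height"
proof -
  let ?U = "{z. 0 \<le> Im z} - sites"
  have ang: "continuous_on ?U (ang (pole k))" for k
  proof -
    have nz: "of_real (pole k) + z \<noteq> 0" "of_real (pole k) - cnj z \<noteq> 0" if "z \<notin> sites" for z
    proof -
      show "of_real (pole k) + z \<noteq> 0"
      proof
        assume "of_real (pole k) + z = 0"
        then have "z = - of_real (pole k)" by (simp add: eq_neg_iff_add_eq_0 add.commute)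
        then show False using that pole_in_sites[of k] by simp
      qed
      show "of_real (pole k) - cnj z \<noteq> 0"
      proof
        assume "of_real (pole k) - cnj z = 0"
        then have "cnj z = of_real (pole k)" by simp
        then show False using that pole_in_sites[of k] sites_cnj[of z] by simp
      qed
    qed
    have "continuous_on ?U (\<lambda>z. Arg (of_real (pole k) + z))"
      using nz by (intro continuous_on_compose2[OF continuous_Arg_upper] continuous_on_add continuous_on_const continuous_on_id) auto
    moreover have "continuous_on ?U (\<lambda>z. Arg (of_real (pole k) - cnj z))"
      using nz by (intro continuous_on_compose2[OF continuous_Arg_upper] continuous_on_diff continuous_on_const continuous_on_cnj continuous_on_id) auto
    ultimately show ?thesis unfolding ang_def[abs_def] by (rule continuous_on_add)
  qed
  have cont: "continuous_on (?U \<inter> ball 0 R) height" for R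
  proof (rule uniform_limit_theorem)
    show "uniform_limit (?U \<inter> ball 0 R) (\<lambda>n z. \<Sum>k<n. (-1) ^ k * ang (pole k) z) height sequentially"
      unfolding height_def[abs_def]
    proof (rule Weierstrass_m_test_ev)
      show "summable (\<lambda>k. 4 * \<bar>R\<bar> * (1 / pole k))" by (intro summable_mult summable_inverse_pole)
      show "\<forall>\<^sub>F k in sequentially. \<forall>z\<in>?U \<inter> ball 0 R. norm ((-1) ^ k * ang (pole k) z) \<le> 4 * \<bar>R\<bar> * (1 / pole k)"
        using eventually_pole_gt[of "2 * \<bar>R\<bar>"]
      proof eventually_elim
        case (elim k)
        show ?case
        proof
          fix z assume "z \<in> ?U \<inter> ball 0 R"
          then have "cmod z < R" by simp
          then have z: "cmod z \<le> \<bar>R\<bar>" by linarith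
          then have "\<bar>ang (pole k) z\<bar> \<le> 4 * cmod z * (1 / pole k)" using abs_ang_le[OF pole_pos, of z k] elim by simp
          also have "\<dots> \<le> 4 * \<bar>R\<bar> * (1 / pole k)" using z pole_pos[of k] by (intro mult_right_mono) auto
          finally show "norm ((-1) ^ k * ang (pole k) z) \<le> 4 * \<bar>R\<bar> * (1 / pole k)" by (simp add: abs_mult power_abs)
        qed
      qed
    qed
    show "\<forall>\<^sub>F n in sequentially. continuous_on (?U \<inter> ball 0 R) (\<lambda>z. \<Sum>k<n. (-1) ^ k * ang (pole k) z)"
      by (intro always_eventually allI continuous_intros continuous_on_subset[OF ang]) auto
  qed simp
  show ?thesis unfolding continuous_on_eq_continuous_within
  proof
    fix z assume z: "z \<in> ?U"
    have "continuous (at z within ?U \<inter> ball 0 (cmod z + 1)) height"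
      using cont[of "cmod z + 1"] z unfolding continuous_on_eq_continuous_within by simp
    moreover have "at z within ?U \<inter> ball 0 (cmod z + 1) = at z within ?U"
      by (rule at_within_nhd[of z "ball 0 (cmod z + 1)"]) auto
    ultimately show "continuous (at z within ?U) height" by simp
  qed
qed

lemma sgn_cnj_self: "w \<noteq> 0 \<Longrightarrow> sgn w * cnj (sgn w) = 1" for w :: complex
  by (metis cis_Arg cis_cnj cis_mult add.right_inverse cis_zero)

lemma sgn_divide_cnj:
  fixes z w :: complex
  assumes "w \<noteq> 0"
  shows "sgn (z / w) = sgn z * cnj (sgn w)"
proof -
  have "z = z / w * w" using assms by simp
  then have "sgn z = sgn (z / w) * sgn w" by (metis sgn_mult)
  then have "sgn z * cnj (sgn w) = sgn (z / w) * (sgn w * cnj (sgn w))" by (simp only: mult.assoc)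
  then show ?thesis using sgn_cnj_self[OF assms] by simp
qed

text \<open>Across the real axis \<open>height\<close> itself jumps, so only its class modulo 2 pi
  is compared. Each summand agrees with the local logarithms up to a multiple of 2 pi, and having
  \<open>cis\<close> equal to 1 survives the limit of the partial sums.\<close>

lemma height_local:
  assumes d: "0 < d" "\<And>i. d \<le> cmod (z0 - of_real (site i))" and z: "z \<in> ball z0 (d / 2)"
  shows "cis (height z) = cis (height z0 - Im (weights.logsum (\<lambda>i. of_real (psign i)) z0 z))"
proof -
  note W = weights_psign
  let ?L = "\<lambda>b. Ln (1 + (z - z0) / (z0 - b))"
  let ?p = "\<lambda>k. complex_of_real (pole k)"
  define T where "T k = (-1) ^ k * ang (pole k) z - (-1) ^ k * ang (pole k) z0
      + Im (of_real ((-1) ^ k) * ?L (?p k) + of_real (- ((-1) ^ k)) * ?L (- ?p k))" for k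
  define S where "S = height z - height z0 + Im (weights.logsum (\<lambda>i. of_real (psign i)) z0 z)"
  have "(\<lambda>k. Im (of_real (psign (2 * k)) * ?L (of_real (site (2 * k))) + of_real (psign (2 * k + 1)) * ?L (of_real (site (2 * k + 1)))))
      sums Im (weights.logsum (\<lambda>i. of_real (psign i)) z0 z)"
    by (rule sums_Im[OF sums_pairs[OF weights.logsum_props(1)[OF W d z]]])
  then have "(\<lambda>k. Im (of_real ((-1) ^ k) * ?L (?p k) + of_real (- ((-1) ^ k)) * ?L (- ?p k)))
      sums Im (weights.logsum (\<lambda>i. of_real (psign i)) z0 z)"
    unfolding psign_even psign_odd site_even site_odd of_real_minus .
  then have T: "T sums S" unfolding T_def S_def by (intro sums_add sums_diff height_sums)
  have cisT: "cis (T k) = 1" for k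
  proof -
    let ?a = "?p k"
    have site: "of_real (site (2 * k)) = ?a" "of_real (site (2 * k + 1)) = - ?a" by simp_all
    have nz: "z - ?a \<noteq> 0" "z + ?a \<noteq> 0" "z0 - ?a \<noteq> 0" "z0 + ?a \<noteq> 0"
      using weights.half_dist(2)[OF W d(2) z, of "2 * k"] weights.half_dist(2)[OF W d(2) z, of "2 * k + 1"]
        d(1) d(2)[of "2 * k"] d(2)[of "2 * k + 1"] unfolding site by auto
    have q: "1 + (z - z0) / (z0 - ?a) = (z - ?a) / (z0 - ?a)" "1 + (z - z0) / (z0 - - ?a) = (z + ?a) / (z0 + ?a)"
      using nz by (simp_all add: field_simps)
    have cisL: "cis (Im (Ln x)) = sgn x" if "x \<noteq> 0" for x using cis_Arg[OF that] Arg_eq_Im_Ln[OF that] by simp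
    have sc: "sgn (cnj x) = cnj (sgn x)" for x :: complex by (simp add: sgn_eq)
    have cisA: "cis (ang (pole k) y) = - (sgn (y + ?a) * cnj (sgn (y - ?a)))" if "y + ?a \<noteq> 0" "y - ?a \<noteq> 0" for y
    proof -
      have n: "?a + y \<noteq> 0" "?a - cnj y \<noteq> 0"
      proof -
        show "?a + y \<noteq> 0" using that by (simp add: add.commute)
        have "?a - cnj y = - cnj (y - ?a)" by simp
        then show "?a - cnj y \<noteq> 0" using that by (metis complex_cnj_zero_iff neg_equal_0_iff_equal)
      qed
      have "cis (ang (pole k) y) = sgn (?a + y) * sgn (?a - cnj y)"
        unfolding ang_def cis_mult[symmetric] cis_Arg[OF n(1)] cis_Arg[OF n(2)] ..
      also have "?a - cnj y = - cnj (y - ?a)" by simp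
      also have "sgn (- cnj (y - ?a)) = - cnj (sgn (y - ?a))" by (simp only: sgn_minus sc)
      finally show ?thesis by (simp add: add.commute)
    qed
    define t where "t = ang (pole k) z - ang (pole k) z0 + Im (?L ?a) - Im (?L (- ?a))"
    have Tt: "T k = (-1) ^ k * t" by (simp add: T_def t_def algebra_simps)
    have "cis t = cis (ang (pole k) z) * cnj (cis (ang (pole k) z0)) * cis (Im (?L ?a)) * cnj (cis (Im (?L (- ?a))))"
      by (simp add: t_def cis_cnj cis_mult)
    also have "\<dots> = (sgn (z + ?a) * cnj (sgn (z + ?a))) * (sgn (z - ?a) * cnj (sgn (z - ?a))) * (sgn (z0 + ?a) * cnj (sgn (z0 + ?a))) * (sgn (z0 - ?a) * cnj (sgn (z0 - ?a)))"
    proof -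
      have L: "cis (Im (?L ?a)) = sgn (z - ?a) * cnj (sgn (z0 - ?a))" "cis (Im (?L (- ?a))) = sgn (z + ?a) * cnj (sgn (z0 + ?a))"
        unfolding q using nz cisL[of "(z - ?a) / (z0 - ?a)"] cisL[of "(z + ?a) / (z0 + ?a)"] by (simp_all only: divide_eq_0_iff sgn_divide_cnj simp_thms)
      have "- (A * cnj B) * cnj (- (C * cnj D)) * (B * cnj D) * cnj (A * cnj C) = (A * cnj A) * (B * cnj B) * (C * cnj C) * (D * cnj D)" for A B C D
        by (simp add: mult_ac)
      then show ?thesis unfolding cisA[OF nz(2,1)] cisA[OF nz(4,3)] L by (simp only:)
    qed
    also have "\<dots> = 1" using nz by (simp add: sgn_cnj_self)
    finally have t1: "cis t = 1" .
    then have "cis (- t) = 1" by (metis cis_cnj complex_cnj_one)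
    then show ?thesis unfolding Tt using t1 by (cases "even k") auto
  qed
  have fin: "cis (\<Sum>k<n. T k) = 1" for n by (induction n) (auto simp: cisT simp flip: cis_mult)
  have "(\<lambda>n. cis (\<Sum>k<n. T k)) \<longlonglongrightarrow> cis S"
    using T unfolding sums_def by (intro continuous_on_tendsto_compose[OF continuous_on_cis[OF continuous_on_id, of UNIV]]) auto
  then have "cis S = 1" unfolding fin by (simp add: LIMSEQ_const_iff)
  moreover have "height z = (height z0 - Im (weights.logsum (\<lambda>i. of_real (psign i)) z0 z)) + S" by (simp add: S_def)
  ultimately show ?thesis by (metis cis_mult mult.right_neutral)
qed

section \<open>The surface\<close>

definition period :: R3 where "period = (0, 0, 2 * pi)"

text \<open>Comparing values of \<open>cis\<close> admits all heights modulo 2 pi at once and makes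
  the set independent of the branch chosen in \<open>height\<close>.\<close>

definition tower :: "R3 set" where
  "tower = {(surfx z, surfy z, t) | z t. z \<notin> sites \<and> cis t = cis (height z)}"

definition wrap :: "complex \<Rightarrow> R3 \<times> real \<times> real" where
  "wrap z = ((surfx z, surfy z, 0), cos (height z), sin (height z))"

lemma quot_map_period: "quot_map period (p, q, t) = ((p, q, 0), cos t, sin t)"
  by (simp add: quot_map_def period_def Let_def power2_eq_square)

lemma towerI: "z \<notin> sites \<Longrightarrow> cis t = cis (height z) \<Longrightarrow> (surfx z, surfy z, t) \<in> tower"
  by (auto simp: tower_def)

lemma towerE:
  assumes "x \<in> tower"
  obtains z t where "x = (surfx z, surfy z, t)" "z \<notin> sites" "cis t = cis (height z)"
  using assms by (auto simp: tower_def)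

lemma cis_eq_parts: "cis s = cis t \<longleftrightarrow> cos s = cos t \<and> sin s = sin t"
  by (simp add: complex_eq_iff)

lemma quotient_tower: "quotient_surface tower period = wrap ` (- sites)"
proof
  show "quotient_surface tower period \<subseteq> wrap ` (- sites)"
  proof
    fix y assume "y \<in> quotient_surface tower period"
    then obtain x where x: "x \<in> tower" "y = quot_map period x" by (auto simp: quotient_surface_def)
    obtain z t where z: "x = (surfx z, surfy z, t)" "z \<notin> sites" "cis t = cis (height z)" using towerE[OF x(1)] .
    then have "y = wrap z" using x by (simp add: quot_map_period wrap_def cis_eq_parts)
    then show "y \<in> wrap ` (- sites)" using z by blast
  qed
  show "wrap ` (- sites) \<subseteq> quotient_surface tower period"
  proof
    fix y assume "y \<in> wrap ` (- sites)"
    then obtain z where z: "z \<notin> sites" "y = wrap z" by blast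
    then have "y = quot_map period (surfx z, surfy z, height z)" by (simp add: quot_map_period wrap_def)
    then show "y \<in> quotient_surface tower period" unfolding quotient_surface_def using towerI[OF z(1) refl] by blast
  qed
qed

lemma surf_deriv:
  assumes "z \<notin> sites"
  shows "(surfx has_derivative (\<lambda>h. Re (fx z * h))) (at z)" "(surfy has_derivative (\<lambda>h. Re (fy z * h))) (at z)"
proof -
  have W: "weights (\<lambda>i. of_real (Re (wlim i)))" "weights (\<lambda>i. of_real (Im (wlim i)))"
    using wlim_parts_le by (simp_all add: weights_def)
  have P: "(\<lambda>i. wlim i / (z - of_real (site i))) sums Phi z" "(\<lambda>i. cnj (wlim i) / (z - of_real (site i))) sums Psi z"
    unfolding Phi_def Psi_def by (intro weights.csum_sums weights_cnj weights_wlim)+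
  have "(\<lambda>i. (wlim i / (z - of_real (site i)) + cnj (wlim i) / (z - of_real (site i))) / 2) sums fx z"
    unfolding fx_def by (intro sums_divide sums_add P)
  moreover have "(w / x + cnj w / x) / 2 = of_real (Re w) / x" for w x :: complex
    unfolding add_divide_distrib[symmetric] complex_add_cnj by simp
  ultimately have x: "csum (\<lambda>i. of_real (Re (wlim i))) z = fx z"
    using sums_unique2[OF weights.csum_sums[OF W(1), of z]] by simp
  have "(\<lambda>i. (wlim i / (z - of_real (site i)) - cnj (wlim i) / (z - of_real (site i))) / (2 * \<i>)) sums fy z"
    unfolding fy_def by (intro sums_divide sums_diff P)
  moreover have "(w / x - cnj w / x) / (2 * \<i>) = of_real (Im w) / x" for w x :: complex
    unfolding diff_divide_distrib[symmetric] complex_diff_cnj by (cases "x = 0") (simp_all add: field_simps)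
  ultimately have y: "csum (\<lambda>i. of_real (Im (wlim i))) z = fy z"
    using sums_unique2[OF weights.csum_sums[OF W(2), of z]] by simp
  show "(surfx has_derivative (\<lambda>h. Re (fx z * h))) (at z)" "(surfy has_derivative (\<lambda>h. Re (fy z * h))) (at z)"
    using pot_deriv[where w = "\<lambda>i. Re (wlim i)", OF wlim_parts_le(1) assms] pot_deriv[where w = "\<lambda>i. Im (wlim i)", OF wlim_parts_le(2) assms]
    unfolding x y surfx_def[symmetric] surfy_def[symmetric] .
qed

text \<open>Replaces the discontinuous \<open>height\<close> near z0 by a smooth branch, the real
  part of i times the local primitive of \<open>chi\<close>.\<close>

lemma height_chart:
  assumes "z0 \<notin> sites"
  obtains d L where "0 < d" "ball z0 d \<subseteq> - sites" "L z0 = 0"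
    "\<And>z. z \<in> ball z0 d \<Longrightarrow> (L has_derivative (\<lambda>h. Re (fz z * h))) (at z)"
    "\<And>z. z \<in> ball z0 d \<Longrightarrow> cis (height z) = cis (height z0 + L z)"
proof -
  note W = weights_psign
  let ?S = "weights.logsum (\<lambda>i. of_real (psign i)) z0"
  obtain d where d: "d > 0" "\<And>i. d \<le> cmod (z0 - of_real (site i))" using sites_dist[OF assms] by blast
  have z0: "z0 \<in> ball z0 (d / 2)" using d by simp
  have sub: "ball z0 (d / 2) \<subseteq> - sites"
  proof
    fix z assume z: "z \<in> ball z0 (d / 2)"
    have "z - of_real (site i) \<noteq> 0" for i by (rule weights.half_dist(2)[OF W d(2) z])
    then show "z \<in> - sites" by (auto simp: sites_def)
  qed
  show ?thesis
  proof (rule that[of "d / 2" "\<lambda>z. Re (\<i> * ?S z)"])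
    show "0 < d / 2" using d by simp
    have "(\<lambda>i. complex_of_real (psign i) * Ln (1 + (z0 - z0) / (z0 - of_real (site i)))) sums ?S z0"
      by (rule weights.logsum_props(1)[OF W d z0])
    then have "?S z0 = 0" by (simp add: sums_iff)
    then show "Re (\<i> * ?S z0) = 0" by simp
    fix z assume z: "z \<in> ball z0 (d / 2)"
    show "((\<lambda>z. Re (\<i> * ?S z)) has_derivative (\<lambda>h. Re (fz z * h))) (at z)"
      unfolding fz_def chi_def by (intro has_derivative_Re_field DERIV_cmult weights.logsum_props(2)[OF W d z])
    show "cis (height z) = cis (height z0 + Re (\<i> * ?S z))"
      using height_local[OF d z] by simp
  qed (rule sub)
qed

lemma continuous_cis_height:
  assumes "z0 \<notin> sites"
  shows "isCont (\<lambda>z. cis (height z)) z0"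
proof -
  obtain d L where L: "0 < d" "ball z0 d \<subseteq> - sites" "L z0 = 0"
    "\<And>z. z \<in> ball z0 d \<Longrightarrow> (L has_derivative (\<lambda>h. Re (fz z * h))) (at z)"
    "\<And>z. z \<in> ball z0 d \<Longrightarrow> cis (height z) = cis (height z0 + L z)"
    using height_chart[OF assms] by blast
  have z0: "z0 \<in> ball z0 d" using L(1) by simp
  have "isCont L z0" by (rule has_derivative_continuous[OF L(4)[OF z0]])
  then have "isCont (\<lambda>z. height z0 + L z) z0" by (intro continuous_intros)
  moreover have "isCont cis x" for x
    using continuous_on_cis[OF continuous_on_id, of UNIV] by (simp add: continuous_on_eq_continuous_at)
  ultimately have "isCont (\<lambda>z. cis (height z0 + L z)) z0" by (rule isCont_o2)
  moreover have "\<forall>\<^sub>F z in nhds z0. cis (height z) = cis (height z0 + L z)"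
    using eventually_mono[OF eventually_nhds_in_open[OF open_ball z0] L(5)] .
  ultimately show ?thesis using isCont_cong[of "\<lambda>z. cis (height z)" "\<lambda>z. cis (height z0 + L z)" z0] by blast
qed

lemma continuous_surf: "z \<notin> sites \<Longrightarrow> isCont surfx z" "z \<notin> sites \<Longrightarrow> isCont surfy z"
  using surf_deriv has_derivative_continuous by blast+

section \<open>The quotient as a homeomorphic copy of the punctured plane\<close>

lemma continuous_wrap: "continuous_on (- sites) wrap"
proof (intro continuous_at_imp_continuous_on ballI)
  fix z assume "z \<in> - sites"
  then have z: "z \<notin> sites" by simp
  have "isCont (\<lambda>z. ((surfx z, surfy z, 0), Re (cis (height z)), Im (cis (height z)))) z"
    by (intro continuous_Pair continuous_surf continuous_Re continuous_Im continuous_const continuous_cis_height z)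
  then show "isCont wrap z" unfolding wrap_def[abs_def] by simp
qed

definition fold_up :: "complex \<Rightarrow> complex" where "fold_up z = (if Im z < 0 then cnj z else z)"

lemma fold_up: "0 \<le> Im (fold_up z)" "fold_up z \<in> sites \<longleftrightarrow> z \<in> sites" "surfx (fold_up z) = surfx z" "surfy (fold_up z) = surfy z"
  by (auto simp: fold_up_def sites_cnj surfx_def surfy_def pot_cnj)

lemma surf_eq_fold_up:
  assumes "z1 \<notin> sites" "z2 \<notin> sites" "surfx z1 = surfx z2" "surfy z1 = surfy z2"
  shows "fold_up z1 = fold_up z2"
  using assms by (intro surf_injective) (auto simp: fold_up)

text \<open>The horizontal coordinates determine z up to conjugation. Off the real axis sin (height
  z) is nonzero and changes sign under conjugation, so the last coordinate separates the two
  candidates.\<close>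

lemma wrap_inj: "inj_on wrap (- sites)"
proof (rule inj_onI)
  fix z1 z2 assume z: "z1 \<in> - sites" "z2 \<in> - sites" and eq: "wrap z1 = wrap z2"
  then have f: "fold_up z1 = fold_up z2" by (intro surf_eq_fold_up) (auto simp: wrap_def)
  have s: "sin (height z1) = sin (height z2)" using eq by (simp add: wrap_def)
  show "z1 = z2"
  proof (rule ccontr)
    assume ne: "z1 \<noteq> z2"
    then have c: "z1 = cnj z2" "Im z2 \<noteq> 0" using f by (auto simp: fold_up_def complex_eq_iff split: if_splits)
    then have "sin (height z2) = 0" using s height_cnj[of z2] by simp
    moreover have "0 < sin (height z2) \<or> 0 < sin (height (cnj z2))"
      using c(2) height_upper[of z2] height_upper[of "cnj z2"] sin_gt_zero by (cases "0 < Im z2") auto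
    ultimately show False using height_cnj[OF c(2)] by simp
  qed
qed

lemma norm_proj_le:
  fixes p :: "'a::real_normed_vector \<times> 'b::real_normed_vector"
  shows "norm (fst p) \<le> norm p" "norm (snd p) \<le> norm p"
  using norm_fst_le[of "fst p" "snd p"] norm_snd_le[of "snd p" "fst p"] by simp_all

text \<open>Properness: points near infinity are expelled by the logarithmic growth of the second
  coordinate, points near a site by the unbounded first coordinate.\<close>

lemma wrap_preimage_compact:
  assumes K: "compact K"
  shows "compact (- sites \<inter> wrap -` K)"
proof -
  let ?Z = "- sites \<inter> wrap -` K"
  obtain B where B: "\<And>x. x \<in> K \<Longrightarrow> norm x \<le> B" using compact_imp_bounded[OF K] unfolding bounded_iff by blast
  have xy: "\<bar>surfx z\<bar> \<le> B" "\<bar>surfy z\<bar> \<le> B" if "z \<in> ?Z" for z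
  proof -
    have n: "norm (wrap z) \<le> B" using B that by blast
    have "norm (fst (wrap z)) \<le> norm (wrap z)" by (rule norm_proj_le)
    moreover have "norm (fst (fst (wrap z))) \<le> norm (fst (wrap z))" by (rule norm_proj_le)
    moreover have "norm (snd (fst (wrap z))) \<le> norm (fst (wrap z))" by (rule norm_proj_le)
    moreover have "norm (fst (snd (fst (wrap z)))) \<le> norm (snd (fst (wrap z)))" by (rule norm_proj_le)
    ultimately show "\<bar>surfx z\<bar> \<le> B" "\<bar>surfy z\<bar> \<le> B" using n by (simp_all add: wrap_def)
  qed
  obtain C where C: "\<And>z. z \<notin> sites \<Longrightarrow> 1/2 < cmod z \<Longrightarrow>
    2 * sin (eta 0) * ln (cmod z) - tan (eta 0) * \<bar>surfx z\<bar> - C \<le> surfy z" using growth by blast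
  define s where "s = 2 * sin (eta 0)"
  have s: "0 < s" using sin_eta_0 by (simp add: s_def)
  have t: "0 < tan (eta 0)" using sin_eta_0 cos_eta_pos[of 0] by (simp add: tan_def)
  have "cmod z \<le> max (1/2) (exp ((B + tan (eta 0) * B + C) / s))" if z: "z \<in> ?Z" for z
  proof (cases "1/2 < cmod z")
    case True
    have "tan (eta 0) * \<bar>surfx z\<bar> \<le> tan (eta 0) * B" using t xy[OF z] by (intro mult_left_mono) auto
    then have "s * ln (cmod z) \<le> B + tan (eta 0) * B + C" using C[of z] True z xy[OF z] unfolding s_def by auto
    then have "ln (cmod z) \<le> (B + tan (eta 0) * B + C) / s" using s by (simp add: field_simps)
    then have "exp (ln (cmod z)) \<le> exp ((B + tan (eta 0) * B + C) / s)" by (simp only: exp_le_cancel_iff)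
    moreover have "exp (ln (cmod z)) = cmod z" using True by (intro exp_ln) linarith
    ultimately show ?thesis by simp
  qed simp
  then have bnd: "bounded ?Z" unfolding bounded_iff by blast
  have "open (- ?Z)" unfolding open_dist
  proof
    fix x assume x: "x \<in> - ?Z"
    show "\<exists>e>0. \<forall>y. dist y x < e \<longrightarrow> y \<in> - ?Z"
    proof (cases "x \<in> sites")
      case True
      then obtain i where i: "x = of_real (site i)" by (auto simp: sites_def)
      obtain d where d: "0 < d" "\<And>z. z \<notin> sites \<Longrightarrow> cmod (z - of_real (site i)) < d \<Longrightarrow> B < \<bar>surfx z\<bar>"
        using surfx_near_site[where i = i and K = B] by blast
      have "y \<in> - ?Z" if "dist y x < d" for y
      proof
        assume y: "y \<in> ?Z"
        then have "B < \<bar>surfx y\<bar>" using d(2)[of y] that i by (simp add: dist_norm)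
        then show False using xy(1)[OF y] by simp
      qed
      then show ?thesis using d(1) by blast
    next
      case False
      have "openin (top_of_set (- sites)) (- sites \<inter> wrap -` (- K))"
        using continuous_wrap compact_imp_closed[OF K] by (intro continuous_openin_preimage_gen) auto
      then have "open (- sites \<inter> wrap -` (- K))" using openin_open_eq[OF open_Compl[OF closed_sites]] by blast
      moreover have "x \<in> - sites \<inter> wrap -` (- K)" using False x by blast
      ultimately obtain e where "e > 0" "\<forall>y. dist y x < e \<longrightarrow> y \<in> - sites \<inter> wrap -` (- K)" unfolding open_dist by blast
      then show ?thesis by blast
    qed
  qed
  then have "closed ?Z" by (simp add: closed_def)
  then show ?thesis using bnd compact_eq_bounded_closed by blast
qed

text \<open>A convergent sequence together with its limit is compact, so by properness it lifts into
  a compact part of the domain. Closedness of the map is what turns \<open>wrap\<close> into a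
  homeomorphism onto its image.\<close>

lemma wrap_closed_image:
  assumes "closedin (top_of_set (- sites)) U"
  shows "closed (wrap ` U)"
  unfolding closed_sequential_limits
proof (intro allI impI, elim conjE)
  fix x l assume x: "\<forall>n. x n \<in> wrap ` U" and l: "x \<longlonglongrightarrow> l"
  obtain T where T: "closed T" "U = - sites \<inter> T" using assms unfolding closedin_closed by blast
  define K where "K = insert l (range x)"
  have "compact K" unfolding K_def by (rule compact_sequence_with_limit[OF l])
  then have "compact ((- sites \<inter> wrap -` K) \<inter> T)" by (intro compact_Int_closed wrap_preimage_compact T)
  then have "compact (wrap ` ((- sites \<inter> wrap -` K) \<inter> T))"
    by (intro compact_continuous_image continuous_on_subset[OF continuous_wrap]) auto
  then have "closed (wrap ` ((- sites \<inter> wrap -` K) \<inter> T))" by (rule compact_imp_closed)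
  moreover have "x n \<in> wrap ` ((- sites \<inter> wrap -` K) \<inter> T)" for n
  proof -
    obtain z where "z \<in> U" "x n = wrap z" using x by blast
    moreover have "x n \<in> K" by (simp add: K_def)
    ultimately show ?thesis using T by auto
  qed
  ultimately have "l \<in> wrap ` ((- sites \<inter> wrap -` K) \<inter> T)" using l unfolding closed_sequential_limits by blast
  then show "l \<in> wrap ` U" using T by blast
qed

lemma wrap_homeomorphism:
  obtains g where "homeomorphism (- sites) (wrap ` (- sites)) wrap g"
proof (rule homeomorphism_injective_closed_map[OF continuous_wrap refl wrap_inj])
  fix U assume U: "closedin (top_of_set (- sites)) U"
  have "U \<subseteq> - sites" using closedin_imp_subset[OF U] .
  then show "closedin (top_of_set (wrap ` (- sites))) (wrap ` U)"
    by (intro closed_subset image_mono wrap_closed_image U)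
qed (rule that)

lemma continuous_quot_map: "continuous_on UNIV (quot_map v)"
  unfolding quot_map_def[abs_def] Let_def divide_inverse by (intro continuous_intros)

text \<open>The tower is the full preimage of its quotient under the continuous map
  \<open>quot_map\<close>, and the quotient is closed by properness.\<close>

lemma closed_tower: "closed tower"
proof -
  have eq: "tower = quot_map period -` (wrap ` (- sites))"
  proof
    show "tower \<subseteq> quot_map period -` (wrap ` (- sites))"
      using quotient_tower unfolding quotient_surface_def by blast
    show "quot_map period -` (wrap ` (- sites)) \<subseteq> tower"
    proof
      fix x assume "x \<in> quot_map period -` (wrap ` (- sites))"
      then obtain z where z: "z \<notin> sites" "quot_map period x = wrap z" by blast
      obtain p q t where x: "x = (p, q, t)" by (cases x) auto
      have "x = (surfx z, surfy z, t)" "cis t = cis (height z)"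
        using z(2) unfolding x quot_map_period wrap_def by (simp_all add: cis_eq_parts)
      then show "x \<in> tower" using towerI[OF z(1)] by simp
    qed
  qed
  have cl: "closed (wrap ` (- sites))" by (intro wrap_closed_image closedin_subtopology_refl[THEN iffD2]) simp
  show ?thesis unfolding eq by (rule closed_vimage[OF cl continuous_quot_map])
qed

lemma cis_eq_2pi:
  assumes "cis s = cis t"
  obtains k :: int where "s = t + 2 * pi * of_int k"
proof -
  have "cis (s - t) = cis s * cnj (cis t)" by (simp add: cis_cnj cis_mult)
  also have "\<dots> = 1" unfolding assms by (simp add: cis_cnj cis_mult)
  finally have "cos (s - t) = 1" by (simp add: complex_eq_iff)
  then obtain k :: int where "s - t = of_int k * 2 * pi" unfolding cos_one_2pi_int by blast
  then show ?thesis using that[of k] by (simp add: algebra_simps)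
qed

lemma cis_add_2pi: "cis (t + 2 * pi * of_int k) = cis t"
proof -
  have "cis (t + 2 * pi * of_int k) = cis t * cis (2 * pi * of_int k)" by (rule cis_mult[symmetric])
  then show ?thesis by (simp add: cis_multiple_2pi)
qed

lemma cis_eq_close:
  assumes "cis s = cis t" "\<bar>s - t\<bar> < 4"
  shows "s = t"
proof -
  obtain k :: int where k: "s = t + 2 * pi * of_int k" using cis_eq_2pi[OF assms(1)] .
  have "k = 0"
  proof (rule ccontr)
    assume "k \<noteq> 0"
    then have "1 \<le> \<bar>real_of_int k\<bar>" by linarith
    then have "2 * pi * 1 \<le> 2 * pi * \<bar>real_of_int k\<bar>" by (intro mult_left_mono) auto
    also have "\<dots> = \<bar>s - t\<bar>" unfolding k by (simp add: abs_mult)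
    finally show False using assms(2) pi_gt3 by linarith
  qed
  then show ?thesis using k by simp
qed

lemma tower_chart:
  assumes "p \<in> tower"
  shows "\<exists>i U u ux uy uxx uxy uyy. minimal_chart tower p i U u ux uy uxx uxy uyy \<and>
     (\<forall>q\<in>U. \<bar>graph_gauss_curv (ux q) (uy q) (uxx q) (uxy q) (uyy q)\<bar> \<le> 120000\<^sup>2)"
proof -
  obtain z0 t0 where p: "p = (surfx z0, surfy z0, t0)" "z0 \<notin> sites" "cis t0 = cis (height z0)" using towerE[OF assms] .
  obtain d L where L: "0 < d" "ball z0 d \<subseteq> - sites" "L z0 = 0"
    "\<And>z. z \<in> ball z0 d \<Longrightarrow> (L has_derivative (\<lambda>h. Re (fz z * h))) (at z)"
    "\<And>z. z \<in> ball z0 d \<Longrightarrow> cis (height z) = cis (height z0 + L z)"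
    using height_chart[OF p(2)] by blast
  define Z where "Z z = t0 + L z" for z
  have Z0: "Z z0 = t0" by (simp add: Z_def L(3))
  have dZ: "(Z has_derivative (\<lambda>h. Re (fz z * h))) (at z)" if "z \<in> ball z0 d" for z
    unfolding Z_def using has_derivative_add[OF has_derivative_const L(4)[OF that], of t0] by simp
  have cisZ: "cis (Z z) = cis (height z)" if "z \<in> ball z0 d" for z
    unfolding L(5)[OF that] Z_def by (simp only: cis_mult[symmetric] p(3))
  \<comment> \<open>Together with the margin 3 in W below, the margin 1 keeps the third coordinates
    less than 4 apart, hence less than 2 pi.\<close>
  define D where "D = ball z0 d \<inter> Z -` {t0 - 1<..<t0 + 1}"
  have contZ: "continuous_on (ball z0 d) Z"
    using dZ by (intro continuous_at_imp_continuous_on ballI) (blast intro: has_derivative_continuous)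
  have D: "open D" unfolding D_def by (rule continuous_open_preimage[OF contZ open_ball open_greaterThanLessThan])
  have z0D: "z0 \<in> D" using L(1) Z0 by (simp add: D_def)
  have Ds: "z \<in> ball z0 d" "z \<notin> sites" "\<bar>Z z - t0\<bar> < 1" if "z \<in> D" for z using that L(2) by (auto simp: D_def)
  obtain g where g: "homeomorphism (- sites) (wrap ` (- sites)) wrap g" using wrap_homeomorphism .
  have rel: "\<exists>W. open W \<and> tower \<inter> W = (\<lambda>z. (surfx z, surfy z, Z z)) ` N"
    if N: "open N" "z0 \<in> N" "N \<subseteq> D" for N
  proof -
    have Ns: "N \<subseteq> - sites" using N(3) Ds(2) by blast
    then have "openin (top_of_set (- sites)) N" using N(1) by (simp add: open_subset)
    then have "openin (top_of_set (wrap ` (- sites))) (wrap ` N)" by (rule homeomorphism_imp_open_map[OF g])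
    then obtain W0 where W0: "open W0" "wrap ` N = wrap ` (- sites) \<inter> W0" unfolding openin_open by blast
    \<comment> \<open>The first condition selects the right parameters in the quotient, the second
      the right one among the vertical translates.\<close>
    define W where "W = quot_map period -` W0 \<inter> {x. \<bar>snd (snd x) - t0\<bar> < 3}"
    have "open (quot_map period -` W0)" by (rule open_vimage[OF W0(1) continuous_quot_map])
    moreover have "open {x :: R3. \<bar>snd (snd x) - t0\<bar> < 3}" by (intro open_Collect_less continuous_intros)
    ultimately have "open W" unfolding W_def by (rule open_Int)
    moreover have "tower \<inter> W = (\<lambda>z. (surfx z, surfy z, Z z)) ` N"
    proof
      show "tower \<inter> W \<subseteq> (\<lambda>z. (surfx z, surfy z, Z z)) ` N"
      proof
        fix x assume x: "x \<in> tower \<inter> W"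
        then have xt: "x \<in> tower" by simp
        obtain z t where z: "x = (surfx z, surfy z, t)" "z \<notin> sites" "cis t = cis (height z)" using towerE[OF xt] .
        have "quot_map period x = wrap z" using z by (simp add: quot_map_period wrap_def cis_eq_parts)
        then have "wrap z \<in> wrap ` N" using W0(2) z(2) x by (auto simp: W_def)
        then have zN: "z \<in> N" using inj_on_image_mem_iff[OF wrap_inj _ Ns] z(2) by blast
        then have zD: "z \<in> D" using N(3) by blast
        have "\<bar>t - t0\<bar> < 3" using x z(1) by (simp add: W_def)
        then have "\<bar>t - Z z\<bar> < 4" using Ds(3)[OF zD] by linarith
        then have "t = Z z" using cis_eq_close[of t "Z z"] z(3) cisZ[OF Ds(1)[OF zD]] by simp
        then show "x \<in> (\<lambda>z. (surfx z, surfy z, Z z)) ` N" using zN z(1) by blast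
      qed
      show "(\<lambda>z. (surfx z, surfy z, Z z)) ` N \<subseteq> tower \<inter> W"
      proof
        fix x assume "x \<in> (\<lambda>z. (surfx z, surfy z, Z z)) ` N"
        then obtain z where z: "z \<in> N" "x = (surfx z, surfy z, Z z)" by blast
        then have zD: "z \<in> D" using N(3) by blast
        have c: "cis (Z z) = cis (height z)" by (rule cisZ[OF Ds(1)[OF zD]])
        have "quot_map period x = wrap z" using z(2) c by (simp add: quot_map_period wrap_def cis_eq_parts)
        moreover have "wrap z \<in> W0" using W0(2) z(1) by blast
        moreover have "x \<in> tower" using towerI[OF Ds(2)[OF zD] c] z(2) by simp
        ultimately show "x \<in> tower \<inter> W" using Ds(3)[OF zD] z(2) by (simp add: W_def)
      qed
    qed
    ultimately show ?thesis by blast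
  qed
  have hol: "f holomorphic_on D" if "\<And>z. z \<notin> sites \<Longrightarrow> (f has_field_derivative F z) (at z)" for f F
    unfolding holomorphic_on_def field_differentiable_def using has_field_derivative_at_within[OF that[OF Ds(2)]] by blast
  have "\<exists>i U u ux uy uxx uxy uyy. minimal_chart tower (surfx z0, surfy z0, Z z0) i U u ux uy uxx uxy uyy \<and>
     (\<forall>q\<in>U. \<bar>graph_gauss_curv (ux q) (uy q) (uxx q) (uxy q) (uyy q)\<bar> \<le> 120000\<^sup>2)"
  proof (rule minimal_chart_weierstrass[OF D z0D, where a = fx and b = fy and c = fz])
    fix z assume z: "z \<in> D"
    show "(surfx has_derivative (\<lambda>h. Re (fx z * h))) (at z)" "(surfy has_derivative (\<lambda>h. Re (fy z * h))) (at z)"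
      by (rule surf_deriv[OF Ds(2)[OF z]])+
    show "(Z has_derivative (\<lambda>h. Re (fz z * h))) (at z)" by (rule dZ[OF Ds(1)[OF z]])
    show "(fx z)\<^sup>2 + (fy z)\<^sup>2 + (fz z)\<^sup>2 = 0" by (rule conformal[OF Ds(2)[OF z]])
    show "cmod (normal_dot (fx z) (fy z) (fz z) (deriv fx z) (deriv fy z) (deriv fz z)) \<le> 120000 * normal_sq (fx z) (fy z) (fz z)"
      by (rule curvature_bound(2)[OF Ds(2)[OF z]])
  next
    show "fx holomorphic_on D" by (rule hol[OF data_deriv(1)])
    show "fy holomorphic_on D" by (rule hol[OF data_deriv(2)])
    show "fz holomorphic_on D" by (rule hol[OF data_deriv(3)])
    show "normal_sq (fx z0) (fy z0) (fz z0) \<noteq> 0" using curvature_bound(1)[OF p(2)] by simp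
  qed (rule rel)
  then show ?thesis unfolding p(1) Z0 .
qed

section \<open>Connectedness\<close>

lemma zero_notin_sites: "0 \<notin> sites" and two_notin_sites: "2 \<notin> sites"
proof -
  show "0 \<notin> sites" using abs_site_ge_1 by (auto simp: sites_def) (metis abs_zero not_one_le_zero)
  have "site i \<noteq> 2" for i
  proof (cases "i div 2")
    case 0
    then show ?thesis by (simp add: site_def)
  next
    case (Suc k)
    have "10000 \<le> pole (i div 2)" using pole_Suc_ge[of k] pole_ge_1[of k] Suc by simp
    then show ?thesis by (auto simp: site_def)
  qed
  then show "2 \<notin> sites" by (auto simp: sites_def complex_eq_iff)
qed

text \<open>Modulo 2 pi the height is continuous across the real axis while conjugation negates it
  off the axis, so approaching from both sides shows that real points have height in the multiples
  of pi. Hence reflected sheets belong to the tower along their boundary too.\<close>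

lemma cis_height_real:
  assumes "Im z = 0" "z \<notin> sites"
  shows "cis (- height z) = cis (height z)"
proof -
  define x where "x n = z + \<i> * of_real (1 / real (Suc n))" for n
  have "(\<lambda>n. \<i> * of_real (1 / real (Suc n))) \<longlonglongrightarrow> \<i> * complex_of_real 0"
    using LIMSEQ_inverse_real_of_nat by (intro tendsto_mult tendsto_const tendsto_of_real) (simp add: inverse_eq_divide)
  then have x: "x \<longlonglongrightarrow> z" unfolding x_def using tendsto_add[OF tendsto_const] by fastforce
  have cz: "cnj z = z" using assms(1) by (simp add: complex_eq_iff)
  have x': "(\<lambda>n. cnj (x n)) \<longlonglongrightarrow> z" using tendsto_cnj[OF x] cz by simp
  have c: "isCont (\<lambda>z. cis (height z)) z" by (rule continuous_cis_height[OF assms(2)])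
  have l1: "(\<lambda>n. cnj (cis (height (x n)))) \<longlonglongrightarrow> cnj (cis (height z))" by (intro tendsto_cnj isCont_tendsto_compose[OF c x])
  have l2: "(\<lambda>n. cis (height (cnj (x n)))) \<longlonglongrightarrow> cis (height z)" by (rule isCont_tendsto_compose[OF c x'])
  have "cis (height (cnj (x n))) = cnj (cis (height (x n)))" for n
  proof -
    have "Im (x n) \<noteq> 0" using assms(1) by (simp add: x_def)
    then show ?thesis by (simp add: height_cnj cis_cnj)
  qed
  then have "cnj (cis (height z)) = cis (height z)" using LIMSEQ_unique[OF l1] l2 by simp
  then show ?thesis by (simp add: cis_cnj)
qed

text \<open>The closed upper half plane without the sites parametrises half of a fundamental domain; its translates
  and reflected copies are glued alternately along the images of the points 0 (height 0) and 2 (height pi).\<close>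

lemma connected_tower: "connected tower"
proof -
  let ?U = "{z. 0 \<le> Im z} - sites"
  define P where "P s m = (\<lambda>z. (surfx z, surfy z, s * height z + 2 * pi * of_int m)) ` ?U" for s :: real and m :: int
  define C where "C m = P 1 m \<union> P (- 1) m" for m
  have "connected {z. 0 < Im z}" by (intro convex_connected convex_halfspace_Im_gt)
  moreover have "{z. 0 < Im z} \<subseteq> ?U" using notin_sites_Im by force
  moreover have "?U \<subseteq> closure {z. 0 < Im z}"
  proof -
    have "{z. 0 < Im z} = {z. \<i> \<bullet> z > 0}" "{z. 0 \<le> Im z} = {z. \<i> \<bullet> z \<ge> 0}" by (simp_all add: inner_complex_def)
    then show ?thesis using closure_halfspace_gt[of \<i> 0] by auto
  qed
  ultimately have U: "connected ?U" by (rule connected_intermediate_closure)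
  have contP: "connected (P s m)" for s m
    unfolding P_def
  proof (intro connected_continuous_image U continuous_on_Pair continuous_on_add continuous_on_mult continuous_on_const continuous_height_upper)
    show "continuous_on ?U surfx" "continuous_on ?U surfy"
      using continuous_surf by (auto intro!: continuous_at_imp_continuous_on)
  qed
  have mem: "(surfx z, surfy z, height z + 2 * pi * of_int m) \<in> C m" "(surfx z, surfy z, - height z + 2 * pi * of_int m) \<in> C m" if "z \<in> ?U" for z m
    using that unfolding C_def P_def by (auto intro!: image_eqI[where x = z])
  have connC: "connected (C m)" for m
  proof -
    have z: "0 \<in> ?U" using zero_notin_sites by simp
    have "(surfx 0, surfy 0, 2 * pi * of_int m) \<in> P 1 m \<inter> P (- 1) m"
      unfolding P_def using z by (auto intro!: image_eqI[where x = 0] simp: height_0)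
    then show ?thesis unfolding C_def by (intro connected_Un contP) blast
  qed
  have sub: "C m \<subseteq> tower" for m
  proof
    fix x assume "x \<in> C m"
    then obtain z where z: "z \<in> ?U" and x: "x = (surfx z, surfy z, height z + 2 * pi * of_int m) \<or> x = (surfx z, surfy z, - height z + 2 * pi * of_int m)"
      unfolding C_def P_def by auto
    from x show "x \<in> tower"
    proof
      assume "x = (surfx z, surfy z, height z + 2 * pi * of_int m)"
      then show ?thesis using z by (auto intro!: towerI simp: cis_add_2pi)
    next
      assume x: "x = (surfx z, surfy z, - height z + 2 * pi * of_int m)"
      show ?thesis
      proof (cases "Im z = 0")
        case True
        have "cis (- height z + 2 * pi * of_int m) = cis (height z)"
          unfolding cis_add_2pi by (rule cis_height_real[OF True]) (use z in simp)
        then show ?thesis unfolding x using z by (intro towerI) auto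
      next
        case False
        have e: "surfx (cnj z) = surfx z" "surfy (cnj z) = surfy z" by (simp_all add: surfx_def surfy_def pot_cnj)
        have "(surfx (cnj z), surfy (cnj z), - height z + 2 * pi * of_int m) \<in> tower"
          unfolding height_cnj[OF False, symmetric] using z by (intro towerI cis_add_2pi) (simp add: sites_cnj)
        then show ?thesis unfolding x e .
      qed
    qed
  qed
  have cover: "\<exists>m. x \<in> C m" if x: "x \<in> tower" for x
  proof -
    obtain z t where z: "x = (surfx z, surfy z, t)" "z \<notin> sites" "cis t = cis (height z)" using towerE[OF x] .
    obtain m :: int where m: "t = height z + 2 * pi * of_int m" using cis_eq_2pi[OF z(3)] .
    show ?thesis
    proof (cases "0 \<le> Im z")
      case True
      then show ?thesis using mem(1)[of z m] z m by auto
    next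
      case False
      have e: "surfx (cnj z) = surfx z" "surfy (cnj z) = surfy z" "height (cnj z) = - height z"
        using False by (simp_all add: surfx_def surfy_def pot_cnj height_cnj)
      have "cnj z \<in> ?U" using False z(2) by (simp add: sites_cnj)
      from mem(2)[OF this, of m] show ?thesis unfolding e z(1) m by auto
    qed
  qed
  define x0 where "x0 = (surfx 0, surfy 0, height 0 + 2 * pi * of_int 0)"
  have link: "\<exists>y. y \<in> C m \<and> y \<in> C (m + 1)" for m
  proof -
    have "2 \<in> ?U" using two_notin_sites by simp
    \<comment> \<open>At the point 2 the height is pi, and pi + 2 pi m equals -pi + 2 pi (m +
      1).\<close>
    from mem(1)[OF this, of m] mem(2)[OF this, of "m + 1"] show ?thesis by (auto simp: height_2 algebra_simps)
  qed
  have same: "connected_component tower x y" if "x \<in> C m" "y \<in> C m" for x y m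
    unfolding connected_component_def using connC[of m] sub[of m] that by blast
  have all: "\<forall>y\<in>C m. connected_component tower x0 y" for m
  proof (induction m rule: int_induct[where k = 0])
    case base
    have "x0 \<in> C 0" unfolding x0_def by (rule mem(1)) (use zero_notin_sites in simp)
    then show ?case using same by blast
  next
    case (step1 i)
    obtain y where y: "y \<in> C i" "y \<in> C (i + 1)" using link by blast
    show ?case using step1(2) y same connected_component_trans by blast
  next
    case (step2 i)
    obtain y where y: "y \<in> C (i - 1)" "y \<in> C (i - 1 + 1)" using link[of "i - 1"] by blast
    then have "y \<in> C i" by simp
    then show ?case using step2(2) y(1) same connected_component_trans by blast
  qed
  show ?thesis unfolding connected_iff_connected_component
  proof (intro ballI)
    fix x y assume "x \<in> tower" "y \<in> tower"
    then have "connected_component tower x0 x" "connected_component tower x0 y" using all cover by blast+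
    then show "connected_component tower x y" using connected_component_sym connected_component_trans by blast
  qed
qed

section \<open>The group of periods and the genus\<close>

lemma surf_0: "surfx 0 = 0" "surfy 0 = 0"
  by (simp_all add: surfx_def surfy_def pot_def)

text \<open>A horizontal period of slope \<open>\<kappa>\<close> would spread the wedge bound along
  its direction, leaving the image above a line of that slope. The two extreme wings then force
  \<open>\<kappa>\<close> to be at least tan (eta 0) and at most -tan (eta 0). If the first
  component is 0, iterated translation crosses the lower bound.\<close>

lemma no_horizontal_period:
  assumes per: "\<And>z n. z \<notin> sites \<Longrightarrow> \<exists>z'. z' \<notin> sites \<and> surfx z' = surfx z + of_int n * q1 \<and> surfy z' = surfy z + of_int n * q2"
  shows "q1 = 0 \<and> q2 = 0"
proof -
  define \<sigma> where "\<sigma> = tan (eta 0)"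
  have \<sigma>: "0 < \<sigma>" using sin_eta_0 cos_eta_pos[of 0] by (simp add: \<sigma>_def tan_def)
  obtain C where C: "\<And>z. z \<notin> sites \<Longrightarrow> - \<sigma> * \<bar>surfx z\<bar> - C \<le> surfy z" using surfy_lower unfolding \<sigma>_def by blast
  have low: "- \<sigma> * \<bar>surfx z + of_int n * q1\<bar> - C \<le> surfy z + of_int n * q2" if "z \<notin> sites" for z n
  proof -
    obtain z' where z': "z' \<notin> sites" "surfx z' = surfx z + of_int n * q1" "surfy z' = surfy z + of_int n * q2"
      using per[OF \<open>z \<notin> sites\<close>] by blast
    show ?thesis using C[OF z'(1)] unfolding z'(2,3) .
  qed
  have q1: "q1 = 0"
  proof (rule ccontr)
    assume q1: "q1 \<noteq> 0"
    define \<kappa> where "\<kappa> = q2 / q1"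
    have q2: "q2 = \<kappa> * q1" using q1 by (simp add: \<kappa>_def)
    obtain C' where C': "\<And>X. \<exists>z. z \<notin> sites \<and> surfx z \<le> - X \<and> surfy z \<le> \<sigma> * surfx z + C'"
      "\<And>X. \<exists>z. z \<notin> sites \<and> X \<le> surfx z \<and> surfy z \<le> - \<sigma> * surfx z + C'"
      using surf_wings unfolding \<sigma>_def by blast
    define E where "E = \<sigma> * \<bar>q1\<bar> + C + \<bar>q2\<bar>"
    have shift: "- E \<le> surfy z - \<kappa> * surfx z" if z: "z \<notin> sites" for z
    proof -
      \<comment> \<open>The multiple of the period that brings the first coordinate back to within
        |q1| of 0, where the wedge bound is a constant.\<close>
      define n where "n = \<lfloor>- surfx z / q1\<rfloor>"
      define r where "r = - surfx z / q1 - of_int n"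
      have r: "0 \<le> r" "r \<le> 1" unfolding r_def n_def by linarith+
      have n: "of_int n * q1 = - surfx z - r * q1" using q1 by (simp add: r_def field_simps)
      have "\<bar>surfx z + of_int n * q1\<bar> \<le> \<bar>q1\<bar>" unfolding n using r by (simp add: abs_mult mult_left_le_one_le)
      then have a: "\<sigma> * \<bar>surfx z + of_int n * q1\<bar> \<le> \<sigma> * \<bar>q1\<bar>" using \<sigma> by (intro mult_left_mono) auto
      have "of_int n * q2 = \<kappa> * (of_int n * q1)" by (simp add: q2)
      also have "\<dots> = - \<kappa> * surfx z - r * q2" unfolding n q2 by (simp add: algebra_simps)
      finally have "of_int n * q2 = - \<kappa> * surfx z - r * q2" .
      moreover have "\<bar>r * q2\<bar> \<le> \<bar>q2\<bar>" using r by (simp add: abs_mult mult_left_le_one_le)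
      ultimately show ?thesis using low[OF z, of n] a unfolding E_def by linarith
    qed
    have one: "\<sigma> \<le> \<kappa>"
    proof (rule ccontr)
      assume "\<not> \<sigma> \<le> \<kappa>"
      then have pos: "0 < \<sigma> - \<kappa>" by simp
      obtain z where z: "z \<notin> sites" "surfx z \<le> - ((\<bar>E\<bar> + \<bar>C'\<bar> + 1) / (\<sigma> - \<kappa>))" "surfy z \<le> \<sigma> * surfx z + C'" using C'(1) by blast
      have "(\<sigma> - \<kappa>) * surfx z \<le> (\<sigma> - \<kappa>) * - ((\<bar>E\<bar> + \<bar>C'\<bar> + 1) / (\<sigma> - \<kappa>))" using z(2) pos by (intro mult_left_mono) auto
      also have "\<dots> = - (\<bar>E\<bar> + \<bar>C'\<bar> + 1)" using pos by simp
      finally show False using shift[OF z(1)] z(3) by (simp add: algebra_simps)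
    qed
    have two: "\<kappa> \<le> - \<sigma>"
    proof (rule ccontr)
      assume "\<not> \<kappa> \<le> - \<sigma>"
      then have pos: "0 < \<sigma> + \<kappa>" by simp
      obtain z where z: "z \<notin> sites" "(\<bar>E\<bar> + \<bar>C'\<bar> + 1) / (\<sigma> + \<kappa>) \<le> surfx z" "surfy z \<le> - \<sigma> * surfx z + C'" using C'(2) by blast
      have "(\<sigma> + \<kappa>) * ((\<bar>E\<bar> + \<bar>C'\<bar> + 1) / (\<sigma> + \<kappa>)) \<le> (\<sigma> + \<kappa>) * surfx z" using z(2) pos by (intro mult_left_mono) auto
      moreover have "(\<sigma> + \<kappa>) * ((\<bar>E\<bar> + \<bar>C'\<bar> + 1) / (\<sigma> + \<kappa>)) = \<bar>E\<bar> + \<bar>C'\<bar> + 1" using pos by simp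
      ultimately show False using shift[OF z(1)] z(3) by (simp add: algebra_simps)
    qed
    show False using one two \<sigma> by linarith
  qed
  moreover have "q2 = 0"
  proof (rule ccontr)
    assume q2: "q2 \<noteq> 0"
    \<comment> \<open>An integer of sign opposite to q2, large enough to push the point over the
      origin below -C.\<close>
    define n where "n = - (sgn q2 * of_int (\<lceil>(\<bar>C\<bar> + 1) / \<bar>q2\<bar>\<rceil>))"
    obtain m :: int where m: "n = of_int m"
    proof -
      have "n = of_int (- (if q2 < 0 then - 1 else 1) * \<lceil>(\<bar>C\<bar> + 1) / \<bar>q2\<bar>\<rceil>)" using q2 by (simp add: n_def sgn_if)
      then show ?thesis using that by blast
    qed
    have "(\<bar>C\<bar> + 1) / \<bar>q2\<bar> * \<bar>q2\<bar> \<le> of_int \<lceil>(\<bar>C\<bar> + 1) / \<bar>q2\<bar>\<rceil> * \<bar>q2\<bar>" by (intro mult_right_mono) auto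
    then have "\<bar>C\<bar> + 1 \<le> of_int \<lceil>(\<bar>C\<bar> + 1) / \<bar>q2\<bar>\<rceil> * \<bar>q2\<bar>" using q2 by simp
    also have "\<dots> = - (n * q2)" by (simp add: n_def abs_sgn mult_ac)
    finally have "\<bar>C\<bar> + 1 \<le> - (of_int m * q2)" unfolding m .
    then show False using low[OF zero_notin_sites, of m] by (simp add: surf_0 q1)
  qed
  ultimately show ?thesis by blast
qed

lemma tower_periodic: "singly_periodic_with tower period"
proof -
  have shift: "x + of_int k *\<^sub>R period \<in> tower" if x: "x \<in> tower" for x and k :: int
  proof -
    obtain z t where z: "x = (surfx z, surfy z, t)" "z \<notin> sites" "cis t = cis (height z)" using towerE[OF x] .
    have "x + of_int k *\<^sub>R period = (surfx z, surfy z, t + 2 * pi * of_int k)" by (simp add: z(1) period_def)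
    then show ?thesis using towerI[OF z(2), of "t + 2 * pi * of_int k"] z(3) by (simp add: cis_add_2pi)
  qed
  have "of_int k *\<^sub>R period \<in> periods tower" for k :: int
  proof -
    have "(\<lambda>x. x + of_int k *\<^sub>R period) ` tower = tower"
    proof
      show "(\<lambda>x. x + of_int k *\<^sub>R period) ` tower \<subseteq> tower" using shift by blast
      show "tower \<subseteq> (\<lambda>x. x + of_int k *\<^sub>R period) ` tower"
      proof
        fix x assume "x \<in> tower"
        then have "x + of_int (- k) *\<^sub>R period \<in> tower" by (rule shift)
        then show "x \<in> (\<lambda>x. x + of_int k *\<^sub>R period) ` tower" by (rule rev_image_eqI) simp
      qed
    qed
    then show ?thesis by (simp add: periods_def)
  qed
  moreover have "w \<in> range (\<lambda>k::int. of_int k *\<^sub>R period)" if w: "w \<in> periods tower" for w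
  proof -
    have im: "(\<lambda>x. x + w) ` tower = tower" using w by (simp add: periods_def)
    have up: "x + w \<in> tower" if "x \<in> tower" for x using im that by blast
    have down: "x - w \<in> tower" if "x \<in> tower" for x
    proof -
      obtain y where "y \<in> tower" "x = y + w" using im \<open>x \<in> tower\<close> by blast
      then show ?thesis by simp
    qed
    have all: "x + of_int n *\<^sub>R w \<in> tower" if x: "x \<in> tower" for x and n :: int
    proof (induction n rule: int_induct[where k = 0])
      case (step1 i)
      then show ?case using up[OF step1(2)] by (simp add: algebra_simps)
    next
      case (step2 i)
      then show ?case using down[OF step2(2)] by (simp add: algebra_simps)
    qed (use x in simp)
    obtain q1 q2 s where q: "w = (q1, q2, s)" by (cases w) auto
    have "q1 = 0 \<and> q2 = 0"
    proof (rule no_horizontal_period)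
      fix z and n :: int assume z: "z \<notin> sites"
      have mem: "(surfx z, surfy z, height z) + of_int n *\<^sub>R w \<in> tower" by (rule all[OF towerI[OF z refl]])
      obtain z' t where "(surfx z, surfy z, height z) + of_int n *\<^sub>R w = (surfx z', surfy z', t)" "z' \<notin> sites" "cis t = cis (height z')"
        using towerE[OF mem] .
      then show "\<exists>z'. z' \<notin> sites \<and> surfx z' = surfx z + of_int n * q1 \<and> surfy z' = surfy z + of_int n * q2"
        by (intro exI[of _ z']) (simp add: q)
    qed
    then have ws: "w = (0, 0, s)" by (simp add: q)
    have "(surfx 0, surfy 0, height 0) + w \<in> tower" by (rule up[OF towerI[OF zero_notin_sites refl]])
    then have mem: "(0, 0, s) \<in> tower" by (simp add: surf_0 height_0 ws)
    obtain z t where z: "(0, 0, s) = (surfx z, surfy z, t)" "z \<notin> sites" "cis t = cis (height z)" using towerE[OF mem] .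
    \<comment> \<open>Only the parameter 0 lies over the origin of the horizontal plane, and its
      height is 0, so a vertical period is a multiple of 2 pi.\<close>
    have "fold_up z = fold_up 0" using z by (intro surf_eq_fold_up) (auto simp: zero_notin_sites surf_0)
    then have "z = 0" by (auto simp: fold_up_def split: if_splits)
    then have c: "cis s = cis 0" using z by (simp add: height_0)
    obtain k :: int where "s = 0 + 2 * pi * of_int k" using cis_eq_2pi[OF c] .
    then have "w = of_int k *\<^sub>R period" by (simp add: ws period_def)
    then show ?thesis by blast
  qed
  ultimately have "periods tower = range (\<lambda>k::int. of_int k *\<^sub>R period)" by blast
  moreover have "period \<noteq> 0" by (simp add: period_def zero_prod_def)
  ultimately show ?thesis by (simp add: singly_periodic_with_def)
qed

text \<open>Stereographic projection: the sphere minus a point is a copy of the plane and is open in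
  the sphere, so open subsets of the plane correspond to open subsets of the sphere.\<close>

lemma genus_zero_plane_domain:
  fixes U :: "complex set"
  assumes "open U"
  shows "genus_zero U"
proof -
  define b :: R3 where "b = (1, 0, 0)"
  have b: "b \<in> sphere 0 1" by (simp add: b_def norm_Pair)
  have "(sphere (0::R3) 1 - {b}) homeomorphic (UNIV :: complex set)"
    by (rule homeomorphic_punctured_sphere_affine[OF _ b]) (simp_all add: aff_dim_UNIV)
  then have "(UNIV :: complex set) homeomorphic (sphere (0::R3) 1 - {b})" using homeomorphic_sym by blast
  then obtain h k where h: "homeomorphism (UNIV :: complex set) (sphere 0 1 - {b}) h k" unfolding homeomorphic_def by blast
  have "openin (top_of_set (sphere 0 1 - {b})) (h ` U)" by (rule homeomorphism_imp_open_map[OF h]) (use assms in simp)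
  moreover have "openin (top_of_set (sphere 0 1)) (sphere 0 1 - {b})" by (rule openin_delete) simp
  ultimately have "openin (top_of_set (sphere 0 1)) (h ` U)" by (rule openin_trans)
  moreover have "U homeomorphic (h ` U)"
  proof -
    have "h ` U \<subseteq> sphere 0 1 - {b}" using homeomorphism_image1[OF h] by blast
    then have "homeomorphism U (h ` U) h k" by (rule homeomorphism_of_subsets[OF h subset_UNIV _ refl])
    then show ?thesis unfolding homeomorphic_def by blast
  qed
  ultimately show ?thesis unfolding genus_zero_def by blast
qed

theorem theorem1p1:
  shows "\<exists>M v. properly_embedded_minimal_surface M \<and> bounded_gauss_curvature M \<and>
           singly_periodic_with M v \<and>
           genus_zero (quotient_surface M v) \<and>
           infinite (ends_of (quotient_surface M v)) \<and>
           (\<exists>!e. limit_end (quotient_surface M v) e)"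
proof (intro exI conjI)
  show "properly_embedded_minimal_surface tower"
    unfolding properly_embedded_minimal_surface_def using closed_tower connected_tower tower_chart by blast
  show "bounded_gauss_curvature tower"
    unfolding bounded_gauss_curvature_def using tower_chart by blast
  show "singly_periodic_with tower period" by (rule tower_periodic)
  have hom: "(- sites) homeomorphic quotient_surface tower period"
    unfolding quotient_tower homeomorphic_def using wrap_homeomorphism by blast
  obtain S where S: "openin (top_of_set (sphere (0::R3) 1)) S" "(- sites) homeomorphic S"
    using genus_zero_plane_domain[OF open_Compl[OF closed_sites]] unfolding genus_zero_def by blast
  have "quotient_surface tower period homeomorphic S"
    using homeomorphic_trans[OF homeomorphic_sym[THEN iffD1, OF hom] S(2)] .
  then show "genus_zero (quotient_surface tower period)" unfolding genus_zero_def using S(1) by blast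
  show "infinite (ends_of (quotient_surface tower period))" "\<exists>!e. limit_end (quotient_surface tower period) e"
    by (rule homeomorphic_ends[OF hom sites.infinite_ends sites.unique_limit_end])+
qed

end
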